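(* Let $(X,\Delta)$ be a sharply $F$-pure pair in characteristic $p>0$ (in particular $\Delta\ge 0$, and $(X,\Delta)$ is log canonical) such that the index of $K_X+\Delta$ is not divisible by $p$. Let $W\subseteq X$ be a log canonical center of $(X,\Delta)$ (hence also an $F$-pure center), and let $\nu:W^{\mathrm N}\to W$ be the normalization of $W$. Let $\pi:X'\to X$ be a proper birational morphism from a normal scheme and $E\subseteq X'$ a normal prime divisor of discrepancy $-1$ with $\pi(E)=W$, so that $E\to W$ factors through $W^{\mathrm N}$. Let $\Delta_{W^{\mathrm N},\mathrm{div}}$ be the divisorial part of the different on $W^{\mathrm N}$ (relative to $E$), and let $\Delta_{W^{\mathrm N},F\text{-}\mathrm{diff}}$ be the $F$-different of $(X,\Delta)$ on $W^{\mathrm N}$. Then $$\Delta_{W^{\mathrm N},\mathrm{div}}\ \le\ \Delta_{W^{\mathrm N},F\text{-}\mathrm{diff}} .$$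
   Context: Conventions. All schemes are separated, excellent, and (in characteristic $p>0$) $F$-finite; $F^e$ is the $e$-th iterate of Frobenius; $K(X)$ is the function field (or constant sheaf of rational functions). A pair $(X,\Delta)$ consists of a normal integral scheme $X$ and a $\mathbb Q$-divisor $\Delta$ with $K_X+\Delta$ $\mathbb Q$-Cartier. For $\pi:X'\to X$ proper birational with $X'$ normal, choose $\pi_*K_{X'}=K_X$ and write $K_{X'}+\Delta_{X'}=\pi^*(K_X+\Delta)$. A prime divisor $E\subset X'$ has discrepancy $-1$ if $\mathrm{coeff}_E\Delta_{X'}=1$. $(X,\Delta)$ is sub-log canonical if for all such $\pi$ all coefficients of $\Delta_{X'}$ are $\le 1$; log canonical if moreover $\Delta\ge0$ (the same definition is used for $\mathbb R$-divisors). Maps and divisors. Let $Y$ be normal integral $F$-finite of characteristic $p$, $\mathcal L$ a line bundle. A nonzero $\phi:F^e_*\mathcal L\to\mathcal O_Y$ corresponds, via $\mathcal Hom(F^e_*\mathcal L,\mathcal O_Y)\cong F^e_*(\mathcal L^{-1}\otimes\mathcal O_Y((1-p^e)K_Y))$, to an effective Weil divisor $D_\phi$; put $\Delta_\phi=\frac1{p^e-1}D_\phi$, so $\mathcal O_Y((1-p^e)(K_Y+\Delta_\phi))\cong\mathcal L$. For a nonzero $\phi:F^e_*\mathcal L\to K(Y)$, choose (locally) an effective Cartier divisor $G_0$ with $\phi(F^e_*\mathcal L((1-p^e)G_0))\subseteq\mathcal O_Y$, let $\Delta'$ be the divisor of the restricted map, and set $\Delta_\phi=\Delta'-G_0$.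 Conversely a $\mathbb Q$-divisor $\Delta$ with $(p^e-1)(K_Y+\Delta)$ Cartier determines, up to units, a map $\phi_\Delta=\phi_\Delta^e:F^e_*\mathcal O_Y((1-p^e)(K_Y+\Delta))\to K(Y)$ with divisor $\Delta$. $F$-purity. If $p$ does not divide the index of $K_X+\Delta$, $(X,\Delta)$ is sub-$F$-pure if $\mathcal O_X\subseteq\mathrm{Image}(\phi_\Delta^e)$ for all sufficiently divisible $e>0$, and (sharply) $F$-pure if moreover $\Delta\ge0$. Centers. An integral subscheme $W\subseteq X$ is a log canonical center if, at the generic point of $W$, $\Delta$ is effective and $(X,\Delta)$ is log canonical, and some prime divisor $E$ of discrepancy $-1$ on some normal proper birational model maps onto $W$. It is an $F$-pure center if, at the generic point of $W$, $\Delta$ is effective, $(X,\Delta)$ is $F$-pure and $\phi_\Delta(F^e_*(I_W\cdot\mathcal L))\subseteq I_W$, where $\mathcal L=\mathcal O_X((1-p^e)(K_X+\Delta))$ and $I_W$ is the ideal sheaf of $W$. $F$-different. For an $F$-pure center $W$ with $(p^e-1)(K_X+\Delta)$ Cartier and $\mathcal L=\mathcal O_X((1-p^e)(K_X+\Delta))$, choose an effective Cartier divisor $G$ not containing the generic point of $W$ with $\phi_\Delta(F^e_*\mathcal L)\subseteq\mathcal O_X(G)$. Then $\phi_\Delta$ induces $\phi_W:F^e_*\mathcal L|_W\to\mathcal O_W(G|_W)\subseteq K(W)$. For $\kappa:W'\to W$ proper birational with $W'$ normal (e.g. the normalization), $\phi_W$ extends to $\phi_{W'}:F^e_*\kappa^*(\mathcal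 L|_W)\to K(W')$, and $\Delta_{W',F\text{-}\mathrm{diff}}$ is the divisor corresponding to $\phi_{W'}$. Different. If $E\subset X'$ is a normal prime divisor with $\mathrm{coeff}_E\Delta_{X'}=1$, the different $\Delta_E$ is the canonically determined $\mathbb Q$-divisor on $E$ with $(K_{X'}+\Delta_{X'})|_E\sim_{\mathbb Q}K_E+\Delta_E$ obtained from the Poincaré residue map at the generic point of $E$ (Kollár, Singularities of the MMP, Chapter 4). Divisorial part. Let $f:Y\to Z$ be surjective and proper between normal integral schemes, $K_Y+\Delta_Y\sim_{\mathbb Q}f^*L$ with $L$ $\mathbb Q$-Cartier, and $(Y,\Delta_Y)$ sub-log canonical over a neighborhood of the generic point of $Z$. Then $\Delta_{Z,\mathrm{div}}=\sum_Q(1-c_Q)Q$ over prime Weil divisors $Q\subset Z$, where $c_Q$ is the supremum of $c\in\mathbb R$ such that $(Y,\Delta_Y+cf^*Q)$ is sub-log canonical over a neighborhood of the generic point $\eta_Q$ of $Q$. The divisorial part of the different on $W'$ relative to $E$ (where $E\to W$ factors through $W'$) is $\Delta_{W',\mathrm{div}}$ computed for $E\to W'$ and the pair $(E,\Delta_E)$. *)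

theory Defs
  imports
    "HOL-Algebra.Algebra"
    "HOL-Algebra.Algebraic_Closure_Type"
    "Jordan_Normal_Form.Determinant"
begin

text \<open>
  Encoding of schemes.  All schemes here are integral and separated.  Following Chevalley
  (EGA I, section 8), such a scheme with function field \<open>K\<close> is identified with the set of its local
  rings, as subrings of \<open>K\<close>, and it is presented by the coordinate rings of an open affine cover.
  The field \<open>K\<close> is the universe of a type of class \<open>field\<close>.  Points are local rings, and \<open>M\<close> is a
  generization of \<open>N\<close> iff \<open>N \<subseteq> M\<close>.  A dominant morphism is given by the embedding of function
  fields; for a birational morphism this is the identity.
\<close>

section \<open>Subrings of a field\<close>

abbreviation KR :: "'a::field ring" where
  "KR \<equiv> ring_of_type_algebra"

abbreviation ring_on :: "'a::field set \<Rightarrow> 'a ring" where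
  "ring_on A \<equiv> KR\<lparr>carrier := A\<rparr>"

definition frac_full :: "'a::field set \<Rightarrow> bool" where
  "frac_full A \<longleftrightarrow> (\<forall>x. \<exists>a\<in>A. \<exists>b\<in>A. b \<noteq> 0 \<and> x = a / b)"

definition loc_at :: "'a::field set \<Rightarrow> 'a set \<Rightarrow> 'a set" where
  "loc_at A P = {a / s | a s. a \<in> A \<and> s \<in> A - P}"

definition Spec :: "'a::field set \<Rightarrow> 'a set set" where
  "Spec A = {loc_at A P | P. primeideal P (ring_on A)}"

definition invert :: "'a::field set \<Rightarrow> 'a \<Rightarrow> 'a set" where
  "invert A f = generate_ring KR (insert (inverse f) A)"

definition max_ideal :: "'a::field set \<Rightarrow> 'a set" where
  "max_ideal N = {x \<in> N. x = 0 \<or> inverse x \<notin> N}"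

definition dominates :: "'a::field set \<Rightarrow> 'a set \<Rightarrow> bool" where
  "dominates V N \<longleftrightarrow> N \<subseteq> V \<and> max_ideal N \<subseteq> max_ideal V"

definition valuation_subring :: "'a::field set \<Rightarrow> bool" where
  "valuation_subring V \<longleftrightarrow> subring V KR \<and> (\<forall>x. x \<in> V \<or> inverse x \<in> V)"

definition int_closure :: "'a::field set \<Rightarrow> 'a set" where
  "int_closure A =
     {x. \<exists>q :: 'a poly. lead_coeff q = 1 \<and> (\<forall>i. poly.coeff q i \<in> A) \<and> poly q x = 0}"

definition fin_gen_over :: "'a::field set \<Rightarrow> 'a set \<Rightarrow> bool" where
  "fin_gen_over A C \<longleftrightarrow> (\<exists>S. finite S \<and> C = generate_ring KR (A \<union> S))"

definition F_finite :: "'a::field set \<Rightarrow> bool" where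
  "F_finite A \<longleftrightarrow> (\<exists>S. finite S \<and> S \<subseteq> A \<and>
     (\<forall>x\<in>A. \<exists>c. (\<forall>s\<in>S. c s \<in> A) \<and> x = (\<Sum>s\<in>S. c s ^ CHAR('a) * s)))"

text \<open>The order along a discrete valuation ring; only used for nonzero elements.\<close>

definition uniformizer :: "'a::field set \<Rightarrow> 'a \<Rightarrow> bool" where
  "uniformizer R t \<longleftrightarrow> t \<noteq> 0 \<and> max_ideal R = (\<lambda>a. t * a) ` R"

definition ord_at :: "'a::field set \<Rightarrow> 'a \<Rightarrow> int" where
  "ord_at R x = (THE n. \<exists>t. uniformizer R t \<and> x * t powi (- n) \<in> R - max_ideal R)"

section \<open>Integral separated schemes\<close>

definition open_in_Spec :: "'a::field set \<Rightarrow> 'a set set \<Rightarrow> bool" where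
  "open_in_Spec A U \<longleftrightarrow> U \<subseteq> Spec A \<and>
     (\<forall>N\<in>U. \<exists>f\<in>A. f \<noteq> 0 \<and> N \<in> Spec (invert A f) \<and> Spec (invert A f) \<subseteq> U)"

text \<open>
  Gluing along \<open>Spec A \<inter> Spec B\<close> requires it to be open in both; the result is separated iff all these
  intersections are affine with coordinate ring generated by \<open>A\<close> and \<open>B\<close>.
\<close>

definition atlas :: "'a::field set set \<Rightarrow> bool" where
  "atlas \<A> \<longleftrightarrow> \<A> \<noteq> {} \<and>
     (\<forall>A\<in>\<A>. subring A KR \<and> frac_full A) \<and>
     (\<forall>A\<in>\<A>. \<forall>B\<in>\<A>. Spec A \<inter> Spec B = Spec (generate_ring KR (A \<union> B)) \<and>
                   open_in_Spec A (Spec A \<inter> Spec B))"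

definition points :: "'a::field set set \<Rightarrow> 'a set set" where
  "points \<A> = (\<Union>A\<in>\<A>. Spec A)"

definition zariski_open :: "'a::field set set \<Rightarrow> 'a set set \<Rightarrow> bool" where
  "zariski_open \<A> U \<longleftrightarrow> U \<subseteq> points \<A> \<and> (\<forall>A\<in>\<A>. open_in_Spec A (U \<inter> Spec A))"

definition affine_open :: "'a::field set set \<Rightarrow> 'a set \<Rightarrow> bool" where
  "affine_open \<A> C \<longleftrightarrow> Spec C \<subseteq> points \<A> \<and> atlas (insert C \<A>)"

definition open_subscheme :: "'a::field set set \<Rightarrow> 'a set set \<Rightarrow> 'a set set" where
  "open_subscheme \<A> U = {invert A f | A f. A \<in> \<A> \<and> f \<in> A \<and> f \<noteq> 0 \<and> Spec (invert A f) \<subseteq> U}"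

text \<open>Noetherian \<open>F\<close>-finite rings are automatically excellent (Kunz).\<close>

definition F_finite_scheme :: "'a::field set set \<Rightarrow> bool" where
  "F_finite_scheme \<A> \<longleftrightarrow> atlas \<A> \<and> (\<forall>A\<in>\<A>. noetherian_ring (ring_on A) \<and> F_finite A)"

definition normal_scheme :: "'a::field set set \<Rightarrow> bool" where
  "normal_scheme \<A> \<longleftrightarrow> F_finite_scheme \<A> \<and> (\<forall>N\<in>points \<A>. int_closure N = N)"

text \<open>
  Proper birational morphisms: a morphism of finite type satisfying the valuative criterion.  As
  both schemes are integral, valuation rings of the function field suffice (EGA II, 7.3.10).
\<close>

definition proper_birational :: "'a::field set set \<Rightarrow> 'a set set \<Rightarrow> bool" where
  "proper_birational \<A>' \<A> \<longleftrightarrow>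
     (\<forall>N'\<in>points \<A>'. \<exists>N\<in>points \<A>. dominates N' N) \<and>
     (\<forall>A\<in>\<A>. \<exists>\<C>. finite \<C> \<and> (\<forall>C\<in>\<C>. affine_open \<A>' C \<and> A \<subseteq> C \<and> fin_gen_over A C) \<and>
        {N' \<in> points \<A>'. \<exists>N\<in>Spec A. dominates N' N} = (\<Union>C\<in>\<C>. Spec C)) \<and>
     (\<forall>V. valuation_subring V \<and> (\<exists>N\<in>points \<A>. dominates V N) \<longrightarrow>
        (\<exists>N'\<in>points \<A>'. dominates V N'))"

text \<open>
  The closed integral subscheme with generic point \<open>M\<close>, as a scheme with function field the residue
  field of \<open>M\<close>.  The residue field is the universe of another type, with residue map \<open>r\<close> (whose
  values outside \<open>M\<close> are irrelevant).
\<close>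

definition residue_map :: "'a::field set \<Rightarrow> ('a \<Rightarrow> 'b::field) \<Rightarrow> bool" where
  "residue_map M r \<longleftrightarrow> r \<in> Ring.ring_hom (ring_on M) KR \<and> r ` M = UNIV \<and>
     (\<forall>x\<in>M. r x = 0 \<longleftrightarrow> x \<in> max_ideal M)"

definition subscheme :: "'a::field set set \<Rightarrow> 'a set \<Rightarrow> ('a \<Rightarrow> 'b::field) \<Rightarrow> 'b set set" where
  "subscheme \<A> M r = {r ` A | A. A \<in> \<A> \<and> M \<in> Spec A}"

definition scheme_normalization :: "'a::field set set \<Rightarrow> 'a set set" where
  "scheme_normalization \<A> = int_closure ` \<A>"

section \<open>Divisors\<close>

text \<open>
  A prime divisor is represented by the local ring of its generic point, which has codimension 1.
  Divisors are coefficient functions on prime divisors; values elsewhere are irrelevant unless stated.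
\<close>

definition prime_divisors :: "'a::field set set \<Rightarrow> 'a set set" where
  "prime_divisors \<A> =
     {R \<in> points \<A>. R \<noteq> UNIV \<and> (\<forall>N\<in>points \<A>. R \<subseteq> N \<longrightarrow> N = R \<or> N = UNIV)}"

type_synonym 'a wdiv = "'a set \<Rightarrow> real"

definition Q_divisor :: "'a::field set set \<Rightarrow> 'a wdiv \<Rightarrow> bool" where
  "Q_divisor \<A> D \<longleftrightarrow> (\<forall>R. D R \<in> \<rat>) \<and> (\<forall>R. R \<notin> prime_divisors \<A> \<longrightarrow> D R = 0) \<and>
     (\<forall>A\<in>\<A>. finite {R \<in> Spec A. D R \<noteq> 0})"

text \<open>\<open>f\<close> is a local equation of \<open>D\<close> at the point \<open>N\<close>.\<close>

definition local_eq :: "'a::field set set \<Rightarrow> 'a wdiv \<Rightarrow> 'a set \<Rightarrow> 'a \<Rightarrow> bool" where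
  "local_eq \<A> D N f \<longleftrightarrow> f \<noteq> 0 \<and>
     (\<forall>R\<in>prime_divisors \<A>. N \<subseteq> R \<longrightarrow> D R = real_of_int (ord_at R f))"

definition Cartier :: "'a::field set set \<Rightarrow> 'a wdiv \<Rightarrow> bool" where
  "Cartier \<A> D \<longleftrightarrow> (\<forall>N\<in>points \<A>. \<exists>f. local_eq \<A> D N f)"

definition Q_Cartier :: "'a::field set set \<Rightarrow> 'a wdiv \<Rightarrow> bool" where
  "Q_Cartier \<A> D \<longleftrightarrow> (\<exists>n>0. Cartier \<A> (\<lambda>R. real n * D R))"

definition cartier_index :: "'a::field set set \<Rightarrow> 'a wdiv \<Rightarrow> nat" where
  "cartier_index \<A> D = (LEAST n. n > 0 \<and> Cartier \<A> (\<lambda>R. real n * D R))"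

text \<open>\<open>D\<close> is, at the point \<open>N\<close>, the real combination of the principal divisors listed in \<open>hs\<close>.\<close>

definition local_R_eq :: "'a::field set set \<Rightarrow> 'a wdiv \<Rightarrow> 'a set \<Rightarrow> (real \<times> 'a) list \<Rightarrow> bool" where
  "local_R_eq \<A> D N hs \<longleftrightarrow> (\<forall>(a, h)\<in>set hs. h \<noteq> 0) \<and>
     (\<forall>R\<in>prime_divisors \<A>. N \<subseteq> R \<longrightarrow> D R = (\<Sum>(a, h)\<leftarrow>hs. a * real_of_int (ord_at R h)))"

definition R_Cartier :: "'a::field set set \<Rightarrow> 'a wdiv \<Rightarrow> bool" where
  "R_Cartier \<A> D \<longleftrightarrow> (\<forall>N\<in>points \<A>. \<exists>hs. local_R_eq \<A> D N hs)"

text \<open>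
  Pull-back of an \<open>\<real>\<close>-Cartier divisor along the dominant morphism given by the embedding \<open>\<iota>\<close> of
  function fields: coefficient along the prime divisor \<open>R\<close> of the source.
\<close>

definition pullback :: "('b::field \<Rightarrow> 'a::field) \<Rightarrow> 'b set set \<Rightarrow> 'b wdiv \<Rightarrow> 'a wdiv" where
  "pullback \<iota> \<A> D R = (THE c. \<exists>N hs. N \<in> points \<A> \<and> dominates R (\<iota> ` N) \<and> local_R_eq \<A> D N hs \<and>
     c = (\<Sum>(a, h)\<leftarrow>hs. a * real_of_int (ord_at R (\<iota> h))))"

text \<open>The stalk at \<open>N\<close> of \<open>\<O>(D)\<close>, as a subset of the function field.\<close>

definition sheaf_stalk :: "'a::field set set \<Rightarrow> 'a wdiv \<Rightarrow> 'a set \<Rightarrow> 'a set" where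
  "sheaf_stalk \<A> D N =
     {f. f = 0 \<or> (\<forall>R\<in>prime_divisors \<A>. N \<subseteq> R \<longrightarrow> 0 \<le> real_of_int (ord_at R f) + D R)}"

section \<open>Canonical divisors\<close>

text \<open>
  On a normal \<open>F\<close>-finite scheme whose function field has \<open>[K : K^p] = p^n\<close>, a canonical divisor is the
  divisor of a nonzero rational section of the top exterior power of the sheaf of absolute Kaehler
  differentials, which is free of rank \<open>n\<close> at points of codimension 1.  The Cartier operator gives
  the isomorphism \<open>Hom(F_* O(D), O) = F_* O((1-p)K - D)\<close>.  The same form is used on all birational
  models, so that \<open>K\<close> pushes forward to \<open>K\<close>.

  A list \<open>ys\<close> is a \<open>p\<close>-basis of the subring \<open>R\<close> if \<open>R\<close> is free over its subring of \<open>p\<close>-th powers on the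
  monomials in \<open>ys\<close> with exponents less than \<open>p\<close>; then the \<open>d y\<^sub>i\<close> are a basis of the differentials.
\<close>

definition p_basis :: "'a::field set \<Rightarrow> 'a list \<Rightarrow> bool" where
  "p_basis R ys \<longleftrightarrow> set ys \<subseteq> R \<and>
     (let E = {..<length ys} \<rightarrow>\<^sub>E {..<CHAR('a)} in
      \<forall>x\<in>R. \<exists>!c. c \<in> (E \<rightarrow>\<^sub>E R) \<and>
        x = (\<Sum>a\<in>E. c a ^ CHAR('a) * (\<Prod>i<length ys. (ys ! i) ^ a i)))"

definition derivation :: "('a::field \<Rightarrow> 'a) \<Rightarrow> bool" where
  "derivation D \<longleftrightarrow> (\<forall>x y. D (x + y) = D x + D y) \<and> (\<forall>x y. D (x * y) = x * D y + y * D x)"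

definition partial :: "'a::field list \<Rightarrow> nat \<Rightarrow> 'a \<Rightarrow> 'a" where
  "partial ys j =
     (THE D. derivation D \<and> (\<forall>i<length ys. D (ys ! i) = (if i = j then 1 else 0)))"

text \<open>The pair \<open>(g, [x\<^sub>1, \<dots>, x\<^sub>n])\<close> stands for the rational top form \<open>g dx\<^sub>1 \<and> \<dots> \<and> dx\<^sub>n\<close>.\<close>

type_synonym 'a topform = "'a \<times> 'a list"

definition rational_form :: "'a::field topform \<Rightarrow> bool" where
  "rational_form \<omega> \<longleftrightarrow> fst \<omega> \<noteq> 0 \<and> p_basis UNIV (snd \<omega>)"

text \<open>The coefficient \<open>u\<close> in \<open>\<omega> = u dy\<^sub>1 \<and> \<dots> \<and> dy\<^sub>n\<close>.\<close>

definition form_coeff :: "'a::field topform \<Rightarrow> 'a list \<Rightarrow> 'a" where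
  "form_coeff \<omega> ys =
     fst \<omega> * det (mat (length ys) (length ys) (\<lambda>(i, j). partial ys j (snd \<omega> ! i)))"

definition form_ord :: "'a::field topform \<Rightarrow> 'a set \<Rightarrow> int" where
  "form_ord \<omega> R = (THE k. \<exists>ys. p_basis R ys \<and> k = ord_at R (form_coeff \<omega> ys))"

text \<open>The divisor \<open>K + \<Delta>\<close> for the canonical divisor \<open>K\<close> of \<open>\<omega>\<close>.\<close>

definition log_div :: "'a::field topform \<Rightarrow> 'a wdiv \<Rightarrow> 'a wdiv" where
  "log_div \<omega> \<Delta> R = real_of_int (form_ord \<omega> R) + \<Delta> R"

section \<open>Pairs and log canonicity\<close>

definition pair :: "'a::field set set \<Rightarrow> 'a topform \<Rightarrow> 'a wdiv \<Rightarrow> bool" where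
  "pair \<A> \<omega> \<Delta> \<longleftrightarrow> normal_scheme \<A> \<and> Q_divisor \<A> \<Delta> \<and> Q_Cartier \<A> (log_div \<omega> \<Delta>)"

text \<open>
  The divisor \<open>\<Delta>'\<close> on a birational model defined by \<open>K' + \<Delta>' = \<pi>\<^sup>*(K + \<Delta>)\<close>; its coefficient along \<open>R\<close>
  depends neither on the model nor on \<open>\<omega>\<close>.
\<close>

definition crepant :: "'a::field set set \<Rightarrow> 'a topform \<Rightarrow> 'a wdiv \<Rightarrow> 'a wdiv" where
  "crepant \<A> \<omega> \<Delta> R = pullback id \<A> (log_div \<omega> \<Delta>) R - real_of_int (form_ord \<omega> R)"

definition sub_lc :: "'a::field set set \<Rightarrow> 'a topform \<Rightarrow> 'a wdiv \<Rightarrow> bool" where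
  "sub_lc \<A> \<omega> \<Delta> \<longleftrightarrow> normal_scheme \<A> \<and> R_Cartier \<A> (log_div \<omega> \<Delta>) \<and>
     (\<forall>\<A>'. normal_scheme \<A>' \<and> proper_birational \<A>' \<A> \<longrightarrow>
        (\<forall>R\<in>prime_divisors \<A>'. crepant \<A> \<omega> \<Delta> R \<le> 1))"

definition log_canonical :: "'a::field set set \<Rightarrow> 'a topform \<Rightarrow> 'a wdiv \<Rightarrow> bool" where
  "log_canonical \<A> \<omega> \<Delta> \<longleftrightarrow> sub_lc \<A> \<omega> \<Delta> \<and> (\<forall>R\<in>prime_divisors \<A>. 0 \<le> \<Delta> R)"

text \<open>The integral subscheme \<open>W\<close> is given by its generic point \<open>M\<close>.\<close>

definition lc_center :: "'a::field set set \<Rightarrow> 'a topform \<Rightarrow> 'a wdiv \<Rightarrow> 'a set \<Rightarrow> bool" where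
  "lc_center \<A> \<omega> \<Delta> M \<longleftrightarrow> M \<in> points \<A> \<and>
     (\<exists>U. zariski_open \<A> U \<and> M \<in> U \<and> log_canonical (open_subscheme \<A> U) \<omega> \<Delta>) \<and>
     (\<exists>\<A>' R. normal_scheme \<A>' \<and> proper_birational \<A>' \<A> \<and> R \<in> prime_divisors \<A>' \<and>
        crepant \<A> \<omega> \<Delta> R = 1 \<and> dominates R M)"

section \<open>Maps and divisors, \<open>F\<close>-purity\<close>

text \<open>Maps \<open>F\<^sup>e\<^sub>* \<L> \<rightarrow> K(Y)\<close> are given by their extension to the generic point.\<close>

definition p_inv_linear :: "nat \<Rightarrow> ('a::field \<Rightarrow> 'a) \<Rightarrow> bool" where
  "p_inv_linear e \<phi> \<longleftrightarrow> (\<forall>x y. \<phi> (x + y) = \<phi> x + \<phi> y) \<and>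
     (\<forall>a x. \<phi> (a ^ (CHAR('a) ^ e) * x) = a * \<phi> x)"

text \<open>
  At a prime divisor \<open>R\<close>, with \<open>L\<close> the stalk of the line bundle, \<open>Hom(F\<^sup>e\<^sub>* L, R)\<close> is a free \<open>F\<^sup>e\<^sub>* R\<close>-module
  of rank 1.  The coefficient at \<open>R\<close> of the divisor of \<open>\<phi> = \<Phi>(d \<cdot> _)\<close>, \<open>\<Phi>\<close> a generator, is the order of \<open>d\<close>.
  This covers maps to \<open>K(Y)\<close> as well: replacing \<open>L\<close> by its twist by \<open>(1-p\<^sup>e)G\<close> adds \<open>(p\<^sup>e-1)G\<close> to the
  divisor.
\<close>

definition hom_generator :: "nat \<Rightarrow> 'a::field set \<Rightarrow> 'a set \<Rightarrow> ('a \<Rightarrow> 'a) \<Rightarrow> bool" where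
  "hom_generator e L R \<Phi> \<longleftrightarrow> p_inv_linear e \<Phi> \<and> \<Phi> ` L \<subseteq> R \<and>
     (\<forall>\<psi>. p_inv_linear e \<psi> \<and> \<psi> ` L \<subseteq> R \<longrightarrow> (\<exists>c\<in>R. \<forall>x. \<psi> x = \<Phi> (c * x)))"

definition map_order :: "nat \<Rightarrow> 'a::field set \<Rightarrow> 'a set \<Rightarrow> ('a \<Rightarrow> 'a) \<Rightarrow> int" where
  "map_order e L R \<phi> =
     (THE k. \<exists>\<Phi> d. hom_generator e L R \<Phi> \<and> d \<noteq> 0 \<and> (\<forall>x. \<phi> x = \<Phi> (d * x)) \<and> k = ord_at R d)"

definition map_divisor :: "nat \<Rightarrow> 'a::field set \<Rightarrow> 'a set \<Rightarrow> ('a \<Rightarrow> 'a) \<Rightarrow> real" where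
  "map_divisor e L R \<phi> = real_of_int (map_order e L R \<phi>) / (real (CHAR('a) ^ e) - 1)"

text \<open>\<open>\<L> = \<O>((1-p\<^sup>e)(K + \<Delta>))\<close>\<close>

definition L_stalk ::
  "'a::field set set \<Rightarrow> 'a topform \<Rightarrow> 'a wdiv \<Rightarrow> nat \<Rightarrow> 'a set \<Rightarrow> 'a set" where
  "L_stalk \<A> \<omega> \<Delta> e =
     sheaf_stalk \<A> (\<lambda>R. (1 - real (CHAR('a) ^ e)) * log_div \<omega> \<Delta> R)"

definition index_divides ::
  "'a::field set set \<Rightarrow> 'a topform \<Rightarrow> 'a wdiv \<Rightarrow> nat \<Rightarrow> bool" where
  "index_divides \<A> \<omega> \<Delta> e \<longleftrightarrow>
     Cartier \<A> (\<lambda>R. (real (CHAR('a) ^ e) - 1) * log_div \<omega> \<Delta> R)"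

text \<open>\<open>\<phi>\<close> is a map \<open>\<phi>\<^sub>\<Delta>\<^sup>e\<close>; it is unique up to units.\<close>

definition phi_map ::
  "'a::field set set \<Rightarrow> 'a topform \<Rightarrow> 'a wdiv \<Rightarrow> nat \<Rightarrow> ('a \<Rightarrow> 'a) \<Rightarrow> bool" where
  "phi_map \<A> \<omega> \<Delta> e \<phi> \<longleftrightarrow> p_inv_linear e \<phi> \<and> (\<exists>x. \<phi> x \<noteq> 0) \<and>
     (\<forall>R\<in>prime_divisors \<A>. map_divisor e (L_stalk \<A> \<omega> \<Delta> e R) R \<phi> = \<Delta> R)"

definition sub_F_pure :: "'a::field set set \<Rightarrow> 'a topform \<Rightarrow> 'a wdiv \<Rightarrow> bool" where
  "sub_F_pure \<A> \<omega> \<Delta> \<longleftrightarrow> (\<exists>e\<^sub>0>0. \<forall>e>0. e\<^sub>0 dvd e \<longrightarrow> index_divides \<A> \<omega> \<Delta> e \<and>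
     (\<exists>\<phi>. phi_map \<A> \<omega> \<Delta> e \<phi> \<and> (\<forall>N\<in>points \<A>. N \<subseteq> \<phi> ` L_stalk \<A> \<omega> \<Delta> e N)))"

definition F_pure :: "'a::field set set \<Rightarrow> 'a topform \<Rightarrow> 'a wdiv \<Rightarrow> bool" where
  "F_pure \<A> \<omega> \<Delta> \<longleftrightarrow> sub_F_pure \<A> \<omega> \<Delta> \<and> (\<forall>R\<in>prime_divisors \<A>. 0 \<le> \<Delta> R)"

section \<open>Differents\<close>

text \<open>
  The \<open>F\<close>-different on the normalization of the center with generic point \<open>M\<close> and residue map \<open>r\<close>.
  A generator \<open>g\<close> of \<open>\<L>\<close> at \<open>M\<close> trivializes the restriction of \<open>\<L>\<close> at its generic point, and the induced
  map is then \<open>\<psi>\<close>.  The twist by an effective Cartier divisor \<open>G\<close> in the construction of \<open>\<psi>\<close> has no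
  effect at the generic point of the center, where \<open>\<psi>\<close> is determined.  If \<open>h\<close> generates \<open>\<L>\<close> at the
  image \<open>N\<close> of \<open>S\<close>, then \<open>r (h / g)\<close> generates the pulled back line bundle at \<open>S\<close>.
\<close>

definition F_different ::
  "'a::field set set \<Rightarrow> 'a topform \<Rightarrow> 'a wdiv \<Rightarrow> nat \<Rightarrow> ('a \<Rightarrow> 'a) \<Rightarrow> 'a set \<Rightarrow> ('a \<Rightarrow> 'b::field) \<Rightarrow> 'b wdiv"
  where
  "F_different \<A> \<omega> \<Delta> e \<phi> M r S = (THE c. \<exists>g \<psi> N h.
     g \<noteq> 0 \<and> L_stalk \<A> \<omega> \<Delta> e M = (\<lambda>x. g * x) ` M \<and>
     p_inv_linear e \<psi> \<and> (\<forall>x\<in>M. \<phi> (g * x) \<in> M \<and> \<psi> (r x) = r (\<phi> (g * x))) \<and>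
     N \<in> points \<A> \<and> N \<subseteq> M \<and> dominates S (r ` N) \<and>
     h \<noteq> 0 \<and> L_stalk \<A> \<omega> \<Delta> e N = (\<lambda>x. h * x) ` N \<and>
     c = map_divisor e ((\<lambda>y. r (h / g) * y) ` S) S \<psi>)"

text \<open>
  The different of \<open>(X, \<Delta>)\<close> on a normal prime divisor \<open>E\<close> (with local ring \<open>R\<close> and residue map \<open>r\<close>) of
  coefficient 1, at a prime divisor \<open>Q\<close> of \<open>E\<close>.  Let \<open>t\<close> be a uniformizer of \<open>R\<close> and \<open>t, ys\<close> a \<open>p\<close>-basis
  of \<open>R\<close>.  If \<open>f\<close> is a local equation of \<open>m(K + \<Delta>)\<close> at the point \<open>N\<close> of \<open>X\<close> corresponding to \<open>Q\<close>, then
  \<open>\<O>(m(K + \<Delta>))\<close> is generated there by \<open>1/f\<close>, that is, by the pluri-form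
    \<open>\<omega>\<^sup>m / f = (t\<^sup>m u\<^sup>m / f) (dt/t \<and> dy\<^sub>2 \<and> \<dots> \<and> dy\<^sub>n)\<^sup>m\<close>,  \<open>u = form_coeff \<omega> (t # ys)\<close>,
  whose Poincare residue is \<open>r (t\<^sup>m u\<^sup>m / f) (dr(y\<^sub>2) \<and> \<dots> \<and> dr(y\<^sub>n))\<^sup>m\<close>.  The divisor of the
  residue is \<open>- m\<close> times the different.
\<close>

definition different ::
  "'a::field set set \<Rightarrow> 'a topform \<Rightarrow> 'a wdiv \<Rightarrow> 'a set \<Rightarrow> ('a \<Rightarrow> 'b::field) \<Rightarrow> 'b wdiv" where
  "different \<A> \<omega> \<Delta> R r Q = (THE c. \<exists>m N f t ys.
     m > 0 \<and> N \<in> points \<A> \<and> N \<subseteq> R \<and> r ` N = Q \<and>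
     local_eq \<A> (\<lambda>R'. real m * log_div \<omega> \<Delta> R') N f \<and>
     uniformizer R t \<and> p_basis R (t # ys) \<and>
     c = - (real_of_int (ord_at Q (r ((t * form_coeff \<omega> (t # ys)) ^ m / f)))
            + real m * real_of_int (form_ord (1, map r ys) Q)) / real m)"

text \<open>
  The divisorial part for the morphism from \<open>\<B>\<close> to \<open>\<S>\<close> given by \<open>\<iota>\<close>.  A neighborhood \<open>U\<close> of the generic
  point of \<open>Q\<close> is only admitted if \<open>Q\<close> is Cartier on it, so that \<open>f\<^sup>*Q\<close> makes sense over \<open>U\<close>.
\<close>

definition preimage_of ::
  "('c::field \<Rightarrow> 'b::field) \<Rightarrow> 'b set set \<Rightarrow> 'c set set \<Rightarrow> 'b set set" where
  "preimage_of \<iota> \<B> U = {P \<in> points \<B>. \<exists>N\<in>U. dominates P (\<iota> ` N)}"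

definition prime_div :: "'c set \<Rightarrow> 'c wdiv" where
  "prime_div Q R = (if R = Q then 1 else 0)"

definition lc_threshold ::
  "('c::field \<Rightarrow> 'b::field) \<Rightarrow> 'c set set \<Rightarrow> 'b set set \<Rightarrow> 'b topform \<Rightarrow> 'b wdiv \<Rightarrow> 'c set \<Rightarrow> real" where
  "lc_threshold \<iota> \<S> \<B> \<omega> \<Delta> Q = Sup {c. \<exists>U. zariski_open \<S> U \<and> Q \<in> U \<and>
     Cartier (open_subscheme \<S> U) (prime_div Q) \<and>
     sub_lc (open_subscheme \<B> (preimage_of \<iota> \<B> U)) \<omega>
       (\<lambda>P. \<Delta> P + c * pullback \<iota> \<S> (prime_div Q) P)}"

definition divisorial_part ::
  "('c::field \<Rightarrow> 'b::field) \<Rightarrow> 'c set set \<Rightarrow> 'b set set \<Rightarrow> 'b topform \<Rightarrow> 'b wdiv \<Rightarrow> 'c wdiv" where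
  "divisorial_part \<iota> \<S> \<B> \<omega> \<Delta> Q = 1 - lc_threshold \<iota> \<S> \<B> \<omega> \<Delta> Q"

end

(* The map phi attached to (X, Delta) is the e-th power of the Cartier operator of a rational form,
   twisted by a unit.  Taking residues along E turns the Cartier operator of X' into that of E, so
   the restriction of phi to E is a twisted Cartier operator of a form defining the different; on the
   function field of W it agrees with the map psi defining the F-different.
   Let s be a local equation of Q and let c be 1 minus the coefficient of the F-different at Q.  Then
   psi(a s^k x) = 1 for a unit a, some x and k read off from c, and a discrepancy below -1 of
   (E, Delta_E + c f^*Q) over the generic point of Q would force this value 1 into a maximal ideal.
   So c is at most the log canonical threshold; the set of admissible c is bounded above because
   some prime divisor over E maps onto Q (Chevalley and the valuative criterion). *)
theory Submission
 imports Defs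
begin

section \<open>$p$-bases of a field\<close>

text \<open>Duality for Frobenius is made explicit. In coordinates given by a p-basis the iterates
  of the Cartier operator generate the maps in question, so the order of a map along a discrete
  valuation ring can be read off from the multiples that preserve the ring
  (\<open>hom_level\<close>). This test does not depend on coordinates, passes to residue fields and
  applies on every birational model of \<open>E\<close>, so no resolution is required. Write q = p^e
  and let m be the level of a map. A multiplier of order m + q - 1 still attains the value 1, while
  one of order m + q lands in the maximal ideal. This gap of exactly one turns the value 1 on
  \<open>W\<close> into the bound 1 for coefficients over \<open>E\<close>. Since divisors live on
  codimension one points of normal schemes, discrete valuation rings must be produced: Serre's
  criterion and the finiteness of normalization are proved with elements, the latter from
  F-finiteness. A second obstacle is that F-purity concerns sufficiently divisible exponents while
  the given \<open>e\<close> is not of that kind; iterating the Cartier operator bridges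
  this.\<close>

definition exps :: "nat => nat => (nat => nat) set" where
 "exps p n = {..<n} \<rightarrow>\<^sub>E {..<p}"

definition mon :: "'a::field list => (nat => nat) => 'a" where
 "mon ys a = (\<Prod>i<length ys. ys ! i ^ a i)"

definition comb :: "'a::field list => ((nat => nat) => 'a) => 'a" where
 "comb ys c = (\<Sum>a\<in>exps CHAR('a) (length ys). c a ^ CHAR('a) * mon ys a)"

text \<open>Coordinates are chosen; for a p-basis only their values on \<open>exps\<close> are
  determined, so they are compared there only.\<close>

definition crd :: "'a::field list => 'a => (nat => nat) => 'a" where
 "crd ys x = (SOME c. x = comb ys c)"

definition top_exp :: "nat => nat => nat => nat" where
 "top_exp p n = (\<lambda>i\<in>{..<n}. p - 1)"

text \<open>The Cartier operator in the coordinates \<open>ys\<close>.\<close>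

definition car :: "'a::field list => 'a => 'a" where
 "car ys x = crd ys x (top_exp CHAR('a) (length ys))"

text \<open>The partial derivative along \<open>ys ! j\<close>, with p-th powers as constants.
  Dividing by \<open>ys ! j\<close> is harmless at exponent 0, where \<open>of_nat (a j)\<close>
  vanishes.\<close>

definition del :: "'a::field list => nat => 'a => 'a" where
 "del ys j x = (\<Sum>a\<in>exps CHAR('a) (length ys).
   crd ys x a ^ CHAR('a) * (of_nat (a j) * mon ys a / ys ! j))"

lemma finite_exps [simp]: "finite (exps p n)" by (simp add: exps_def finite_PiE)

lemma card_exps: "card (exps p n) = p ^ n" by (simp add: exps_def card_PiE)

lemma exps_less: "a \<in> exps p n ==> i < n ==> a i < p" by (auto simp: exps_def)

lemma exps_eqI:
 assumes "a \<in> exps p n" "b \<in> exps p n" "\<And>i. i < n ==> a i = b i"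
 shows "a = b" using assms unfolding exps_def by (metis PiE_ext lessThan_iff)

lemma mon_cong: "(\<And>i. i < length ys ==> a i = b i) ==> mon ys a = mon ys b" by (simp add: mon_def)

lemma mon_add: "mon ys (%i. a i + b i) = mon ys a * mon ys b" by (simp add: mon_def power_add prod.distrib)

lemma mon_mult: "mon ys (%i. a i * k) = mon ys a ^ k" by (simp add: mon_def power_mult prod_power_distrib)

lemma mon_zero [simp]: "mon ys (%i. 0) = 1" by (simp add: mon_def)

lemma mon_unit: "j < length ys ==> mon ys (%i. if i = j then k else 0) = ys ! j ^ k"
 unfolding mon_def by (subst prod.remove[where x = j]) (auto intro!: prod.neutral)

section \<open>Derivations of a field\<close>

lemma derivation_zero: "derivation D ==> D 0 = 0" unfolding derivation_def by (metis add_cancel_right_left)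

lemma derivation_add: "derivation D ==> D (x + y) = D x + D y" by (simp add: derivation_def)

lemma derivation_mult: "derivation D ==> D (x * y) = x * D y + y * D x" by (simp add: derivation_def)

lemma derivation_diff: "derivation D ==> D (x - y) = D x - D y"
 by (metis add_diff_cancel_left' derivation_add diff_add_cancel add.commute)

lemma derivation_one: "derivation D ==> D (1::'a::field) = 0"
 using derivation_mult[of D 1 1] by (metis add_cancel_right_right mult_1)

lemma derivation_power:
 "derivation D ==> D (x ^ n) = of_nat n * x ^ (n - 1) * D x" for x :: "'a::field"
proof (induction n)
 case 0
 then show ?case by (simp add: derivation_one)
next
 case (Suc n)
 then show ?case by (cases n) (auto simp: derivation_mult algebra_simps)
qed

lemma derivation_sum: "derivation D ==> D (sum f I) = (\<Sum>i\<in>I. D (f i))"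
 by (induction I rule: infinite_finite_induct) (auto simp: derivation_zero derivation_add)

lemma derivation_prod:
 assumes "derivation D" "finite I" "\<And>i. i \<in> I ==> f i ~= (0::'a::field)"
 shows "D (prod f I) = (\<Sum>i\<in>I. prod f I / f i * D (f i))" using assms(2,3)
proof (induction I rule: finite_induct)
 case empty
 then show ?case by (simp add: derivation_one assms(1))
next
 case (insert j I)
 have "D (prod f (insert j I)) = f j * D (prod f I) + prod f I * D (f j)"
  using insert by (simp add: derivation_mult assms(1))
 also have "f j * D (prod f I) = (\<Sum>i\<in>I. prod f (insert j I) / f i * D (f i))"
  using insert by (simp add: sum_distrib_left algebra_simps)
 finally show ?case using insert by (simp add: algebra_simps)
qed

lemma derivation_linear:
 assumes "derivation D" "derivation E"
 shows "derivation (%x. a * D x + b * E x)" using assms unfolding derivation_def by (simp add: algebra_simps)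

section \<open>Frobenius-linear algebra in characteristic p\<close>

locale char_p =
 fixes p :: nat and ty :: "'a::field itself"
 assumes prime_p: "normalization_semidom_class.prime p" and char_p [simp]: "CHAR('a) = p"
begin

lemma prime_char: "normalization_semidom_class.prime CHAR('a)" using prime_p by simp

lemmas comb_eq = comb_def[where 'a = 'a, unfolded char_p]
lemmas car_eq = car_def[where 'a = 'a, unfolded char_p]
lemmas del_eq = del_def[where 'a = 'a, unfolded char_p]

lemma p_gt_1: "p > 1" using prime_p by (rule prime_gt_1_nat)

lemma p_gt_0 [simp]: "p > 0" using p_gt_1 by simp

lemma frob_add: "(x + y :: 'a) ^ p = x ^ p + y ^ p" using freshmans_dream[OF prime_char] by simp

lemma frob_sum: "(sum f I :: 'a) ^ p = (\<Sum>i\<in>I. f i ^ p)" by (rule freshmans_dream_sum[OF prime_char]) simp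

lemma frob_diff: "(x - y :: 'a) ^ p = x ^ p - y ^ p" using frob_add[of "x - y" y] by simp

text \<open>Fermat's little theorem: integers are their own p-th powers, so they pass through
  Cartier type maps as scalars.\<close>

lemma of_nat_pow_p: "(of_nat n :: 'a) ^ p = of_nat n" by (induction n) (auto simp: frob_add zero_power)

lemma of_nat_p [simp]: "(of_nat p :: 'a) = 0" using of_nat_CHAR[where 'a = 'a] by simp

lemma of_nat_mod_p: "(of_nat (n mod p) :: 'a) = of_nat n"
proof -
 have "(of_nat n :: 'a) = of_nat (n mod p + p * (n div p))" by simp
 then show ?thesis unfolding of_nat_add of_nat_mult by simp
qed

lemma of_nat_nz: "0 < n ==> n < p ==> (of_nat n :: 'a) ~= 0"
 by (simp add: of_nat_eq_0_iff_char_dvd nat_dvd_not_less)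

lemma derivation_p_power:
 assumes "derivation D"
 shows "D ((c :: 'a) ^ p) = 0" "D (c ^ p * x) = c ^ p * D x"
 using derivation_power[OF assms, of c p] derivation_mult[OF assms] by simp_all

text \<open>The field as a vector space over itself through Frobenius; the monomials of a p-basis
  are a basis for this structure.\<close>

sublocale frob: vector_space "%c x::'a. c ^ p * x"
 by unfold_locales (auto simp: algebra_simps frob_add power_mult_distrib)

lemma mon_red:
 fixes ys :: "'a list"
 shows "mon ys m = mon ys (%i. m i div p) ^ p * mon ys (\<lambda>i\<in>{..<length ys}. m i mod p)"
proof -
 have "mon ys m = mon ys (%i. m i div p * p + m i mod p)" by simp
 also have "... = mon ys (%i. m i div p) ^ p * mon ys (%i. m i mod p)" unfolding mon_add mon_mult ..
 also have "mon ys (%i. m i mod p) = mon ys (\<lambda>i\<in>{..<length ys}. m i mod p)" by (rule mon_cong) simp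
 finally show ?thesis .
qed

lemma mod_exps: "(\<lambda>i\<in>{..<n}. m i mod p) \<in> exps p n" by (auto simp: exps_def)

lemma eq_mod_iff:
 assumes "a \<in> exps p n"
 shows "a = (\<lambda>i\<in>{..<n}. m i mod p) \<longleftrightarrow> (\<forall>i<n. m i mod p = a i)" (is "?l \<longleftrightarrow> ?r")
proof
 assume ?r
 then show ?l by (intro exps_eqI[OF assms mod_exps]) simp
next
 assume l: ?l
 show ?r using fun_cong[OF l] by (auto split: if_splits)
qed

lemma top_exps: "top_exp p n \<in> exps p n" by (auto simp: exps_def top_exp_def)

lemma comb_diff: "comb ys (%a. c a - d a) = comb ys c - comb (ys::'a list) d"
 by (simp add: comb_eq frob_diff algebra_simps sum_subtractf)

lemma comb_add: "comb ys (%a. c a + d a) = comb ys c + comb (ys::'a list) d"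
 by (simp add: comb_eq frob_add algebra_simps sum.distrib)

lemma comb_smult: "comb ys (%a. e * c a) = e ^ p * comb (ys::'a list) c"
 by (simp add: comb_eq power_mult_distrib sum_distrib_left algebra_simps)

lemma comb_single:
 assumes "a \<in> exps p (length ys)"
 shows "comb (ys::'a list) (%b. if b = a then e else 0) = e ^ p * mon ys a"
proof -
 have "comb ys (%b. if b = a then e else 0) =
   (\<Sum>b\<in>exps p (length ys). if b = a then e ^ p * mon ys a else 0)" unfolding comb_eq by (rule sum.cong) auto
 also have "... = e ^ p * mon ys a" using assms by simp
 finally show ?thesis .
qed

lemma comb_cong: "(\<And>a. a \<in> exps p (length ys) ==> c a = d a) ==> comb (ys::'a list) c = comb ys d"
 by (simp add: comb_eq)

lemma p_basis_iff:
 "p_basis R (ys::'a list) \<longleftrightarrow> set ys \<subseteq> R &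
   (\<forall>x\<in>R. \<exists>!c. c \<in> (exps p (length ys) \<rightarrow>\<^sub>E R) & x = comb ys c)"
 by (simp add: p_basis_def exps_def comb_eq mon_def Let_def)

lemma p_basisD:
 assumes "p_basis R (ys::'a list)" "0 \<in> R"
 shows "set ys \<subseteq> R" "x \<in> R ==> \<exists>c. (\<forall>a\<in>exps p (length ys). c a \<in> R) & x = comb ys c"
  "[|\<And>a. a \<in> exps p (length ys) ==> c a \<in> R; comb ys c = 0; a \<in> exps p (length ys)|] ==> c a = 0"
proof -
 note * = assms(1)[unfolded p_basis_iff]
 show "set ys \<subseteq> R" using * by blast
 show "\<exists>c. (\<forall>a\<in>exps p (length ys). c a \<in> R) & x = comb ys c" if "x \<in> R" using * that by (metis PiE_mem)
 assume c: "\<And>a. a \<in> exps p (length ys) ==> c a \<in> R" "comb ys c = 0" "a \<in> exps p (length ys)"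
 let ?c = "restrict c (exps p (length ys))" and ?z = "\<lambda>a\<in>exps p (length ys). 0 :: 'a"
 have "comb ys ?c = 0" "comb ys ?z = 0" using c(2) comb_cong[of ys ?c c] by (simp_all add: comb_eq zero_power)
 moreover have "?c \<in> exps p (length ys) \<rightarrow>\<^sub>E R" "?z \<in> exps p (length ys) \<rightarrow>\<^sub>E R"
  using c(1) assms(2) by (auto simp: PiE_def)
 ultimately have "?c = ?z" using * assms(2) by (metis (no_types, lifting))
 then show "c a = 0" using c(3) by (metis restrict_apply)
qed

lemma p_basisI:
 assumes "set (ys::'a list) \<subseteq> R"
  "\<And>x. x \<in> R ==> \<exists>c. (\<forall>a\<in>exps p (length ys). c a \<in> R) & x = comb ys c"
  "\<And>c a. [|\<And>a. a \<in> exps p (length ys) ==> c a \<in> R; comb ys c = 0; a \<in> exps p (length ys)|]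
    ==> c a = 0"
  "\<And>x y. x \<in> R ==> y \<in> R ==> x - y \<in> R"
 shows "p_basis R ys" unfolding p_basis_iff
proof (intro conjI ballI)
 fix x assume "x \<in> R"
 then obtain c where c: "\<forall>a\<in>exps p (length ys). c a \<in> R" "x = comb ys c" using assms(2) by blast
 show "\<exists>!c. c \<in> (exps p (length ys) \<rightarrow>\<^sub>E R) & x = comb ys c"
 proof (rule ex1I)
  show "restrict c (exps p (length ys)) \<in> (exps p (length ys) \<rightarrow>\<^sub>E R) &
    x = comb ys (restrict c (exps p (length ys)))"
   using c comb_cong[of ys "restrict c (exps p (length ys))" c] by auto
  fix d assume d: "d \<in> (exps p (length ys) \<rightarrow>\<^sub>E R) & x = comb ys d"
  have "comb ys (%a. d a - c a) = 0" using c d by (simp add: comb_diff)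
  then have "d a - c a = 0" if "a \<in> exps p (length ys)" for a
   using that c d assms(4) by (intro assms(3)[of "%a. d a - c a" a]) auto
  then have "d a = restrict c (exps p (length ys)) a" for a using d by (cases "a \<in> exps p (length ys)") auto
  then show "d = restrict c (exps p (length ys))" ..
 qed
qed (use assms in auto)

lemma p_basis_UNIV_iff:
 "p_basis UNIV (ys::'a list) \<longleftrightarrow> (\<forall>x. \<exists>c. x = comb ys c) &
   (\<forall>c. comb ys c = 0 --> (\<forall>a\<in>exps p (length ys). c a = 0))"
 (is "?l \<longleftrightarrow> ?r")
proof
 assume ?l
 then show ?r using p_basisD[of UNIV ys] by (metis UNIV_I)
next
 assume ?r
 then show ?l by (intro p_basisI) auto
qed

section \<open>Coordinates, partial derivatives and the Cartier operator of a p-basis\<close>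

context
 fixes ys :: "'a list"
 assumes pb: "p_basis UNIV ys"
begin

lemma comb_crd: "comb ys (crd ys x) = x"
 using pb unfolding p_basis_UNIV_iff crd_def by (metis (mono_tags, lifting) someI_ex)

lemma crd_eq: "x = comb ys c ==> a \<in> exps p (length ys) ==> crd ys x a = c a"
proof -
 assume *: "x = comb ys c" "a \<in> exps p (length ys)"
 have "comb ys (%a. crd ys x a - c a) = 0" using * comb_crd[of x] by (simp add: comb_diff)
 then show ?thesis using * pb unfolding p_basis_UNIV_iff by (metis eq_iff_diff_eq_0)
qed

lemma crd_add: "a \<in> exps p (length ys) ==> crd ys (x + y) a = crd ys x a + crd ys y a"
 by (rule crd_eq) (simp_all add: comb_add comb_crd)

lemma crd_smult: "a \<in> exps p (length ys) ==> crd ys (e ^ p * x) a = e * crd ys x a"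
 by (rule crd_eq) (simp_all add: comb_smult comb_crd)

lemma crd_mon:
 assumes "a \<in> exps p (length ys)"
 shows "crd ys (mon ys m) a =
  (if \<forall>i<length ys. m i mod p = a i then mon ys (%i. m i div p) else 0)"
proof -
 let ?m = "\<lambda>i\<in>{..<length ys}. m i mod p"
 have "mon ys m = comb ys (%b. if b = ?m then mon ys (%i. m i div p) else 0)"
  using comb_single[OF mod_exps] mon_red[of ys m] by simp
 from crd_eq[OF this assms] have
  "crd ys (mon ys m) a = (if a = ?m then mon ys (%i. m i div p) else 0)" .
 moreover have "a = ?m \<longleftrightarrow> (\<forall>i<length ys. m i mod p = a i)" by (rule eq_mod_iff[OF assms])
 ultimately show ?thesis by simp
qed

text \<open>A vanishing entry would make the monomial with that single exponent 1 vanish, against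
  uniqueness of coordinates.\<close>

lemma basis_nz: "i < length ys ==> ys ! i ~= 0"
proof
 assume i: "i < length ys" and z: "ys ! i = 0"
 let ?a = "\<lambda>j\<in>{..<length ys}. if j = i then 1 else (0::nat)"
 have a: "?a \<in> exps p (length ys)" using p_gt_1 by (auto simp: exps_def)
 have "mon ys ?a = 0" using i z unfolding mon_def by (subst prod_zero_iff) (auto intro!: bexI[of _ i])
 then have "comb ys (%b. if b = ?a then 1 else 0) = 0" using comb_single[OF a, of 1] by simp
 then have "(if ?a = ?a then 1 else 0) = (0::'a)" using pb[unfolded p_basis_UNIV_iff, THEN conjunct2, rule_format,
    of "%b. if b = ?a then 1 else 0" ?a] a by blast
 then show False by simp
qed

text \<open>The multiplier \<open>s\<close> serves two kinds of additive maps at once: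
  \<open>s c = c\<close> for maps of Cartier type, \<open>s c = c ^ p\<close> for maps linear over
  p-th powers.\<close>

lemma eq_on_monomials:
 fixes F G :: "'a => 'a"
 assumes F: "\<And>x y. F (x + y) = F x + F y" "\<And>c x. F (c ^ p * x) = s c * F x"
  and G: "\<And>x y. G (x + y) = G x + G y" "\<And>c x. G (c ^ p * x) = s c * G x"
  and eq: "\<And>a. a \<in> exps p (length ys) ==> F (mon ys a) = G (mon ys a)"
 shows "F x = G x"
proof -
 have 0: "F 0 = 0" "G 0 = 0" using F(1)[of 0 0] G(1)[of 0 0] by (metis add_cancel_right_right add_0)+
 have S: "F (sum f I) = (\<Sum>i\<in>I. F (f i))" "G (sum f I) = (\<Sum>i\<in>I. G (f i))"
  for f :: "(nat => nat) => 'a" and I by (induction I rule: infinite_finite_induct) (auto simp: 0 F G)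
 have "F (comb ys (crd ys x)) = G (comb ys (crd ys x))" unfolding comb_eq S F(2) G(2) using eq by simp
 then show ?thesis by (simp add: comb_crd)
qed

lemma car_add: "car ys (x + y) = car ys x + car ys y" by (simp add: car_eq crd_add top_exps)

lemma car_smult: "car ys (c ^ p * x) = c * car ys x" by (simp add: car_eq crd_smult top_exps)

lemma car_zero: "car ys 0 = 0" using car_add[of 0 0] by (metis add_cancel_right_right add_0)

lemma car_sum: "car ys (sum f I) = (\<Sum>i\<in>I. car ys (f i))"
 by (induction I rule: infinite_finite_induct) (auto simp: car_zero car_add)

lemma car_mon:
 "car ys (mon ys m) = (if \<forall>i<length ys. m i mod p = p - 1 then mon ys (%i. m i div p) else 0)"
 unfolding car_eq crd_mon[OF top_exps] by (simp add: top_exp_def)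

text \<open>Multiplication by the complementary monomial shifts the exponent \<open>a\<close> to the
  top one, the only exponent seen by the Cartier operator. Hence this one operator recovers every
  coordinate.\<close>

lemma crd_car:
 assumes "a \<in> exps p (length ys)"
 shows "crd ys x a = car ys (x * mon ys (%i. p - 1 - a i))"
proof (rule eq_on_monomials[where s = "%c. c" and F = "%x. crd ys x a"
   and G = "%x. car ys (x * mon ys (%i. p - 1 - a i))"])
 fix b assume b: "b \<in> exps p (length ys)"
 \<comment> \<open>The sum is at most 2p - 2, so the residue p - 1 means the value p - 1.\<close>
 have "(b i + (p - 1 - a i)) mod p = p - 1 \<longleftrightarrow> b i = a i" if "i < length ys" for i
 proof -
  have "a i < p" "b i < p" using assms b that by (auto dest: exps_less)
  then show ?thesis by (cases "b i \<le> a i") (auto simp: mod_if split: if_splits)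
 qed
 then have *: "(\<forall>i<length ys. (b i + (p - 1 - a i)) mod p = p - 1) \<longleftrightarrow> a = b" using exps_eqI[OF assms b] by auto
 have "mon ys (%i. (a i + (p - 1 - a i)) div p) = mon ys (%i. 0)"
  using assms by (intro mon_cong) (auto dest!: exps_less)
 then have "car ys (mon ys b * mon ys (%i. p - 1 - a i)) = (if a = b then 1 else 0)"
  unfolding mon_add[symmetric] car_mon * by auto
 moreover have "crd ys (mon ys b) a = (if a = b then 1 else 0)"
  using crd_eq[OF _ assms, of "mon ys b" "%c. if c = b then 1 else 0"] comb_single[OF b, of 1] by simp
 ultimately show "crd ys (mon ys b) a = car ys (mon ys b * mon ys (%i. p - 1 - a i))" by simp
qed (auto simp: crd_add crd_smult assms ring_distribs car_add car_smult mult.assoc)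

lemma derivation_mon:
 assumes "derivation D"
 shows "D (mon ys m) = (\<Sum>i<length ys. of_nat (m i) * mon ys m / ys ! i * D (ys ! i))"
proof -
 have "D (mon ys m) = (\<Sum>i<length ys. mon ys m / ys ! i ^ m i * D (ys ! i ^ m i))"
  unfolding mon_def by (rule derivation_prod[OF assms]) (auto simp: basis_nz)
 also have "... = (\<Sum>i<length ys. of_nat (m i) * mon ys m / ys ! i * D (ys ! i))"
 proof (rule sum.cong)
  fix i assume "i \<in> {..<length ys}"
  then show "mon ys m / ys ! i ^ m i * D (ys ! i ^ m i) =
    of_nat (m i) * mon ys m / ys ! i * D (ys ! i)"
   using basis_nz[of i] unfolding derivation_power[OF assms] by (cases "m i") (auto simp: field_simps)
 qed simp
 finally show ?thesis .
qed

lemma del_add: "del ys j (x + y) = del ys j x + del ys j y" unfolding del_eq sum.distrib[symmetric]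
 by (rule sum.cong) (simp_all add: crd_add frob_add ring_distribs add_divide_distrib)

lemma del_smult: "del ys j (c ^ p * x) = c ^ p * del ys j x" unfolding del_eq sum_distrib_left
 by (rule sum.cong) (simp_all add: crd_smult power_mult_distrib)

lemma del_mon: "j < length ys ==> del ys j (mon ys m) = of_nat (m j) * mon ys m / ys ! j"
proof -
 assume j: "j < length ys"
 let ?m = "\<lambda>i\<in>{..<length ys}. m i mod p"
 have "del ys j (mon ys m) = (\<Sum>a\<in>exps p (length ys). if a = ?m then
   mon ys (%i. m i div p) ^ p * (of_nat (?m j) * mon ys ?m / ys ! j) else 0)" unfolding del_eq
 proof (rule sum.cong)
  fix a assume a: "a \<in> exps p (length ys)"
  note eq = eq_mod_iff[OF a, of m]
  show "crd ys (mon ys m) a ^ p * (of_nat (a j) * mon ys a / ys ! j) = (if a = ?m then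
   mon ys (%i. m i div p) ^ p * (of_nat (?m j) * mon ys ?m / ys ! j) else 0)" unfolding crd_mon[OF a] eq[symmetric]
   by (cases "a = ?m") (simp_all only: simp_thms if_True if_False zero_power[OF p_gt_0] mult_zero_left)
 qed simp
 also have "... = mon ys (%i. m i div p) ^ p * (of_nat (?m j) * mon ys ?m / ys ! j)" using mod_exps by simp
 also have "... = of_nat (m j mod p) * mon ys m / ys ! j" using j mon_red[of ys m] by simp
 finally show ?thesis by (simp add: of_nat_mod_p)
qed

text \<open>Truncated subtraction is harmless at exponent 0, where the coefficient vanishes. Without
  division it is visible that a subring containing \<open>ys\<close> also contains these
  values.\<close>

lemma del_mon_pred:
 assumes j: "j < length ys"
 shows "del ys j (mon ys m) = of_nat (m j) * mon ys (m(j := m j - 1))"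
proof (cases "m j")
 case (Suc k)
 then have "mon ys m = mon ys (%i. (m(j := k)) i + (if i = j then 1 else 0))" by (intro mon_cong) auto
 then have eq: "mon ys m = mon ys (m(j := k)) * ys ! j" using j by (simp only: mon_add mon_unit power_one_right)
 show ?thesis unfolding del_mon[OF j] unfolding eq using Suc basis_nz[OF j] by simp
qed (simp add: del_mon[OF j])

text \<open>The Leibniz rule holds for two monomials, and both sides are linear over p-th powers in
  each factor separately.\<close>

lemma del_derivation:
 assumes j: "j < length ys"
 shows "derivation (del ys j)"
proof -
 have mon_mult_del: "del ys j (mon ys a * mon ys b) =
   mon ys a * del ys j (mon ys b) + mon ys b * del ys j (mon ys a)" for a b
  using del_mon[OF j, of "%i. a i + b i"] basis_nz[OF j] by (simp add: mon_add del_mon[OF j] field_simps)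
 have 1: "del ys j (x * mon ys b) = x * del ys j (mon ys b) + mon ys b * del ys j x" for x b
  by (rule eq_on_monomials[where s = "%c. c ^ p" and F = "%x. del ys j (x * mon ys b)"
     and G = "%x. x * del ys j (mon ys b) + mon ys b * del ys j x"])
   (use del_smult[of j _ "_ * mon ys b"] in
    \<open>simp_all add: ring_distribs del_add mon_mult_del mult.assoc del_smult mult.left_commute[of "mon ys b"]\<close>)
 have "del ys j (x * y) = x * del ys j y + y * del ys j x" for x y
  by (rule eq_on_monomials[where s = "%c. c ^ p" and F = "%y. del ys j (x * y)"
     and G = "%y. x * del ys j y + y * del ys j x"])
   (simp_all add: 1 ring_distribs del_add del_smult mult.left_commute[of x])
 then show ?thesis by (simp add: derivation_def del_add)
qed

lemma del_basis: "i < length ys ==> j < length ys ==> del ys j (ys ! i) = (if i = j then 1 else 0)"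
 using del_mon[of j "%k. if k = i then 1 else 0"] mon_unit[of i ys 1] basis_nz[of j] by auto

text \<open>A derivation kills p-th powers, so its values on the p-basis determine it.\<close>

lemma derivation_expand:
 assumes "derivation D"
 shows "D x = (\<Sum>i<length ys. D (ys ! i) * del ys i x)"
proof (rule eq_on_monomials[where s = "%c. c ^ p" and F = D
   and G = "%x. \<Sum>i<length ys. D (ys ! i) * del ys i x"])
 show "D (mon ys a) = (\<Sum>i<length ys. D (ys ! i) * del ys i (mon ys a))" for a
  unfolding derivation_mon[OF assms] by (rule sum.cong) (simp_all add: del_mon mult.commute)
 show "(\<Sum>i<length ys. D (ys ! i) * del ys i (x + y)) =
   (\<Sum>i<length ys. D (ys ! i) * del ys i x) + (\<Sum>i<length ys. D (ys ! i) * del ys i y)" for x y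
  by (simp only: del_add ring_distribs sum.distrib)
 show "(\<Sum>i<length ys. D (ys ! i) * del ys i (c ^ p * x)) =
   c ^ p * (\<Sum>i<length ys. D (ys ! i) * del ys i x)" for c x
  unfolding sum_distrib_left by (rule sum.cong) (simp_all add: del_smult)
qed (simp_all add: derivation_add[OF assms] derivation_p_power[OF assms])

lemma derivation_eq_del:
 assumes "derivation D" "j < length ys" "\<And>i. i < length ys ==> D (ys ! i) = (if i = j then 1 else 0)"
 shows "D = del ys j"
proof
 fix x
 have "D x = (\<Sum>i<length ys. if i = j then del ys i x else 0)"
  unfolding derivation_expand[OF assms(1), of x] using assms(3) by (intro sum.cong) auto
 then show "D x = del ys j x" using assms(2) by simp
qed

lemma partial_eq_del: "j < length ys ==> partial ys j = del ys j" unfolding partial_def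
 by (rule the_equality) (auto simp: del_derivation del_basis intro: derivation_eq_del)

text \<open>Exact forms have Cartier image 0: lowering an exponent below p by one never gives p - 1,
  and at exponent 0 truncation gives 0, which differs from p - 1 as p > 1.\<close>

lemma car_del: "j < length ys ==> car ys (del ys j x) = 0"
proof (rule eq_on_monomials[where s = "%c. c" and F = "%x. car ys (del ys j x)"
   and G = "%_. 0"])
 fix a assume j: "j < length ys" and a: "a \<in> exps p (length ys)"
 have "\<not> (\<forall>i<length ys. (a(j := a j - 1)) i mod p = p - 1)"
  using j exps_less[OF a j] p_gt_1 by (auto intro!: exI[of _ j])
 then have "car ys (mon ys (a(j := a j - 1))) = 0" unfolding car_mon by (rule if_not_P)
 then show "car ys (del ys j (mon ys a)) = 0"
  using car_smult[of "of_nat (a j)"] by (simp add: del_mon_pred[OF j] of_nat_pow_p)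
qed (auto simp: del_add car_add del_smult car_smult)

lemma del_of_mult: "j < length ys ==> del ys j (x * y) = x * del ys j y + y * del ys j x"
 by (rule derivation_mult[OF del_derivation])

lemma del_iter_mon:
 assumes j: "j < length ys"
 shows "(del ys j ^^ l) (mon ys m) = of_nat (\<Prod>i<l. m j - i) * mon ys (m(j := m j - l))"
proof (induction l)
 case 0
 show ?case by simp
next
 case (Suc l)
 have lin: "del ys j (of_nat n * x) = of_nat n * del ys j x" for n x
  using del_smult[of j "of_nat n" x] by (simp only: of_nat_pow_p)
 have "(del ys j ^^ Suc l) (mon ys m) = of_nat (\<Prod>i<l. m j - i) *
   (of_nat (m j - l) * mon ys (m(j := m j - l, j := m j - l - 1)))"
  by (simp only: funpow.simps o_apply Suc lin del_mon_pred[OF j] fun_upd_same)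
 then show ?case by (simp add: mult_ac del: fun_upd_apply)
qed

text \<open>Composite of the (p-1)-st powers of all partial derivatives. It expresses the p-th power
  of the Cartier operator through derivations, up to a power of (p-1)!.\<close>

definition del_all :: "nat => 'a => 'a" where
 "del_all k = fold (%j f. (del ys j ^^ (p - 1)) \<circ> f) [0..<k] id"

lemma del_all_simps: "del_all 0 x = x" "del_all (Suc k) x = (del ys k ^^ (p - 1)) (del_all k x)"
 by (simp_all add: del_all_def)

lemma del_all_car: "del_all (length ys) x = of_nat (fact (p - 1) ^ length ys) * car ys x ^ p"
proof (rule eq_on_monomials[where s = "%c. c ^ p" and F = "del_all (length ys)"
   and G = "%x. of_nat (fact (p - 1) ^ length ys) * car ys x ^ p"])
 have iter: "(del ys j ^^ l) (x + y) = (del ys j ^^ l) x + (del ys j ^^ l) y"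
  "(del ys j ^^ l) (c ^ p * x) = c ^ p * (del ys j ^^ l) x" for j l x y c
  by (induction l) (auto simp: del_add del_smult)
 have "del_all k (x + y) = del_all k x + del_all k y" "del_all k (c ^ p * x) = c ^ p * del_all k x" for k x y c
  by (induction k) (auto simp: del_all_simps iter)
 then show "del_all (length ys) (x + y) = del_all (length ys) x + del_all (length ys) y"
  "del_all (length ys) (c ^ p * x) = c ^ p * del_all (length ys) x" for x y c by blast+
 fix a assume a: "a \<in> exps p (length ys)"
 define N where "N k = (fact (p - 1) ^ k :: nat)" for k
 \<comment> \<open>After \<open>k\<close> variables only monomials with top exponent in all of them
   survive, and these variables have been differentiated away.\<close>
 have "del_all k (mon ys a) = (if \<forall>i<k. a i = p - 1
   then of_nat (N k) * mon ys (%i. if i < k then 0 else a i) else 0)" if "k \<le> length ys" for k using that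
 proof (induction k)
  case (Suc k)
  let ?b = "%i. if i < k then 0 else a i"
  have k: "k < length ys" using Suc.prems by simp
  have zero: "(del ys k ^^ (p - 1)) 0 = 0" using iter(2)[where c = 0 and x = 0] by (simp add: zero_power)
  have "(del ys k ^^ (p - 1)) (of_nat (N k) * mon ys ?b) = of_nat (N k) * (del ys k ^^ (p - 1)) (mon ys ?b)"
   using iter(2)[where j = k and l = "p - 1" and c = "of_nat (N k)" and x = "mon ys ?b"] by (simp only: of_nat_pow_p)
  also have "... = of_nat (N k) * (of_nat (\<Prod>i<p - 1. a k - i) * mon ys (?b(k := a k - (p - 1))))"
   unfolding del_iter_mon[OF k] by (simp only: less_irrefl if_False)
  finally have step: "(del ys k ^^ (p - 1)) (of_nat (N k) * mon ys ?b) =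
    of_nat (N k * (\<Prod>i<p - 1. a k - i)) * mon ys (?b(k := a k - (p - 1)))" by (simp only: of_nat_mult mult.assoc)
  have ak: "a k < p" by (rule exps_less[OF a k])
  have IH: "del_all k (mon ys a) = (if \<forall>i<k. a i = p - 1 then of_nat (N k) * mon ys ?b else 0)" using Suc by simp
  show ?case
  proof (cases "a k = p - 1")
   case True
   have "(\<Prod>i<p - 1. p - 1 - i) = fact (p - 1)" by (simp only: fact_prod_rev atLeast0LessThan of_nat_id)
   then have "N k * (\<Prod>i<p - 1. a k - i) = N (Suc k)" unfolding True by (simp only: N_def power_Suc mult.commute)
   moreover have "?b(k := a k - (p - 1)) = (%i. if i < Suc k then 0 else a i)" using True by auto
   moreover have "(\<forall>i<Suc k. a i = p - 1) \<longleftrightarrow> (\<forall>i<k. a i = p - 1)" using True by (auto simp: less_Suc_eq)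
   ultimately show ?thesis unfolding del_all_simps IH using step zero by (simp only: if_distrib[of "del ys k ^^ (p - 1)"])
  next
   case False
   then have "(\<Prod>i<p - 1. a k - i) = 0" using ak by (auto intro!: bexI[of _ "a k"])
   then have "(del ys k ^^ (p - 1)) (del_all k (mon ys a)) = 0"
    unfolding IH using step zero by (simp only: if_distrib[of "del ys k ^^ (p - 1)"] mult_zero_right of_nat_0 mult_zero_left if_cancel)
   then show ?thesis unfolding del_all_simps using False by auto
  qed
 qed (simp add: del_all_simps N_def)
 from this[of "length ys"] have 1: "del_all (length ys) (mon ys a) = (if \<forall>i<length ys. a i = p - 1
   then of_nat (N (length ys)) * mon ys (%i. if i < length ys then 0 else a i) else 0)" by simp
 have 2: "mon ys (%i. if i < length ys then 0 else a i) = 1"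
  using mon_cong[of ys "%i. if i < length ys then 0 else a i" "%_. 0"] by simp
 have 3: "mon ys (%i. a i div p) = 1" using mon_cong[of ys "%i. a i div p" "%_. 0"] exps_less[OF a] by simp
 have 4: "(\<forall>i<length ys. a i mod p = p - 1) \<longleftrightarrow> (\<forall>i<length ys. a i = p - 1)" using exps_less[OF a] by simp
 have if_power: "(if Q then x * 1 else 0) = x * (if Q then 1 else 0) ^ p" for Q and x :: 'a
  by (simp add: zero_power)
 show "del_all (length ys) (mon ys a) = of_nat (fact (p - 1) ^ length ys) * car ys (mon ys a) ^ p"
  unfolding 1 2 car_mon 3 4 N_def by (rule if_power)
qed (simp_all only: car_add car_smult frob_add power_mult_distrib ring_distribs mult.left_commute)

text \<open>
 Horner's scheme: the formula for \<open>z\<close> is stable under products, and under adding constants of the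
 derivation because the other powers of \<open>z\<close> contribute exact terms only.
\<close>

lemma car_top_power:
 assumes k: "k < length ys" and b: "b k = 0"
 shows "car ys (z ^ (p - 1) * del ys k z * mon ys b) =
  del ys k z * car ys (ys ! k ^ (p - 1) * mon ys b)"
  and "i < p - 1 ==> car ys (z ^ i * del ys k z * mon ys b) = 0"
proof -
 let ?D = "del ys k"
 note der = del_derivation[OF k]
 have Dm: "?D (mon ys b) = 0" by (simp add: del_mon[OF k] b)
 have exact: "car ys (z ^ i * ?D z * (c * mon ys b)) = 0" if "i < p - 1" "?D c = 0" for i z c
 proof -
  have nz: "(of_nat (Suc i) :: 'a) ~= 0" using that by (intro of_nat_nz) auto
  have "?D (z ^ Suc i * (c * mon ys b)) = of_nat (Suc i) * (z ^ i * ?D z * (c * mon ys b))"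
   unfolding del_of_mult[OF k] derivation_power[OF der] that(2) Dm by simp
  \<comment> \<open>The inverse of \<open>Suc i\<close>, which exists as \<open>Suc i < p\<close>,
    is its own p-th power and can be pulled out of the Cartier operator.\<close>
  then have "z ^ i * ?D z * (c * mon ys b) =
    inverse (of_nat (Suc i)) ^ p * ?D (z ^ Suc i * (c * mon ys b))"
   using nz by (simp only: power_inverse of_nat_pow_p) (simp add: field_simps)
  then show ?thesis by (simp only: car_smult car_del[OF k])  simp
 qed
 from exact[of i 1] show "i < p - 1 ==> car ys (z ^ i * ?D z * mon ys b) = 0" by (simp add: derivation_one[OF der])
 define A where "A z \<longleftrightarrow> car ys (z ^ (p - 1) * ?D z * mon ys b) =
  ?D z * car ys (ys ! k ^ (p - 1) * mon ys b)" for z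
 have pow: "z ^ (p - 1) * z = z ^ p" for z :: 'a using p_gt_0 by (metis power_minus_mult)
 have mult: "A (z * w)" if "A z" "A w" for z w
 proof -
  have "(z * w) ^ (p - 1) * ?D (z * w) * mon ys b =
    (z ^ (p - 1) * z) * (w ^ (p - 1) * ?D w * mon ys b) +
    (w ^ (p - 1) * w) * (z ^ (p - 1) * ?D z * mon ys b)"
   by (simp add: del_of_mult[OF k] power_mult_distrib algebra_simps)
  then have "car ys ((z * w) ^ (p - 1) * ?D (z * w) * mon ys b) =
    z * (?D w * car ys (ys ! k ^ (p - 1) * mon ys b)) +
    w * (?D z * car ys (ys ! k ^ (p - 1) * mon ys b))"
   using that unfolding A_def pow by (simp add: car_add car_smult)
  then show ?thesis unfolding A_def by (simp add: del_of_mult[OF k] algebra_simps)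
 qed
 have shift: "A (z + c)" if "A z" "?D c = 0" for z c
 proof -
  have "(z + c) ^ (p - 1) * ?D (z + c) * mon ys b =
    (\<Sum>i\<le>p - 1. z ^ i * ?D z * (of_nat ((p - 1) choose i) * c ^ (p - 1 - i) * mon ys b))"
   using that unfolding binomial_ring[of z c] sum_distrib_right derivation_add[OF der]
   by (intro sum.cong) (simp_all add: mult_ac)
  \<comment> \<open>Only the term with \<open>z ^ (p - 1)\<close> survives; its binomial coefficient
    is 1 and the other terms are exact.\<close>
  also have "... = (\<Sum>i<p - 1. z ^ i * ?D z * (of_nat ((p - 1) choose i) * c ^ (p - 1 - i) * mon ys b)) +
    z ^ (p - 1) * ?D z * mon ys b" unfolding lessThan_Suc_atMost[symmetric] sum.lessThan_Suc by simp
  also have "car ys ... = car ys (z ^ (p - 1) * ?D z * mon ys b)"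
  proof -
   have "?D (of_nat ((p - 1) choose i) * c ^ (p - 1 - i)) = 0" for i
   proof -
    have "?D (of_nat m) = 0" for m
     by (induction m) (simp_all add: derivation_zero[OF der] derivation_add[OF der] derivation_one[OF der])
    then show ?thesis using that by (simp add: del_of_mult[OF k] derivation_power[OF der])
   qed
   then show ?thesis unfolding car_add car_sum by (simp add: exact)
  qed
  finally show ?thesis using that unfolding A_def by (simp add: derivation_add[OF der])
 qed
 have yk: "A (ys ! k)" using k by (simp add: A_def del_basis)
 have const: "A c" if "?D c = 0" for c using that by (simp add: A_def car_zero)
 have powA: "A (ys ! k ^ m)" for m by (induction m) (auto intro: mult yk const simp: derivation_one[OF der])
 \<comment> \<open>Grouping by the exponent of \<open>ys ! k\<close> writes \<open>z\<close> as a
   polynomial in \<open>ys ! k\<close> of degree below p whose coefficients \<open>c i\<close> are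
   constants for \<open>?D\<close>.\<close>
 define E where "E i = {a \<in> exps p (length ys). a k = i}" for i
 define c where "c i = (\<Sum>a\<in>E i. crd ys z a ^ p * mon ys (a(k := 0)))" for i
 have Dc: "?D (c i) = 0" for i
  unfolding c_def derivation_sum[OF der] derivation_p_power[OF der] by (simp add: del_mon[OF k])
 have split: "mon ys a = mon ys (a(k := 0)) * ys ! k ^ a k" for a
 proof -
  have "mon ys a = mon ys (%i. (a(k := 0)) i + (if i = k then a k else 0))" by (rule mon_cong) simp
  then show ?thesis using k by (simp only: mon_add mon_unit)
 qed
 have "z = (\<Sum>i<p. c i * ys ! k ^ i)"
 proof -
  have "z = (\<Sum>a\<in>exps p (length ys). crd ys z a ^ p * mon ys a)" using comb_crd[of z] by (simp add: comb_eq)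
  also have "... = (\<Sum>i<p. \<Sum>a\<in>E i. crd ys z a ^ p * mon ys a)" unfolding E_def
   by (rule sum.group[symmetric]) (auto dest: exps_less[OF _ k])
  also have "... = (\<Sum>i<p. c i * ys ! k ^ i)" unfolding c_def sum_distrib_right
   by (intro sum.cong refl) (subst split, auto simp: E_def)
  finally show ?thesis .
 qed
 \<comment> \<open>The offset \<open>n\<close> is there because Horner's scheme peels off the lowest
   coefficient first.\<close>
 moreover have "A (\<Sum>i<m. c (n + i) * ys ! k ^ i)" for m n
 proof (induction m arbitrary: n)
  case 0
  then show ?case by (simp add: const derivation_zero[OF der])
 next
  case (Suc m)
  have "(\<Sum>i<Suc m. c (n + i) * ys ! k ^ i) = (\<Sum>i<m. c (Suc n + i) * ys ! k ^ i) * ys ! k + c n"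
   unfolding sum.lessThan_Suc_shift sum_distrib_right by (simp add: mult_ac)
  then show ?case using shift[OF mult[OF Suc yk] Dc] by (simp only:)
 qed
 from this[of 0 p] have "A (\<Sum>i<p. c i * ys ! k ^ i)" by simp
 ultimately have "A z" by simp
 then show "car ys (z ^ (p - 1) * ?D z * mon ys b) = ?D z * car ys (ys ! k ^ (p - 1) * mon ys b)"
  by (simp add: A_def)
qed

end

section \<open>Independence of monomials and exchange of basis elements\<close>

definition p_independent :: "'a list => bool" where
 "p_independent zs \<longleftrightarrow> (\<forall>c. comb zs c = 0 --> (\<forall>a\<in>exps p (length zs). c a = 0))"

lemma monomials_independent:
 assumes "p_independent zs"
 shows "inj_on (mon zs) (exps p (length zs))"
  and "frob.independent (mon zs ` exps p (length zs))"
proof -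
 show inj: "inj_on (mon zs) (exps p (length zs))"
 proof (rule inj_onI, rule ccontr)
  fix a b assume ab: "a \<in> exps p (length zs)" "b \<in> exps p (length zs)" "mon zs a = mon zs b" "a ~= b"
  have "comb zs (%d. (if d = a then 1 else 0) - (if d = b then 1 else 0)) = 0"
   unfolding comb_diff comb_single[OF ab(1)] comb_single[OF ab(2)] using ab by simp
  from assms[unfolded p_independent_def, rule_format, OF this ab(1)] show False using ab(4) by simp
 qed
 show "frob.independent (mon zs ` exps p (length zs))"
 proof (rule frob.independent_if_scalars_zero)
  fix f x assume f: "(\<Sum>x\<in>mon zs ` exps p (length zs). f x ^ p * x) = 0"
   and x: "x \<in> mon zs ` exps p (length zs)"
  have "comb zs (%a. f (mon zs a)) = 0" using f by (simp add: sum.reindex[OF inj] comb_eq)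
  then have "f (mon zs a) = 0" if "a \<in> exps p (length zs)" for a
   using assms[unfolded p_independent_def, rule_format, of "%a. f (mon zs a)"] that by simp
  then show "f x = 0" using x by blast
 qed simp
qed

lemma monomials_span:
 assumes "p_basis UNIV (ys::'a list)"
 shows "frob.span (mon ys ` exps p (length ys)) = UNIV"
proof -
 have "comb ys (crd ys x) \<in> frob.span (mon ys ` exps p (length ys))" for x
  unfolding comb_eq by (intro frob.span_sum frob.span_scale frob.span_base) auto
 then show ?thesis using comb_crd[OF assms] by auto
qed

text \<open>Dimension count over the p-th powers: independent monomials, as many as in a basis, must
  span.\<close>

lemma p_basis_by_independence:
 assumes ys: "p_basis UNIV (ys::'a list)" and len: "length zs = length ys"
  and ind: "p_independent zs"
 shows "p_basis UNIV zs" unfolding p_basis_UNIV_iff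
proof (intro conjI allI)
 let ?E = "exps p (length ys)"
 note inj = monomials_independent(1)[OF ind, unfolded len]
  and indep = monomials_independent(2)[OF ind, unfolded len]
 fix x
 have "x \<in> frob.span (mon zs ` ?E)"
 proof (rule ccontr)
  assume x: "x \<notin> frob.span (mon zs ` ?E)"
  then have "frob.independent (insert x (mon zs ` ?E))" using indep by (simp add: frob.independent_insert)
  then have "card (insert x (mon zs ` ?E)) \<le> card (mon ys ` ?E)"
   using frob.independent_span_bound[of "mon ys ` ?E"] monomials_span[OF ys] by simp
  also have "... \<le> card ?E" by (rule card_image_le) simp
  also have "... = card (mon zs ` ?E)" using card_image[OF inj] by simp
  finally have "x \<in> mon zs ` ?E" by (simp add: card_insert_if split: if_splits)
  then show False using x frob.span_base by blast
 qed
 then obtain u where u: "x = (\<Sum>v\<in>mon zs ` ?E. u v ^ p * v)" by (auto simp: frob.span_finite)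
 show "\<exists>c. x = comb zs c"
  by (rule exI[of _ "%a. u (mon zs a)"]) (simp only: u sum.reindex[OF inj] comb_eq len o_def)
qed (use ind in \<open>auto simp: p_independent_def\<close>)

text \<open>The number \<open>p ^ n\<close> of monomials is the dimension over Frobenius, and it
  determines \<open>n\<close> because p > 1.\<close>

lemma p_basis_length:
 assumes "p_basis UNIV (ys::'a list)" "p_basis UNIV (zs::'a list)"
 shows "length ys = length zs"
proof -
 have le: "length zs \<le> length ys" if "p_basis UNIV (ys::'a list)" "p_basis UNIV (zs::'a list)" for ys zs
 proof -
  have ind: "p_independent zs" using that(2) by (auto simp: p_basis_UNIV_iff p_independent_def)
  have "p ^ length zs = card (mon zs ` exps p (length zs))"
   using card_image[OF monomials_independent(1)[OF ind]] by (simp add: card_exps)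
  also have "... \<le> card (mon ys ` exps p (length ys))"
   using frob.independent_span_bound[OF _ monomials_independent(2)[OF ind], of "mon ys ` exps p (length ys)"]
    monomials_span[OF that(1)] by simp
  also have "... \<le> p ^ length ys"
   using card_image_le[OF finite_exps, of "mon ys" p "length ys"] by (simp add: card_exps)
  finally show ?thesis using p_gt_1 by simp
 qed
 show ?thesis using le[OF assms] le[OF assms(2,1)] by simp
qed

text \<open>Both claims come from evaluating the old Cartier operator on monomials in the new list.
  It separates these monomials, which gives independence, and since \<open>del ys k z\<close> is the
  Jacobian of the exchange, the formula expresses that the operator belongs to the top form and not
  to the coordinates.\<close>

lemma exchange:
 assumes ys: "p_basis UNIV (ys::'a list)" and k: "k < length ys" and nz: "del ys k z ~= 0"
 shows p_basis_exchange: "p_basis UNIV (ys[k := z])"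
  and car_exchange: "car (ys[k := z]) x = inverse (del ys k z) * car ys (del ys k z * x)"
proof -
 let ?zs = "ys[k := z]" and ?n = "length ys"
 have split: "mon ?zs a = z ^ a k * mon ys (a(k := 0))" for a
 proof -
  have "mon ?zs a = mon ?zs (%i. (a(k := 0)) i + (if i = k then a k else 0))" by (rule mon_cong) simp
  also have "... = mon ?zs (a(k := 0)) * z ^ a k"
   using k by (simp only: mon_add mon_unit length_list_update nth_list_update_eq)
  also have "mon ?zs (a(k := 0)) = mon ys (a(k := 0))"
   unfolding mon_def by (simp, rule prod.cong) (auto simp: nth_list_update)
  finally show ?thesis by simp
 qed
 \<comment> \<open>Exponents of \<open>z\<close> below p - 1 give exact terms; at exponent p - 1 the
   element \<open>z\<close> behaves like \<open>ys ! k\<close>.\<close>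
 have main: "car ys (del ys k z * mon ?zs a) =
   (if a k = p - 1 then del ys k z * car ys (mon ys a) else 0)" if "a k < p" for a
 proof -
  have "ys ! k ^ (p - 1) * mon ys (a(k := 0)) = mon ys (a(k := p - 1))"
  proof -
   have "mon ys (a(k := p - 1)) = mon ys (%i. (a(k := 0)) i + (if i = k then p - 1 else 0))"
    by (rule mon_cong) simp
   then show ?thesis using k by (simp only: mon_add mon_unit mult.commute)
  qed
  note eq = this
  have comm: "del ys k z * mon ?zs a = z ^ a k * del ys k z * mon ys (a(k := 0))" by (simp add: split)
  show ?thesis
  proof (cases "a k = p - 1")
   case True
   then have "a(k := p - 1) = a" by auto
   with True show ?thesis unfolding comm using car_top_power(1)[OF ys k, of "a(k := 0)" z] eq by simp
  next
   case False
   then show ?thesis unfolding comm using car_top_power(2)[OF ys k, of "a(k := 0)" "a k" z] that by simp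
  qed
 qed
 show zs: "p_basis UNIV ?zs"
 proof (rule p_basis_by_independence[OF ys], simp, unfold p_independent_def, intro allI impI ballI)
  fix c a assume c: "comb ?zs c = 0" and "a \<in> exps p (length ?zs)"
  then have a: "a \<in> exps p ?n" by simp
  \<comment> \<open>Complementary exponents: pairing with this monomial singles out the coefficient
    at \<open>a\<close>.\<close>
  let ?t = "%i. p - 1 - a i"
  have trm: "car ys (del ys k z * mon ?zs ?t * mon ?zs b) = (if b = a then del ys k z else 0)"
   if b: "b \<in> exps p ?n" for b
  proof -
   have eq: "del ys k z * mon ?zs ?t * mon ?zs b = del ys k z * mon ?zs (%i. ?t i + b i)" by (simp add: mon_add)
   have ak: "a k < p" "b k < p" using a b k by (auto dest: exps_less)
   show ?thesis
   proof (cases "?t k + b k < p")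
    case True
    have "b = a" if "\<forall>i<?n. (?t i + b i) mod p = p - 1"
    proof (rule exps_eqI[OF b a])
     fix i assume i: "i < ?n"
     then have "a i < p" "b i < p" using a b by (auto dest: exps_less)
     moreover have "p - 1 - a i + b i < p | (p - 1 - a i + b i - p < p - 1 &
       (p - 1 - a i + b i) mod p = p - 1 - a i + b i - p)" using calculation by (auto simp: mod_if)
     ultimately show "b i = a i" using that[rule_format, OF i] by auto
    qed
    moreover have "car ys (mon ys (%i. ?t i + a i)) = 1"
    proof -
     have *: "?t i + a i = p - 1" if "i < ?n" for i using exps_less[OF a that] by simp
     have "mon ys (%i. (?t i + a i) div p) = mon ys (%i. 0)" by (rule mon_cong) (simp only: *, simp)
     moreover have "(?t i + a i) mod p = p - 1" if "i < ?n" for i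
      by (simp only: *[OF that] mod_less diff_less p_gt_0 zero_less_one)
     ultimately show ?thesis unfolding car_mon[OF ys] by simp
    qed
    moreover have "?t k + a k = p - 1" using ak by simp
    ultimately show ?thesis unfolding eq main[of "%i. ?t i + b i", OF True] using True k
     by (cases "b = a") (auto simp: car_mon[OF ys])
   next
    case False
    \<comment> \<open>A carry in the exponent of \<open>z\<close>: the factor \<open>z ^ p\<close>
      comes out, and the exponent \<open>b k - a k - 1\<close> left over is below p - 1, so the
      remaining value is 0.\<close>
    let ?m = "%i. if i = k then ?t k + b k - p else ?t i + b i"
    have "mon ?zs (%i. ?t i + b i) = mon ?zs (%i. ?m i + (if i = k then p else 0))"
     using False by (intro mon_cong) simp
    then have "mon ?zs (%i. ?t i + b i) = z ^ p * mon ?zs ?m" using k by (simp only: mon_add) (simp add: mon_unit)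
    then have "car ys (del ys k z * mon ?zs (%i. ?t i + b i)) = z * car ys (del ys k z * mon ?zs ?m)"
     using car_smult[OF ys, of z] by (simp add: mult.left_commute)
    also have "car ys (del ys k z * mon ?zs ?m) = 0" using ak False by (subst main) auto
    finally have "car ys (del ys k z * mon ?zs (%i. ?t i + b i)) = 0" by simp
    moreover have "b ~= a" using False ak by auto
    ultimately show ?thesis unfolding eq by (simp only: if_False)
   qed
  qed
  have "0 = car ys (del ys k z * mon ?zs ?t * comb ?zs c)" using c car_zero[OF ys] by simp
  also have "... = (\<Sum>b\<in>exps p ?n. c b * car ys (del ys k z * mon ?zs ?t * mon ?zs b))"
   unfolding comb_eq sum_distrib_left car_sum[OF ys] length_list_update
   by (intro sum.cong refl) (simp add: car_smult[OF ys, symmetric] mult_ac)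
  also have "... = (\<Sum>b\<in>exps p ?n. if b = a then c a * del ys k z else 0)"
   by (intro sum.cong refl) (simp only: trm, simp)
  also have "... = c a * del ys k z" using a by simp
  finally show "c a = 0" using nz by simp
 qed
 have "car ys (del ys k z * x) = del ys k z * car ?zs x"
 proof (rule eq_on_monomials[OF zs, where s = "%c. c" and F = "%x. car ys (del ys k z * x)"
   and G = "%x. del ys k z * car ?zs x"])
  fix a assume a: "a \<in> exps p (length ?zs)"
  then have "a k < p" using k by (auto dest: exps_less)
  moreover have "a i div p = 0" if "i < ?n" for i using exps_less[OF a] that by simp
  then have "mon ?zs (%i. a i div p) = 1" "mon ys (%i. a i div p) = 1"
   using mon_cong[of ?zs "%i. a i div p" "%i. 0"] mon_cong[of ys "%i. a i div p" "%i. 0"] by simp_all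
  ultimately show "car ys (del ys k z * mon ?zs a) = del ys k z * car ?zs (mon ?zs a)"
   using k exps_less[OF a] by (auto simp: main car_mon[OF ys] car_mon[OF zs])
 qed (auto simp: car_add[OF ys] car_add[OF zs] car_smult[OF ys] car_smult[OF zs] ring_distribs mult.left_commute)
 then show "car ?zs x = inverse (del ys k z) * car ys (del ys k z * x)" using nz by simp
qed

end

section \<open>The Cartier operator\<close>

definition jac_mat :: "'a::field list => 'a list => 'a mat" where
 "jac_mat xs ys = mat (length ys) (length ys) (%(i, j). partial ys j (xs ! i))"

definition jac :: "'a::field list => 'a list => 'a" where
 "jac xs ys = det (jac_mat xs ys)"

text \<open>The Cartier operator on top forms, read on coefficients: it sends
  \<open>x * \<omega>\<close> to \<open>cartier \<omega> x * \<omega>\<close>, and so can be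
  computed in any coordinates (\<open>cartier_eq\<close>).\<close>

definition cartier :: "'a::field topform => 'a => 'a" where
 "cartier \<omega> x = inverse (fst \<omega>) * car (snd \<omega>) (fst \<omega> * x)"

lemma form_coeff_jac: "form_coeff \<omega> ys = fst \<omega> * jac (snd \<omega>) ys" by (simp add: form_coeff_def jac_def jac_mat_def)

text \<open>In the Leibniz formula a permutation other than the identity moves some index different
  from \<open>k\<close>, whose row is a standard basis vector.\<close>

lemma det_single_row:
 assumes k: "k < n"
 shows "det (mat n n (%(i, j). if i = k then v j else if i = j then 1 else 0)) = (v k :: 'b::comm_ring_1)"
proof -
 let ?M = "mat n n (%(i, j). if i = k then v j else if i = j then 1 else 0)"
 let ?t = "%q. signof q * (\<Prod>i = 0..<n. ?M $$ (i, q i))"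
 have 0: "?t q = 0" if q: "q permutes {0..<n}" "q ~= id" for q
 proof -
  have "\<exists>i<n. i ~= k & q i ~= i"
  proof (rule ccontr)
   assume *: "\<not> ?thesis"
   have "q i = i" if "i ~= k" for i using * that q(1) by (cases "i < n") (auto simp: permutes_def)
   moreover have "q k = k" using calculation permutes_inj[OF q(1)] by (metis injD)
   ultimately have "q = id" by (metis eq_id_iff)
   then show False using q by simp
  qed
  then obtain i where i: "i < n" "i ~= k" "q i ~= i" by blast
  moreover have "q i < n" using i(1) permutes_in_image[OF q(1), of i] by auto
  ultimately have "?M $$ (i, q i) = 0" by auto
  then have "(\<Prod>i = 0..<n. ?M $$ (i, q i)) = 0" using i(1) by (intro prod_zero) auto
  then show ?thesis by simp
 qed
 have "det ?M = (\<Sum>q\<in>{q. q permutes {0..<n}}. ?t q)" by (simp add: det_def)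
 also have "... = (\<Sum>q\<in>{id}. ?t q)"
 proof (rule sum.mono_neutral_right)
  show "\<forall>q\<in>{q. q permutes {0..<n}} - {id}. ?t q = 0" using 0 by blast
 qed (simp_all add: finite_permutations permutes_id)
 also have "... = (\<Prod>i = 0..<n. if i = k then v k else 1)"
 proof -
  have "(\<Prod>i = 0..<n. ?M $$ (i, i)) = (\<Prod>i = 0..<n. if i = k then v k else 1)" by (rule prod.cong) auto
  then show ?thesis by (simp del: index_mat)
 qed
 also have "... = v k" using k by simp
 finally show ?thesis .
qed

section \<open>Jacobians and the transformation rule of the Cartier operator\<close>

context char_p
begin

lemma p_inv_linear_iff:
 "p_inv_linear e (\<psi>::'a => 'a) \<longleftrightarrow> (\<forall>x y. \<psi> (x + y) = \<psi> x + \<psi> y) &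
   (\<forall>a x. \<psi> (a ^ (p ^ e) * x) = a * \<psi> x)" by (simp add: p_inv_linear_def)

lemma jac_entry:
 assumes "p_basis UNIV (ys::'a list)" "i < length ys" "j < length ys"
 shows "jac_mat xs ys $$ (i, j) = del ys j (xs ! i)" using assms by (simp add: jac_mat_def partial_eq_del)

text \<open>Expanding the derivations of one basis in those of another turns the chain rule into a
  matrix product.\<close>

lemma jac_chain:
 assumes xs: "p_basis UNIV (xs::'a list)" and ys: "p_basis UNIV (ys::'a list)" and zs: "p_basis UNIV (zs::'a list)"
 shows "jac xs zs = jac xs ys * jac ys zs"
proof -
 define n where "n = length ys"
 have len: "length xs = n" "length ys = n" "length zs = n"
  using p_basis_length[OF xs ys] p_basis_length[OF zs ys] by (simp_all add: n_def)
 have c: "jac_mat xs zs \<in> carrier_mat n n" "jac_mat xs ys \<in> carrier_mat n n" "jac_mat ys zs \<in> carrier_mat n n"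
  by (simp_all add: jac_mat_def len)
 have "jac_mat xs zs = jac_mat xs ys * jac_mat ys zs"
 proof (rule eq_matI)
  fix i j assume "i < dim_row (jac_mat xs ys * jac_mat ys zs)" "j < dim_col (jac_mat xs ys * jac_mat ys zs)"
  then have ij: "i < n" "j < n" using c by auto
  have "jac_mat xs zs $$ (i, j) = (\<Sum>l<n. del ys l (xs ! i) * del zs j (ys ! l))"
   using derivation_expand[OF ys del_derivation[OF zs], of j "xs ! i"] ij len
   by (simp add: jac_entry[OF zs] mult.commute)
  also have "... = (jac_mat xs ys * jac_mat ys zs) $$ (i, j)"
   using c ij len by (simp add: scalar_prod_def jac_entry[OF ys] jac_entry[OF zs] atLeast0LessThan)
  finally show "jac_mat xs zs $$ (i, j) = (jac_mat xs ys * jac_mat ys zs) $$ (i, j)" .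
 qed (use c in auto)
 then show ?thesis unfolding jac_def using det_mult[OF c(2,3)] by simp
qed

lemma jac_exchange:
 assumes ys: "p_basis UNIV (ys::'a list)" and k: "k < length ys"
 shows "jac (ys[k := z]) ys = del ys k z"
proof -
 have "jac_mat (ys[k := z]) ys =
   mat (length ys) (length ys) (%(i, j). if i = k then del ys j z else if i = j then 1 else 0)"
  by (rule eq_matI) (auto simp: jac_mat_def partial_eq_del[OF ys] del_basis[OF ys])
 then show ?thesis using det_single_row[OF k, of "%j. del ys j z"] by (simp add: jac_def)
qed

lemma jac_refl:
 assumes ys: "p_basis UNIV (ys::'a list)"
 shows "jac ys ys = 1"
proof -
 have "jac_mat ys ys = 1\<^sub>m (length ys)"
  by (rule eq_matI) (auto simp: jac_mat_def partial_eq_del[OF ys] del_basis[OF ys])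
 then show ?thesis by (simp add: jac_def)
qed

lemma jac_nz:
 assumes "p_basis UNIV (xs::'a list)" "p_basis UNIV (ys::'a list)"
 shows "jac xs ys ~= 0" using jac_chain[OF assms assms(1)] jac_refl[OF assms(1)] by auto

text \<open>The transformation rule is treated as a relation because it is proved by composing
  single exchanges.\<close>

definition compat :: "'a list => 'a list => bool" where
 "compat xs ys \<longleftrightarrow> (\<forall>x. car xs x = inverse (jac xs ys) * car ys (jac xs ys * x))"

lemma compat_trans:
 assumes "p_basis UNIV (xs::'a list)" "p_basis UNIV (ys::'a list)" "p_basis UNIV (zs::'a list)"
  and "compat xs ys" "compat ys zs"
 shows "compat xs zs" using assms(4,5) by (simp add: compat_def jac_chain[OF assms(1,2,3)] mult_ac)

lemma compat_exchange:
 assumes "p_basis UNIV (ys::'a list)" "k < length ys" "del ys k z ~= 0"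
 shows "compat (ys[k := z]) ys" using car_exchange[OF assms] by (simp add: compat_def jac_exchange assms)

text \<open>Steinitz exchange: the entries of \<open>xs\<close> are brought in one at a time, each
  step respecting the transformation rule.\<close>

lemma compat_exchange_steps:
 assumes xs: "p_basis UNIV (xs::'a list)" and ys: "p_basis UNIV (ys::'a list)"
 shows "k \<le> length ys ==> \<exists>zs. p_basis UNIV zs & compat zs ys & (\<forall>i<k. zs ! i = xs ! i)"
proof (induction k)
 case 0
 show ?case using ys by (intro exI[of _ ys]) (simp add: compat_def jac_refl)
next
 case (Suc k)
 then obtain zs where zs: "p_basis UNIV zs" "compat zs ys" and eq: "\<forall>i<k. zs ! i = xs ! i" by auto
 define n where "n = length ys"
 have len: "length xs = n" "length ys = n" "length zs = n"
  using p_basis_length[OF xs ys] p_basis_length[OF zs(1) ys] by (simp_all add: n_def)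
 have k: "k < n" using Suc len by simp
 \<comment> \<open>Otherwise \<open>xs ! k\<close> would be killed by its own dual derivation: this
   derivation vanishes on the first \<open>k\<close> entries, which already agree with
   \<open>xs\<close>, and the partial derivatives at the later entries vanish.\<close>
 have "\<exists>j<n. k \<le> j & del zs j (xs ! k) ~= 0"
 proof (rule ccontr)
  assume *: "\<not> ?thesis"
  let ?D = "del xs k"
  have "?D (zs ! i) * del zs i (xs ! k) = 0" if "i < n" for i
  proof (cases "i < k")
   case True
   then show ?thesis using eq del_basis[OF xs, of i k] k len by simp
  next
   case False
   then show ?thesis using * that by simp
  qed
  then have "(\<Sum>i<n. ?D (zs ! i) * del zs i (xs ! k)) = 0" by (intro sum.neutral) simp
  then have "?D (xs ! k) = 0" using derivation_expand[OF zs(1) del_derivation[OF xs], of k "xs ! k"] k len by simp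
  then show False using del_basis[OF xs, of k k] k len by simp
 qed
 then obtain j where j: "j < n" "k \<le> j" "del zs j (xs ! k) ~= 0" by blast
 have "\<exists>us. p_basis UNIV us & compat us ys & (\<forall>i<k. us ! i = xs ! i) & del us k (xs ! k) ~= 0"
 proof (cases "del zs k (xs ! k) = 0")
  case False
  then show ?thesis using zs eq by blast
 next
  case True
  then have "j ~= k" using j by auto
  \<comment> \<open>The pivot at \<open>k\<close> vanishes. Replacing \<open>zs ! j\<close> by
    \<open>zs ! j - zs ! k\<close> changes the k-th partial derivative into the sum of the k-th and
    the j-th, which is nonzero on \<open>xs ! k\<close>.\<close>
  define us where "us = zs[j := zs ! j - zs ! k]"
  have "del zs j (zs ! j - zs ! k) ~= 0" using j k \<open>j ~= k\<close> len
   by (simp add: derivation_diff[OF del_derivation[OF zs(1)]] del_basis[OF zs(1)])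
  then have us: "p_basis UNIV us" "compat us zs"
   using j len by (simp_all add: us_def p_basis_exchange[OF zs(1)] compat_exchange[OF zs(1)])
  have lu: "length us = n" by (simp add: us_def len)
  have "derivation (%x. 1 * del zs k x + 1 * del zs j x)"
   using j k len by (intro derivation_linear del_derivation[OF zs(1)]) auto
  then have "del us k = (%x. 1 * del zs k x + 1 * del zs j x)" by (rule derivation_eq_del[OF us(1), symmetric])
    (use j k \<open>j ~= k\<close> len lu in \<open>auto simp: us_def nth_list_update del_basis[OF zs(1)]
     derivation_diff[OF del_derivation[OF zs(1)]]\<close>)
  then have "del us k (xs ! k) ~= 0" using j True by simp
  moreover have "\<forall>i<k. us ! i = xs ! i" using eq j by (simp add: us_def)
  ultimately show ?thesis using us compat_trans[OF us(1) zs(1) ys us(2) zs(2)] by blast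
 qed
 then obtain us where us: "p_basis UNIV us" "compat us ys" "\<forall>i<k. us ! i = xs ! i" "del us k (xs ! k) ~= 0"
  by blast
 have lu: "length us = n" using p_basis_length[OF us(1) ys] len by simp
 have "p_basis UNIV (us[k := xs ! k])" "compat (us[k := xs ! k]) us"
  using us k lu by (simp_all add: p_basis_exchange compat_exchange)
 moreover have "\<forall>i<Suc k. us[k := xs ! k] ! i = xs ! i"
  using us(3) k lu by (auto simp: nth_list_update less_Suc_eq)
 ultimately show ?case using compat_trans us ys by blast
qed

lemma car_transform:
 assumes xs: "p_basis UNIV (xs::'a list)" and ys: "p_basis UNIV (ys::'a list)"
 shows "car xs x = inverse (jac xs ys) * car ys (jac xs ys * x)"
proof -
 obtain zs where zs: "p_basis UNIV zs" "compat zs ys" "\<forall>i<length ys. zs ! i = xs ! i"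
  using compat_exchange_steps[OF xs ys, of "length ys"] by auto
 have "zs = xs" using zs(3) p_basis_length[OF zs(1) ys] p_basis_length[OF xs ys] by (auto intro: nth_equalityI)
 then show ?thesis using zs by (simp add: compat_def)
qed

lemma form_coeff_nz:
 "rational_form \<omega> ==> p_basis UNIV (ys::'a list) ==> form_coeff \<omega> ys ~= 0"
 unfolding rational_form_def form_coeff_jac using jac_nz by simp

lemma form_coeff_change:
 assumes "rational_form \<omega>" "p_basis UNIV (xs::'a list)" "p_basis UNIV (ys::'a list)"
 shows "form_coeff \<omega> ys = form_coeff \<omega> xs * jac xs ys"
 using assms jac_chain[of "snd \<omega>" xs ys] by (simp add: form_coeff_jac rational_form_def)

lemma cartier_eq:
 assumes "rational_form \<omega>" "p_basis UNIV (ys::'a list)"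
 shows "cartier \<omega> x = inverse (form_coeff \<omega> ys) * car ys (form_coeff \<omega> ys * x)"
 using assms by (simp add: cartier_def form_coeff_jac rational_form_def car_transform[of "snd \<omega>" ys] mult_ac)

section \<open>Iterates of the Cartier operator of a form\<close>

lemma car_iter_add: "p_basis UNIV (ys::'a list) ==> (car ys ^^ e) (x + y) = (car ys ^^ e) x + (car ys ^^ e) y"
 by (induction e arbitrary: x y) (auto simp: car_add)

lemma car_iter_smult: "p_basis UNIV (ys::'a list) ==> (car ys ^^ e) (c ^ (p ^ e) * x) = c * (car ys ^^ e) x"
proof (induction e arbitrary: x c)
 case (Suc e)
 have "c ^ (p ^ Suc e) = (c ^ p) ^ (p ^ e)" by (simp add: power_mult)
 with Suc show ?case by (simp add: car_smult)
qed simp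

lemma cartier_iter:
 assumes "rational_form \<omega>" "p_basis UNIV (ys::'a list)"
 shows "(cartier \<omega> ^^ e) x = inverse (form_coeff \<omega> ys) * (car ys ^^ e) (form_coeff \<omega> ys * x)"
proof (induction e)
 case 0
 then show ?case using form_coeff_nz[OF assms] by simp
next
 case (Suc e)
 let ?u = "form_coeff \<omega> ys"
 have u: "?u * (inverse ?u * y) = y" for y using form_coeff_nz[OF assms] by (simp add: field_simps)
 show ?case by (simp only: funpow.simps o_apply Suc.IH cartier_eq[OF assms, of "inverse ?u * _"] u)
qed

text \<open>The exponent \<open>p ^ e - 1\<close> completes one factor of the coefficient to a
  \<open>p ^ e\<close>-th power, which leaves the iterate as a scalar. All later twists by
  \<open>p ^ e - 1\<close> originate here.\<close>

lemma cartier_iter_power: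
 assumes "rational_form \<omega>" "p_basis UNIV (ys::'a list)"
 shows "(cartier \<omega> ^^ e) (form_coeff \<omega> ys ^ (p ^ e - 1) * x) = (car ys ^^ e) x"
proof -
 let ?u = "form_coeff \<omega> ys"
 have nz: "?u ~= 0" by (rule form_coeff_nz[OF assms])
 have "?u * ?u ^ (p ^ e - 1) = ?u ^ (p ^ e)" using power_minus_mult[of "p ^ e" ?u] by (simp add: mult.commute)
 then have eq: "?u * (?u ^ (p ^ e - 1) * x) = ?u ^ (p ^ e) * x" by (simp only: mult.assoc[symmetric])
 show ?thesis unfolding cartier_iter[OF assms] eq car_iter_smult[OF assms(2)] using nz by simp
qed

lemma cartier_linear:
 assumes "rational_form (\<omega>::'a topform)"
 shows "p_inv_linear e (cartier \<omega> ^^ e)"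
proof -
 have ys: "p_basis UNIV (snd \<omega>)" using assms by (simp add: rational_form_def)
 show ?thesis unfolding p_inv_linear_iff cartier_iter[OF assms ys]
 proof (intro conjI allI)
  fix a x
  have "form_coeff \<omega> (snd \<omega>) * (a ^ p ^ e * x) = a ^ p ^ e * (form_coeff \<omega> (snd \<omega>) * x)"
   by (rule mult.left_commute)
  then show "inverse (form_coeff \<omega> (snd \<omega>)) * (car (snd \<omega>) ^^ e) (form_coeff \<omega> (snd \<omega>) * (a ^ p ^ e * x)) =
    a * (inverse (form_coeff \<omega> (snd \<omega>)) * (car (snd \<omega>) ^^ e) (form_coeff \<omega> (snd \<omega>) * x))"
   by (simp only: car_iter_smult[OF ys] mult.left_commute[of a])
 qed (simp add: car_iter_add[OF ys] ring_distribs)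
qed

text \<open>Each step is surjective: \<open>c ^ p\<close> times the top monomial is sent to
  \<open>c\<close>.\<close>

lemma cartier_iter_nonzero:
 assumes \<omega>: "rational_form (\<omega>::'a topform)"
 shows "\<exists>x. (cartier \<omega> ^^ e) x ~= 0"
proof -
 have ys: "p_basis UNIV (snd \<omega>)" using \<omega> by (simp add: rational_form_def)
 have "car (snd \<omega>) (c ^ p * mon (snd \<omega>) (%_. p - 1)) = c" for c
  using p_gt_0 by (simp add: car_smult[OF ys] car_mon[OF ys])
 then have "surj (car (snd \<omega>))" by (rule surjI)
 then have "surj (car (snd \<omega>) ^^ e)" by (rule surj_fn)
 then obtain x where "(car (snd \<omega>) ^^ e) x = 1" unfolding surj_def by metis
 then show ?thesis using cartier_iter_power[OF \<omega> ys] by (metis zero_neq_one)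
qed


end

section \<open>Subrings and discrete valuation rings\<close>

definition sring :: "'a::field set => bool" where
 "sring A \<longleftrightarrow> 1 \<in> A & (\<forall>x\<in>A. \<forall>y\<in>A. x - y \<in> A & x * y \<in> A)"

lemma KR_simps [simp]:
 "carrier KR = UNIV" "monoid.mult KR x y = x * y" "monoid.one KR = 1" "ring.zero KR = 0"
 "ring.add KR x y = x + y" by (simp_all add: ring_of_type_algebra_def)

lemma KR_a_inv [simp]: "a_inv KR (x::'a::field) = - x"
proof -
 interpret field "KR :: 'a ring" by (rule field_from_type_algebra)
 have "\<ominus>\<^bsub>KR\<^esub> x + x = 0" using l_neg[of x] by simp
 then show ?thesis by (simp add: eq_neg_iff_add_eq_0)
qed

lemma sringD:
 assumes "sring A"
 shows sring_one: "1 \<in> A" and sring_zero: "0 \<in> A"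
  and sring_diff: "x \<in> A ==> y \<in> A ==> x - y \<in> A"
  and sring_mult: "x \<in> A ==> y \<in> A ==> x * y \<in> A"
  and sring_uminus: "x \<in> A ==> - x \<in> A"
  and sring_add: "x \<in> A ==> y \<in> A ==> x + y \<in> A"
proof -
 show 1: "1 \<in> A" and d: "\<And>x y. x \<in> A ==> y \<in> A ==> x - y \<in> A"
  and "x \<in> A ==> y \<in> A ==> x * y \<in> A" using assms by (auto simp: sring_def)
 show 0: "0 \<in> A" using d[OF 1 1] by simp
 show u: "\<And>x. x \<in> A ==> - x \<in> A" using d[OF 0] by fastforce
 show "x \<in> A ==> y \<in> A ==> x + y \<in> A" using d[OF _ u] by fastforce
qed

lemma sring_power: "sring A ==> x \<in> A ==> x ^ n \<in> A" by (induction n) (auto simp: sring_one sring_mult)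

lemma sring_sum: "sring A ==> (\<And>i. i \<in> I ==> f i \<in> A) ==> sum f I \<in> A"
 by (induction I rule: infinite_finite_induct) (auto simp: sring_zero sring_add)

lemma sring_prod: "sring A ==> (\<And>i. i \<in> I ==> f i \<in> A) ==> prod f I \<in> A"
 by (induction I rule: infinite_finite_induct) (auto simp: sring_one sring_mult)

lemma sring_of_nat: "sring A ==> of_nat n \<in> A" by (induction n) (auto simp: sring_zero sring_one sring_add)

lemma sring_UNIV [simp]: "sring UNIV" by (simp add: sring_def)

lemma subring_iff_sring: "subring A KR \<longleftrightarrow> sring (A :: 'a::field set)"
proof
 interpret field "KR :: 'a ring" by (rule field_from_type_algebra)
 assume "subring A KR"
 then interpret subring A KR .
 show "sring A" unfolding sring_def
 proof (intro conjI ballI)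
  show "1 \<in> A" using one_closed by simp
  fix x y assume xy: "x \<in> A" "y \<in> A"
  show "x * y \<in> A" using m_closed[OF xy] by simp
  have "- y \<in> A" using subringE(5)[OF subring_axioms xy(2)] by simp
  then show "x - y \<in> A" using subringE(7)[OF subring_axioms xy(1)] by fastforce
 qed
next
 interpret field "KR :: 'a ring" by (rule field_from_type_algebra)
 assume "sring A"
 then show "subring A KR" by (intro subringI) (auto simp: sringD)
qed

definition unit_in :: "'a::field set => 'a => bool" where
 "unit_in R x \<longleftrightarrow> x ~= 0 & x \<in> R & inverse x \<in> R"

lemma unit_in_iff: "x \<in> R - max_ideal R \<longleftrightarrow> unit_in R x" by (auto simp: unit_in_def max_ideal_def)

lemma unit_in_mult: "sring R ==> unit_in R x ==> unit_in R y ==> unit_in R (x * y)"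
 by (simp add: unit_in_def sring_mult)

lemma unit_in_inverse: "unit_in R x ==> unit_in R (inverse x)" by (simp add: unit_in_def)

lemma unit_in_one: "sring R ==> unit_in R 1" by (simp add: unit_in_def sring_one)

lemma unit_in_power: "sring R ==> unit_in R x ==> unit_in R (x ^ n)"
 by (induction n) (auto simp: unit_in_one unit_in_mult)

lemma unit_in_powi: "sring R ==> unit_in R x ==> unit_in R (x powi n)"
 by (auto simp: power_int_def unit_in_power unit_in_inverse)

lemma max_ideal_mult:
 assumes "sring R" "x \<in> max_ideal R" "y \<in> R"
 shows "x * y \<in> max_ideal R"
proof -
 have "x = 0 | y = 0" if "inverse (x * y) \<in> R"
 proof (rule ccontr)
  assume *: "\<not> (x = 0 | y = 0)"
  then have "inverse x = inverse (x * y) * y" by (simp add: field_simps)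
  then have "inverse x \<in> R" using that assms sring_mult by metis
  then show False using assms * by (auto simp: max_ideal_def)
 qed
 then show ?thesis using assms by (auto simp: max_ideal_def sring_mult)
qed

definition dvr :: "'a::field set => bool" where
 "dvr R \<longleftrightarrow> sring R & (\<exists>t. t \<in> R & t ~= 0 & inverse t \<notin> R & (\<forall>x. x ~= 0 --> (\<exists>n. unit_in R (x * t powi n))))"

lemma dvr_sring: "dvr R ==> sring R" by (simp add: dvr_def)

lemma dvr_uniformizer_ex:
 assumes "dvr R"
 shows "\<exists>t. uniformizer R t & (\<forall>x. x ~= 0 --> (\<exists>n. unit_in R (x * t powi n)))"
proof -
 note R = dvr_sring[OF assms]
 obtain t where t: "t \<in> R" "t ~= 0" "inverse t \<notin> R" "\<And>x. x ~= 0 ==> \<exists>n. unit_in R (x * t powi n)"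
  using assms unfolding dvr_def by metis
 have "x \<in> (%a. t * a) ` R" if "x \<in> max_ideal R" for x
 proof (cases "x = 0")
  case True
  then show ?thesis using sring_zero[OF R] by force
 next
  case False
  obtain n where n: "unit_in R (x * t powi n)" using t(4)[OF False] by blast
  have "n < 0"
  proof (rule ccontr)
   assume "\<not> n < 0"
   then have "t powi n \<in> R" using t(1) R by (simp add: power_int_def sring_power)
   then have "x * t powi n \<in> max_ideal R" using max_ideal_mult[OF R that] by blast
   then show False using n unit_in_iff by blast
  qed
  then have "t powi (- n) = t * t ^ nat (- n - 1)"
   using t(2) by (simp add: power_int_def power_Suc[symmetric] nat_diff_distrib Suc_nat_eq_nat_zadd1)
  moreover have "x = x * t powi n * t powi (- n)" using t(2) by (simp add: power_int_minus)
  ultimately have "x = t * (t ^ nat (- n - 1) * (x * t powi n))" by (simp add: mult_ac)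
  moreover have "t ^ nat (- n - 1) * (x * t powi n) \<in> R"
   using n t(1) R by (auto simp: unit_in_def intro!: sring_mult sring_power)
  ultimately show ?thesis by blast
 qed
 moreover have "t * a \<in> max_ideal R" if "a \<in> R" for a
  using max_ideal_mult[OF R _ that, of t] t by (simp add: max_ideal_def)
 ultimately have "uniformizer R t" using t(2) by (auto simp: uniformizer_def)
 then show ?thesis using t(4) by blast
qed

lemma uniformizer_in_max: "sring R ==> uniformizer R t ==> t \<in> max_ideal R"
 using sring_one[of R] by (auto simp: uniformizer_def image_iff intro!: bexI[of _ 1])

lemma uniformizer_assoc:
 assumes "sring R" "uniformizer R t" "uniformizer R s"
 shows "unit_in R (s / t)"
proof -
 have "t \<in> max_ideal R" "s \<in> max_ideal R" using assms uniformizer_in_max by blast+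
 then obtain a b where "t = s * a" "s = t * b" "a \<in> R" "b \<in> R" using assms by (metis uniformizer_def imageE)
 moreover have "t ~= 0" "s ~= 0" using assms by (auto simp: uniformizer_def)
 ultimately have "s / t = b" "inverse (s / t) = a" "a \<in> R" "b \<in> R" "b ~= 0" by (auto simp: field_simps)
 then show ?thesis by (simp add: unit_in_def)
qed

lemma uniformizer_not_unit: "sring R ==> uniformizer R t ==> inverse t \<notin> R & t \<in> R & t ~= 0"
 using sring_one[of R] by (auto simp: uniformizer_def max_ideal_def)

lemma uniformizer_power_unit:
 assumes R: "sring R" and t: "uniformizer R t" and u: "unit_in R (t powi n)"
 shows "n = 0"
proof -
 note T = uniformizer_not_unit[OF R t]
 have *: "\<not> unit_in R (t ^ Suc k)" for k
 proof
  assume "unit_in R (t ^ Suc k)"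
  then have "inverse (t ^ Suc k) * t ^ k \<in> R" using T R by (auto simp: unit_in_def intro: sring_mult sring_power)
  then show False using T by (simp add: field_simps)
 qed
 show ?thesis
 proof (cases n)
  case (nonneg k)
  then show ?thesis using u * by (cases k) (simp_all del: of_nat_Suc power_Suc)
 next
  case (neg k)
  then show ?thesis using unit_in_inverse[OF u] * by (simp add: power_int_minus del: of_nat_Suc power_Suc)
 qed
qed

text \<open>Two uniformizers differ by a unit, so the definite description in \<open>ord_at\<close>
  does not depend on the uniformizer occurring there.\<close>

lemma ord_unique:
 assumes R: "sring R" and t: "uniformizer R t" and x: "x ~= 0" and u: "unit_in R (x * t powi (- n))"
 shows "ord_at R x = n" unfolding ord_at_def unit_in_iff
proof (rule the_equality)
 show "\<exists>t. uniformizer R t & unit_in R (x * t powi - n)" using t u by blast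
 fix m assume "\<exists>t. uniformizer R t & unit_in R (x * t powi - m)"
 then obtain s where s: "uniformizer R s" "unit_in R (x * s powi - m)" by blast
 have nz: "t ~= 0" "s ~= 0" using s t by (auto simp: uniformizer_def)
 have "unit_in R (x * s powi - m * (s / t) powi m * inverse (x * t powi - n))"
  by (rule unit_in_mult[OF R unit_in_mult[OF R s(2) unit_in_powi[OF R uniformizer_assoc[OF R t s(1)]]]
     unit_in_inverse[OF u]])
 also have "x * s powi - m * (s / t) powi m * inverse (x * t powi - n) = t powi (n - m)"
  using nz x by (simp add: power_int_minus power_int_diff power_int_divide_distrib field_simps)
 finally show "m = n" using uniformizer_power_unit[OF R t] by fastforce
qed

lemma ord_ex:
 assumes "dvr R"
 shows "\<exists>t. uniformizer R t & (\<forall>x. x ~= 0 --> unit_in R (x * t powi (- ord_at R x)))"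
proof -
 obtain t where t: "uniformizer R t" "\<And>x. x ~= 0 ==> \<exists>n. unit_in R (x * t powi n)"
  using dvr_uniformizer_ex[OF assms] by blast
 have "unit_in R (x * t powi (- ord_at R x))" if x: "x ~= 0" for x
 proof -
  obtain n where n: "unit_in R (x * t powi n)" using t(2) x by blast
  then have "ord_at R x = - n" using ord_unique[OF dvr_sring[OF assms] t(1) x, of "- n"] by simp
  then show ?thesis using n by simp
 qed
 then show ?thesis using t(1) by blast
qed

locale dvr_loc =
 fixes R :: "'a::field set"
 assumes dvr: "dvr R"
begin

lemma R: "sring R" by (rule dvr_sring[OF dvr])

lemma ord_mult: "x ~= 0 ==> y ~= 0 ==> ord_at R (x * y) = ord_at R x + ord_at R y"
proof -
 assume nz: "x ~= 0" "y ~= 0"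
 obtain t where t: "uniformizer R t" "\<And>x. x ~= 0 ==> unit_in R (x * t powi (- ord_at R x))"
  using ord_ex[OF dvr] by blast
 have "t ~= 0" using t(1) by (simp add: uniformizer_def)
 then have "x * y * t powi (- (ord_at R x + ord_at R y)) =
   (x * t powi (- ord_at R x)) * (y * t powi (- ord_at R y))"
  using power_int_add[of t "- ord_at R x" "- ord_at R y"] by (simp add: mult_ac)
 also have "unit_in R ..." by (rule unit_in_mult[OF R t(2)[OF nz(1)] t(2)[OF nz(2)]])
 finally show ?thesis using ord_unique[OF R t(1)] nz by simp
qed

lemma ord_unit: "unit_in R x ==> ord_at R x = 0"
 using ord_ex[OF dvr] ord_unique[OF R, of _ x 0] by (auto simp: unit_in_def)

lemma ord_one: "ord_at R 1 = 0" by (rule ord_unit[OF unit_in_one[OF R]])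

lemma ord_inverse: "x ~= 0 ==> ord_at R (inverse x) = - ord_at R x"
 using ord_mult[of x "inverse x"] ord_one by simp

lemma ord_divide: "x ~= 0 ==> y ~= 0 ==> ord_at R (x / y) = ord_at R x - ord_at R y"
 by (simp add: divide_inverse ord_mult ord_inverse)

lemma ord_power: "x ~= 0 ==> ord_at R (x ^ n) = int n * ord_at R x"
 by (induction n) (auto simp: ord_one ord_mult algebra_simps)

lemma ord_powi: "x ~= 0 ==> ord_at R (x powi n) = n * ord_at R x"
 by (auto simp: power_int_def ord_power ord_inverse)

lemma ord_uniformizer: "uniformizer R t ==> ord_at R t = 1"
 using ord_unique[OF R, of t t 1] unit_in_one[OF R] by (auto simp: uniformizer_def)

lemma uniformizer_ex: "\<exists>t. uniformizer R t" using ord_ex[OF dvr] by blast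

lemma ord_zero_unit: "x ~= 0 ==> ord_at R x = 0 ==> unit_in R x" using ord_ex[OF dvr] by fastforce

lemma mem_iff: "x ~= 0 ==> x \<in> R \<longleftrightarrow> 0 \<le> ord_at R x"
proof -
 assume x: "x ~= 0"
 obtain t where t: "uniformizer R t" using uniformizer_ex by blast
 note T = uniformizer_not_unit[OF R t] ord_uniformizer[OF t]
 define n where "n = ord_at R x"
 have "ord_at R (x * t powi (- n)) = 0" using x T by (simp add: ord_mult ord_powi n_def)
 then have u: "unit_in R (x * t powi (- n))" using x T by (intro ord_zero_unit) auto
 have "x \<in> R" if "0 \<le> n"
 proof -
  have "t powi n \<in> R" using that T R by (simp add: power_int_def sring_power)
  then have "x * t powi (- n) * t powi n \<in> R" using u R by (simp only: unit_in_def sring_mult)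
  then show ?thesis using T by (simp add: power_int_minus mult.assoc)
 qed
 moreover have "0 \<le> n" if "x \<in> R"
 proof (rule ccontr)
  assume "\<not> 0 \<le> n"
  then have "inverse t = x * inverse (x * t powi (- n)) * t ^ nat (- n - 1)"
   using x T by (simp add: power_int_def power_Suc[symmetric] field_simps nat_diff_distrib Suc_nat_eq_nat_zadd1)
  also have "... \<in> R" using u T that R by (auto simp: unit_in_def intro!: sring_mult sring_power)
  finally show False using T by simp
 qed
 ultimately show ?thesis by (auto simp: n_def)
qed

lemma max_iff: "x ~= 0 ==> x \<in> max_ideal R \<longleftrightarrow> 0 < ord_at R x"
 using mem_iff[of x] mem_iff[of "inverse x"] by (auto simp: max_ideal_def ord_inverse)

lemma unit_iff: "x ~= 0 ==> unit_in R x \<longleftrightarrow> ord_at R x = 0" using ord_unit ord_zero_unit by blast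

lemma uniformizer_iff: "uniformizer R t \<longleftrightarrow> t ~= 0 & ord_at R t = 1"
proof
 assume t: "t ~= 0 & ord_at R t = 1"
 have "x \<in> max_ideal R \<longleftrightarrow> x \<in> (%a. t * a) ` R" for x
 proof (cases "x = 0")
  case True
  then show ?thesis using sring_zero[OF R] by (auto simp: max_ideal_def)
 next
  case False
  have "x \<in> (%a. t * a) ` R \<longleftrightarrow> x / t \<in> R" using t by (auto simp: image_iff field_simps intro: bexI[of _ "x / t"])
  then show ?thesis using t False max_iff[OF False] mem_iff[of "x / t"] by (simp add: ord_divide)
 qed
 then show "uniformizer R t" using t by (auto simp: uniformizer_def)
qed (auto simp: ord_uniformizer uniformizer_def)

text \<open>\<open>ord_at R 0\<close> carries no meaning, so a bound on orders that is closed under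
  addition treats 0 separately.\<close>

definition above :: "int => 'a => bool" where
 "above n x \<longleftrightarrow> x = 0 | n \<le> ord_at R x"

lemma above_iff: "uniformizer R t ==> above n x \<longleftrightarrow> x * t powi (- n) \<in> R"
 using mem_iff[of "x * t powi (- n)"] sring_zero[OF R]
 by (cases "x = 0") (auto simp: above_def uniformizer_iff ord_mult ord_powi)

lemma above_add: "above n x ==> above n y ==> above n (x + y)"
 using uniformizer_ex above_iff R by (auto simp: ring_distribs sring_add)

lemma above_sum: "(\<And>i. i \<in> I ==> above n (f i)) ==> above n (sum f I)"
proof (induction I rule: infinite_finite_induct)
 case (insert i I)
 then show ?case by (simp add: above_add)
qed (simp_all add: above_def)

lemma above_mult: "above n x ==> above m y ==> above (n + m) (x * y)" by (auto simp: above_def ord_mult)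

lemma above_0: "above 0 x \<longleftrightarrow> x \<in> R" using mem_iff[of x] sring_zero[OF R] by (auto simp: above_def)

lemma max_eq_above: "max_ideal R = {x. above 1 x}"
proof -
 have "x \<in> max_ideal R \<longleftrightarrow> above 1 x" for x
  using max_iff[of x] sring_zero[OF R] by (cases "x = 0") (auto simp: above_def max_ideal_def)
 then show ?thesis by blast
qed

lemma root_mem: "n > 0 ==> x ^ n \<in> R ==> x \<in> R" using mem_iff[of x] mem_iff[of "x ^ n"] sring_zero[OF R]
 by (cases "x = 0") (auto simp: ord_power zero_le_mult_iff)

end

lemma dvr_frac_full:
 assumes "dvr R"
 shows "frac_full R" unfolding frac_full_def
proof
 interpret dvr_loc R using assms by unfold_locales
 fix x :: 'a
 show "\<exists>a\<in>R. \<exists>b\<in>R. b ~= 0 & x = a / b"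
 proof (cases "x = 0 | x \<in> R")
  case True
  then show ?thesis using R by (intro bexI[of _ x] bexI[of _ 1]) (auto simp: sringD)
 next
  case False
  then have "inverse x \<in> R" using mem_iff[of x] mem_iff[of "inverse x"] by (simp add: ord_inverse)
  then show ?thesis
   using False sring_one[OF R] by (rule_tac bexI[of _ 1], rule_tac bexI[of _ "inverse x"]) (auto simp: field_simps)
 qed
qed

lemma common_denominator:
 assumes A: "sring A" "frac_full A" and "finite I"
 shows "\<exists>d\<in>A. d ~= 0 & (\<forall>i\<in>I. d * f i \<in> A)" using assms(3)
proof (induction I rule: finite_induct)
 case empty
 then show ?case using sring_one[OF A(1)] by (intro bexI[of _ 1]) auto
next
 case (insert j I)
 then obtain d where d: "d \<in> A" "d ~= 0" "\<forall>i\<in>I. d * f i \<in> A" by blast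
 obtain a b where ab: "a \<in> A" "b \<in> A" "b ~= 0" "f j = a / b" using A(2) unfolding frac_full_def by blast
 have "b * d * f j = d * a" using ab by simp
 then have "b * d * f j \<in> A" using ab(1) d(1) sring_mult[OF A(1)] by metis
 moreover have "b * d * f i \<in> A" if "i \<in> I" for i
  using sring_mult[OF A(1) ab(2), of "d * f i"] d(3) that by (simp add: mult.assoc)
 moreover have "b * d \<in> A" using ab d A(1) by (auto simp: sring_mult)
 ultimately show ?case using ab(3) d(2) by (intro bexI[of _ "b * d"] conjI ballI) auto
qed

lemma det_mem:
 assumes R: "sring R" and M: "M \<in> carrier_mat n n" "\<And>i j. i < n ==> j < n ==> M $$ (i, j) \<in> R"
 shows "det M \<in> R"
proof -
 have "det M = (\<Sum>q\<in>{q. q permutes {0..<n}}. signof q * (\<Prod>i = 0..<n. M $$ (i, q i)))"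
  using M(1) by (simp add: det_def)
 also have "... \<in> R"
 proof (intro sring_sum[OF R] sring_mult[OF R] sring_prod[OF R] M(2))
  show "signof q \<in> R" for q using R by (simp add: sign_def sringD)
  fix q i assume "q \<in> {q. q permutes {0..<n}}" "i \<in> {0..<n}"
  then show "q i < n" using permutes_in_image[of q "{0..<n}" i] by auto
 qed auto
 finally show ?thesis .
qed

section \<open>$p$-bases of discrete valuation rings\<close>

context char_p
begin

lemma mon_mem: "sring R ==> set ys \<subseteq> R ==> mon ys a \<in> R" unfolding mon_def by (intro sring_prod sring_power) auto

lemma comb_mem:
 "sring R ==> set (ys::'a list) \<subseteq> R ==> (\<And>a. a \<in> exps p (length ys) ==> c a \<in> R) ==> comb ys c \<in> R"
 unfolding comb_eq by (intro sring_sum sring_mult sring_power mon_mem) auto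

text \<open>By \<open>del_all_car\<close> the p-th power of a coordinate is, up to a power of
  (p-1)!, a composite of partial derivatives applied to a multiple of \<open>x\<close>. So
  \<open>I\<close> only has to be stable under derivations and under extraction of p-th roots. It is
  used with \<open>I\<close> the ring and with \<open>I\<close> its maximal ideal.\<close>

lemma crd_mem_of_stable:
 assumes ys: "p_basis UNIV (ys::'a list)" and R: "sring R" and ysR: "set ys \<subseteq> R"
  and I: "\<And>x y. x \<in> I ==> y \<in> R ==> x * y \<in> I" "\<And>c. c ^ p \<in> I \<longleftrightarrow> c \<in> I"
  and stable: "\<And>j x. j < length ys ==> x \<in> I ==> del ys j x \<in> I"
  and inv: "\<And>n. 0 < n ==> n < p ==> inverse (of_nat n) \<in> R"
  and x: "x \<in> I" and a: "a \<in> exps p (length ys)"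
 shows "crd ys x a \<in> I"
proof -
 have fact: "(of_nat (fact n) :: 'a) ~= 0 & inverse (of_nat (fact n) :: 'a) \<in> R" if "n < p" for n using that
 proof (induction n)
  case (Suc n)
  have eq: "(of_nat (fact (Suc n)) :: 'a) = of_nat (Suc n) * of_nat (fact n)"
   by (simp only: fact_Suc of_nat_mult of_nat_id)
  show ?case using Suc inv[of "Suc n"] of_nat_nz[of "Suc n"] sring_mult[OF R]
   unfolding eq by (simp del: of_nat_Suc)
 qed (use R in \<open>simp add: sring_one\<close>)
 have it: "(del ys j ^^ l) x \<in> I" if "j < length ys" "x \<in> I" for j l x
  using that by (induction l) (auto intro: stable)
 have all: "k \<le> length ys ==> x \<in> I ==> del_all ys k x \<in> I" for k x
  by (induction k) (auto simp: del_all_simps[OF ys] it)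
 let ?u = "of_nat (fact (p - 1)) ^ length ys :: 'a" and ?x = "x * mon ys (%i. p - 1 - a i)"
 have "?u * car ys ?x ^ p \<in> I"
  using all[OF order_refl I(1)[OF x mon_mem[OF R ysR]]] unfolding del_all_car[OF ys] of_nat_power by blast
 moreover have "inverse ?u \<in> R" using fact[of "p - 1"] p_gt_0 by (simp add: power_inverse[symmetric] sring_power[OF R])
 ultimately have "?u * car ys ?x ^ p * inverse ?u \<in> I" by (rule I(1))
 moreover have "?u * y * inverse ?u = y" for y using fact[of "p - 1"] p_gt_0 by simp
 ultimately show ?thesis unfolding crd_car[OF ys a] I(2)[symmetric, of "car ys _"] by (simp only:)
qed

text \<open>Denominators become p-th powers, that is, scalars for Frobenius-linear maps.\<close>

lemma frob_fraction: "b ~= 0 ==> (a :: 'a) / b = inverse b ^ p * (a * b ^ (p - 1))"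
proof -
 assume b: "b ~= 0"
 have "b ^ p = b ^ (p - 1) * b" using power_minus_mult[OF p_gt_0, of b] by simp
 then show ?thesis unfolding power_inverse using b by (simp add: field_simps)
qed

lemma p_basis_field:
 assumes R: "sring R" and fr: "frac_full R" and pb: "p_basis R (ys::'a list)"
 shows "p_basis UNIV ys" unfolding p_basis_UNIV_iff
proof (intro conjI allI impI ballI)
 note B = p_basisD[OF pb sring_zero[OF R]]
 fix x
 obtain a b where ab: "a \<in> R" "b \<in> R" "b ~= 0" "x = a / b" using fr unfolding frac_full_def by blast
 have "a * b ^ (p - 1) \<in> R" using ab R by (intro sring_mult sring_power)
 then obtain c where c: "a * b ^ (p - 1) = comb ys c" using B(2) by blast
 have "x = inverse b ^ p * (a * b ^ (p - 1))" unfolding ab(4) by (rule frob_fraction[OF ab(3)])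
 then show "\<exists>c. x = comb ys c" unfolding c comb_smult[symmetric] by blast
next
 note B = p_basisD[OF pb sring_zero[OF R]]
 fix c a assume c: "comb ys c = 0" and a: "a \<in> exps p (length ys)"
 obtain d where d: "d \<in> R" "d ~= 0" "\<And>a. a \<in> exps p (length ys) ==> d * c a \<in> R"
  using common_denominator[OF R fr finite_exps] by metis
 have "comb ys (%a. d * c a) = 0" using c by (simp add: comb_smult)
 from B(3)[OF d(3) this a] show "c a = 0" using d by simp
qed

context
 fixes R and ys :: "'a list"
 assumes R: "sring R" and fr: "frac_full R" and pb: "p_basis R ys"
begin

lemma crd_mem: "x \<in> R ==> a \<in> exps p (length ys) ==> crd ys x a \<in> R"
 using p_basisD(2)[OF pb sring_zero[OF R], of x] crd_eq[OF p_basis_field[OF R fr pb]] by metis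

lemma car_mem: "x \<in> R ==> car ys x \<in> R" by (simp add: car_eq crd_mem top_exps)

lemma car_iter_mem: "x \<in> R ==> (car ys ^^ e) x \<in> R" by (induction e) (auto simp: car_mem)

lemma p_basis_subset: "set ys \<subseteq> R" using p_basisD(1)[OF pb sring_zero[OF R]] .

text \<open>The coordinates of \<open>c\<close> are Cartier images of multiples of \<open>c\<close>
  by monomials in \<open>R\<close>, and \<open>c\<close> is recombined from them.\<close>

lemma mem_of_car:
 assumes "\<And>x. x \<in> R ==> car ys (c * x) \<in> R"
 shows "c \<in> R"
proof -
 have "comb ys (crd ys c) \<in> R" using assms mon_mem[OF R p_basis_subset] crd_car[OF p_basis_field[OF R fr pb]]
  by (intro comb_mem[OF R p_basis_subset]) simp
 then show ?thesis by (simp add: comb_crd[OF p_basis_field[OF R fr pb]])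
qed

text \<open>Frobenius duality over \<open>R\<close>: the iterate generates the maps of its kind from
  \<open>R\<close> to \<open>R\<close>, so only multipliers in \<open>R\<close> preserve
  \<open>R\<close>.\<close>

lemma car_iter_mem_iff: "(\<forall>x\<in>R. (car ys ^^ e) (c * x) \<in> R) \<longleftrightarrow> c \<in> R"
proof
 show "\<forall>x\<in>R. (car ys ^^ e) (c * x) \<in> R ==> c \<in> R"
 proof (induction e arbitrary: c)
  case 0
  then show ?case using sring_one[OF R] by fastforce
 next
  case (Suc e)
  have "car ys (c * x) \<in> R" if x: "x \<in> R" for x
  proof (rule Suc.IH, rule ballI)
   fix z assume z: "z \<in> R"
   \<comment> \<open>The arbitrary factor \<open>z\<close> moves inside as \<open>z ^ p\<close>, so
     that the induction hypothesis applies to the multiplier \<open>car ys (c * x)\<close>.\<close>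
   have "(car ys ^^ e) (z * car ys (c * x)) = (car ys ^^ e) (car ys (z ^ p * (c * x)))"
    by (simp only: car_smult[OF p_basis_field[OF R fr pb]])
   also have "... = (car ys ^^ Suc e) (c * (z ^ p * x))"
    unfolding funpow_Suc_right o_apply by (simp add: mult.left_commute)
   also have "... \<in> R" using Suc.prems x z R by (blast intro: sring_mult sring_power)
   finally show "(car ys ^^ e) (car ys (c * x) * z) \<in> R" by (simp add: mult.commute)
  qed
  then show ?case by (rule mem_of_car)
 qed
qed (use R in \<open>auto intro: car_iter_mem sring_mult\<close>)

lemma del_mem:
 assumes x: "x \<in> R" and j: "j < length ys"
 shows "del ys j x \<in> R" unfolding del_eq
proof (intro sring_sum[OF R] sring_mult[OF R] sring_power[OF R] crd_mem[OF x])
 fix a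
 show "of_nat (a j) * mon ys a / ys ! j \<in> R"
  using del_mon_pred[OF p_basis_field[OF R fr pb] j, of a] sring_mult[OF R sring_of_nat[OF R] mon_mem[OF R p_basis_subset]]
  unfolding del_mon[OF p_basis_field[OF R fr pb] j] by simp
qed

end

lemma jac_mem:
 assumes R: "sring R" and ys: "p_basis UNIV (ys::'a list)"
  and st: "\<And>j x. j < length ys ==> x \<in> R ==> del ys j x \<in> R"
  and xs: "set xs \<subseteq> R" "length xs = length ys"
 shows "jac xs ys \<in> R" unfolding jac_def
proof (rule det_mem[OF R, of _ "length ys"])
 show "jac_mat xs ys \<in> carrier_mat (length ys) (length ys)" by (simp add: jac_mat_def)
qed (use xs st jac_entry[OF ys] in \<open>auto simp: subset_eq\<close>)

text \<open>Both Jacobians lie in \<open>R\<close> and are inverse to each other by the chain rule.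
  This makes orders of forms independent of the p-basis.\<close>

lemma jac_p_bases_unit:
 assumes R: "sring R" and fr: "frac_full R" and ys: "p_basis R (ys::'a list)" and zs: "p_basis R (zs::'a list)"
 shows "unit_in R (jac ys zs)"
proof -
 note U = p_basis_field[OF R fr ys] p_basis_field[OF R fr zs]
 have "jac ys zs \<in> R" "jac zs ys \<in> R"
  using del_mem[OF R fr] ys zs U p_basis_length[OF U] p_basis_subset[OF R fr ys] p_basis_subset[OF R fr zs]
  by (auto intro!: jac_mem[OF R] simp: subset_eq)
 moreover have "jac ys zs * jac zs ys = 1" using jac_chain[OF U U(1)] jac_refl[OF U(1)] by simp
 ultimately show ?thesis unfolding unit_in_def by (metis inverse_unique mult_zero_left zero_neq_one)
qed

text \<open>Scaling an entry by the p-th power of its denominator moves it into \<open>R\<close> and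
  preserves the p-basis property, since p-th powers are constants.\<close>

lemma p_basis_in:
 assumes R: "sring (R::'a set)" and fr: "frac_full R" and zs: "p_basis UNIV (zs::'a list)"
 shows "\<exists>ys. p_basis UNIV ys & length ys = length zs & set ys \<subseteq> R"
proof -
 have "\<exists>ys. p_basis UNIV ys & length ys = length zs & (\<forall>i<k. ys ! i \<in> R)" if "k \<le> length zs" for k using that
 proof (induction k)
  case 0
  show ?case using zs by (intro exI[of _ zs]) simp
 next
  case (Suc k)
  then obtain ys where ys: "p_basis UNIV ys" "length ys = length zs" "\<forall>i<k. ys ! i \<in> R" by auto
  have k: "k < length ys" using Suc ys by simp
  obtain a b where ab: "a \<in> R" "b \<in> R" "b ~= 0" "ys ! k = a / b" using fr unfolding frac_full_def by blast
  let ?z = "b ^ p * ys ! k"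
  have "del ys k ?z ~= 0" using k ab(3) by (simp add: del_smult[OF ys(1)] del_basis[OF ys(1)])
  then have "p_basis UNIV (ys[k := ?z])" by (rule p_basis_exchange[OF ys(1) k])
  moreover have "?z = a * b ^ (p - 1)"
   unfolding ab(4) frob_fraction[OF ab(3)] using ab(3) by (simp add: power_inverse)
  then have "?z \<in> R" using ab R by (auto intro: sring_mult sring_power)
  then have "\<forall>i<Suc k. ys[k := ?z] ! i \<in> R" using ys(3) k by (auto simp: less_Suc_eq)
  ultimately show ?case using ys(2) by (intro exI[of _ "ys[k := ?z]"]) simp
 qed
 from this[of "length zs"] show ?thesis by (metis order_refl in_set_conv_nth subsetI)
qed

end

locale char_p_dvr = char_p p ty + dvr_loc R
 for p :: nat and ty :: "'a::field itself" and R :: "'a set"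
begin

lemma fr: "frac_full R" by (rule dvr_frac_full[OF dvr])

text \<open>From \<open>n ^ p = n\<close> the order equals p times itself, so it is 0.\<close>

lemma unit_of_nat: "0 < n ==> n < p ==> unit_in R (of_nat n)"
proof -
 assume n: "0 < n" "n < p"
 have "int p * ord_at R (of_nat n) = ord_at R (of_nat n)"
  using ord_power[OF of_nat_nz[OF n], of p] by (simp add: of_nat_pow_p)
 then have "ord_at R (of_nat n) = 0" using p_gt_1 by auto
 then show ?thesis using ord_zero_unit[OF of_nat_nz[OF n]] by simp
qed

lemma p_basis_of_stable:
 assumes ys: "p_basis UNIV (ys::'a list)" "set ys \<subseteq> R"
  and st: "\<And>j x. j < length ys ==> x \<in> R ==> del ys j x \<in> R"
 shows "p_basis R ys"
proof (rule p_basisI[OF ys(2)])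
 fix x assume x: "x \<in> R"
 have "crd ys x a \<in> R" if "a \<in> exps p (length ys)" for a
 proof (rule crd_mem_of_stable[OF ys(1) R ys(2) sring_mult[OF R] _ st _ x that])
  show "c ^ p \<in> R \<longleftrightarrow> c \<in> R" for c using root_mem[OF p_gt_0] sring_power[OF R] by blast
  show "inverse (of_nat n) \<in> R" if "0 < n" "n < p" for n using unit_of_nat[OF that] by (simp add: unit_in_def)
 qed
 then show "\<exists>c. (\<forall>a\<in>exps p (length ys). c a \<in> R) & x = comb ys c" using comb_crd[OF ys(1), of x] by metis
qed (use R ys(1) in \<open>auto simp: p_basis_UNIV_iff sring_diff\<close>)

text \<open>F-finiteness yields one denominator \<open>d\<close> for the partial derivatives on all
  of \<open>R\<close>, as they are linear over p-th powers; a power of \<open>d\<close> then clears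
  the determinant. The bound makes a minimal Jacobian available.\<close>

lemma jac_bounded:
 assumes ff: "F_finite R" and zs: "p_basis UNIV (zs::'a list)"
 shows "\<exists>L. \<forall>ys. set ys \<subseteq> R --> length ys = length zs --> jac ys zs ~= 0 --> L \<le> ord_at R (jac ys zs)"
proof -
 obtain S where S: "finite S" "S \<subseteq> R" "\<And>x. x \<in> R ==> \<exists>c. (\<forall>s\<in>S. c s \<in> R) & x = (\<Sum>s\<in>S. c s ^ p * s)"
  using ff unfolding F_finite_def char_p by blast
 obtain d where d: "d \<in> R" "d ~= 0" "\<And>s j. s \<in> S ==> j < length zs ==> d * del zs j s \<in> R"
  using common_denominator[OF R fr, of "S \<times> {..<length zs}" "%(s, j). del zs j s"] S(1) by auto
 have st: "d * del zs j x \<in> R" if x: "x \<in> R" and j: "j < length zs" for j x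
 proof -
  obtain c where c: "\<forall>s\<in>S. c s \<in> R" "x = (\<Sum>s\<in>S. c s ^ p * s)" using S(3)[OF x] by blast
  have "d * del zs j x = (\<Sum>s\<in>S. c s ^ p * (d * del zs j s))"
   unfolding c(2) derivation_sum[OF del_derivation[OF zs j]] del_smult[OF zs] sum_distrib_left
   by (simp add: mult.left_commute)
  also have "... \<in> R" using c(1) d(3) j by (intro sring_sum[OF R] sring_mult[OF R sring_power[OF R]]) auto
  finally show ?thesis .
 qed
 have "- (int (length zs) * ord_at R d) \<le> ord_at R (jac ys zs)"
  if ys: "set ys \<subseteq> R" "length ys = length zs" "jac ys zs ~= 0" for ys
 proof -
  have "det (d \<cdot>\<^sub>m jac_mat ys zs) \<in> R"
  proof (rule det_mem[OF R, of _ "length zs"])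
   show "d \<cdot>\<^sub>m jac_mat ys zs \<in> carrier_mat (length zs) (length zs)" by (simp add: jac_mat_def)
   fix i j assume ij: "i < length zs" "j < length zs"
   then have "(d \<cdot>\<^sub>m jac_mat ys zs) $$ (i, j) = d * del zs j (ys ! i)"
    using jac_entry[OF zs ij, of ys] by (simp add: jac_mat_def)
   then show "(d \<cdot>\<^sub>m jac_mat ys zs) $$ (i, j) \<in> R" using st ij ys by (simp add: subset_eq)
  qed
  then have "d ^ length zs * jac ys zs \<in> R" by (simp add: jac_def jac_mat_def)
  then show ?thesis using mem_iff[of "d ^ length zs * jac ys zs"] d ys(3) by (simp add: ord_mult ord_power)
 qed
 then show ?thesis by blast
qed

text \<open>
 A \<open>p\<close>-basis of \<open>R\<close> is a \<open>p\<close>-basis of the field, contained in \<open>R\<close>, whose Jacobian has minimal order: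
 replacing its \<open>j\<close>-th element by \<open>x\<close> multiplies the Jacobian by \<open>del ys j x\<close>.
\<close>

lemma p_basis_ex:
 assumes ff: "F_finite R" and zs: "p_basis UNIV (zs::'a list)"
 shows "\<exists>ys. p_basis R ys"
proof -
 obtain L where L: "\<And>ys. set ys \<subseteq> R ==> length ys = length zs ==> jac ys zs ~= 0 ==> L \<le> ord_at R (jac ys zs)"
  using jac_bounded[OF ff zs] by blast
 define P where "P ys \<longleftrightarrow> p_basis UNIV ys & set ys \<subseteq> R" for ys :: "'a list"
 \<comment> \<open>Shifting by the lower bound \<open>L\<close> turns orders into natural numbers,
   where a minimum exists.\<close>
 define m where "m ys = nat (ord_at R (jac ys zs) - L)" for ys
 have "\<exists>ys. P ys" using p_basis_in[OF R fr zs] by (auto simp: P_def)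
 then obtain ys where ys: "P ys" and min: "\<And>us. P us ==> m ys \<le> m us" using ex_has_least_nat[of P _ m] by metis
 have yb: "p_basis UNIV ys" "set ys \<subseteq> R" using ys by (auto simp: P_def)
 have "del ys j x \<in> R" if j: "j < length ys" and x: "x \<in> R" for j x
 proof (cases "del ys j x = 0")
  case True
  then show ?thesis using sring_zero[OF R] by simp
 next
  case False
  let ?us = "ys[j := x]"
  note us = p_basis_exchange[OF yb(1) j False]
  have "set ?us \<subseteq> R" using yb(2) x by (meson set_update_subsetI)
  then have "P ?us" using us by (simp add: P_def)
  then have "m ys \<le> m ?us" by (rule min)
  moreover have "L \<le> ord_at R (jac ys zs)" using L[OF yb(2) p_basis_length[OF yb(1) zs] jac_nz[OF yb(1) zs]] .
  moreover have "L \<le> ord_at R (jac ?us zs)"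
   using L[OF _ p_basis_length[OF us zs] jac_nz[OF us zs]] \<open>set ?us \<subseteq> R\<close> by blast
  ultimately have "ord_at R (jac ys zs) \<le> ord_at R (jac ?us zs)" by (auto simp: m_def)
  also have "jac ?us zs = del ys j x * jac ys zs" using jac_chain[OF us yb(1) zs] jac_exchange[OF yb(1) j] by simp
  also have "ord_at R ... = ord_at R (del ys j x) + ord_at R (jac ys zs)"
   by (rule ord_mult[OF False jac_nz[OF yb(1) zs]])
  finally show ?thesis using mem_iff[OF False] by simp
 qed
 then show ?thesis using p_basis_of_stable[OF yb] by blast
qed

text \<open>Exchanging an entry multiplies the Jacobian by a partial derivative; as the old Jacobian
  is a unit and the new one lies in \<open>R\<close>, so does that derivative.\<close>

lemma p_basis_of_jac_unit:
 assumes ys: "p_basis R ys" and us: "p_basis UNIV us" "set us \<subseteq> R" and u: "unit_in R (jac us ys)"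
 shows "p_basis R us"
proof (rule p_basis_of_stable[OF us])
 note yb = p_basis_field[OF R fr ys]
 fix j x assume j: "j < length us" and x: "x \<in> R"
 show "del us j x \<in> R"
 proof (cases "del us j x = 0")
  case True
  then show ?thesis using sring_zero[OF R] by simp
 next
  case False
  have "set (us[j := x]) \<subseteq> R" using us(2) x by (meson set_update_subsetI)
  then have "jac (us[j := x]) ys \<in> R"
   using jac_mem[OF R yb del_mem[OF R fr ys]] p_basis_length[OF us(1) yb] by simp
  moreover have "jac (us[j := x]) ys = del us j x * jac us ys"
   using jac_chain[OF p_basis_exchange[OF us(1) j False] us(1) yb] jac_exchange[OF us(1) j] by simp
  ultimately have "jac (us[j := x]) ys * inverse (jac us ys) \<in> R" using u R by (simp add: unit_in_def sring_mult)
  then show ?thesis using \<open>jac (us[j := x]) ys = del us j x * jac us ys\<close> u by (simp add: unit_in_def mult.assoc)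
 qed
qed

lemma p_basis_replace:
 assumes us: "p_basis R (us::'a list)" and i: "i < length us" and z: "z \<in> R" "unit_in R (del us i z)"
 shows "p_basis R (us[i := z])"
proof -
 note ub = p_basis_field[OF R fr us]
 have "del us i z ~= 0" using z(2) by (auto simp: unit_in_def)
 then show ?thesis using z(2) set_update_subsetI[OF p_basis_subset[OF R fr us] z(1)]
  by (intro p_basis_of_jac_unit[OF us p_basis_exchange[OF ub i]]) (simp_all add: jac_exchange[OF ub i])
qed

lemma p_basis_add_mult:
 assumes us: "p_basis R (us::'a list)" and "i < length us" "j < length us" "i ~= j" "c = 1 | c = - 1"
 shows "p_basis R (us[i := us ! i + c * us ! j])"
proof (rule p_basis_replace[OF us])
 note ub = p_basis_field[OF R fr us]
 have "us ! i \<in> R" "us ! j \<in> R" using p_basis_subset[OF R fr us] assms by auto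
 then show "us ! i + c * us ! j \<in> R" using assms R by (auto simp: sring_add sring_diff)
 have "del us i (us ! i + us ! j) = 1" "del us i (us ! i - us ! j) = 1"
  using assms by (simp_all add: derivation_add[OF del_derivation[OF ub]] derivation_diff[OF del_derivation[OF ub]] del_basis[OF ub])
 then have "del us i (us ! i + c * us ! j) = 1" using assms(5) by auto
 then show "unit_in R (del us i (us ! i + c * us ! j))" using unit_in_one[OF R] by simp
qed (use assms in auto)

text \<open>Some partial derivative of \<open>t\<close> is a unit, so \<open>t\<close> can be
  exchanged into the p-basis. Otherwise the maximal ideal would be stable under the derivations, all
  coordinates of \<open>t\<close> would lie in it, and their p-th powers would force the order of
  \<open>t\<close> to be at least 2.\<close>

lemma p_basis_uniformizer_ex:
 assumes ff: "F_finite R" and zs: "p_basis UNIV (zs::'a list)"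
 shows "\<exists>t ys. uniformizer R t & p_basis R (t # ys)"
proof -
 obtain ys where ys: "p_basis R ys" using p_basis_ex[OF ff zs] by blast
 note yb = p_basis_field[OF R fr ys] and yR = p_basis_subset[OF R fr ys]
 obtain t where t: "uniformizer R t" using uniformizer_ex by blast
 note T = uniformizer_not_unit[OF R t] ord_uniformizer[OF t]
 define M where "M = max_ideal R"
 have M: "M = {x. above 1 x}" by (simp add: M_def max_eq_above)
 have tM: "t \<in> M" using T by (simp add: M above_def)
 have MR: "x \<in> M ==> x \<in> R" for x by (simp add: M_def max_ideal_def)
 have Mmult: "x \<in> M ==> y \<in> R ==> x * y \<in> M" for x y unfolding M_def by (rule max_ideal_mult[OF R])
 have Madd: "x \<in> M ==> y \<in> M ==> x + y \<in> M" for x y by (simp add: M above_add)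
 have notM: "x \<in> R ==> x \<notin> M ==> unit_in R x" for x unfolding M_def using unit_in_iff[of x R] by blast
 have "\<exists>j<length ys. del ys j t \<notin> M"
 proof (rule ccontr)
  assume *: "\<not> ?thesis"
  have stable: "del ys j x \<in> M" if j: "j < length ys" and x: "x \<in> M" for j x
  proof -
   obtain y where y: "x = t * y" "y \<in> R" using x t by (auto simp: M_def uniformizer_def)
   have "t * del ys j y \<in> M" "y * del ys j t \<in> M"
    using Mmult[OF tM del_mem[OF R fr ys y(2) j]] Mmult[of "del ys j t" y] * j y(2) by (auto simp: mult.commute)
   then show ?thesis unfolding y(1) del_of_mult[OF yb j] by (rule Madd)
  qed
  have "crd ys t a \<in> M" if "a \<in> exps p (length ys)" for a
  proof (rule crd_mem_of_stable[OF yb R yR Mmult _ stable _ tM that])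
   show "c ^ p \<in> M \<longleftrightarrow> c \<in> M" for c
   proof (cases "c = 0")
    case False
    have "1 \<le> int p * n \<longleftrightarrow> 1 \<le> n" for n
     using p_gt_0 by (metis zero_less_mult_iff int_one_le_iff_zero_less of_nat_0_less_iff order_less_imp_not_less)
    then show ?thesis using False by (simp add: M above_def ord_power)
   qed (simp add: zero_power)
  qed (use unit_of_nat in \<open>auto simp: unit_in_def\<close>)
  then have "above 2 (crd ys t a ^ p * mon ys a)" if "a \<in> exps p (length ys)" for a
  proof -
   have "above 1 (crd ys t a)" using \<open>\<And>a. _ ==> crd ys t a \<in> M\<close> that by (simp add: M)
   then have "above 2 (crd ys t a ^ p)"
    using p_gt_1 mult_mono[of 2 "int p" 1 "ord_at R (crd ys t a)"] by (auto simp: above_def ord_power zero_power)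
   then show ?thesis using above_mult[of 2 _ 0] mon_mem[OF R yR] above_0 by fastforce
  qed
  then have "above 2 (comb ys (crd ys t))" unfolding comb_eq by (rule above_sum)
  then have "above 2 t" by (simp add: comb_crd[OF yb])
  then show False using T by (simp add: above_def)
 qed
 then obtain j where j: "j < length ys" "del ys j t \<notin> M" by blast
 have tR: "t \<in> R" using T by simp
 define us where "us = ys[j := t]"
 have us: "p_basis R us" "j < length us" "us ! j = t"
  unfolding us_def using j tR by (auto intro!: p_basis_replace[OF ys] notM del_mem[OF R fr ys])
 have "\<exists>us. p_basis R us & 0 < length us & us ! 0 = t"
 proof (cases "j = 0")
  case False
  \<comment> \<open>Three elementary operations bring \<open>t\<close> to the front: the pair (u, t)
    becomes (u + t, t), then (u + t, -u), then (t, -u).\<close>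
  define us1 where "us1 = us[0 := us ! 0 + 1 * us ! j]"
  define us2 where "us2 = us1[j := us1 ! j + (- 1) * us1 ! 0]"
  define us3 where "us3 = us2[0 := us2 ! 0 + 1 * us2 ! j]"
  have "p_basis R us1" unfolding us1_def by (rule p_basis_add_mult) (use us False in auto)
  then have "p_basis R us2" unfolding us2_def by (rule p_basis_add_mult) (use us False in \<open>auto simp: us1_def\<close>)
  then have "p_basis R us3" unfolding us3_def
   by (rule p_basis_add_mult) (use us False in \<open>auto simp: us1_def us2_def\<close>)
  moreover have "us3 ! 0 = t" "0 < length us3" using us False less_trans[OF neq0_conv[THEN iffD1, OF False] us(2)] by (auto simp: us1_def us2_def us3_def)
  ultimately show ?thesis by blast
 qed (use us in auto)
 then show ?thesis using t by (metis length_greater_0_conv list.exhaust_sel hd_conv_nth)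
qed

end

section \<open>Residues and generators of Hom\<close>

lemma residue_mapD:
 assumes M: "sring M" and r: "residue_map M (r :: 'a::field => 'b::field)"
 shows res_add: "x \<in> M ==> y \<in> M ==> r (x + y) = r x + r y"
  and res_mult: "x \<in> M ==> y \<in> M ==> r (x * y) = r x * r y"
  and res_one: "r 1 = 1" and res_zero: "r 0 = 0"
  and res_diff: "x \<in> M ==> y \<in> M ==> r (x - y) = r x - r y"
  and res_surj: "\<exists>x\<in>M. r x = z"
  and res_eq_0: "x \<in> M ==> r x = 0 \<longleftrightarrow> x \<in> max_ideal M"
proof -
 note h = r[unfolded residue_map_def]
 show add: "r (x + y) = r x + r y" if "x \<in> M" "y \<in> M" for x y
  using ring_hom_add[of r "ring_on M" KR x y] h that by simp
 show "r (x * y) = r x * r y" if "x \<in> M" "y \<in> M" for x y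
  using ring_hom_mult[of r "ring_on M" KR x y] h that by simp
 show "r 1 = 1" using ring_hom_one[of r "ring_on M" KR] h by simp
 show "r 0 = 0" using add[of 0 0] sring_zero[OF M] by (metis add_cancel_right_right add_0)
 show "r (x - y) = r x - r y" if "x \<in> M" "y \<in> M" using add[of "x - y" y] sring_diff[OF M that] that by simp
 show "\<exists>x\<in>M. r x = z" using h by (metis UNIV_I imageE)
 show "x \<in> M ==> r x = 0 \<longleftrightarrow> x \<in> max_ideal M" using h by blast
qed

context
 fixes M and r :: "'a::field => 'b::field"
 assumes M: "sring M" and r: "residue_map M r"
begin

lemma res_power: "x \<in> M ==> r (x ^ n) = r x ^ n"
 by (induction n) (auto simp: res_one[OF M r] res_mult[OF M r] sring_power[OF M])

lemma res_sum: "(\<And>i. i \<in> I ==> f i \<in> M) ==> r (sum f I) = (\<Sum>i\<in>I. r (f i))"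
 by (induction I rule: infinite_finite_induct) (auto simp: res_zero[OF M r] res_add[OF M r] sring_sum[OF M])

lemma res_prod: "(\<And>i. i \<in> I ==> f i \<in> M) ==> r (prod f I) = (\<Prod>i\<in>I. r (f i))"
 by (induction I rule: infinite_finite_induct) (auto simp: res_one[OF M r] res_mult[OF M r] sring_prod[OF M])

lemma res_of_nat: "r (of_nat n) = of_nat n"
 by (induction n) (auto simp: res_zero[OF M r] res_one[OF M r] res_add[OF M r] sring_one[OF M] sring_of_nat[OF M])

lemma res_nz: "unit_in M x ==> r x ~= 0" using res_eq_0[OF M r] unit_in_iff[of x M] by blast

lemma res_inverse: "unit_in M x ==> r (inverse x) = inverse (r x)"
proof -
 assume u: "unit_in M x"
 then have "r x * r (inverse x) = 1"
  using res_mult[OF M r, of x "inverse x"] res_one[OF M r] by (simp add: unit_in_def)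
 then show ?thesis by (metis inverse_unique)
qed

lemma res_divide: "y \<in> M ==> unit_in M x ==> r (y / x) = r y / r x"
 using res_mult[OF M r, of y "inverse x"] res_inverse[of x] by (simp add: divide_inverse unit_in_def)

lemma res_mon: "set ys \<subseteq> M ==> r (mon ys a) = mon (map r ys) a" unfolding mon_def length_map
 by (subst res_prod) (auto simp: subset_eq res_power sring_power[OF M])

end

lemma (in char_p) char_p_residue:
 assumes M: "sring M" and r: "residue_map M (r :: 'a => 'b::field)"
 shows "char_p TYPE('b) p"
proof
 have "(of_nat p :: 'b) = 0" using res_of_nat[OF M r, of p] res_zero[OF M r] by simp
 then have "CHAR('b) dvd p" by (simp add: of_nat_eq_0_iff_char_dvd)
 then show "CHAR('b) = p" using prime_p CHAR_not_1[where 'a = 'b] by (auto simp: prime_nat_iff)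
qed (rule prime_p)

text \<open>Exponents for a list \<open>t # ys\<close>, cut off beyond its length so that they
  belong to \<open>exps\<close>.\<close>

definition cons_exp :: "nat => nat => (nat => nat) => nat => nat" where
 "cons_exp n i b = (\<lambda>k\<in>{..<Suc n}. case k of 0 => i | Suc k' => b k')"

lemma mon_Cons: "mon (t # ys) a = t ^ a 0 * mon ys (%i. a (Suc i))"
 unfolding mon_def length_Cons prod.lessThan_Suc_shift by simp

lemma mon_cons_exp: "mon (t # ys) (cons_exp (length ys) i b) = t ^ i * mon ys b"
proof -
 have "mon ys (%k. cons_exp (length ys) i b (Suc k)) = mon ys b" by (rule mon_cong) (simp add: cons_exp_def)
 then show ?thesis by (simp add: mon_Cons cons_exp_def)
qed

lemma cons_exp_exps: "b \<in> exps p n ==> i < p ==> cons_exp n i b \<in> exps p (Suc n)"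
 by (auto simp: exps_def cons_exp_def PiE_iff split: nat.split)

lemma cons_exp_inj:
 assumes "b \<in> exps p n" "b' \<in> exps p n" "cons_exp n i b = cons_exp n i b'"
 shows "b = b'"
proof (rule exps_eqI[OF assms(1,2)])
 fix k assume "k < n"
 then show "b k = b' k" using fun_cong[OF assms(3), of "Suc k"] by (simp add: cons_exp_def)
qed

lemma cons_exp_surj:
 assumes "a \<in> exps p (Suc n)"
 shows "\<exists>b\<in>exps p n. a = cons_exp n (a 0) b"
proof
 let ?b = "\<lambda>k\<in>{..<n}. a (Suc k)"
 show "?b \<in> exps p n" using assms by (auto simp: exps_def PiE_iff)
 show "a = cons_exp n (a 0) ?b"
 proof (rule ext)
  fix k
  show "a k = cons_exp n (a 0) ?b k"
  proof (cases "k < Suc n")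
   case True
   then show ?thesis by (cases k) (simp_all add: cons_exp_def)
  next
   case False
   then show ?thesis using assms by (auto simp: exps_def PiE_iff extensional_def cons_exp_def)
  qed
 qed
qed

lemma cons_exp_image: "{a \<in> exps p (Suc n). a 0 = i} = cons_exp n i ` exps p n" if "i < p"
proof (intro equalityI subsetI)
 fix a assume "a \<in> {a \<in> exps p (Suc n). a 0 = i}"
 then show "a \<in> cons_exp n i ` exps p n" using cons_exp_surj[of a p n] by auto
qed (use cons_exp_exps[OF _ that] in \<open>auto simp: cons_exp_def\<close>)

context char_p
begin

lemma crd_sum:
 assumes ys: "p_basis UNIV (ys::'a list)" and a: "a \<in> exps p (length ys)"
 shows "crd ys (sum f I) a = (\<Sum>i\<in>I. crd ys (f i) a)"
proof -
 have "crd ys 0 a = 0" using crd_smult[OF ys a, of 0 0] by simp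
 then show ?thesis by (induction I rule: infinite_finite_induct) (auto simp: crd_add[OF ys a])
qed

lemma crd_single:
 assumes ys: "p_basis UNIV (ys::'a list)" and "a \<in> exps p (length ys)" "b \<in> exps p (length ys)"
 shows "crd ys (c ^ p * mon ys b) a = (if a = b then c else 0)"
 using crd_eq[OF ys comb_single[OF assms(3), symmetric] assms(2)] by simp

lemma p_inv_linear_scale: "p_inv_linear e \<psi> ==> p_inv_linear e (%x. \<psi> (c * x))" for \<psi> :: "'a => 'a"
proof -
 assume \<psi>: "p_inv_linear e \<psi>"
 have "\<psi> (c * (a ^ (p ^ e) * x)) = a * \<psi> (c * x)" for a x
  using \<psi> unfolding mult.left_commute[of c "a ^ (p ^ e)" x] by (simp add: p_inv_linear_iff)
 then show ?thesis using \<psi> by (simp add: p_inv_linear_iff ring_distribs)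
qed

lemma frob_add_iter: "(x + y :: 'a) ^ (p ^ e) = x ^ (p ^ e) + y ^ (p ^ e)"
 by (rule freshmans_dream'[OF prime_char]) simp

lemma frob_sum_iter: "(sum f I :: 'a) ^ (p ^ e) = (\<Sum>i\<in>I. f i ^ (p ^ e))"
 using p_gt_0 by (induction I rule: infinite_finite_induct) (auto simp: frob_add_iter)

text \<open>If \<open>x\<close> is a combination of the \<open>s\<close> over p-th powers and its
  coefficients are combinations of the \<open>u\<close> for exponent \<open>e\<close>, then the
  products \<open>u ^ p * s\<close> generate for exponent \<open>Suc e\<close>.\<close>

lemma F_finite_iter:
 assumes A: "sring (A::'a set)" "F_finite A"
 shows "\<exists>S. finite S & S \<subseteq> A & (\<forall>x\<in>A. \<exists>c. (\<forall>s\<in>S. c s \<in> A) & x = (\<Sum>s\<in>S. c s ^ (p ^ e) * s))"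
proof (induction e)
 case 0
 show ?case using sring_one[OF A(1)] by (intro exI[of _ "{1}"]) (auto intro: exI[of _ "%_. x" for x])
next
 case (Suc e)
 then obtain U where U: "finite U" "U \<subseteq> A" "\<And>x. x \<in> A ==> \<exists>c. (\<forall>s\<in>U. c s \<in> A) & x = (\<Sum>u\<in>U. c u ^ (p ^ e) * u)"
  by blast
 have "\<exists>S. finite S & S \<subseteq> A & (\<forall>x\<in>A. \<exists>c. (\<forall>s\<in>S. c s \<in> A) & x = (\<Sum>s\<in>S. c s ^ p * s))"
  using A(2) by (simp add: F_finite_def)
 then obtain S where S: "finite S" "S \<subseteq> A" "\<And>x. x \<in> A ==> \<exists>c. (\<forall>s\<in>S. c s \<in> A) & x = (\<Sum>s\<in>S. c s ^ p * s)" by blast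
 define q where "q = p ^ Suc e"
 let ?h = "%(s, u). u ^ p * s"
 have "\<exists>c. (\<forall>t\<in>?h ` (S \<times> U). c t \<in> A) & x = (\<Sum>t\<in>?h ` (S \<times> U). c t ^ q * t)" if x: "x \<in> A" for x
 proof -
  obtain c where c: "\<forall>s\<in>S. c s \<in> A" "x = (\<Sum>s\<in>S. c s ^ p * s)" using S(3)[OF x] by blast
  have "\<forall>s. \<exists>f. s \<in> S --> (\<forall>u\<in>U. f u \<in> A) & c s = (\<Sum>u\<in>U. f u ^ (p ^ e) * u)" using U(3) c(1) by blast
  from choice[OF this] obtain d where d: "\<And>s. s \<in> S ==> (\<forall>u\<in>U. d s u \<in> A) & c s = (\<Sum>u\<in>U. d s u ^ (p ^ e) * u)"
   by blast
  have "c s ^ p * s = (\<Sum>u\<in>U. d s u ^ q * (u ^ p * s))" if "s \<in> S" for s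
  proof -
   have "c s ^ p * s = (\<Sum>u\<in>U. (d s u ^ (p ^ e) * u) ^ p * s)" using d[OF that] by (simp add: frob_sum sum_distrib_right)
   also have "... = (\<Sum>u\<in>U. d s u ^ q * (u ^ p * s))"
    unfolding q_def by (simp add: power_mult_distrib power_mult[symmetric] mult.commute[of "p ^ e"] mult.assoc)
   finally show ?thesis .
  qed
  then have "x = (\<Sum>s\<in>S. \<Sum>u\<in>U. d s u ^ q * (u ^ p * s))" unfolding c(2) by (rule sum.cong[OF refl])
  also have "... = (\<Sum>(s, u)\<in>S \<times> U. d s u ^ q * (u ^ p * s))" by (rule sum.cartesian_product)
  also have "... = (\<Sum>i\<in>S \<times> U. (case i of (s, u) => d s u) ^ q * ?h i)" by (intro sum.cong) auto
  \<comment> \<open>Different pairs may give the same product; their coefficients are added first,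
    which Frobenius permits.\<close>
  also have "... = (\<Sum>t\<in>?h ` (S \<times> U). \<Sum>i\<in>{i \<in> S \<times> U. ?h i = t}. (case i of (s, u) => d s u) ^ q * ?h i)"
   using S(1) U(1) by (intro sum.image_gen) simp
  also have "... = (\<Sum>t\<in>?h ` (S \<times> U). (\<Sum>i\<in>{i \<in> S \<times> U. ?h i = t}. (case i of (s, u) => d s u)) ^ q * t)"
   unfolding q_def frob_sum_iter sum_distrib_right by (intro sum.cong refl) auto
  finally show ?thesis
   using d by (intro exI[of _ "%t. \<Sum>i\<in>{i \<in> S \<times> U. ?h i = t}. (case i of (s, u) => d s u)"] conjI)
    (auto intro!: sring_sum[OF A(1)])
 qed
 moreover have "?h ` (S \<times> U) \<subseteq> A" using S(2) U(2) A(1) by (auto intro!: sring_mult sring_power)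
 ultimately show ?case unfolding q_def using S(1) U(1) by (intro exI[of _ "?h ` (S \<times> U)"]) blast
qed

text \<open>
 Dually to the space of \<open>p\<^sup>-\<^sup>e\<close>-linear maps: for \<open>\<psi> ~= 0\<close> the linear map sending \<open>d\<close> to the values of
 \<open>\<psi> (d * _)\<close> on a basis is injective, hence surjective.
\<close>

lemma universal_of_nonzero:
 assumes ff: "F_finite (UNIV :: 'a set)" and \<psi>: "p_inv_linear e \<psi>" and nz: "\<psi> x0 ~= 0"
  and \<psi>': "p_inv_linear e (\<psi>' :: 'a => 'a)"
 shows "\<exists>d. \<forall>x. \<psi>' x = \<psi> (d * x)"
proof -
 define q where "q = p ^ e"
 note lin = \<psi>[unfolded p_inv_linear_iff, folded q_def] and lin' = \<psi>'[unfolded p_inv_linear_iff, folded q_def]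
 interpret V: vector_space "%c x :: 'a. c ^ q * x"
  unfolding q_def by unfold_locales (auto simp: ring_distribs frob_add_iter power_mult_distrib)
 obtain S where S: "finite S" "\<And>x::'a. \<exists>c. x = (\<Sum>s\<in>S. c s ^ q * s)"
  using F_finite_iter[OF sring_UNIV ff, of e] unfolding q_def by auto
 have spanS: "V.span S = UNIV" using S by (auto simp: V.span_finite)
 obtain B where B: "V.independent B" "UNIV \<subseteq> V.span B" using V.basis_exists[of UNIV] by metis
 have finB: "finite B" using V.independent_span_bound[OF S(1) B(1)] spanS by blast
 interpret V: finite_dimensional_vector_space "%c x :: 'a. c ^ q * x" B using B finB by unfold_locales auto
 have expand: "\<exists>c. x = (\<Sum>b\<in>B. c b ^ q * b)" for x using B(2) V.span_finite[OF finB] by auto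
 have ind: "c b = 0" if "(\<Sum>b\<in>B. c b ^ q * b) = 0" "b \<in> B" for c b
  using V.independentD[OF B(1) finB order_refl that] .
 have sum: "f (sum g I) = (\<Sum>i\<in>I. f (g i))" if "\<forall>x y. f (x + y) = f x + f y" for f :: "'a => 'a" and g :: "'a => 'a" and I
 proof -
  have "f 0 = 0" using that[rule_format, of 0 0] by (metis add_cancel_right_right add_0)
  then show ?thesis using that by (induction I rule: infinite_finite_induct) auto
 qed
 have determined: "f x = g x" if f: "\<forall>x y. f (x + y) = f x + f y" "\<forall>a x. f (a ^ q * x) = a * f x"
  and g: "\<forall>x y. g (x + y) = g x + g y" "\<forall>a x. g (a ^ q * x) = a * g x" and eq: "\<And>b. b \<in> B ==> f b = g b"
  for f g x
 proof -
  obtain c where c: "x = (\<Sum>b\<in>B. c b ^ q * b)" using expand by blast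
  show ?thesis unfolding c sum[OF f(1)] sum[OF g(1)] using f(2) g(2) eq by simp
 qed
 \<comment> \<open>The values of \<open>\<psi> (d * _)\<close> on the basis are packed as
   coordinates of a single element, so \<open>T\<close> is an endomorphism of a finite-dimensional
   space.\<close>
 define T where "T d = (\<Sum>b\<in>B. \<psi> (d * b) ^ q * b)" for d
 have scale_lin: "\<forall>x y. \<psi> (d * (x + y)) = \<psi> (d * x) + \<psi> (d * y)" "\<forall>a x. \<psi> (d * (a ^ q * x)) = a * \<psi> (d * x)" for d
  using p_inv_linear_scale[OF \<psi>, of d] by (simp_all add: p_inv_linear_iff q_def)
 have frobq: "(x + y) ^ q = x ^ q + y ^ q" for x y :: 'a unfolding q_def by (rule frob_add_iter)
 have q0: "0 < q" by (simp add: q_def)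
 have "Vector_Spaces.linear (%c x. c ^ q * x) (%c x. c ^ q * x) T"
 proof unfold_locales
  show "T (x + y) = T x + T y" for x y using lin by (simp add: T_def ring_distribs frobq sum.distrib)
  show "T (c ^ q * x) = c ^ q * T x" for c x
   unfolding T_def sum_distrib_left mult.assoc lin[THEN conjunct2, rule_format] power_mult_distrib ..
 qed
 moreover have "inj T"
 proof (rule injI)
  fix c d assume "T c = T d"
  then have "(\<Sum>b\<in>B. (\<psi> (c * b) - \<psi> (d * b)) ^ q * b) = 0"
  proof -
   have "(x - y) ^ q = x ^ q - y ^ q" for x y :: 'a using frobq[of "x - y" y] by simp
   then show ?thesis using \<open>T c = T d\<close> by (simp add: T_def ring_distribs sum_subtractf)
  qed
  then have "\<psi> (c * b) = \<psi> (d * b)" if "b \<in> B" for b using ind[of "%b. \<psi> (c * b) - \<psi> (d * b)"] that by simp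
  then have eq: "\<psi> (c * x) = \<psi> (d * x)" for x using determined[OF scale_lin[of c] scale_lin[of d]] by blast
  show "c = d"
  proof (rule ccontr)
   assume ne: "c ~= d"
   \<comment> \<open>At the argument \<open>x0 / (c - d)\<close> the two equal values differ by
     \<open>\<psi> x0\<close>.\<close>
   have "c * (x0 / (c - d)) = d * (x0 / (c - d)) + x0" using ne by (simp add: field_simps)
   then have "\<psi> x0 = 0" using eq[of "x0 / (c - d)"] lin by simp
   then show False using nz by simp
  qed
 qed
 ultimately have "surj T" by (rule V.linear_inj_imp_surj)
 then obtain d where d: "T d = (\<Sum>b\<in>B. \<psi>' b ^ q * b)" by (metis surjD)
 have "\<psi> (d * b) = \<psi>' b" if "b \<in> B" for b
 proof -
  have "(x - y) ^ q = x ^ q - y ^ q" for x y :: 'a using frobq[of "x - y" y] by simp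
  then have "(\<Sum>b\<in>B. (\<psi> (d * b) - \<psi>' b) ^ q * b) = 0" using d by (simp add: T_def ring_distribs sum_subtractf)
  then show ?thesis using ind[of "%b. \<psi> (d * b) - \<psi>' b"] that by simp
 qed
 then have "\<psi>' x = \<psi> (d * x)" for x
  using determined[OF scale_lin[of d] lin'[THEN conjunct1] lin'[THEN conjunct2]] by metis
 then show ?thesis by blast
qed

text \<open>A generator of the one-dimensional space of such maps; over an F-finite field every
  nonzero map is one.\<close>

definition universal :: "nat => ('a => 'a) => bool" where
 "universal e \<psi> \<longleftrightarrow> p_inv_linear e \<psi> & (\<exists>x. \<psi> x ~= 0) &
   (\<forall>\<psi>'. p_inv_linear e \<psi>' --> (\<exists>d. \<forall>x. \<psi>' x = \<psi> (d * x)))"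

lemma universal_cancel:
 assumes "universal e \<psi>" "\<And>x. \<psi> (c * x) = \<psi> (d * x)"
 shows "c = d"
proof (rule ccontr)
 assume "c ~= d"
 have add: "\<psi> (x + y) = \<psi> x + \<psi> y" for x y using assms(1) by (simp add: universal_def p_inv_linear_iff)
 have "\<psi> x = 0" for x
 proof -
  have "c * (x / (c - d)) = d * (x / (c - d)) + x" using \<open>c ~= d\<close> by (simp add: field_simps)
  then show ?thesis using assms(2)[of "x / (c - d)"] add[of "d * (x / (c - d))" x] by simp
 qed
 then show False using assms(1) by (auto simp: universal_def)
qed

lemma universal_scale:
 assumes "universal e \<psi>" "c ~= 0"
 shows "universal e (%x. \<psi> (c * x))" unfolding universal_def
proof (intro conjI allI impI)
 show "p_inv_linear e (%x. \<psi> (c * x))" using assms by (simp add: universal_def p_inv_linear_scale)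
 obtain x where "\<psi> x ~= 0" using assms by (auto simp: universal_def)
 then show "\<exists>x. \<psi> (c * x) ~= 0" using assms(2) by (intro exI[of _ "x / c"]) simp
 fix \<psi>' assume "p_inv_linear e (\<psi>' :: 'a => 'a)"
 then obtain d where "\<forall>x. \<psi>' x = \<psi> (d * x)" using assms(1) by (auto simp: universal_def)
 then show "\<exists>d. \<forall>x. \<psi>' x = \<psi> (c * (d * x))" using assms(2) by (intro exI[of _ "d / c"]) simp
qed

end

context char_p_dvr
begin

context
 fixes t :: 'a and ys :: "'a list" and r :: "'a => 'b::field"
 assumes t: "uniformizer R t" and pb: "p_basis R (t # ys)" and r: "residue_map R r"
begin

interpretation res: char_p p "TYPE('b)" by (rule char_p_residue[OF R r])

lemma basis_R: "t \<in> R" "set ys \<subseteq> R" "r t = 0"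
 using p_basis_subset[OF R fr pb] res_eq_0[OF R r] uniformizer_in_max[OF R t] by auto

lemma res_comb_sum:
 assumes c: "\<And>b. b \<in> exps p (length ys) ==> c b \<in> R"
 shows "r (\<Sum>b\<in>exps p (length ys). c b ^ p * mon ys b) = comb (map r ys) (%b. r (c b))"
proof -
 have "r (\<Sum>b\<in>exps p (length ys). c b ^ p * mon ys b) = (\<Sum>b\<in>exps p (length ys). r (c b ^ p * mon ys b))"
  using c by (intro res_sum[OF R r] sring_mult[OF R] sring_power[OF R] mon_mem[OF R basis_R(2)])
 also have "... = comb (map r ys) (%b. r (c b))" unfolding res.comb_eq length_map using c by (intro sum.cong refl)
   (simp add: res_mult[OF R r] res_power[OF R r] res_mon[OF R r basis_R(2)] sring_power[OF R] mon_mem[OF R basis_R(2)])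
 finally show ?thesis .
qed

text \<open>Monomials involving \<open>t\<close> vanish in the residue field, so only coordinates
  with exponent 0 at \<open>t\<close> remain.\<close>

lemma res_expand:
 assumes x: "x \<in> R"
 shows "r x = comb (map r ys) (%b. r (crd (t # ys) x (cons_exp (length ys) 0 b)))"
proof -
 let ?n = "length ys" and ?c = "crd (t # ys) x"
 note pbU = p_basis_field[OF R fr pb]
 have c: "a \<in> exps p (Suc ?n) ==> ?c a \<in> R" for a using crd_mem[OF R fr pb x] by simp
 have c0: "?c (cons_exp ?n 0 b) \<in> R" if "b \<in> exps p ?n" for b by (rule c[OF cons_exp_exps[OF that p_gt_0]])
 have term_R: "?c a ^ p * mon (t # ys) a \<in> R" if "a \<in> exps p (Suc ?n)" for a
  using c[OF that] basis_R by (intro sring_mult[OF R] sring_power[OF R] mon_mem[OF R]) auto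
 have "r x = r (\<Sum>a\<in>exps p (Suc ?n). ?c a ^ p * mon (t # ys) a)" using comb_crd[OF pbU, of x] by (simp add: comb_eq)
 also have "... = (\<Sum>a\<in>exps p (Suc ?n). r (?c a ^ p * mon (t # ys) a))" by (rule res_sum[OF R r term_R])
 also have "... = (\<Sum>a\<in>{a \<in> exps p (Suc ?n). a 0 = 0}. r (?c a ^ p * mon (t # ys) a))"
 proof (rule sum.mono_neutral_right)
  show "\<forall>a\<in>exps p (Suc ?n) - {a \<in> exps p (Suc ?n). a 0 = 0}. r (?c a ^ p * mon (t # ys) a) = 0"
  proof
   fix a assume "a \<in> exps p (Suc ?n) - {a \<in> exps p (Suc ?n). a 0 = 0}"
   then have a: "a \<in> exps p (Suc ?n)" "a 0 ~= 0" by auto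
   then have eq: "?c a ^ p * mon (t # ys) a = t * (t ^ (a 0 - 1) * (?c a ^ p * mon ys (%i. a (Suc i))))"
    by (cases "a 0") (auto simp: mon_Cons)
   moreover have "t ^ (a 0 - 1) * (?c a ^ p * mon ys (%i. a (Suc i))) \<in> R"
    using c[OF a(1)] basis_R by (intro sring_mult[OF R] sring_power[OF R] mon_mem[OF R])
   ultimately show "r (?c a ^ p * mon (t # ys) a) = 0"
    unfolding eq using res_mult[OF R r basis_R(1)] basis_R(3) by simp
  qed
 qed auto
 also have "... = (\<Sum>b\<in>exps p ?n. r (?c (cons_exp ?n 0 b) ^ p * mon ys b))"
 proof -
  have "inj_on (cons_exp ?n 0) (exps p ?n)" by (rule inj_onI) (rule cons_exp_inj)
  then show ?thesis unfolding cons_exp_image[OF p_gt_0] by (simp only: sum.reindex o_def mon_cons_exp) simp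
 qed
 also have "... = r (\<Sum>b\<in>exps p ?n. ?c (cons_exp ?n 0 b) ^ p * mon ys b)"
  by (intro res_sum[OF R r, symmetric] sring_mult[OF R] sring_power[OF R] mon_mem[OF R basis_R(2)] c0)
 also have "... = comb (map r ys) (%b. r (?c (cons_exp ?n 0 b)))" by (intro res_comb_sum c0)
 finally show ?thesis .
qed

text \<open>A relation among residues lifts to an element \<open>t * z\<close> whose coordinates at
  exponent 0 of \<open>t\<close> are the lifted coefficients. Reading such a coordinate multiplies
  by \<open>t ^ (p - 1)\<close>; together with the factor \<open>t\<close> this is a p-th power, so
  the coordinate is divisible by \<open>t\<close>.\<close>

lemma p_basis_residue: "p_basis UNIV (map r ys)" unfolding res.p_basis_UNIV_iff length_map
proof (intro conjI allI impI ballI)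
 fix z
 obtain x where "x \<in> R" "r x = z" using res_surj[OF R r] by blast
 then show "\<exists>c. z = comb (map r ys) c" using res_expand by blast
next
 let ?n = "length ys"
 note pbU = p_basis_field[OF R fr pb]
 fix d b assume d: "comb (map r ys) d = 0" and b: "b \<in> exps p ?n"
 have "\<forall>b. \<exists>x. x \<in> R & r x = d b" using res_surj[OF R r] by blast
 from choice[OF this] obtain c where c: "\<And>b. c b \<in> R" "\<And>b. r (c b) = d b" by blast
 define y where "y = (\<Sum>b\<in>exps p ?n. c b ^ p * mon ys b)"
 have yR: "y \<in> R" unfolding y_def
  using c by (intro sring_sum[OF R] sring_mult[OF R] sring_power[OF R] mon_mem[OF R basis_R(2)])
 have "r y = 0" unfolding y_def using res_comb_sum[of c] c d by simp
 then obtain z where z: "y = t * z" "z \<in> R" using res_eq_0[OF R r yR] t by (auto simp: uniformizer_def)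
 have b': "cons_exp ?n 0 b \<in> exps p (length (t # ys))" using cons_exp_exps[OF b p_gt_0] by simp
 have "crd (t # ys) y (cons_exp ?n 0 b) = (\<Sum>b'\<in>exps p ?n. if b' = b then c b else 0)"
  unfolding y_def crd_sum[OF pbU b']
 proof (rule sum.cong)
  fix b' assume b1: "b' \<in> exps p ?n"
  then have "crd (t # ys) (c b' ^ p * mon (t # ys) (cons_exp ?n 0 b')) (cons_exp ?n 0 b) =
    (if cons_exp ?n 0 b = cons_exp ?n 0 b' then c b' else 0)"
   using cons_exp_exps[OF b1 p_gt_0] by (intro crd_single[OF pbU b']) simp
  then show "crd (t # ys) (c b' ^ p * mon ys b') (cons_exp ?n 0 b) = (if b' = b then c b else 0)"
   using cons_exp_inj[OF b b1, of 0] by (auto simp: mon_cons_exp)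
 qed simp
 then have "c b = crd (t # ys) y (cons_exp ?n 0 b)" using b by simp
 also have "... = car (t # ys) (t * z * mon (t # ys) (%i. p - 1 - cons_exp ?n 0 b i))"
  unfolding crd_car[OF pbU b'] z(1) ..
 also have "t * z * mon (t # ys) (%i. p - 1 - cons_exp ?n 0 b i) =
   t ^ p * (z * mon ys (%i. p - 1 - cons_exp ?n 0 b (Suc i)))"
  using power_minus_mult[OF p_gt_0, of t] by (simp add: mon_Cons cons_exp_def mult_ac)
 also have "car (t # ys) ... = t * car (t # ys) (z * mon ys (%i. p - 1 - cons_exp ?n 0 b (Suc i)))"
  by (rule car_smult[OF pbU])
 finally have eq: "c b = t * car (t # ys) (z * mon ys (%i. p - 1 - cons_exp ?n 0 b (Suc i)))" .
 have "car (t # ys) (z * mon ys (%i. p - 1 - cons_exp ?n 0 b (Suc i))) \<in> R"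
  using z(2) by (intro car_mem[OF R fr pb] sring_mult[OF R] mon_mem[OF R basis_R(2)])
 then have "r (c b) = 0" unfolding eq using res_mult[OF R r basis_R(1)] basis_R(3) by simp
 then show "d b = 0" using c by simp
qed

text \<open>The factor \<open>t ^ (p - 1)\<close> makes the operator read the coordinate with
  exponent 0 at \<open>t\<close> and top exponent elsewhere, and by \<open>res_expand\<close> this
  coordinate survives reduction.\<close>

lemma car_residue:
 assumes x: "x \<in> R"
 shows "r (car (t # ys) (t ^ (p - 1) * x)) = car (map r ys) (r x)"
proof -
 let ?n = "length ys"
 note pbU = p_basis_field[OF R fr pb]
 have T: "cons_exp ?n 0 (top_exp p ?n) \<in> exps p (length (t # ys))" using cons_exp_exps[OF top_exps p_gt_0] by simp
 have "mon (t # ys) (%i. p - 1 - cons_exp ?n 0 (top_exp p ?n) i) = t ^ (p - 1)"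
  using mon_cong[of ys "%i. p - 1 - cons_exp ?n 0 (top_exp p ?n) (Suc i)" "%_. 0"]
  by (simp add: mon_Cons cons_exp_def top_exp_def)
 then have "car (t # ys) (t ^ (p - 1) * x) = crd (t # ys) x (cons_exp ?n 0 (top_exp p ?n))"
  unfolding crd_car[OF pbU T] by (simp add: mult.commute)
 moreover have "car (map r ys) (r x) = r (crd (t # ys) x (cons_exp ?n 0 (top_exp p ?n)))"
  unfolding res.car_eq length_map using res.crd_eq[OF p_basis_residue res_expand[OF x]] res.top_exps by simp
 ultimately show ?thesis by simp
qed

lemma car_iter_residue:
 assumes x: "x \<in> R"
 shows "(car (t # ys) ^^ e) (t ^ (p ^ e - 1) * x) \<in> R"
  and "r ((car (t # ys) ^^ e) (t ^ (p ^ e - 1) * x)) = (car (map r ys) ^^ e) (r x)"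
proof -
 note pbU = p_basis_field[OF R fr pb]
 show "(car (t # ys) ^^ e) (t ^ (p ^ e - 1) * x) \<in> R"
  using x basis_R(1) by (intro car_iter_mem[OF R fr pb] sring_mult[OF R] sring_power[OF R])
 show "r ((car (t # ys) ^^ e) (t ^ (p ^ e - 1) * x)) = (car (map r ys) ^^ e) (r x)" using x
 proof (induction e arbitrary: x)
  case (Suc e)
  have pe: "0 < p ^ e" by simp
  \<comment> \<open>The factor \<open>t ^ (p - 1)\<close> for one step is separated from a p-th
    power, which leaves that step as the twist for the remaining \<open>e\<close> steps.\<close>
  have "p ^ Suc e - 1 = (p ^ e - 1) * p + (p - 1)"
   using pe p_gt_0 by (cases "p ^ e"; cases p) (auto simp: algebra_simps)
  then have "t ^ (p ^ Suc e - 1) * x = (t ^ (p ^ e - 1)) ^ p * (t ^ (p - 1) * x)"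
   by (simp only: power_add power_mult mult.assoc)
  then have eq: "(car (t # ys) ^^ Suc e) (t ^ (p ^ Suc e - 1) * x) =
    (car (t # ys) ^^ e) (t ^ (p ^ e - 1) * car (t # ys) (t ^ (p - 1) * x))"
   by (simp only: funpow_Suc_right o_apply car_smult[OF pbU])
  have "car (t # ys) (t ^ (p - 1) * x) \<in> R"
   using Suc.prems basis_R(1) by (intro car_mem[OF R fr pb] sring_mult[OF R] sring_power[OF R])
  then show ?case unfolding eq Suc.IH[OF \<open>car (t # ys) (t ^ (p - 1) * x) \<in> R\<close>] car_residue[OF Suc.prems]
   by (simp only: funpow_Suc_right o_apply)
 qed simp
qed

end

section \<open>Orders of forms and of maps\<close>

text \<open>The definite description in \<open>form_ord\<close> is justified because Jacobians
  between p-bases of \<open>R\<close> are units.\<close>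

lemma form_ord_eq:
 assumes \<omega>: "rational_form (\<omega>::'a topform)" and ys: "p_basis R ys"
 shows "form_ord \<omega> R = ord_at R (form_coeff \<omega> ys)" unfolding form_ord_def
proof (rule the_equality)
 fix k assume "\<exists>ys. p_basis R ys & k = ord_at R (form_coeff \<omega> ys)"
 then obtain zs where zs: "p_basis R zs" "k = ord_at R (form_coeff \<omega> zs)" by blast
 note U = p_basis_field[OF R fr ys] p_basis_field[OF R fr zs(1)]
 have u: "unit_in R (jac ys zs)" by (rule jac_p_bases_unit[OF R fr ys zs(1)])
 have "form_coeff \<omega> zs = form_coeff \<omega> ys * jac ys zs" by (rule form_coeff_change[OF \<omega> U])
 then show "k = ord_at R (form_coeff \<omega> ys)"
  using zs(2) ord_mult[OF form_coeff_nz[OF \<omega> U(1)] jac_nz[OF U]] ord_unit[OF u] by simp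
qed (use ys in blast)

text \<open>In a p-basis of \<open>R\<close> the operator is the standard one up to a twist by
  \<open>form_coeff \<omega> ys ^ (p ^ e - 1)\<close>, and for the standard one duality decides
  which multipliers preserve \<open>R\<close>. Thus the operator alone determines the order of the
  form.\<close>

lemma cartier_mem_iff:
 assumes \<omega>: "rational_form (\<omega>::'a topform)" and ys: "p_basis R ys" and d: "d ~= 0"
 shows "(\<forall>x\<in>R. (cartier \<omega> ^^ e) (d * x) \<in> R) \<longleftrightarrow> int (p ^ e - 1) * form_ord \<omega> R \<le> ord_at R d"
proof -
 note U = p_basis_field[OF R fr ys]
 let ?u = "form_coeff \<omega> ys"
 have u: "?u ~= 0" by (rule form_coeff_nz[OF \<omega> U])
 have "(cartier \<omega> ^^ e) (d * x) = (car ys ^^ e) (d / ?u ^ (p ^ e - 1) * x)" for x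
 proof -
  have "d * x = ?u ^ (p ^ e - 1) * (d / ?u ^ (p ^ e - 1) * x)" using u by simp
  then show ?thesis by (simp only: cartier_iter_power[OF \<omega> U])
 qed
 then have "(\<forall>x\<in>R. (cartier \<omega> ^^ e) (d * x) \<in> R) \<longleftrightarrow> d / ?u ^ (p ^ e - 1) \<in> R"
  by (simp only: car_iter_mem_iff[OF R fr ys])
 also have "... \<longleftrightarrow> int (p ^ e - 1) * ord_at R ?u \<le> ord_at R d" using u d by (simp add: mem_iff ord_divide ord_power)
 finally show ?thesis by (simp add: form_ord_eq[OF \<omega> ys])
qed

text \<open>The Poincare residue, in terms of Cartier operators.\<close>

lemma cartier_residue:
 assumes \<omega>: "rational_form (\<omega>::'a topform)" and t: "uniformizer R t" and pb: "p_basis R (t # ys)"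
  and r: "residue_map R (r :: 'a => 'b::field)" and x: "x \<in> R"
 shows "(cartier \<omega> ^^ e) ((t * form_coeff \<omega> (t # ys)) ^ (p ^ e - 1) * x) \<in> R"
  and "r ((cartier \<omega> ^^ e) ((t * form_coeff \<omega> (t # ys)) ^ (p ^ e - 1) * x)) =
   (car (map r ys) ^^ e) (r x)"
proof -
 note U = p_basis_field[OF R fr pb]
 have "(t * form_coeff \<omega> (t # ys)) ^ (p ^ e - 1) * x =
   form_coeff \<omega> (t # ys) ^ (p ^ e - 1) * (t ^ (p ^ e - 1) * x)" by (simp add: power_mult_distrib mult_ac)
 then have eq: "(cartier \<omega> ^^ e) ((t * form_coeff \<omega> (t # ys)) ^ (p ^ e - 1) * x) =
   (car (t # ys) ^^ e) (t ^ (p ^ e - 1) * x)" by (simp only: cartier_iter_power[OF \<omega> U])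
 show "(cartier \<omega> ^^ e) ((t * form_coeff \<omega> (t # ys)) ^ (p ^ e - 1) * x) \<in> R"
  "r ((cartier \<omega> ^^ e) ((t * form_coeff \<omega> (t # ys)) ^ (p ^ e - 1) * x)) = (car (map r ys) ^^ e) (r x)"
  unfolding eq by (rule car_iter_residue[OF t pb r x])+
qed

text \<open>The residual forms of two adapted coordinate systems are compared through their Cartier
  operators: both are residues of the operator of \<open>\<omega>\<close>, hence differ by a twist
  with the residue of \<open>\<eta>\<close>.\<close>

lemma residue_form_ord:
 assumes \<omega>: "rational_form (\<omega>::'a topform)" and r: "residue_map R (r :: 'a => 'b::field)"
  and t: "uniformizer R t" "p_basis R (t # ys)" and s: "uniformizer R s" "p_basis R (s # zs)"
  and Q: "dvr Q" "F_finite (Q :: 'b set)"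
 defines "\<eta> \<equiv> (s * form_coeff \<omega> (s # zs)) / (t * form_coeff \<omega> (t # ys))"
 shows "unit_in R \<eta>" "ord_at Q (r \<eta>) + form_ord (1, map r zs) Q = form_ord (1, map r ys) Q"
proof -
 interpret res: char_p p "TYPE('b)" by (rule char_p_residue[OF R r])
 interpret Q: char_p_dvr p "TYPE('b)" Q using Q(1) by unfold_locales
 let ?\<theta> = "t * form_coeff \<omega> (t # ys)" and ?\<theta>' = "s * form_coeff \<omega> (s # zs)"
 have nz: "t ~= 0" "s ~= 0" "form_coeff \<omega> (t # ys) ~= 0" "form_coeff \<omega> (s # zs) ~= 0"
  using t s form_coeff_nz[OF \<omega>] p_basis_field[OF R fr] by (auto simp: uniformizer_def)
 have "ord_at R \<eta> = 0" unfolding \<eta>_def using nz form_ord_eq[OF \<omega> t(2)] form_ord_eq[OF \<omega> s(2)] t(1) s(1)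
  by (simp add: ord_divide ord_mult uniformizer_iff)
 then show u: "unit_in R \<eta>" using nz by (intro ord_zero_unit) (auto simp: \<eta>_def)
 note pbr = p_basis_residue[OF t r] p_basis_residue[OF s r]
 have forms: "rational_form (1, map r ys)" "rational_form (1, map r zs)"
  using pbr by (auto simp: rational_form_def)
 have car: "cartier (1, map r us) = car (map r us)" for us by (auto simp: cartier_def)
 have rel: "cartier (1, map r zs) x = cartier (1, map r ys) (r \<eta> ^ (p - 1) * x)" for x
 proof -
  obtain y where y: "y \<in> R" "r y = x" using res_surj[OF R r] by blast
  have "?\<theta>' ^ (p - 1) * y = ?\<theta> ^ (p - 1) * (\<eta> ^ (p - 1) * y)" unfolding \<eta>_def using nz by (simp add: power_divide)
  moreover have "\<eta> ^ (p - 1) * y \<in> R" using u y R by (auto simp: unit_in_def intro: sring_mult sring_power)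
  moreover have "car (map r zs) (r y) = r (cartier \<omega> (?\<theta>' ^ (p - 1) * y))"
   using cartier_residue(2)[OF \<omega> s r y(1), of 1] by simp
  ultimately have "car (map r zs) (r y) = r (cartier \<omega> (?\<theta> ^ (p - 1) * (\<eta> ^ (p - 1) * y)))" by (simp only:)
  also have "... = car (map r ys) (r (\<eta> ^ (p - 1) * y))"
   using cartier_residue(2)[OF \<omega> t r, of "\<eta> ^ (p - 1) * y" 1] \<open>\<eta> ^ (p - 1) * y \<in> R\<close> by simp
  also have "r (\<eta> ^ (p - 1) * y) = r \<eta> ^ (p - 1) * r y"
   using u y R by (simp add: unit_in_def res_mult[OF R r] res_power[OF R r] sring_power)
  finally show ?thesis using y(2) by (simp add: car)
 qed
 obtain ws where ws: "p_basis Q ws" using Q.p_basis_ex[OF Q(2) pbr(1)] by blast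
 have r\<eta>: "r \<eta> ~= 0" by (rule res_nz[OF R r u])
 obtain \<pi> where \<pi>: "uniformizer Q \<pi>" using Q.uniformizer_ex by blast
 \<comment> \<open>The comparison is tested on powers of a uniformizer of \<open>Q\<close>;
   inserting each of the two thresholds for \<open>n\<close> then gives equality.\<close>
 have iff: "int (p - 1) * form_ord (1, map r zs) Q \<le> n \<longleftrightarrow>
   int (p - 1) * form_ord (1, map r ys) Q \<le> n + int (p - 1) * ord_at Q (r \<eta>)" for n
 proof -
  have d: "\<pi> powi n ~= 0" "ord_at Q (\<pi> powi n) = n" using \<pi> by (auto simp: Q.uniformizer_iff Q.ord_powi)
  have "(\<forall>x\<in>Q. cartier (1, map r zs) (\<pi> powi n * x) \<in> Q) \<longleftrightarrow>
    (\<forall>x\<in>Q. cartier (1, map r ys) (r \<eta> ^ (p - 1) * \<pi> powi n * x) \<in> Q)" by (simp only: rel mult.assoc)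
  then show ?thesis using Q.cartier_mem_iff[OF forms(2) ws d(1), of 1] d r\<eta>
    Q.cartier_mem_iff[OF forms(1) ws, of "r \<eta> ^ (p - 1) * \<pi> powi n" 1]
   by (simp add: Q.ord_mult Q.ord_power add.commute)
 qed
 have "int (p - 1) * form_ord (1, map r zs) Q =
   int (p - 1) * form_ord (1, map r ys) Q - int (p - 1) * ord_at Q (r \<eta>)"
  using iff[of "int (p - 1) * form_ord (1, map r zs) Q"]
   iff[of "int (p - 1) * form_ord (1, map r ys) Q - int (p - 1) * ord_at Q (r \<eta>)"] by simp
 then have "int (p - 1) * (ord_at Q (r \<eta>) + form_ord (1, map r zs) Q) = int (p - 1) * form_ord (1, map r ys) Q"
  by (simp add: algebra_simps)
 moreover have "int (p - 1) ~= 0" using p_gt_1 by simp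
 ultimately show "ord_at Q (r \<eta>) + form_ord (1, map r zs) Q = form_ord (1, map r ys) Q"
  using mult_left_cancel[of "int (p - 1)"] by blast
qed

text \<open>For a universal map this is minus the order of its divisor on the trivial stalk
  \<open>R\<close>, in a form that avoids choosing a generator of Hom.\<close>

definition hom_level :: "nat => ('a => 'a) => int => bool" where
 "hom_level e \<psi> m \<longleftrightarrow> (\<forall>d. d ~= 0 --> (\<forall>x\<in>R. \<psi> (d * x) \<in> R) \<longleftrightarrow> m \<le> ord_at R d)"

lemma map_order_eq:
 assumes u: "universal e \<psi>" and m: "hom_level e \<psi> m" and b: "b ~= 0"
 shows "map_order e ((%x. b * x) ` R) R \<psi> = ord_at R b - m"
proof -
 obtain \<pi> where \<pi>: "uniformizer R \<pi>" using uniformizer_ex by blast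
 have lin: "p_inv_linear e \<psi>" using u by (simp add: universal_def)
 let ?b = "(%x. b * x) ` R"
 \<comment> \<open>The order is such that \<open>g * b\<close> has order \<open>m\<close>, which
   makes \<open>\<psi> (g * _)\<close> a generator on the stalk \<open>b * R\<close>.\<close>
 define g where "g = \<pi> powi m / b"
 have g: "g ~= 0" "ord_at R g = m - ord_at R b" using \<pi> b by (auto simp: g_def uniformizer_iff ord_divide ord_powi)
 let ?\<Phi> = "%x. \<psi> (g * x)"
 have pres: "\<psi> (c * x) \<in> R" if "x \<in> ?b" "c ~= 0" "m \<le> ord_at R (c * b)" for c x
 proof -
  obtain y where y: "y \<in> R" "x = b * y" using \<open>x \<in> ?b\<close> by blast
  then show ?thesis using m[unfolded hom_level_def, rule_format, of "c * b"] that b by (simp add: mult.assoc)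
 qed
 have gen: "hom_generator e ?b R ?\<Phi>" unfolding hom_generator_def
 proof (intro conjI allI impI)
  show "p_inv_linear e ?\<Phi>" by (rule p_inv_linear_scale[OF lin])
  show "?\<Phi> ` ?b \<subseteq> R" using pres[of _ g] g b by (auto simp: ord_mult)
  fix \<psi>' assume \<psi>': "p_inv_linear e \<psi>' & \<psi>' ` ?b \<subseteq> R"
  then obtain d where d: "\<And>x. \<psi>' x = \<psi> (d * x)" using u by (auto simp: universal_def)
  have "d / g \<in> R"
  proof (cases "d = 0")
   case True
   then show ?thesis using sring_zero[OF R] by simp
  next
   case False
   have "\<forall>x\<in>R. \<psi> (d * b * x) \<in> R" using \<psi>' d by (auto simp: mult.assoc image_subset_iff)
   then have "m \<le> ord_at R (d * b)" using m[unfolded hom_level_def, rule_format, of "d * b"] False b by simp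
   then show ?thesis using False b g by (simp add: mem_iff ord_divide ord_mult)
  qed
  then show "\<exists>c\<in>R. \<forall>x. \<psi>' x = \<psi> (g * (c * x))" using d g by (intro bexI[of _ "d / g"]) auto
 qed
 have \<psi>g: "\<psi> x = ?\<Phi> (inverse g * x)" for x
 proof -
  have "g * (inverse g * x) = x" using g(1) by (simp add: field_simps)
  then show ?thesis by (simp only:)
 qed
 show ?thesis unfolding map_order_def
 proof (rule the_equality)
  show "\<exists>\<Phi> d. hom_generator e ?b R \<Phi> & d ~= 0 & (\<forall>x. \<psi> x = \<Phi> (d * x)) & ord_at R b - m = ord_at R d"
  proof (rule exI[of _ ?\<Phi>], rule exI[of _ "inverse g"], intro conjI allI)
   show "\<psi> x = \<psi> (g * (inverse g * x))" for x by (rule \<psi>g)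
  qed (use gen g in \<open>simp_all add: ord_inverse\<close>)
  fix k assume "\<exists>\<Phi> d. hom_generator e ?b R \<Phi> & d ~= 0 & (\<forall>x. \<psi> x = \<Phi> (d * x)) & k = ord_at R d"
  then obtain \<Phi> d where \<Phi>: "hom_generator e ?b R \<Phi>" "d ~= 0" "\<And>x. \<psi> x = \<Phi> (d * x)" "k = ord_at R d" by blast
  obtain c where c: "c \<in> R" "\<And>x. \<Phi> x = \<psi> (g * (c * x))"
   using gen[unfolded hom_generator_def] \<Phi>(1)[unfolded hom_generator_def] by metis
  obtain c' where c': "c' \<in> R" "\<And>x. \<psi> (g * x) = \<Phi> (c' * x)"
   using gen[unfolded hom_generator_def] \<Phi>(1)[unfolded hom_generator_def] by metis
  \<comment> \<open>Two generators differ by mutually inverse elements of \<open>R\<close>, hence by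
    a unit, which does not affect the order.\<close>
  have "c * c' = 1"
  proof (rule universal_cancel[OF universal_scale[OF u g(1)]])
   fix x show "\<psi> (g * (c * c' * x)) = \<psi> (g * (1 * x))" using c(2)[of "c' * x"] c'(2)[of x] by (simp add: mult.assoc)
  qed
  then have "unit_in R c" using c(1) c'(1) by (metis unit_in_def inverse_unique mult_zero_left zero_neq_one)
  moreover have "c * d = inverse g"
  proof (rule universal_cancel[OF universal_scale[OF u g(1)]])
   fix x show "\<psi> (g * (c * d * x)) = \<psi> (g * (inverse g * x))"
    unfolding \<psi>g[of x, symmetric] using \<Phi>(3)[of x] c(2)[of "d * x"] by (simp only: mult.assoc)
  qed
  ultimately show "k = ord_at R b - m"
   using \<Phi>(2,4) g ord_mult[of c d] ord_unit[of c] by (auto simp: ord_inverse unit_in_def)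
 qed
qed

text \<open>If 1 were not attained, all values would lie in the maximal ideal and
  \<open>\<pi>\<close> could be divided out, which means \<open>\<pi> ^ (p ^ e)\<close> in the
  argument. A multiplier of order \<open>m - 1\<close> would then preserve \<open>R\<close>.\<close>

lemma hom_level_top:
 assumes lin: "p_inv_linear e \<psi>" and m: "hom_level e \<psi> m" and d: "d ~= 0" "ord_at R d = m + int (p ^ e) - 1"
 shows "\<exists>x\<in>R. \<psi> (d * x) = 1"
proof (rule ccontr)
 assume *: "\<not> ?thesis"
 have smult: "\<psi> (a ^ (p ^ e) * x) = a * \<psi> x" for a x using lin by (simp add: p_inv_linear_iff)
 have pe: "0 < p ^ e" by simp
 obtain \<pi> where \<pi>: "uniformizer R \<pi>" using uniformizer_ex by blast
 then have \<pi>': "\<pi> ~= 0" "ord_at R \<pi> = 1" by (auto simp: uniformizer_iff)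
 have in_max: "above 1 (\<psi> (d * x))" if x: "x \<in> R" for x
 proof (rule ccontr)
  assume n: "\<not> above 1 (\<psi> (d * x))"
  have "\<psi> (d * x) \<in> R" using m[unfolded hom_level_def, rule_format, OF d(1)] d(2) x pe by auto
  then have u: "unit_in R (\<psi> (d * x))" using n unit_in_iff[of "\<psi> (d * x)" R] by (simp add: max_eq_above)
  let ?y = "inverse (\<psi> (d * x))"
  have "\<psi> (d * (?y ^ (p ^ e) * x)) = ?y * \<psi> (d * x)" using smult[of ?y "d * x"] by (simp add: mult.left_commute)
  also have "... = 1" using u by (simp add: unit_in_def)
  finally show False using * u x R by (auto simp: unit_in_def intro: sring_mult sring_power)
 qed
 let ?d = "inverse \<pi> ^ (p ^ e) * d"
 have "\<psi> (?d * x) \<in> R" if x: "x \<in> R" for x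
 proof -
  have "\<psi> (?d * x) = \<psi> (d * x) * \<pi> powi (- 1)"
   unfolding mult.assoc smult by (simp add: power_int_minus mult.commute)
  then show ?thesis using in_max[OF x] above_iff[OF \<pi>] by simp
 qed
 then have "m \<le> ord_at R ?d" using m[unfolded hom_level_def, rule_format, of ?d] d \<pi>' by simp
 then show False using d \<pi>' by (simp add: ord_mult ord_power ord_inverse)
qed

text \<open>A factor \<open>\<pi> ^ (p ^ e)\<close> of the multiplier leaves the map as a factor
  \<open>\<pi>\<close>, and the remaining multiplier still has order at least
  \<open>m\<close>.\<close>

lemma hom_level_max:
 assumes lin: "p_inv_linear e \<psi>" and m: "hom_level e \<psi> m" and d: "d ~= 0" "m + int (p ^ e) \<le> ord_at R d"
  and x: "x \<in> R"
 shows "\<psi> (d * x) \<in> max_ideal R"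
proof -
 have smult: "\<psi> (a ^ (p ^ e) * x) = a * \<psi> x" for a x using lin by (simp add: p_inv_linear_iff)
 obtain \<pi> where \<pi>: "uniformizer R \<pi>" using uniformizer_ex by blast
 then have \<pi>': "\<pi> ~= 0" "ord_at R \<pi> = 1" by (auto simp: uniformizer_iff)
 let ?d = "inverse \<pi> ^ (p ^ e) * d"
 have "m \<le> ord_at R ?d" using d \<pi>' by (simp add: ord_mult ord_power ord_inverse)
 then have "\<psi> (?d * x) \<in> R" using m[unfolded hom_level_def, rule_format, of ?d] d \<pi>' x by simp
 then have "\<psi> (d * x) * \<pi> powi (- 1) \<in> R" unfolding mult.assoc smult by (simp add: power_int_minus mult.commute)
 then show ?thesis using above_iff[OF \<pi>, of 1] by (simp add: max_eq_above)
qed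

text \<open>Whether a multiplier preserves \<open>R\<close> is upward closed in its order, so a
  level exists once one multiplier preserves \<open>R\<close> and another does not.\<close>

lemma hom_level_ex:
 assumes lin: "p_inv_linear e \<psi>" and nz: "\<psi> x0 ~= 0" and d: "d ~= 0" "\<And>x. x \<in> R ==> \<psi> (d * x) \<in> R"
 shows "\<exists>m. hom_level e \<psi> m"
proof -
 have smult: "\<psi> (a ^ (p ^ e) * x) = a * \<psi> x" for a x using lin by (simp add: p_inv_linear_iff)
 obtain \<pi> where \<pi>: "uniformizer R \<pi>" using uniformizer_ex by blast
 then have \<pi>': "\<pi> ~= 0" "ord_at R \<pi> = 1" by (auto simp: uniformizer_iff)
 define P where "P d \<longleftrightarrow> d ~= 0 & (\<forall>x\<in>R. \<psi> (d * x) \<in> R)" for d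
 have up: "P d'" if "P d" "d' ~= 0" "ord_at R d \<le> ord_at R d'" for d d' unfolding P_def
 proof (intro conjI ballI)
  fix x assume x: "x \<in> R"
  have "d' / d \<in> R" using that by (auto simp: mem_iff ord_divide P_def)
  then have "\<psi> (d * (d' / d * x)) \<in> R" using that(1) x R unfolding P_def by (blast intro: sring_mult)
  then show "\<psi> (d' * x) \<in> R" using that(1) by (simp add: P_def)
 qed (rule that(2))
 \<comment> \<open>Multiplying by \<open>a\<^sup>q\<close> multiplies the value at \<open>x0\<close> by \<open>a\<close>, so it cannot always stay in \<open>R\<close>.\<close>
 have "x0 ~= 0" using nz lin by (auto simp: p_inv_linear_iff dest: spec[of _ 0])
 define a where "a = inverse (\<pi> * \<psi> x0)"
 have "a ~= 0" "a * \<psi> x0 = inverse \<pi>" using nz \<pi>' by (auto simp: a_def)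
 define D where "D = a ^ (p ^ e) * x0"
 have D: "D ~= 0" "\<not> P D"
 proof -
  show "D ~= 0" using \<open>a ~= 0\<close> \<open>x0 ~= 0\<close> by (simp add: D_def)
  have "\<psi> (D * 1) = inverse \<pi>" using smult[of a x0] \<open>a * \<psi> x0 = inverse \<pi>\<close> by (simp add: D_def)
  then show "\<not> P D" using sring_one[OF R] uniformizer_not_unit[OF R \<pi>] by (metis P_def)
 qed
 have Pd: "P d" using d by (simp add: P_def)
 \<comment> \<open>Orders are counted from that of \<open>D\<close>, which fails, so that the least
   admissible one is found among natural numbers.\<close>
 define Q where "Q n \<longleftrightarrow> P (\<pi> powi (ord_at R D + int n))" for n :: nat
 have "ord_at R D < ord_at R d" using up[OF Pd D(1)] D(2) by linarith
 then have "Q (nat (ord_at R d - ord_at R D))" unfolding Q_def using \<pi>' by (intro up[OF Pd]) (auto simp: ord_powi)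
 define n where "n = (LEAST n. Q n)"
 have Qn: "Q n" unfolding n_def by (rule LeastI, fact)
 have "hom_level e \<psi> (ord_at R D + int n)" unfolding hom_level_def
 proof (intro allI impI iffI)
  fix c :: 'a assume c: "c ~= 0"
  assume "\<forall>x\<in>R. \<psi> (c * x) \<in> R"
  then have Pc: "P c" using c by (simp add: P_def)
  show "ord_at R D + int n \<le> ord_at R c"
  proof (rule ccontr)
   assume lt: "\<not> ?thesis"
   have "ord_at R D < ord_at R c" using up[OF Pc D(1)] D(2) by linarith
   then have "Q (nat (ord_at R c - ord_at R D))"
    unfolding Q_def using \<pi>' by (intro up[OF Pc]) (auto simp: ord_powi)
   then have "n \<le> nat (ord_at R c - ord_at R D)" unfolding n_def by (rule Least_le)
   then show False using lt \<open>ord_at R D < ord_at R c\<close> by linarith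
  qed
 next
  fix c :: 'a assume c: "c ~= 0" "ord_at R D + int n \<le> ord_at R c"
  have "P c" using up[OF Qn[unfolded Q_def] c(1)] c(2) \<pi>' by (simp add: ord_powi)
  then show "\<forall>x\<in>R. \<psi> (c * x) \<in> R" by (simp add: P_def)
 qed
 then show ?thesis by blast
qed

lemma cartier_level:
 assumes "rational_form (\<omega>::'a topform)" "p_basis R ys"
 shows "hom_level e (cartier \<omega> ^^ e) (int (p ^ e - 1) * form_ord \<omega> R)"
 unfolding hom_level_def using cartier_mem_iff[OF assms] by blast

lemma hom_level_scale:
 assumes "hom_level e \<psi> m" "c ~= 0"
 shows "hom_level e (%x. \<psi> (c * x)) (m - ord_at R c)" unfolding hom_level_def
proof (intro allI impI)
 fix d :: 'a assume d: "d ~= 0"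
 show "(\<forall>x\<in>R. \<psi> (c * (d * x)) \<in> R) \<longleftrightarrow> m - ord_at R c \<le> ord_at R d"
  using assms(1)[unfolded hom_level_def, rule_format, of "c * d"] assms(2) d by (auto simp: ord_mult mult.assoc)
qed

end

section \<open>Ideals and localizations\<close>

definition sideal :: "'a::field set => 'a set => bool" where
 "sideal A I \<longleftrightarrow> I \<subseteq> A & 0 \<in> I & (\<forall>x\<in>I. \<forall>y\<in>I. x + y \<in> I) & (\<forall>a\<in>A. \<forall>x\<in>I. a * x \<in> I)"

definition sprime :: "'a::field set => 'a set => bool" where
 "sprime A P \<longleftrightarrow> sideal A P & 1 \<notin> P & (\<forall>a\<in>A. \<forall>b\<in>A. a * b \<in> P --> a \<in> P | b \<in> P)"

text \<open>The maximum condition is the form in which noetherianity is used below: for prime ideals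
  above an ideal, ideals of denominators and finite generation.\<close>

definition noeth :: "'a::field set => bool" where
 "noeth A \<longleftrightarrow> sring A &
   (\<forall>\<I>. \<I> ~= {} --> (\<forall>I\<in>\<I>. sideal A I) --> (\<exists>M\<in>\<I>. \<forall>I\<in>\<I>. M \<subseteq> I --> I = M))"

definition loc_ring :: "'a::field set => bool" where
 "loc_ring N \<longleftrightarrow> sring N & (\<forall>x\<in>max_ideal N. \<forall>y\<in>max_ideal N. x + y \<in> max_ideal N)"

lemma cring_ring_on: "sring A ==> cring (ring_on (A::'a::field set))"
proof -
 interpret field "KR :: 'a ring" by (rule field_from_type_algebra)
 assume "sring A"
 then have "subcring A KR" by (intro subcringI') (simp add: subring_iff_sring)
 then show ?thesis using subcring_iff[of A] by simp
qed

lemma ideal_iff_sideal: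
 assumes A: "sring A"
 shows "ideal I (ring_on A) \<longleftrightarrow> sideal (A::'a::field set) I"
proof
 interpret cring "ring_on A" by (rule cring_ring_on[OF A])
 assume "ideal I (ring_on A)"
 then interpret I: ideal I "ring_on A" .
 show "sideal A I" unfolding sideal_def using I.a_subset I.zero_closed I.a_closed I.I_l_closed by auto
next
 interpret cring "ring_on A" by (rule cring_ring_on[OF A])
 assume I: "sideal A I"
 have neg: "- x \<in> I" if "x \<in> I" for x
 proof -
  have "(- 1) * x \<in> I" using I that sring_uminus[OF A sring_one[OF A]] unfolding sideal_def by blast
  then show ?thesis by simp
 qed
 have inv: "\<ominus>\<^bsub>ring_on A\<^esub> x = - x" if "x \<in> I" for x
  using that I neg[OF that] by (intro minus_equality) (auto simp: sideal_def)
 show "ideal I (ring_on A)"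
 proof (rule idealI)
  show "subgroup I (add_monoid (ring_on A))"
  proof
   show "inv\<^bsub>add_monoid (ring_on A)\<^esub> x \<in> I" if "x \<in> I" for x
    using inv[OF that] neg[OF that] by (simp add: a_inv_def)
  qed (use I in \<open>auto simp: sideal_def\<close>)
  show "a \<otimes>\<^bsub>ring_on A\<^esub> x \<in> I" if "a \<in> I" "x \<in> carrier (ring_on A)" for a x
   using that I unfolding sideal_def by (simp, metis mult.commute)
 qed (use I in \<open>auto simp: sideal_def intro: local.ring_axioms\<close>)
qed

lemma primeideal_iff_sprime:
 assumes A: "sring A"
 shows "primeideal P (ring_on A) \<longleftrightarrow> sprime (A::'a::field set) P"
proof
 assume "primeideal P (ring_on A)"
 then interpret P: primeideal P "ring_on A" .
 have I: "sideal A P" using P.ideal_axioms by (simp add: ideal_iff_sideal[OF A])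
 have "1 \<notin> P"
 proof
  assume 1: "1 \<in> P"
  have "A \<subseteq> P" using I 1 unfolding sideal_def by (metis mult.right_neutral subsetI)
  then show False using P.I_notcarr I by (auto simp: sideal_def)
 qed
 then show "sprime A P" unfolding sprime_def using I P.I_prime by simp
next
 assume P: "sprime A P"
 show "primeideal P (ring_on A)" using P sring_one[OF A] cring_ring_on[OF A]
  by (intro primeidealI) (auto simp: sprime_def ideal_iff_sideal[OF A])
qed

lemma noeth_sring: "noeth A ==> sring A" by (simp add: noeth_def)

lemma noeth_max: "noeth A ==> \<I> ~= {} ==> (\<And>I. I \<in> \<I> ==> sideal A I) ==>
  \<exists>M\<in>\<I>. \<forall>I\<in>\<I>. M \<subseteq> I --> I = M" by (simp add: noeth_def)

lemma noeth_iff: "sring A ==> noetherian_ring (ring_on A) \<longleftrightarrow> noeth (A::'a::field set)"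
proof
 assume A: "sring A" and n: "noetherian_ring (ring_on A)"
 interpret noetherian_ring "ring_on A" by (rule n)
 show "noeth A" unfolding noeth_def
 proof (intro conjI A allI impI)
  fix \<I> assume \<I>: "\<I> ~= {}" "\<forall>I\<in>\<I>. sideal A I"
  have "\<Union>C \<in> \<I>" if C: "C ~= {}" "subset.chain \<I> C" for C
  proof -
   have "subset.chain {I. ideal I (ring_on A)} C"
    using C(2) \<I>(2) unfolding subset_chain_def by (auto simp: ideal_iff_sideal[OF A])
   then have "\<Union>C \<in> C" by (rule ideal_chain_is_trivial[OF C(1)])
   then show ?thesis using C(2) unfolding subset_chain_def by blast
  qed
  then show "\<exists>M\<in>\<I>. \<forall>I\<in>\<I>. M \<subseteq> I --> I = M" by (rule subset_Zorn_nonempty[OF \<I>(1)])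
 qed
next
 assume A: "sring A" and n: "noeth A"
 interpret cring "ring_on A" by (rule cring_ring_on[OF A])
 show "noetherian_ring (ring_on A)"
 proof (rule trivial_ideal_chain_imp_noetherian)
  fix C assume C: "C ~= {}" "subset.chain {I. ideal I (ring_on A)} C"
  then have "\<forall>I\<in>C. sideal A I" unfolding subset_chain_def by (auto simp: ideal_iff_sideal[OF A])
  then have "\<exists>M\<in>C. \<forall>I\<in>C. M \<subseteq> I --> I = M" by (intro noeth_max[OF n C(1)]) simp
  then obtain M where M: "M \<in> C" "\<forall>I\<in>C. M \<subseteq> I --> I = M" ..
  have "I \<subseteq> M" if "I \<in> C" for I
  proof -
   have "I \<subseteq> M | M \<subseteq> I" using C(2) M(1) that by (simp add: subset_chain_def)
   then show ?thesis using M(2) that by blast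
  qed
  then have "\<Union>C = M" using M(1) by blast
  then show "\<Union>C \<in> C" using M(1) by simp
 qed
qed

lemma noeth_chain:
 assumes "noeth A" "\<And>n. sideal A (I n)" "\<And>n. I n \<subseteq> I (Suc n)"
 shows "\<exists>n. I (Suc n) = I n"
proof -
 have "\<exists>M\<in>range I. \<forall>J\<in>range I. M \<subseteq> J --> J = M" by (rule noeth_max[OF assms(1)]) (use assms(2) in auto)
 then obtain n where n: "\<forall>J\<in>range I. I n \<subseteq> J --> J = I n" by (metis imageE)
 have "I (Suc n) = I n" using n[rule_format, OF rangeI assms(3)] .
 then show ?thesis ..
qed

lemma gen_sring: "sring (generate_ring KR S)" unfolding sring_def
proof (intro conjI ballI)
 show "1 \<in> generate_ring KR S" using generate_ring.one[of KR S] by simp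
 fix x y assume xy: "x \<in> generate_ring KR S" "y \<in> generate_ring KR S"
 show "x * y \<in> generate_ring KR S" using generate_ring.eng_mult[OF xy] by simp
 have "- y \<in> generate_ring KR S" using generate_ring.a_inv[OF xy(2)] by simp
 from generate_ring.eng_add[OF xy(1) this] show "x - y \<in> generate_ring KR S" by simp
qed

lemma gen_incl: "S \<subseteq> generate_ring KR S" by (rule subsetI, rule generate_ring.incl)

lemma gen_least: "sring T ==> S \<subseteq> T ==> generate_ring KR S \<subseteq> T"
proof
 fix x assume T: "sring T" "S \<subseteq> T"
 assume "x \<in> generate_ring KR S"
 then show "x \<in> T"
 proof (induction rule: generate_ring.induct)
  case (incl h)
  then show ?case using T(2) by blast
 next
  case (a_inv h)
  then show ?case using sring_uminus[OF T(1)] by simp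
 next
  case (eng_add h1 h2)
  then show ?case using sring_add[OF T(1)] by simp
 next
  case (eng_mult h1 h2)
  then show ?case using sring_mult[OF T(1)] by simp
 qed (simp add: sring_one[OF T(1)])
qed

lemma gen_idem: "sring A ==> generate_ring KR A = A" using gen_least[of A A] gen_incl[of A] by auto

lemma sring_image:
 assumes "sring A" "A \<subseteq> M" "sring M" "residue_map M r"
 shows "sring (r ` A)" unfolding sring_def
proof (intro conjI ballI)
 show "1 \<in> r ` A" using sring_one[OF assms(1)] res_one[OF assms(3,4)] by force
 fix x y assume "x \<in> r ` A" "y \<in> r ` A"
 then obtain a b where ab: "a \<in> A" "b \<in> A" "x = r a" "y = r b" by blast
 then have M: "a \<in> M" "b \<in> M" using assms(2) by auto
 have "x - y = r (a - b)" "x * y = r (a * b)"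
  using ab(3,4) res_diff[OF assms(3,4) M] res_mult[OF assms(3,4) M] by simp_all
 then show "x - y \<in> r ` A" "x * y \<in> r ` A"
  using sring_diff[OF assms(1) ab(1,2)] sring_mult[OF assms(1) ab(1,2)] by simp_all
qed

text \<open>Local rings \<open>N\<close> of \<open>A\<close>, described without mentioning prime ideals.\<close>

definition is_loc :: "'a::field set => 'a set => bool" where
 "is_loc A N \<longleftrightarrow> loc_ring N & A \<subseteq> N & (\<forall>x\<in>N. \<exists>s\<in>A. unit_in N s & x * s \<in> A)"

lemma loc_ring_sring: "loc_ring N ==> sring N" by (simp add: loc_ring_def)

lemma dvr_loc_ring: "dvr R ==> loc_ring R"
proof -
 assume R: "dvr R"
 interpret dvr_loc R using R by unfold_locales
 show ?thesis unfolding loc_ring_def using R by (simp add: max_eq_above above_add)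
qed

lemma max_ideal_sub: "max_ideal N \<subseteq> N" by (auto simp: max_ideal_def)

lemma one_not_max: "1 \<notin> max_ideal N" by (auto simp: max_ideal_def)

lemma zero_in_max: "sring N ==> 0 \<in> max_ideal N" by (simp add: max_ideal_def sring_zero)

lemma unit_cases: "x \<in> N ==> x \<in> max_ideal N | unit_in N x" using unit_in_iff[of x N] by blast

lemma unit_not_max: "unit_in N x ==> x \<notin> max_ideal N" using unit_in_iff[of x N] by blast

lemma unit_mono: "unit_in N x ==> N \<subseteq> M ==> unit_in M x" by (auto simp: unit_in_def)

lemma max_ideal_prime:
 assumes N: "loc_ring N" and A: "sring A" "A \<subseteq> N"
 shows "sprime A (max_ideal N \<inter> A)"
proof -
 note R = loc_ring_sring[OF N]
 have "a * x \<in> max_ideal N" if "a \<in> A" "x \<in> max_ideal N" for a x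
  using max_ideal_mult[OF R that(2), of a] that(1) A(2) by (auto simp: mult.commute)
 moreover have "a \<in> max_ideal N | b \<in> max_ideal N" if "a \<in> A" "b \<in> A" "a * b \<in> max_ideal N" for a b
  using unit_in_mult[OF R, of a b] unit_cases[of a N] unit_cases[of b N] unit_not_max[of N "a * b"] that A(2)
  by blast
 ultimately show ?thesis using N A zero_in_max[OF R] one_not_max[of N]
  unfolding sprime_def sideal_def loc_ring_def by (auto simp: sringD)
qed

lemma loc_at_is_loc:
 assumes A: "sring A" and P: "sprime A P"
 shows "is_loc A (loc_at A P)" "max_ideal (loc_at A P) \<inter> A = P"
proof -
 let ?N = "loc_at A P"
 have P0: "0 \<in> P" and P1: "1 \<notin> P" and PA: "P \<subseteq> A"
  and Padd: "\<And>x y. x \<in> P ==> y \<in> P ==> x + y \<in> P" and Pmult: "\<And>a x. a \<in> A ==> x \<in> P ==> a * x \<in> P"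
  and Pp: "\<And>a b. a \<in> A ==> b \<in> A ==> a * b \<in> P ==> a \<in> P | b \<in> P" using P by (auto simp: sprime_def sideal_def)
 have I: "x / s \<in> ?N" if "x \<in> A" "s \<in> A" "s \<notin> P" for x s using that by (auto simp: loc_at_def)
 have E: "\<exists>a s. x = a / s & a \<in> A & s \<in> A & s \<notin> P & s ~= 0" if "x \<in> ?N" for x
  using that P0 unfolding loc_at_def by auto
 have R: "sring ?N" unfolding sring_def
 proof (intro conjI ballI)
  show "1 \<in> ?N" using I[of 1 1] sring_one[OF A] P1 by simp
  fix x y assume xy: "x \<in> ?N" "y \<in> ?N"
  obtain a s where x: "x = a / s" "a \<in> A" "s \<in> A" "s \<notin> P" "s ~= 0" using E[OF xy(1)] by blast
  obtain b u where y: "y = b / u" "b \<in> A" "u \<in> A" "u \<notin> P" "u ~= 0" using E[OF xy(2)] by blast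
  note * = x y
  have su: "s * u \<in> A" "s * u \<notin> P" using * A Pp by (auto simp: sringD)
  have "x - y = (a * u - b * s) / (s * u)" "x * y = (a * b) / (s * u)" using * by (auto simp: field_simps)
  then show "x - y \<in> ?N" "x * y \<in> ?N" using * su A by (auto intro!: I simp: sringD)
 qed
 have AN: "A \<subseteq> ?N" using I[of _ 1] sring_one[OF A] P1 by auto
 have units: "unit_in ?N s" if "s \<in> A" "s \<notin> P" for s
 proof -
  have "s ~= 0" using that P0 by auto
  then show ?thesis using that AN I[of 1 s] sring_one[OF A] by (auto simp: unit_in_def inverse_eq_divide)
 qed
 have Pmax: "x / s \<in> max_ideal ?N" if x: "x \<in> P" and s: "s \<in> A" "s \<notin> P" for x s
 proof -
  have "x / s \<in> ?N" using I that PA by auto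
  moreover have "\<not> unit_in ?N (x / s)"
  proof
   assume u: "unit_in ?N (x / s)"
   then have "inverse (x / s) \<in> ?N" by (simp add: unit_in_def)
   then obtain b v where b: "inverse (x / s) = b / v" "b \<in> A" "v \<in> A" "v \<notin> P" "v ~= 0" using E by blast
   have "x ~= 0" "s ~= 0" using u by (auto simp: unit_in_def)
   then have "s * v = b * x" using b by (simp add: field_simps)
   then show False using Pp[OF s(1) b(3)] Pmult[OF b(2) x] s b by simp
  qed
  ultimately show ?thesis using unit_cases by blast
 qed
 have maxE: "\<exists>a s. x = a / s & a \<in> P & s \<in> A & s \<notin> P & s ~= 0" if x: "x \<in> max_ideal ?N" for x
 proof -
  have "x \<in> ?N" using x max_ideal_sub by blast
  then obtain a s where as: "x = a / s" "a \<in> A" "s \<in> A" "s \<notin> P" "s ~= 0" using E by blast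
  have "a \<in> P"
  proof (rule ccontr)
   assume "a \<notin> P"
   then have "unit_in ?N (a * inverse s)" using units as R by (intro unit_in_mult unit_in_inverse) auto
   then show False using x as unit_not_max by (metis divide_inverse)
  qed
  then show ?thesis using as by blast
 qed
 have "x + y \<in> max_ideal ?N" if "x \<in> max_ideal ?N" "y \<in> max_ideal ?N" for x y
 proof -
  obtain a s where x: "x = a / s" "a \<in> P" "s \<in> A" "s \<notin> P" "s ~= 0" using maxE[OF \<open>x \<in> max_ideal ?N\<close>] by blast
  obtain b u where y: "y = b / u" "b \<in> P" "u \<in> A" "u \<notin> P" "u ~= 0" using maxE[OF \<open>y \<in> max_ideal ?N\<close>] by blast
  note * = x y
  have "x + y = (u * a + s * b) / (s * u)" using * by (simp add: field_simps)
  moreover have "(u * a + s * b) / (s * u) \<in> max_ideal ?N"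
  proof (rule Pmax)
   show "u * a + s * b \<in> P" by (intro Padd Pmult * )
   show "s * u \<in> A" using * A by (simp add: sring_mult)
   show "s * u \<notin> P" using Pp * by blast
  qed
  ultimately show ?thesis by simp
 qed
 then have loc: "loc_ring ?N" using R by (simp add: loc_ring_def)
 have "\<exists>s\<in>A. unit_in ?N s & x * s \<in> A" if x: "x \<in> ?N" for x
 proof -
  obtain a s where "x = a / s" "a \<in> A" "s \<in> A" "s \<notin> P" "s ~= 0" using E[OF x] by blast
  then show ?thesis using units by (intro bexI[of _ s]) auto
 qed
 then show "is_loc A ?N" using loc AN by (simp add: is_loc_def)
 show "max_ideal ?N \<inter> A = P"
 proof (intro equalityI subsetI)
  fix x assume "x \<in> max_ideal ?N \<inter> A"
  then show "x \<in> P" using units unit_not_max by blast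
 next
  fix x assume x: "x \<in> P"
  then show "x \<in> max_ideal ?N \<inter> A" using Pmax[OF x, of 1] sring_one[OF A] P1 PA by auto
 qed
qed

lemma is_loc_loc_at:
 assumes A: "sring A" and N: "is_loc A N"
 shows "N = loc_at A (max_ideal N \<inter> A)" "sprime A (max_ideal N \<inter> A)"
proof -
 have loc: "loc_ring N" "A \<subseteq> N" using N by (auto simp: is_loc_def)
 note R = loc_ring_sring[OF loc(1)]
 show "sprime A (max_ideal N \<inter> A)" by (rule max_ideal_prime[OF loc(1) A loc(2)])
 show "N = loc_at A (max_ideal N \<inter> A)"
 proof (intro equalityI subsetI)
  fix x assume "x \<in> N"
  then obtain s where s: "s \<in> A" "unit_in N s" "x * s \<in> A" using N by (auto simp: is_loc_def)
  have "x = (x * s) / s" using s by (simp add: unit_in_def)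
  then show "x \<in> loc_at A (max_ideal N \<inter> A)" unfolding loc_at_def using s unit_not_max[OF s(2)] by blast
 next
  fix x assume "x \<in> loc_at A (max_ideal N \<inter> A)"
  then obtain a s where as: "x = a / s" "a \<in> A" "s \<in> A" "s \<notin> max_ideal N" by (auto simp: loc_at_def)
  then have "unit_in N s" using unit_cases[of s N] loc by blast
  then show "x \<in> N" using as loc R by (auto simp: divide_inverse unit_in_def intro: sring_mult)
 qed
qed

lemma Spec_iff:
 assumes A: "sring A"
 shows "N \<in> Spec A \<longleftrightarrow> is_loc A N"
proof
 assume "N \<in> Spec A"
 then obtain P where "N = loc_at A P" "sprime A P" unfolding Spec_def primeideal_iff_sprime[OF A] by auto
 then show "is_loc A N" using loc_at_is_loc(1)[OF A] by simp
next
 assume "is_loc A N"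
 from is_loc_loc_at[OF A this] show "N \<in> Spec A"
  unfolding Spec_def primeideal_iff_sprime[OF A] by (intro CollectI exI conjI)
qed

text \<open>The center of \<open>V\<close> on the affine scheme of \<open>A\<close>, meant for any
  local ring \<open>V\<close> containing \<open>A\<close> and not only for valuation rings.\<close>

definition center :: "'a::field set => 'a set => 'a set" where
 "center A V = loc_at A (max_ideal V \<inter> A)"

lemma center_props:
 assumes A: "sring A" and V: "loc_ring V" and AV: "A \<subseteq> V"
 shows "is_loc A (center A V)" "dominates V (center A V)"
  and "is_loc A N ==> dominates V N ==> N = center A V"
proof -
 note P = max_ideal_prime[OF V A AV] and R = loc_ring_sring[OF V]
 show loc: "is_loc A (center A V)" unfolding center_def by (rule loc_at_is_loc(1)[OF A P])
 have m: "max_ideal (center A V) \<inter> A = max_ideal V \<inter> A" unfolding center_def by (rule loc_at_is_loc(2)[OF A P])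
 have inv: "inverse s \<in> V" if "s \<in> A" "s \<notin> max_ideal V" for s
  using that AV unit_cases[of s V] by (auto simp: unit_in_def)
 have sub: "center A V \<subseteq> V"
  using AV inv R unfolding center_def loc_at_def by (auto simp: divide_inverse intro: sring_mult)
 moreover have "max_ideal (center A V) \<subseteq> max_ideal V"
 proof
  fix x assume x: "x \<in> max_ideal (center A V)"
  then have "x \<in> center A V" using max_ideal_sub by blast
  then obtain s where s: "s \<in> A" "unit_in (center A V) s" "x * s \<in> A" using loc by (auto simp: is_loc_def)
  have "x * s \<in> max_ideal (center A V)"
   using max_ideal_mult[OF _ x, of s] s loc by (auto simp: is_loc_def loc_ring_def unit_in_def)
  then have "x * s \<in> max_ideal V" using m s by blast
  moreover have "inverse s \<in> V" using s(2) sub by (auto simp: unit_in_def)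
  ultimately have "x * s * inverse s \<in> max_ideal V" by (rule max_ideal_mult[OF R])
  then show "x \<in> max_ideal V" using s(2) by (simp add: unit_in_def mult.assoc)
 qed
 ultimately show "dominates V (center A V)" by (simp add: dominates_def)
 assume N: "is_loc A N" "dominates V N"
 have "max_ideal N \<inter> A = max_ideal V \<inter> A"
 proof (intro equalityI subsetI)
  fix x assume x: "x \<in> max_ideal V \<inter> A"
  then have "\<not> unit_in N x" using N(2) unit_mono[of N x V] unit_not_max[of V x] by (auto simp: dominates_def)
  then show "x \<in> max_ideal N \<inter> A" using unit_cases[of x N] x N(1) by (auto simp: is_loc_def)
 qed (use N in \<open>auto simp: dominates_def\<close>)
 then show "N = center A V" using is_loc_loc_at(1)[OF A N(1)] by (simp add: center_def)
qed

lemma dominates_refl [simp]: "dominates V V" by (simp add: dominates_def)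

lemma dominates_trans: "dominates V N ==> dominates N M ==> dominates V M" by (auto simp: dominates_def)

lemma dominates_unit: "dominates V N ==> x \<in> N ==> unit_in V x \<longleftrightarrow> unit_in N x"
 unfolding dominates_def using unit_cases[of x N] unit_not_max[of V x] unit_mono[of N x V] by blast

lemma is_loc_sandwich: "is_loc A N ==> A \<subseteq> D ==> D \<subseteq> N ==> sring D ==> is_loc D N" unfolding is_loc_def by blast

text \<open>Rings of fractions for arbitrary denominators; this covers local rings as well as the
  inversion of one element.\<close>

definition fractions :: "'a::field set => 'a set => bool" where
 "fractions A N \<longleftrightarrow> sring N & A \<subseteq> N & (\<forall>x\<in>N. \<exists>s\<in>A. unit_in N s & x * s \<in> A)"

lemma is_loc_fractions: "is_loc A N ==> fractions A N" by (simp add: is_loc_def fractions_def loc_ring_def)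

text \<open>A monotone map of ideals that is strict on strict inclusions reflects the maximum
  condition. It is used with contraction, with inverse images under a residue map and with
  multiplication by a denominator.\<close>

lemma noeth_transfer:
 fixes A :: "'a::field set" and N :: "'b::field set"
 assumes A: "noeth A" and N: "sring N" and F: "\<And>I. sideal N I ==> sideal A (F I)"
  "\<And>I J. sideal N I ==> sideal N J ==> I \<subseteq> J ==> F I \<subseteq> F J & (F J = F I --> J \<subseteq> I)"
 shows "noeth N" unfolding noeth_def
proof (intro conjI allI impI N)
 fix \<I> assume \<I>: "\<I> ~= {}" "\<forall>I\<in>\<I>. sideal N I"
 have "\<exists>J\<in>F ` \<I>. \<forall>I\<in>F ` \<I>. J \<subseteq> I --> I = J" by (rule noeth_max[OF A]) (use \<I> F(1) in auto)
 then obtain M where M: "M \<in> \<I>" "\<And>I. I \<in> \<I> ==> F M \<subseteq> F I ==> F I = F M" by auto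
 show "\<exists>M\<in>\<I>. \<forall>I\<in>\<I>. M \<subseteq> I --> I = M"
 proof (rule bexI[OF _ M(1)], intro ballI impI equalityI)
  fix I assume "I \<in> \<I>" "M \<subseteq> I"
  then show "I \<subseteq> M" using F(2)[of M I] M(1) M(2)[of I] \<I>(2) by blast
 qed
qed

lemma fractions_noeth:
 assumes A: "noeth A" and N: "fractions A N"
 shows "noeth N"
proof (rule noeth_transfer[OF A, of _ "%I. I \<inter> A"])
 show "sring N" using N by (simp add: fractions_def)
 show "sideal A (I \<inter> A)" if "sideal N I" for I
  using that N noeth_sring[OF A] unfolding sideal_def fractions_def by (auto simp: sringD)
 fix I M assume I: "sideal N I" and M: "sideal N M" and "M \<subseteq> I"
 have "x \<in> M" if IA: "I \<inter> A = M \<inter> A" and x: "x \<in> I" for x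
 proof -
  have "x \<in> N" using x I by (auto simp: sideal_def)
  then obtain s where s: "s \<in> A" "unit_in N s" "x * s \<in> A" using N by (auto simp: fractions_def)
  have "s * x \<in> I" using x I s N unfolding sideal_def fractions_def by blast
  then have "s * x \<in> M" using IA s(3) by (auto simp: mult.commute)
  then have "inverse s * (s * x) \<in> M" using s(2) M unfolding sideal_def unit_in_def by blast
  then show "x \<in> M" using s(2) by (simp add: unit_in_def mult.assoc[symmetric])
 qed
 then show "M \<inter> A \<subseteq> I \<inter> A & (I \<inter> A = M \<inter> A --> I \<subseteq> M)" using \<open>M \<subseteq> I\<close> by blast
qed

lemma noeth_image:
 assumes A: "noeth A" "A \<subseteq> M" and M: "sring M" "residue_map M (r :: 'a::field => 'b::field)"
 shows "noeth (r ` A)"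
proof (rule noeth_transfer[OF A(1), of _ "%I. r -` I \<inter> A"])
 note R = noeth_sring[OF A(1)]
 show "sring (r ` A)" by (rule sring_image[OF R A(2) M])
 show "sideal A (r -` I \<inter> A)" if "sideal (r ` A) I" for I
  using that R A(2) res_add[OF M] res_mult[OF M] res_zero[OF M]
  unfolding sideal_def by (auto simp: sringD subset_eq)
 fix I J assume "sideal (r ` A) I" "sideal (r ` A) J" "I \<subseteq> J"
 then show "r -` I \<inter> A \<subseteq> r -` J \<inter> A & (r -` J \<inter> A = r -` I \<inter> A --> J \<subseteq> I)" unfolding sideal_def by blast
qed

lemma noeth_overring:
 assumes A: "noeth A" "A \<subseteq> N" and N: "sring N" and d: "d ~= 0" "\<And>x. x \<in> N ==> d * x \<in> A"
 shows "noeth N"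
proof (rule noeth_transfer[OF A(1) N, of "%I. (%x. d * x) ` I"])
 have inj: "inj (%x. d * x)" using d(1) by (simp add: inj_def)
 show "(%x. d * x) ` I \<subseteq> (%x. d * x) ` J & ((%x. d * x) ` J = (%x. d * x) ` I --> J \<subseteq> I)" if "I \<subseteq> J" for I J
  using that by (auto simp: inj_image_eq_iff[OF inj])
 fix I assume I: "sideal N I"
 show "sideal A ((%x. d * x) ` I)" unfolding sideal_def
 proof (intro conjI ballI)
  show "(%x. d * x) ` I \<subseteq> A" using I d(2) by (auto simp: sideal_def)
  show "0 \<in> (%x. d * x) ` I" using I by (force simp: sideal_def)
  show "x + y \<in> (%x. d * x) ` I" if "x \<in> (%x. d * x) ` I" "y \<in> (%x. d * x) ` I" for x y
   using that I by (auto simp: sideal_def ring_distribs[symmetric])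
  show "a * x \<in> (%x. d * x) ` I" if ax: "a \<in> A" "x \<in> (%x. d * x) ` I" for a x
   using I ax(2) subsetD[OF A(2) ax(1)] by (auto simp: sideal_def mult.left_commute[of a] intro!: imageI)
 qed
qed

lemma frac_full_mono: "frac_full A ==> A \<subseteq> N ==> frac_full N" unfolding frac_full_def by blast

definition add_gen :: "'a::field set => 'a set => 'a => 'a set" where
 "add_gen A I a = {x + y * a | x y. x \<in> I & y \<in> A}"

lemma add_gen:
 assumes A: "sring A" and I: "sideal A I" and a: "a \<in> A"
 shows "sideal A (add_gen A I a)" "I \<subseteq> add_gen A I a" "a \<in> add_gen A I a"
proof -
 show "I \<subseteq> add_gen A I a" using sring_zero[OF A] by (force simp: add_gen_def)
 show "a \<in> add_gen A I a" using I sring_one[OF A] by (force simp: add_gen_def sideal_def)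
 show "sideal A (add_gen A I a)" unfolding sideal_def
 proof (intro conjI ballI)
  show "add_gen A I a \<subseteq> A" using I A a by (auto simp: add_gen_def sideal_def intro!: sring_add sring_mult)
  show "0 \<in> add_gen A I a" using I sring_zero[OF A] by (force simp: add_gen_def sideal_def)
  fix u assume "u \<in> add_gen A I a"
  then obtain x y where u: "u = x + y * a" "x \<in> I" "y \<in> A" by (auto simp: add_gen_def)
  show "u + v \<in> add_gen A I a" if vI: "v \<in> add_gen A I a" for v
  proof -
   obtain x' y' where v: "v = x' + y' * a" "x' \<in> I" "y' \<in> A" using vI by (auto simp: add_gen_def)
   have "u + v = (x + x') + (y + y') * a" using u v by (simp add: algebra_simps)
   then show ?thesis using u v I A unfolding add_gen_def sideal_def by (blast intro: sring_add)
  qed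
  show "b * u \<in> add_gen A I a" if "b \<in> A" for b
  proof -
   have "b * u = b * x + (b * y) * a" using u by (simp add: algebra_simps)
   then show ?thesis using u I A that unfolding add_gen_def sideal_def by (blast intro: sring_mult)
  qed
 qed
qed

text \<open>An ideal that is maximal among the proper ideals above \<open>I\<close> is
  prime.\<close>

lemma prime_above:
 assumes A: "noeth A" and I: "sideal A I" "1 \<notin> I"
 shows "\<exists>P. sprime A P & I \<subseteq> P"
proof -
 note R = noeth_sring[OF A]
 let ?F = "{J. sideal A J & 1 \<notin> J & I \<subseteq> J}"
 have "\<exists>M\<in>?F. \<forall>J\<in>?F. M \<subseteq> J --> J = M" by (rule noeth_max[OF A]) (use I in auto)
 then obtain M where M': "M \<in> ?F" "\<And>J. J \<in> ?F ==> M \<subseteq> J ==> J = M" by auto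
 have M: "sideal A M" "1 \<notin> M" "I \<subseteq> M" using M'(1) by auto
 have max: "J = M" if "sideal A J" "1 \<notin> J" "M \<subseteq> J" for J using M'(2)[of J] that M(3) by auto
 have "a \<in> M | b \<in> M" if ab: "a \<in> A" "b \<in> A" "a * b \<in> M" for a b
 proof (rule ccontr)
  assume n: "\<not> (a \<in> M | b \<in> M)"
  have "1 \<in> add_gen A M c" if "c \<in> A" "c \<notin> M" for c
  proof (rule ccontr)
   assume "1 \<notin> add_gen A M c"
   then have "add_gen A M c = M" by (rule max[OF add_gen(1)[OF R M(1) that(1)] _ add_gen(2)[OF R M(1) that(1)]])
   then show False using add_gen(3)[OF R M(1) that(1)] that(2) by simp
  qed
  then have "1 \<in> add_gen A M a" "1 \<in> add_gen A M b" using ab n by auto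
  then obtain x y x' y' where *: "1 = x + y * a" "x \<in> M" "y \<in> A" "1 = x' + y' * b" "x' \<in> M" "y' \<in> A"
   by (auto simp: add_gen_def)
  have "(1::'a) = (x + y * a) * (x' + y' * b)" using * by simp
  also have "... = (x' + y' * b) * x + (y * a) * x' + (y * y') * (a * b)" by (simp add: algebra_simps)
  also have "... \<in> M"
  proof -
   have "x' + y' * b \<in> A" "y * a \<in> A" "y * y' \<in> A"
    using * ab R M(1) sring_one[OF R] by (auto simp: sideal_def intro!: sring_mult)
   then show ?thesis using * ab M(1) unfolding sideal_def by blast
  qed
  finally show False using M(2) by simp
 qed
 then have "sprime A M" using M by (auto simp: sprime_def)
 then show ?thesis using M(3) by blast
qed

text \<open>Noetherian induction: a maximal counterexample \<open>M\<close> is neither the whole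
  ring nor prime. If \<open>a * b\<close> lies in \<open>M\<close>, every prime above
  \<open>M\<close> lies above the ideal enlarged by \<open>a\<close> or the one enlarged by
  \<open>b\<close>, and both are strictly larger.\<close>

lemma finite_primes_above:
 assumes A: "noeth A" and I: "sideal A I"
 shows "\<exists>\<P>. finite \<P> & (\<forall>P\<in>\<P>. sprime A P & I \<subseteq> P) & (\<forall>Q. sprime A Q & I \<subseteq> Q --> (\<exists>P\<in>\<P>. P \<subseteq> Q))"
proof (rule ccontr)
 assume bad: "\<not> ?thesis"
 note R = noeth_sring[OF A]
 define good where "good I \<longleftrightarrow> (\<exists>\<P>. finite \<P> & (\<forall>P\<in>\<P>. sprime A P & I \<subseteq> P) &
  (\<forall>Q. sprime A Q & I \<subseteq> Q --> (\<exists>P\<in>\<P>. P \<subseteq> Q)))" for I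
 have "\<not> good I" using bad by (simp add: good_def)
 then have "\<exists>M\<in>{J. sideal A J & \<not> good J}. \<forall>J\<in>{J. sideal A J & \<not> good J}. M \<subseteq> J --> J = M"
  by (intro noeth_max[OF A]) (use I in auto)
 then obtain M where M: "sideal A M" "\<not> good M" and max: "\<And>J. sideal A J ==> \<not> good J ==> M \<subseteq> J ==> J = M" by auto
 have "1 \<notin> M"
 proof
  assume "1 \<in> M"
  then have "\<not> (sprime A Q & M \<subseteq> Q)" for Q by (auto simp: sprime_def)
  then have "good M" unfolding good_def by (intro exI[of _ "{}"]) blast
  then show False using M by simp
 qed
 moreover have "\<not> sprime A M"
 proof
  assume "sprime A M"
  then have "good M" unfolding good_def by (intro exI[of _ "{M}"]) auto
  then show False using M by simp
 qed
 ultimately obtain a b where ab: "a \<in> A" "b \<in> A" "a * b \<in> M" "a \<notin> M" "b \<notin> M" using M(1) by (auto simp: sprime_def)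
 note ga = add_gen[OF R M(1) ab(1)] and gb = add_gen[OF R M(1) ab(2)]
 have good: "good (add_gen A M a)" "good (add_gen A M b)"
  using max[OF ga(1) _ ga(2)] max[OF gb(1) _ gb(2)] ga(3) gb(3) ab by auto
 obtain P1 where P1: "finite P1" "\<forall>P\<in>P1. sprime A P & add_gen A M a \<subseteq> P"
   "\<forall>Q. sprime A Q & add_gen A M a \<subseteq> Q --> (\<exists>P\<in>P1. P \<subseteq> Q)"
  using good(1) unfolding good_def by (elim exE conjE) (rule that)
 obtain P2 where P2: "finite P2" "\<forall>P\<in>P2. sprime A P & add_gen A M b \<subseteq> P"
   "\<forall>Q. sprime A Q & add_gen A M b \<subseteq> Q --> (\<exists>P\<in>P2. P \<subseteq> Q)"
  using good(2) unfolding good_def by (elim exE conjE) (rule that)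
 have "\<exists>P\<in>P1 \<union> P2. P \<subseteq> Q" if Q: "sprime A Q" "M \<subseteq> Q" for Q
 proof -
  have sub: "add_gen A M c \<subseteq> Q" if "c \<in> Q" for c using Q that unfolding add_gen_def sprime_def sideal_def by blast
  have "a \<in> Q | b \<in> Q" using Q ab by (auto simp: sprime_def)
  then show ?thesis
  proof
   assume "a \<in> Q"
   from P1(3)[rule_format, OF conjI[OF Q(1) sub[OF this]]] show ?thesis by (auto simp only: Un_iff)
  next
   assume "b \<in> Q"
   from P2(3)[rule_format, OF conjI[OF Q(1) sub[OF this]]] show ?thesis by (auto simp only: Un_iff)
  qed
 qed
 moreover have "\<forall>P\<in>P1 \<union> P2. sprime A P & M \<subseteq> P"
 proof
  fix P assume "P \<in> P1 \<union> P2"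
  then show "sprime A P & M \<subseteq> P"
   using bspec[OF P1(2), of P] bspec[OF P2(2), of P] ga(2) gb(2) by (metis UnE subset_trans)
 qed
 moreover have "finite (P1 \<union> P2)" using P1(1) P2(1) by simp
 ultimately have "good M" unfolding good_def by (intro exI[of _ "P1 \<union> P2"] conjI allI impI) simp_all
 then show False using M by simp
qed

text \<open>The ideal of denominators of \<open>x\<close> is contained in no prime ideal, so it
  contains 1.\<close>

lemma mem_of_local:
 assumes A: "noeth A" and fr: "frac_full A" and x: "\<And>N. is_loc A N ==> x \<in> N"
 shows "x \<in> A"
proof (rule ccontr)
 assume n: "x \<notin> A"
 note R = noeth_sring[OF A]
 let ?I = "{a \<in> A. a * x \<in> A}"
 have "sideal A ?I" "1 \<notin> ?I" using R n by (auto simp: sideal_def sringD ring_distribs mult.assoc)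
 then obtain P where P: "sprime A P" "?I \<subseteq> P" using prime_above[OF A] by metis
 note L = loc_at_is_loc[OF R P(1)]
 obtain s where s: "s \<in> A" "unit_in (loc_at A P) s" "x * s \<in> A" using x[OF L(1)] L(1) by (auto simp: is_loc_def)
 then have "s \<in> P" using P(2) by (auto simp: mult.commute)
 then show False using L(2) s unit_not_max by blast
qed

section \<open>Integral closure\<close>

text \<open>One common denominator for all powers. Over the noetherian rings considered this amounts
  to integrality (\<open>int_closure_iff\<close>), and closure under ring operations follows from
  the binomial formula.\<close>

definition almost :: "'a::field set => 'a => bool" where
 "almost A x \<longleftrightarrow> (\<exists>c\<in>A. c ~= 0 & (\<forall>n. c * x ^ n \<in> A))"

lemma integral_almost:
 assumes A: "sring A" and fr: "frac_full A" and x: "x \<in> int_closure A"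
 shows "almost A x"
proof -
 obtain q where q: "lead_coeff q = 1" "\<And>i. poly.coeff q i \<in> A" "poly q x = 0"
  using x by (auto simp: int_closure_def)
 obtain a b where ab: "a \<in> A" "b \<in> A" "b ~= 0" "x = a / b" using fr unfolding frac_full_def by blast
 let ?d = "degree q"
 have "b ^ ?d * x ^ n \<in> A" for n
 proof (induction n rule: less_induct)
  case (less n)
  show ?case
  proof (cases "n \<le> ?d")
   case True
   have "b ^ ?d = b ^ (?d - n) * b ^ n" using True by (simp add: power_add[symmetric])
   then have "b ^ ?d * x ^ n = b ^ (?d - n) * a ^ n" using ab by (simp add: power_divide)
   then show ?thesis using ab A by (simp add: sring_mult sring_power)
  next
   case False
   have "(\<Sum>i\<le>?d. poly.coeff q i * x ^ i) = 0" using q(3) by (simp add: poly_altdef)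
   then have "(\<Sum>i<?d. poly.coeff q i * x ^ i) + x ^ ?d = 0"
    using q(1) by (simp add: lessThan_Suc_atMost[symmetric])
   then have xd: "x ^ ?d = - (\<Sum>i<?d. poly.coeff q i * x ^ i)" by (simp add: eq_neg_iff_add_eq_0 add.commute)
   have "x ^ n = x ^ ?d * x ^ (n - ?d)" using False by (simp add: power_add[symmetric])
   then have "b ^ ?d * x ^ n = - (\<Sum>i<?d. poly.coeff q i * (b ^ ?d * x ^ (i + (n - ?d))))"
    unfolding xd by (simp add: sum_distrib_left sum_distrib_right power_add mult_ac)
   also have "... \<in> A" using False by (intro sring_uminus[OF A] sring_sum[OF A] sring_mult[OF A q(2)] less.IH) auto
   finally show ?thesis .
  qed
 qed
 then show ?thesis unfolding almost_def using ab A by (intro bexI[of _ "b ^ ?d"]) (auto simp: sring_power)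
qed

text \<open>The ideals generated by \<open>c\<close>, \<open>c * x\<close>, ...,
  \<open>c * x ^ n\<close> become stationary; a relation for the next generator, divided by
  \<open>c\<close>, is a monic equation.\<close>

lemma almost_integral:
 assumes A: "noeth A" and x: "almost A x"
 shows "x \<in> int_closure A"
proof -
 note R = noeth_sring[OF A]
 obtain c where c: "c \<in> A" "c ~= 0" "\<And>n. c * x ^ n \<in> A" using x by (auto simp: almost_def)
 define I where "I n = {(\<Sum>i\<le>n. a i * (c * x ^ i)) | a. \<forall>i. a i \<in> A}" for n :: nat
 have "sideal A (I n)" for n unfolding sideal_def
 proof (intro conjI ballI)
  show "I n \<subseteq> A" unfolding I_def by (auto intro!: sring_sum[OF R] sring_mult[OF R _ c(3)])
  show "0 \<in> I n" unfolding I_def using sring_zero[OF R] by (intro CollectI exI[of _ "%_. 0"]) simp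
  fix u assume "u \<in> I n"
  then obtain a where a: "u = (\<Sum>i\<le>n. a i * (c * x ^ i))" "\<forall>i. a i \<in> A" by (auto simp: I_def)
  show "u + v \<in> I n" if "v \<in> I n" for v
  proof -
   obtain b where b: "v = (\<Sum>i\<le>n. b i * (c * x ^ i))" "\<forall>i. b i \<in> A" using \<open>v \<in> I n\<close> by (auto simp: I_def)
   show ?thesis unfolding I_def using a b R
    by (intro CollectI exI[of _ "%i. a i + b i"]) (simp add: sring_add ring_distribs sum.distrib)
  qed
  show "e * u \<in> I n" if "e \<in> A" for e unfolding I_def using a R that
   by (intro CollectI exI[of _ "%i. e * a i"]) (simp add: sring_mult sum_distrib_left mult.assoc)
 qed
 moreover have "I n \<subseteq> I (Suc n)" for n
 proof
  fix u assume "u \<in> I n"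
  then obtain a where a: "u = (\<Sum>i\<le>n. a i * (c * x ^ i))" "\<forall>i. a i \<in> A" by (auto simp: I_def)
  then show "u \<in> I (Suc n)" unfolding I_def using sring_zero[OF R]
   by (intro CollectI exI[of _ "%i. if i \<le> n then a i else 0"]) simp
 qed
 ultimately obtain n where n: "I (Suc n) = I n" using noeth_chain[OF A, of I] by blast
 have "c * x ^ Suc n \<in> I (Suc n)" unfolding I_def using sringD(1,2)[OF R]
  by (intro CollectI exI[of _ "%i. if i = Suc n then 1 else 0"]) (simp add: if_distrib[of "%u. u * _"] cong: if_cong)
 then have "c * x ^ Suc n \<in> I n" unfolding n .
 then obtain a where a: "c * x ^ Suc n = (\<Sum>i\<le>n. a i * (c * x ^ i))" "\<forall>i. a i \<in> A" unfolding I_def by blast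
 have "c * (\<Sum>i\<le>n. a i * x ^ i) = (\<Sum>i\<le>n. a i * (c * x ^ i))" by (simp add: sum_distrib_left mult.left_commute)
 then have xn: "x ^ Suc n = (\<Sum>i\<le>n. a i * x ^ i)" using a(1) c(2) by (metis mult_left_cancel)
 define q where "q = Polynomial.monom 1 (Suc n) - (\<Sum>i\<le>n. Polynomial.monom (a i) i)"
 have co: "poly.coeff q j = (if j = Suc n then 1 else 0) - (if j \<le> n then a j else 0)" for j
  by (simp add: q_def coeff_sum eq_commute)
 have "degree q = Suc n"
 proof (rule antisym)
  show "degree q \<le> Suc n" by (rule degree_le) (auto simp: co)
  show "Suc n \<le> degree q" by (rule le_degree) (simp add: co)
 qed
 then have "lead_coeff q = 1" by (simp add: co)
 moreover have "poly.coeff q j \<in> A" for j using a(2) R by (auto simp: co sringD)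
 moreover have "poly q x = 0" using xn by (simp add: q_def poly_monom poly_sum)
 ultimately show ?thesis unfolding int_closure_def by blast
qed

lemma int_closure_iff: "noeth A ==> frac_full A ==> x \<in> int_closure A \<longleftrightarrow> almost A x"
 using integral_almost almost_integral noeth_sring by blast

lemma int_closure_sub: "sring A ==> A \<subseteq> int_closure A"
proof
 fix x assume A: "sring A" "x \<in> A"
 have "lead_coeff [:- x, 1:] = 1" "poly [:- x, 1:] x = 0" by simp_all
 moreover have "poly.coeff [:- x, 1:] i \<in> A" for i using A by (auto simp: coeff_pCons sringD split: nat.split)
 ultimately show "x \<in> int_closure A" unfolding int_closure_def by blast
qed

lemma int_closure_mono: "A \<subseteq> B ==> int_closure A \<subseteq> int_closure B" unfolding int_closure_def by blast

lemma almost_sring: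
 assumes A: "sring A"
 shows "sring {x. almost A x}" unfolding sring_def
proof (intro conjI ballI)
 show "1 \<in> {x. almost A x}" using sring_one[OF A] by (auto simp: almost_def intro: bexI[of _ 1])
 fix x y assume "x \<in> {x. almost A x}" "y \<in> {x. almost A x}"
 then obtain c d where cd: "c \<in> A" "c ~= 0" "\<And>n. c * x ^ n \<in> A" "d \<in> A" "d ~= 0" "\<And>n. d * y ^ n \<in> A"
  by (auto simp: almost_def)
 have "c * d * (x - y) ^ n \<in> A" for n
 proof -
  have "c * d * (x + (- y)) ^ n = (\<Sum>k\<le>n. of_nat (n choose k) * ((c * x ^ k) * ((- 1) ^ (n - k) * (d * y ^ (n - k)))))"
   unfolding binomial_ring sum_distrib_left by (intro sum.cong refl) (simp add: power_minus[of y] mult_ac)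
  also have "... \<in> A" by (intro sring_sum[OF A] sring_mult[OF A sring_of_nat[OF A]] sring_mult[OF A cd(3)]
     sring_mult[OF A sring_power[OF A sring_uminus[OF A sring_one[OF A]]] cd(6)])
  finally show ?thesis by simp
 qed
 moreover have "c * d * (x * y) ^ n \<in> A" for n
  using sring_mult[OF A cd(3)[of n] cd(6)[of n]] by (simp add: power_mult_distrib mult_ac)
 moreover have "c * d \<in> A" "c * d ~= 0" using cd A by (auto simp: sring_mult)
 ultimately show "x - y \<in> {x. almost A x}" "x * y \<in> {x. almost A x}" unfolding almost_def by blast+
qed

text \<open>If \<open>s\<close> clears the coefficients of a monic equation of degree d for
  \<open>x\<close>, then multiplying the equation by \<open>s ^ d\<close> gives a monic equation for
  \<open>s * x\<close> over \<open>A\<close>.\<close>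

lemma int_closure_fractions:
 assumes A: "sring A" and N: "fractions A N" and x: "x \<in> int_closure N"
 shows "\<exists>s\<in>A. unit_in N s & s * x \<in> int_closure A"
proof -
 note R = N[unfolded fractions_def]
 obtain q where q: "lead_coeff q = 1" "\<And>i. poly.coeff q i \<in> N" "poly q x = 0"
  using x by (auto simp: int_closure_def)
 let ?d = "degree q"
 have "\<exists>s\<in>A. unit_in N s & (\<forall>i<k. s * poly.coeff q i \<in> A)" for k
 proof (induction k)
  case 0
  show ?case using sring_one[OF A] unit_in_one[of N] R by (intro bexI[of _ 1]) auto
 next
  case (Suc k)
  then obtain s where s: "s \<in> A" "unit_in N s" "\<forall>i<k. s * poly.coeff q i \<in> A" by blast
  obtain u where u: "u \<in> A" "unit_in N u" "poly.coeff q k * u \<in> A" using R q(2)[of k] by blast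
  have "u * s * poly.coeff q i \<in> A" if "i < Suc k" for i
  proof (cases "i = k")
   case True
   then show ?thesis using sring_mult[OF A s(1) u(3)] by (simp add: mult_ac)
  next
   case False
   then show ?thesis using sring_mult[OF A u(1)] s(3) that by (simp add: mult.assoc)
  qed
  then show ?case using s u A R by (intro bexI[of _ "u * s"]) (auto simp: sring_mult unit_in_mult)
 qed
 from this[of ?d] obtain s where s: "s \<in> A" "unit_in N s" "\<And>i. i < ?d ==> s * poly.coeff q i \<in> A" by blast
 define f where "f i = (if i < ?d then poly.coeff q i * s ^ (?d - i) else 0)" for i
 have fA: "f i \<in> A" for i
 proof (cases "i < ?d")
  case True
  then have "f i = s ^ (?d - i - 1) * (s * poly.coeff q i)"
   using power_minus_mult[of "?d - i" s] by (simp add: f_def mult_ac)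
  then show ?thesis using s(3)[OF True] s(1) A by (simp add: sring_mult sring_power)
 qed (simp add: f_def sring_zero[OF A])
 define g where "g = Polynomial.monom 1 ?d + (\<Sum>i<?d. Polynomial.monom (f i) i)"
 have co: "poly.coeff g j = (if j = ?d then 1 else 0) + (if j < ?d then f j else 0)" for j
  by (simp add: g_def coeff_sum eq_commute)
 have "degree g = ?d"
 proof (rule antisym)
  show "degree g \<le> ?d" by (rule degree_le) (auto simp: co)
  show "?d \<le> degree g" by (rule le_degree) (simp add: co)
 qed
 then have "lead_coeff g = 1" by (simp add: co)
 moreover have "poly.coeff g j \<in> A" for j using fA A by (auto simp: co sringD)
 moreover have "poly g (s * x) = s ^ ?d * poly q x"
 proof -
  have "poly q x = (\<Sum>i<?d. poly.coeff q i * x ^ i) + x ^ ?d"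
   using q(1) by (simp add: poly_altdef lessThan_Suc_atMost[symmetric])
  moreover have "f i * (s * x) ^ i = s ^ ?d * (poly.coeff q i * x ^ i)" if "i < ?d" for i
  proof -
   have "s ^ ?d = s ^ (?d - i) * s ^ i" using that by (simp add: power_add[symmetric])
   then show ?thesis using that by (simp add: f_def power_mult_distrib mult_ac)
  qed
  then have "(\<Sum>i<?d. f i * (s * x) ^ i) = s ^ ?d * (\<Sum>i<?d. poly.coeff q i * x ^ i)"
   unfolding sum_distrib_left by (intro sum.cong) simp_all
  moreover have "poly g (s * x) = (s * x) ^ ?d + (\<Sum>i<?d. f i * (s * x) ^ i)"
   by (simp add: g_def poly_monom poly_sum)
  ultimately show ?thesis by (simp add: ring_distribs power_mult_distrib)
 qed
 ultimately have "s * x \<in> int_closure A" using q(3) unfolding int_closure_def by (auto intro!: exI[of _ g])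
 then show ?thesis using s by blast
qed

section \<open>Serre's criterion\<close>

text \<open>Since \<open>y\<close> is not integral, repeated multiplication by \<open>y\<close>
  drives every nonzero element of \<open>N\<close> out of the maximal ideal, and at that moment the
  product is a unit. So each element is a unit times a power of \<open>y\<close>, and
  \<open>inverse y\<close> is the uniformizer.\<close>

lemma dvr_of_inverse:
 assumes N: "noeth N" "loc_ring N" "frac_full N" "int_closure N = N"
  and y: "y \<notin> N" "\<And>x. x \<in> max_ideal N ==> x * y \<in> N"
 shows "dvr N"
proof -
 note R = noeth_sring[OF N(1)]
 have not_almost: "\<not> almost N y" using almost_integral[OF N(1)] N(4) y(1) by blast
 obtain a b where ab: "a \<in> N" "b \<in> N" "b ~= 0" "y = a / b" using N(3) unfolding frac_full_def by blast
 have b: "b \<in> max_ideal N"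
 proof (rule ccontr)
  assume "b \<notin> max_ideal N"
  then have "unit_in N b" using unit_cases ab(2) by blast
  then show False using ab y(1) R by (auto simp: divide_inverse unit_in_def sring_mult)
 qed
 have leave: "\<exists>n. x * y ^ n \<in> N & x * y ^ n \<notin> max_ideal N" if x: "x \<in> N" "x ~= 0" for x
 proof (rule ccontr)
  assume *: "\<not> ?thesis"
  have "x * y ^ n \<in> N" for n
  proof (induction n)
   case (Suc n)
   then have "x * y ^ n \<in> max_ideal N" using * by blast
   then show ?case using y(2)[of "x * y ^ n"] by (simp add: mult_ac)
  qed (use x in simp)
  then show False using not_almost x by (auto simp: almost_def)
 qed
 have unit: "\<exists>n. unit_in N (x * y powi n)" if x: "x \<in> N" "x ~= 0" for x
 proof -
  obtain n where n: "x * y ^ n \<in> N" "x * y ^ n \<notin> max_ideal N" using leave[OF x] by blast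
  then have "unit_in N (x * y powi (int n))" using unit_cases by (metis power_int_of_nat)
  then show ?thesis by blast
 qed
 have y0: "y ~= 0" using y(1) sring_zero[OF R] by auto
 obtain n where n: "b * y ^ n \<in> N" "b * y ^ n \<notin> max_ideal N" using leave[OF ab(2,3)] by blast
 \<comment> \<open>One step before the denominator \<open>b\<close> leaves the maximal ideal there
   is an element \<open>x\<close> of it with \<open>x * y\<close> a unit; this puts
   \<open>inverse y\<close> into \<open>N\<close>.\<close>
 define n0 where "n0 = (LEAST n. b * y ^ n \<notin> max_ideal N)"
 have n0: "b * y ^ n0 \<notin> max_ideal N" unfolding n0_def by (rule LeastI, rule n(2))
 have lt: "b * y ^ k \<in> max_ideal N" if "k < n0" for k using not_less_Least[OF that[unfolded n0_def]] by blast
 obtain k where k: "n0 = Suc k" using b n0 by (cases n0) auto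
 define x where "x = b * y ^ k"
 have x: "x \<in> max_ideal N" using lt k by (simp add: x_def)
 have "unit_in N (x * y)" using y(2)[OF x] n0 unit_cases[of "x * y" N] k by (auto simp: x_def mult_ac)
 then have "x * inverse (x * y) \<in> N" using x R max_ideal_sub by (auto simp: unit_in_def intro: sring_mult)
 moreover have "x * inverse (x * y) = inverse y" using \<open>unit_in N (x * y)\<close> y0 by (simp add: unit_in_def)
 ultimately have t: "inverse y \<in> N" by (simp only:)
 have "\<exists>n. unit_in N (z * inverse y powi n)" if z: "z ~= 0" for z
 proof -
  obtain c d where cd: "c \<in> N" "d \<in> N" "d ~= 0" "z = c / d" using N(3) unfolding frac_full_def by blast
  then have "c ~= 0" using z by auto
  then obtain n m where nm: "unit_in N (c * y powi n)" "unit_in N (d * y powi m)" using unit cd by metis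
  have "unit_in N (c * y powi n * inverse (d * y powi m))"
   by (rule unit_in_mult[OF R nm(1) unit_in_inverse[OF nm(2)]])
  also have "c * y powi n * inverse (d * y powi m) = z * inverse y powi (m - n)"
   using y0 cd by (simp add: power_int_diff power_int_inverse field_simps)
  finally show ?thesis by blast
 qed
 then show ?thesis unfolding dvr_def using R t y0 y(1) by (intro conjI exI[of _ "inverse y"]) auto
qed

text \<open>Serre's argument with an associated prime. Among the ideals of denominators of the
  multiples \<open>u * y\<close> outside \<open>N\<close> a maximal one is prime, and in the
  localization there multiplication by \<open>u * y\<close> carries the maximal ideal into the
  ring.\<close>

lemma dvr_localization_avoiding:
 assumes N: "noeth N" "frac_full N" and normal: "\<And>R. is_loc N R ==> int_closure R = R"
  and y: "y \<notin> N"
 shows "\<exists>R. is_loc N R & dvr R & y \<notin> R"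
proof -
 note S = noeth_sring[OF N(1)]
 let ?colon = "%w. {z \<in> N. z * w \<in> N}"
 have sid: "sideal N (?colon w)" for w using S by (auto simp: sideal_def sringD ring_distribs mult.assoc)
 obtain u where u: "u \<in> N" "u * y \<notin> N"
   and max: "\<And>v. v \<in> N ==> v * y \<notin> N ==> ?colon (u * y) \<subseteq> ?colon (v * y) ==> ?colon (v * y) = ?colon (u * y)"
 proof -
  have "\<exists>M\<in>{?colon (u * y) | u. u \<in> N & u * y \<notin> N}.
    \<forall>J\<in>{?colon (u * y) | u. u \<in> N & u * y \<notin> N}. M \<subseteq> J --> J = M"
  proof (rule noeth_max[OF N(1)])
   show "{?colon (u * y) | u. u \<in> N & u * y \<notin> N} ~= {}" using y sring_one[OF S] by force
  qed (use sid in auto)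
  then obtain u where u: "u \<in> N" "u * y \<notin> N"
   and max: "\<forall>J\<in>{?colon (u * y) | u. u \<in> N & u * y \<notin> N}. ?colon (u * y) \<subseteq> J --> J = ?colon (u * y)" by auto
  show thesis by (rule that[OF u max[rule_format]]) auto
 qed
 define w where "w = u * y"
 define P where "P = ?colon w"
 have P: "sprime N P" unfolding sprime_def
 proof (intro conjI ballI impI)
  show "sideal N P" unfolding P_def by (rule sid)
  show "1 \<notin> P" using u by (simp add: P_def w_def)
  fix a b assume ab: "a \<in> N" "b \<in> N" "a * b \<in> P"
  have "b \<in> P" if "a \<notin> P"
  proof -
   have aw: "a * u * y \<notin> N" using that ab(1) by (auto simp: P_def w_def mult.assoc)
   have "z * (a * u * y) \<in> N" if "z * (u * y) \<in> N" for z using sring_mult[OF S ab(1) that] by (simp add: mult_ac)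
   then have "?colon (u * y) \<subseteq> ?colon (a * u * y)" by blast
   then have "?colon (a * u * y) = ?colon (u * y)" using max[of "a * u"] aw ab(1) u(1) S by (simp add: sring_mult)
   moreover have "b \<in> ?colon (a * u * y)" using ab by (auto simp: P_def w_def mult_ac)
   ultimately show ?thesis by (simp add: P_def w_def)
  qed
  then show "a \<in> P | b \<in> P" by blast
 qed
 let ?R = "loc_at N P"
 note L = loc_at_is_loc[OF S P]
 have RS: "sring ?R" using L(1) by (simp add: is_loc_def loc_ring_def)
 have wR: "w \<notin> ?R"
 proof
  assume "w \<in> ?R"
  then obtain s where s: "s \<in> N" "unit_in ?R s" "w * s \<in> N" using L(1) by (auto simp: is_loc_def)
  then have "s \<in> P" by (simp add: P_def mult.commute)
  then show False using L(2) s unit_not_max by blast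
 qed
 have "x * w \<in> ?R" if x: "x \<in> max_ideal ?R" for x
 proof -
  have "x \<in> ?R" using x max_ideal_sub by blast
  then obtain s where s: "s \<in> N" "unit_in ?R s" "x * s \<in> N" using L(1) by (auto simp: is_loc_def)
  have "x * s \<in> max_ideal ?R" using max_ideal_mult[OF RS x, of s] s by (simp add: unit_in_def)
  then have "x * s \<in> P" using L(2) s by blast
  then have "x * s * w \<in> ?R" using L(1) by (auto simp: P_def is_loc_def)
  then have "inverse s * (x * s * w) \<in> ?R" using s(2) RS by (simp add: unit_in_def sring_mult)
  moreover have "inverse s * (x * s * w) = x * w" using s(2) by (simp add: unit_in_def field_simps)
  ultimately show ?thesis by simp
 qed
 then have "dvr ?R"
  using dvr_of_inverse[OF fractions_noeth[OF N(1) is_loc_fractions[OF L(1)]] _ frac_full_mono[OF N(2)] normal[OF L(1)] wR]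
   L(1) by (auto simp: is_loc_def)
 moreover have "y \<notin> ?R"
 proof
  assume "y \<in> ?R"
  moreover have "u \<in> ?R" using u(1) L(1) by (auto simp: is_loc_def)
  ultimately show False using wR RS by (simp add: w_def sring_mult)
 qed
 ultimately show ?thesis using L(1) by blast
qed

text \<open>A large power of an element of negative order absorbs any denominator.\<close>

lemma dvr_maximal:
 assumes R: "dvr R" and N: "sring N" "R \<subseteq> N"
 shows "N = R | N = UNIV"
proof (rule ccontr)
 interpret dvr_loc R using R by unfold_locales
 assume *: "\<not> ?thesis"
 then obtain x where x: "x \<in> N" "x \<notin> R" using N(2) by blast
 then have x0: "x ~= 0" "ord_at R x < 0" using sring_zero[OF R] mem_iff[of x] by (metis, metis not_le)
 have "z \<in> N" for z
 proof (cases "z = 0")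
  case False
  define n where "n = nat (- ord_at R z)"
  have "ord_at R (z * inverse x ^ n) = ord_at R z + int n * (- ord_at R x)"
   using x0 False by (simp add: ord_mult ord_power ord_inverse)
  also have "... \<ge> 0"
  proof (cases "0 \<le> ord_at R z")
   case True
   then show ?thesis using x0 by (simp add: n_def)
  next
   case f: False
   then have "int n = - ord_at R z" by (simp add: n_def)
   moreover have "int n * 1 \<le> int n * (- ord_at R x)" using x0 by (intro mult_left_mono) auto
   ultimately show ?thesis by simp
  qed
  finally have "z * inverse x ^ n \<in> N" using mem_iff[of "z * inverse x ^ n"] False x0 N(2) by auto
  then have "z * inverse x ^ n * x ^ n \<in> N" using x(1) N(1) by (simp add: sring_mult sring_power)
  then show ?thesis using x0 by (simp add: mult.assoc power_mult_distrib[symmetric])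
 qed (use sring_zero[OF N(1)] in simp)
 then show False using * by blast
qed

section \<open>Finiteness of normalization\<close>

text \<open>A maximal finitely generated ideal inside \<open>J\<close> absorbs every further element
  of \<open>J\<close>.\<close>

lemma noeth_fg:
 assumes C: "noeth C" and J: "sideal C J"
 shows "\<exists>G. finite G & G \<subseteq> J & (\<forall>x\<in>J. \<exists>c. (\<forall>g\<in>G. c g \<in> C) & x = (\<Sum>g\<in>G. c g * g))"
proof -
 note R = noeth_sring[OF C]
 have Jc: "0 \<in> J" "J \<subseteq> C" "\<And>x y. x \<in> J ==> y \<in> J ==> x + y \<in> J" "\<And>a x. a \<in> C ==> x \<in> J ==> a * x \<in> J"
  using J by (auto simp: sideal_def)
 define sp where "sp G = {\<Sum>g\<in>G. c g * g | c. \<forall>g\<in>G. c g \<in> C}" for G :: "'a set"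
 have sp_sideal: "sideal C (sp G)" if "finite G" "G \<subseteq> J" for G unfolding sideal_def
 proof (intro conjI ballI)
  show "sp G \<subseteq> C" using that Jc(2) unfolding sp_def by (auto intro!: sring_sum[OF R] sring_mult[OF R])
  show "0 \<in> sp G" unfolding sp_def using sring_zero[OF R] by (intro CollectI exI[of _ "%_. 0"]) simp
  fix x assume "x \<in> sp G"
  then obtain c where c: "x = (\<Sum>g\<in>G. c g * g)" "\<forall>g\<in>G. c g \<in> C" unfolding sp_def by blast
  show "a * x \<in> sp G" if "a \<in> C" for a unfolding sp_def using c that R
   by (intro CollectI exI[of _ "%g. a * c g"]) (simp add: sum_distrib_left mult.assoc sring_mult)
  show "x + y \<in> sp G" if y: "y \<in> sp G" for y
  proof -
   obtain d where d: "y = (\<Sum>g\<in>G. d g * g)" "\<forall>g\<in>G. d g \<in> C" using y unfolding sp_def by blast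
   show ?thesis unfolding sp_def using c d R
    by (intro CollectI exI[of _ "%g. c g + d g"]) (simp add: sum.distrib ring_distribs sring_add)
  qed
 qed
 have "\<exists>M\<in>sp ` {G. finite G & G \<subseteq> J}. \<forall>I\<in>sp ` {G. finite G & G \<subseteq> J}. M \<subseteq> I --> I = M"
  by (rule noeth_max[OF C]) (use sp_sideal in auto)
 then obtain G where G: "finite G" "G \<subseteq> J" and max: "\<forall>I\<in>sp ` {G. finite G & G \<subseteq> J}. sp G \<subseteq> I --> I = sp G" by auto
 have "x \<in> sp G" if x: "x \<in> J" for x
 proof -
  have "sp G \<subseteq> sp (insert x G)"
  proof
   fix y assume "y \<in> sp G"
   then obtain c where c: "y = (\<Sum>g\<in>G. c g * g)" "\<forall>g\<in>G. c g \<in> C" unfolding sp_def by blast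
   have "y = (\<Sum>g\<in>insert x G. (if g \<in> G then c g else 0) * g)"
    using G(1) c(1) by (cases "x \<in> G") (auto simp: insert_absorb)
   moreover have "\<forall>g\<in>insert x G. (if g \<in> G then c g else 0) \<in> C" using c(2) sring_zero[OF R] by auto
   ultimately show "y \<in> sp (insert x G)"
    unfolding sp_def by (intro CollectI exI[of _ "%g. if g \<in> G then c g else 0"] conjI)
  qed
  moreover have "sp (insert x G) \<in> sp ` {G. finite G & G \<subseteq> J}" using G x by auto
  ultimately have eq: "sp (insert x G) = sp G" using max by blast
  have "x = (\<Sum>g\<in>insert x G. (if g = x then 1 else 0) * g)"
   using G(1) by (simp add: if_distrib[of "%u. u * _"] cong: if_cong)
  then have "x \<in> sp (insert x G)"
   unfolding sp_def using sringD(1,2)[OF R] by (intro CollectI exI[of _ "%g. if g = x then 1 else 0"]) auto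
  then show ?thesis using eq by simp
 qed
 then show ?thesis using G unfolding sp_def by (intro exI[of _ G]) blast
qed

text \<open>Nakayama's lemma for an idempotent ideal, removing one generator at a time.\<close>

lemma idempotent_ideal:
 assumes C: "noeth C" and J: "sideal C J" and y: "y \<in> J" "y ~= 0"
  and idem: "\<And>g. g \<in> J ==> \<exists>(B::'a set) u v. finite B & (\<forall>b\<in>B. u b \<in> J & v b \<in> J) & (g::'a::field) = (\<Sum>b\<in>B. u b * v b)"
 shows "1 \<in> J"
proof -
 note R = noeth_sring[OF C]
 have Jc: "0 \<in> J" "J \<subseteq> C" "\<And>x y. x \<in> J ==> y \<in> J ==> x + y \<in> J" "\<And>a x. a \<in> C ==> x \<in> J ==> a * x \<in> J"
  using J by (auto simp: sideal_def)
 have Jsum: "sum f B \<in> J" if "\<And>b. b \<in> B ==> f b \<in> J" for f and B :: "'a set"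
  using that by (induction B rule: infinite_finite_induct) (auto simp: Jc)
 obtain G where G: "finite G" "G \<subseteq> J" "\<forall>x\<in>J. \<exists>c. (\<forall>g\<in>G. c g \<in> C) & x = (\<Sum>g\<in>G. c g * g)"
  using noeth_fg[OF C J] by blast
 have main: "\<exists>a\<in>J. \<forall>y\<in>J. (1 - a) * y = 0"
  if "finite G" "G \<subseteq> J" "a \<in> J" "\<forall>y\<in>J. \<exists>c. (\<forall>g\<in>G. c g \<in> C) & (1 - a) * y = (\<Sum>g\<in>G. c g * g)" for G a using that
 proof (induction G arbitrary: a rule: finite_induct)
  case empty
  then show ?case by auto
 next
  case (insert g G)
  note gJ = insert.prems(1) and aJ = insert.prems(2)
  obtain B :: "'a set" and u v where B: "finite B" "\<forall>b\<in>B. u b \<in> J & v b \<in> J" "g = (\<Sum>b\<in>B. u b * v b)"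
   using idem[of g] gJ by blast
  have "\<forall>y. \<exists>c. y \<in> J --> (\<forall>h\<in>insert g G. c h \<in> C) & (1 - a) * y = (\<Sum>h\<in>insert g G. c h * h)"
   using insert.prems(3) by blast
  from choice[OF this] obtain c where
   c0: "\<forall>y. y \<in> J --> (\<forall>h\<in>insert g G. c y h \<in> C) & (1 - a) * y = (\<Sum>h\<in>insert g G. c y h * h)" ..
  have c: "c y h \<in> C" if "y \<in> J" "h \<in> insert g G" for y h using c0 that by blast
  have ceq: "(1 - a) * y = c y g * g + (\<Sum>h\<in>G. c y h * h)" if "y \<in> J" for y using c0 that insert.hyps by simp
  \<comment> \<open>Expanding the second factors in \<open>g = (\<Sum>b\<in>B. u b * v b)\<close>
    gives \<open>g\<close> the coefficient \<open>a + e\<close> in its own expansion, and the other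
    terms use \<open>G\<close> only.\<close>
  define e where "e = (\<Sum>b\<in>B. c (v b) g * u b)"
  have eJ: "e \<in> J" unfolding e_def using B(2) c by (intro Jsum Jc(4)) auto
  define d where "d h = (\<Sum>b\<in>B. u b * c (v b) h)" for h
  have dC: "d h \<in> C" if "h \<in> G" for h
   unfolding d_def using B(2) c that Jc(2) by (intro sring_sum[OF R] sring_mult[OF R]) auto
  have eg: "(1 - a - e) * g = (\<Sum>h\<in>G. d h * h)"
  proof -
   have "(1 - a) * g = (\<Sum>b\<in>B. u b * ((1 - a) * v b))"
    unfolding B(3) sum_distrib_left by (intro sum.cong refl) (simp add: mult.left_commute)
   also have "... = (\<Sum>b\<in>B. u b * (c (v b) g * g + (\<Sum>h\<in>G. c (v b) h * h)))"
    using B(2) ceq by (intro sum.cong refl) simp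
   also have "... = e * g + (\<Sum>b\<in>B. \<Sum>h\<in>G. u b * c (v b) h * h)"
    unfolding e_def ring_distribs sum.distrib sum_distrib_left sum_distrib_right by (simp add: mult_ac)
   also have "(\<Sum>b\<in>B. \<Sum>h\<in>G. u b * c (v b) h * h) = (\<Sum>h\<in>G. d h * h)"
    unfolding d_def sum_distrib_right by (rule sum.swap)
   finally show ?thesis by (simp add: algebra_simps)
  qed
  \<comment> \<open>Chosen so that \<open>1 - a'\<close> is the product of \<open>1 - a\<close>,
    which expands an arbitrary element, and \<open>1 - a - e\<close>, which then removes
    \<open>g\<close>.\<close>
  define a' where "a' = (a + e) + (1 - a - e) * a"
  have a'eq: "1 - a' = (1 - a - e) * (1 - a)" by (simp add: a'_def algebra_simps)
  have a1: "1 - a - e \<in> C" using aJ eJ Jc(2) by (intro sring_diff[OF R] sring_one[OF R]) auto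
  have a'J: "a' \<in> J" using aJ eJ a1 by (simp add: Jc a'_def)
  have "\<exists>c'. (\<forall>h\<in>G. c' h \<in> C) & (1 - a') * y = (\<Sum>h\<in>G. c' h * h)" if y: "y \<in> J" for y
  proof (intro exI conjI ballI)
   have "(1 - a') * y = (1 - a - e) * ((1 - a) * y)" by (simp add: a'eq mult.assoc)
   also have "... = c y g * ((1 - a - e) * g) + (1 - a - e) * (\<Sum>h\<in>G. c y h * h)"
    unfolding ceq[OF y] by (simp add: ring_distribs mult_ac)
   also have "... = (\<Sum>h\<in>G. (c y g * d h + (1 - a - e) * c y h) * h)"
    unfolding eg sum_distrib_left ring_distribs(2) sum.distrib by (simp add: mult.assoc)
   finally show "(1 - a') * y = (\<Sum>h\<in>G. (c y g * d h + (1 - a - e) * c y h) * h)" .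
   show "c y g * d h + (1 - a - e) * c y h \<in> C" if "h \<in> G" for h
    using c[OF y] dC that a1 by (intro sring_add[OF R] sring_mult[OF R]) auto
  qed
  then show ?case using insert.IH[OF _ a'J] gJ by simp
 qed
 have "\<exists>a\<in>J. \<forall>y\<in>J. (1 - a) * y = 0" using main[OF G(1,2) Jc(1)] G(3) by simp
 then obtain a where "a \<in> J" "(1 - a) * y = 0" using y(1) by blast
 then show ?thesis using y(2) by simp
qed

lemma F_finite_fractions:
 assumes p: "CHAR('a) > 0" and A: "F_finite A" "sring A" and N: "fractions A (N :: 'a::field set)"
 shows "F_finite N"
proof -
 obtain S where S: "finite S" "S \<subseteq> A" "\<And>x. x \<in> A ==> \<exists>c. (\<forall>s\<in>S. c s \<in> A) & x = (\<Sum>s\<in>S. c s ^ CHAR('a) * s)"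
  using A(1) unfolding F_finite_def by blast
 note NN = N[unfolded fractions_def]
 have "\<exists>c. (\<forall>s\<in>S. c s \<in> N) & x = (\<Sum>s\<in>S. c s ^ CHAR('a) * s)" if x: "x \<in> N" for x
 proof -
  obtain u where u: "u \<in> A" "unit_in N u" "x * u \<in> A" using NN x by blast
  have "x * u * u ^ (CHAR('a) - 1) \<in> A" using u A(2) by (simp add: sring_mult sring_power)
  then obtain c where c: "\<forall>s\<in>S. c s \<in> A" "x * u * u ^ (CHAR('a) - 1) = (\<Sum>s\<in>S. c s ^ CHAR('a) * s)"
   using S(3) by blast
  have "u ^ (CHAR('a) - 1) * u = u ^ CHAR('a)" by (rule power_minus_mult[OF p])
  then have eq: "x * u ^ CHAR('a) = (\<Sum>s\<in>S. c s ^ CHAR('a) * s)" unfolding c(2)[symmetric] by (metis mult.assoc mult.commute)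
  have "inverse u ^ CHAR('a) * (x * u ^ CHAR('a)) = x"
   using u(2) by (simp add: unit_in_def power_inverse field_simps)
  then have "x = (\<Sum>s\<in>S. (inverse u * c s) ^ CHAR('a) * s)"
   unfolding eq by (simp add: sum_distrib_left power_mult_distrib mult.assoc)
  moreover have "\<forall>s\<in>S. inverse u * c s \<in> N" using c(1) u(2) NN by (auto simp: unit_in_def intro!: sring_mult)
  ultimately show ?thesis by (intro exI[of _ "%s. inverse u * c s"]) simp
 qed
 then show ?thesis using S(1,2) NN unfolding F_finite_def by (intro exI[of _ S]) blast
qed

context char_p
begin

text \<open>An indexed family may repeat generators; coefficients of equal ones are added before
  Frobenius.\<close>

lemma F_finite_family:
 fixes g :: "'i => 'a"
 assumes A: "sring A" and I: "finite I" "\<And>i. i \<in> I ==> g i \<in> A"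
  and gen: "\<And>x. x \<in> A ==> \<exists>c. (\<forall>i\<in>I. c i \<in> A) & x = (\<Sum>i\<in>I. c i ^ p * g i)"
 shows "F_finite A"
proof -
 have "\<exists>c. (\<forall>s\<in>g ` I. c s \<in> A) & x = (\<Sum>s\<in>g ` I. c s ^ p * s)" if x: "x \<in> A" for x
 proof -
  obtain c where c: "\<forall>i\<in>I. c i \<in> A" "x = (\<Sum>i\<in>I. c i ^ p * g i)" using gen[OF x] by blast
  define c' where "c' t = (\<Sum>i\<in>{i \<in> I. g i = t}. c i)" for t
  have "x = (\<Sum>t\<in>g ` I. \<Sum>i\<in>{i \<in> I. g i = t}. c i ^ p * g i)" unfolding c(2) using I(1) by (rule sum.image_gen)
  also have "... = (\<Sum>t\<in>g ` I. c' t ^ p * t)"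
   unfolding c'_def frob_sum sum_distrib_right by (intro sum.cong refl) auto
  finally show ?thesis using c(1) by (intro exI[of _ c'] conjI ballI) (auto simp: c'_def intro!: sring_sum[OF A])
 qed
 then show ?thesis unfolding F_finite_def char_p using I by (intro exI[of _ "g ` I"]) blast
qed

lemma F_finite_field:
 assumes A: "F_finite (A::'a set)" and fr: "frac_full A" and R: "sring A"
 shows "F_finite (UNIV :: 'a set)"
proof (rule F_finite_fractions[OF _ A R])
 show "fractions A UNIV" unfolding fractions_def
 proof (intro conjI ballI)
  fix x
  obtain a b where "a \<in> A" "b \<in> A" "b ~= 0" "x = a / b" using fr unfolding frac_full_def by blast
  then show "\<exists>s\<in>A. unit_in UNIV s & x * s \<in> A" by (intro bexI[of _ b]) (auto simp: unit_in_def)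
 qed auto
qed simp

text \<open>
 For \<open>x\<close> integral over \<open>B\<close>, the conductor \<open>I\<close> of \<open>B[x]\<close> is stable under the maps \<open>\<delta> \<lambda>\<close>, \<open>\<lambda>\<close> a coordinate
 map of \<open>K\<close> over its \<open>p\<close>-th powers.  Hence \<open>I\<close> is idempotent after inverting \<open>\<delta>\<close>, so that it contains
 a power of \<open>\<delta>\<close>; the map \<open>\<lambda>\<close> dual to \<open>1\<close> then reduces the exponent to \<open>3\<close>, independently of \<open>x\<close>.
\<close>

lemma normalization_bound:
 assumes B: "noeth (B::'a set)" "frac_full B" "F_finite B"
 shows "\<exists>d\<in>B. d ~= 0 & (\<forall>x\<in>int_closure B. d * x \<in> B)"
proof -
 note R = noeth_sring[OF B(1)]
 have "\<exists>S. finite S & S \<subseteq> B & (\<forall>x\<in>B. \<exists>c. (\<forall>s\<in>S. c s \<in> B) & x = (\<Sum>s\<in>S. c s ^ p * s))"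
  using B(3) by (simp add: F_finite_def)
 then obtain S where S: "finite S" "S \<subseteq> B" "\<And>x. x \<in> B ==> \<exists>c. (\<forall>s\<in>S. c s \<in> B) & x = (\<Sum>s\<in>S. c s ^ p * s)" by blast
 have "x \<in> frob.span S" for x
 proof -
  obtain a b where ab: "a \<in> B" "b \<in> B" "b ~= 0" "x = a / b" using B(2) unfolding frac_full_def by blast
  have "a * b ^ (p - 1) \<in> B" using ab R by (simp add: sring_mult sring_power)
  then obtain c where c: "a * b ^ (p - 1) = (\<Sum>s\<in>S. c s ^ p * s)" using S(3) by blast
  have "x = inverse b ^ p * (\<Sum>s\<in>S. c s ^ p * s)" unfolding ab(4) c[symmetric] by (rule frob_fraction[OF ab(3)])
  also have "... \<in> frob.span S" by (intro frob.span_scale frob.span_sum) (auto intro: frob.span_base)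
  finally show ?thesis .
 qed
 then have spanS: "frob.span S = UNIV" by blast
 \<comment> \<open>The basis is extracted from \<open>insert 1 S\<close>, so it lies in
   \<open>B\<close> and contains 1; the coordinate at 1 then satisfies
   \<open>l 1 1 = 1\<close>.\<close>
 have "frob.independent {1}" by simp
 then obtain Bs where Bs: "{1} \<subseteq> Bs" "Bs \<subseteq> insert 1 S" "frob.independent Bs" "insert 1 S \<subseteq> frob.span Bs"
  using frob.maximal_independent_subset_extend[of "{1}" "insert 1 S"] by blast
 have finBs: "finite Bs" using Bs(2) S(1) by (meson finite.insertI finite_subset)
 have "frob.span S \<subseteq> frob.span Bs" using Bs(4) by (intro frob.span_minimal) (auto simp: frob.subspace_span)
 then have spanB: "x \<in> frob.span Bs" for x using spanS by blast
 have BsB: "Bs \<subseteq> B" using Bs(2) S(2) sring_one[OF R] by blast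
 define l where "l b x = frob.representation Bs x b" for b x
 have l_add: "l b (x + y) = l b x + l b y" for b x y
  unfolding l_def using frob.representation_add[OF Bs(3) spanB spanB] by simp
 have l_smult: "l b (c ^ p * x) = c * l b x" for b c x
  unfolding l_def using frob.representation_scale[OF Bs(3) spanB] by simp
 have expand: "x = (\<Sum>b\<in>Bs. l b x ^ p * b)" for x
  unfolding l_def using frob.sum_representation_eq[OF Bs(3) spanB finBs order_refl] by simp
 have l1: "l 1 1 = 1" unfolding l_def using frob.representation_basis[OF Bs(3), of 1] Bs(1) by simp
 have l_sum: "l b (sum f I) = (\<Sum>i\<in>I. l b (f i))" for b and f :: "'a => 'a" and I
 proof -
  have "l b 0 = 0" using l_smult[of b 0 0] by simp
  then show ?thesis by (induction I rule: infinite_finite_induct) (auto simp: l_add)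
 qed
 \<comment> \<open>One denominator for the coordinates of the generators works on all of
   \<open>B\<close>, because \<open>l b\<close> takes a factor \<open>c ^ p\<close> out as
   \<open>c\<close>.\<close>
 obtain \<delta> where \<delta>: "\<delta> \<in> B" "\<delta> ~= 0" "\<And>b s. b \<in> Bs ==> s \<in> S ==> \<delta> * l b s \<in> B"
  using common_denominator[OF R B(2), of "Bs \<times> S" "%(b, s). l b s"] finBs S(1) by auto
 have \<delta>l: "\<delta> * l b x \<in> B" if bx: "b \<in> Bs" "x \<in> B" for b x
 proof -
  obtain c where c: "\<forall>s\<in>S. c s \<in> B" "x = (\<Sum>s\<in>S. c s ^ p * s)" using S(3)[OF bx(2)] by blast
  have "\<delta> * l b x = (\<Sum>s\<in>S. c s * (\<delta> * l b s))"
   unfolding c(2) l_sum l_smult sum_distrib_left by (simp add: mult.left_commute)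
  also have "... \<in> B" using c(1) \<delta>(3)[OF bx(1)] by (intro sring_sum[OF R] sring_mult[OF R, of "c _" "\<delta> * l b _"]) auto
  finally show ?thesis .
 qed
 have "\<delta> ^ 3 * x \<in> B" if x: "x \<in> int_closure B" for x
 proof -
  obtain c where c: "c \<in> B" "c ~= 0" "\<And>n. c * x ^ n \<in> B"
   using integral_almost[OF R B(2) x] by (auto simp: almost_def)
  define I where "I = {y \<in> B. \<forall>n. y * x ^ n \<in> B}"
  have I: "0 \<in> I" "I \<subseteq> B" "\<And>x y. x \<in> I ==> y \<in> I ==> x + y \<in> I" "\<And>a x. a \<in> B ==> x \<in> I ==> a * x \<in> I"
   using R by (auto simp: I_def sringD ring_distribs mult.assoc)
  have stable: "\<delta> * l b y \<in> I" if "b \<in> Bs" "y \<in> I" for b y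
  proof -
   have "\<delta> * l b y * x ^ n \<in> B" for n
   proof -
    \<comment> \<open>The factor \<open>x ^ n\<close> enters \<open>l b\<close> as its p-th power,
      which is again a power of \<open>x\<close>.\<close>
    have "\<delta> * l b ((x ^ n) ^ p * y) \<in> B"
     using that by (intro \<delta>l) (auto simp: I_def mult.commute power_mult[symmetric])
    then show ?thesis unfolding l_smult by (simp add: mult_ac)
   qed
   then show ?thesis using \<delta>l that by (auto simp: I_def)
  qed
  define C where "C = {z. \<exists>k. \<delta> ^ k * z \<in> B}"
  define J where "J = {z. \<exists>k. \<delta> ^ k * z \<in> I}"
  have up: "\<delta> ^ k * z \<in> I'" if jk: "\<delta> ^ j * z \<in> I'" "j \<le> k" "\<And>a x. a \<in> B ==> x \<in> I' ==> a * x \<in> I'" for j k z I'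
  proof -
   have "\<delta> ^ k * z = \<delta> ^ (k - j) * (\<delta> ^ j * z)"
    using jk(2) by (simp add: mult.assoc[symmetric] power_add[symmetric])
   also have "... \<in> I'" by (rule jk(3)[OF sring_power[OF R \<delta>(1)] jk(1)])
   finally show ?thesis .
  qed
  have sC: "sring C" unfolding sring_def
  proof (intro conjI ballI)
   show "1 \<in> C" using sring_one[OF R] by (auto simp: C_def intro: exI[of _ 0])
   fix u v assume "u \<in> C" "v \<in> C"
   then obtain j k where jk: "\<delta> ^ j * u \<in> B" "\<delta> ^ k * v \<in> B" by (auto simp: C_def)
   have "\<delta> ^ (j + k) * (u * v) \<in> B" using sring_mult[OF R jk] by (simp add: power_add mult_ac)
   then show "u * v \<in> C" by (auto simp: C_def)
   have "\<delta> ^ (j + k) * u \<in> B" "\<delta> ^ (j + k) * v \<in> B"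
    using up[OF jk(1), of "j + k"] up[OF jk(2), of "j + k"] R by (auto simp: sring_mult)
   then have "\<delta> ^ (j + k) * (u - v) \<in> B" using sring_diff[OF R] by (simp add: right_diff_distrib)
   then show "u - v \<in> C" by (auto simp: C_def)
  qed
  have "fractions B C" unfolding fractions_def
  proof (intro conjI sC ballI)
   show "B \<subseteq> C" by (auto simp: C_def intro: exI[of _ 0])
   fix z assume "z \<in> C"
   then obtain k where k: "\<delta> ^ k * z \<in> B" by (auto simp: C_def)
   have "inverse (\<delta> ^ k) \<in> C" unfolding C_def using \<delta>(2) sring_one[OF R] by (intro CollectI exI[of _ k]) simp
   then have "unit_in C (\<delta> ^ k)" using \<delta> sring_power[OF R \<delta>(1)] \<open>B \<subseteq> C\<close> by (auto simp: unit_in_def)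
   then show "\<exists>s\<in>B. unit_in C s & z * s \<in> B"
    using k sring_power[OF R \<delta>(1)] by (intro bexI[of _ "\<delta> ^ k"]) (auto simp: mult.commute)
  qed
  then have nC: "noeth C" by (rule fractions_noeth[OF B(1)])
  have Jadd: "u + v \<in> J" if uv: "u \<in> J" "v \<in> J" for u v
  proof -
   obtain j k where jk: "\<delta> ^ j * u \<in> I" "\<delta> ^ k * v \<in> I" using uv by (auto simp: J_def)
   have "\<delta> ^ (j + k) * u \<in> I" "\<delta> ^ (j + k) * v \<in> I"
    using up[OF jk(1), of "j + k"] up[OF jk(2), of "j + k"] I(4) by auto
   then have "\<delta> ^ (j + k) * (u + v) \<in> I" using I(3) by (simp add: distrib_left)
   then show ?thesis by (auto simp: J_def)
  qed
  have Jmult: "u * v \<in> J" if uv: "u \<in> C" "v \<in> J" for u v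
  proof -
   obtain j k where jk: "\<delta> ^ j * u \<in> B" "\<delta> ^ k * v \<in> I" using uv by (auto simp: J_def C_def)
   have "\<delta> ^ (j + k) * (u * v) \<in> I" using I(4)[OF jk] by (simp add: power_add mult_ac)
   then show ?thesis by (auto simp: J_def)
  qed
  have sJ: "sideal C J" unfolding sideal_def using Jadd Jmult I(1,2) by (auto simp: J_def C_def)
  have lJ: "l b y \<in> J" if b: "b \<in> Bs" and y: "y \<in> J" for b y
  proof -
   obtain k where k: "\<delta> ^ k * y \<in> I" using y by (auto simp: J_def)
   have "k * 1 \<le> k * p" by (rule mult_le_mono2) (use p_gt_1 in linarith)
   then have "k \<le> k * p" by simp
   then have "\<delta> ^ (k * p) * y \<in> I" by (rule up[OF k _ I(4)])
   then have "\<delta> * l b ((\<delta> ^ k) ^ p * y) \<in> I" using stable[OF b] by (simp add: power_mult)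
   then have "\<delta> ^ Suc k * l b y \<in> I" unfolding l_smult by (simp add: mult.assoc)
   then show ?thesis unfolding J_def by blast
  qed
  have "1 \<in> J"
  proof (rule idempotent_ideal[OF nC sJ])
   show "c \<in> J" using c by (auto simp: J_def I_def intro!: exI[of _ 0])
   show "c ~= 0" by (rule c(2))
   fix g assume g: "g \<in> J"
   have vJ: "l b g ^ (p - 1) * b \<in> J" if b: "b \<in> Bs" for b
   proof -
    have "p - 1 = Suc (p - 2)" using p_gt_1 by simp
    then have eq: "l b g ^ (p - 1) * b = (l b g ^ (p - 2) * b) * l b g" by (simp only: power_Suc mult_ac)
    have "l b g ^ (p - 2) * b \<in> C" using lJ[OF b g] sJ b BsB \<open>fractions B C\<close>
     by (intro sring_mult[OF sC] sring_power[OF sC]) (auto simp: sideal_def fractions_def)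
    then show ?thesis unfolding eq by (rule Jmult[OF _ lJ[OF b g]])
   qed
   \<comment> \<open>This writes the expansion of \<open>g\<close> as a sum of products of two
     elements of \<open>J\<close>; the second factor still contains \<open>l b g\<close> because p
     is at least 2.\<close>
   have "l b g * (l b g ^ (p - 1) * b) = l b g ^ p * b" for b
    using power_minus_mult[OF p_gt_0, of "l b g"] by (metis mult.assoc mult.commute)
   then have "(\<Sum>b\<in>Bs. l b g * (l b g ^ (p - 1) * b)) = (\<Sum>b\<in>Bs. l b g ^ p * b)" by (simp only:)
   then have "g = (\<Sum>b\<in>Bs. l b g * (l b g ^ (p - 1) * b))" by (rule trans[OF expand[of g] sym])
   then show "\<exists>(B::'a set) u v. finite B & (\<forall>b\<in>B. u b \<in> J & v b \<in> J) & g = (\<Sum>b\<in>B. u b * v b)"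
    using finBs lJ[OF _ g] vJ
    by (intro exI[of _ Bs] exI[of _ "%b. l b g"] exI[of _ "%b. l b g ^ (p - 1) * b"]) blast
  qed
  then have "\<exists>k. \<delta> ^ k \<in> I" by (auto simp: J_def)
  define k where "k = (LEAST k. \<delta> ^ k \<in> I)"
  have kI: "\<delta> ^ k \<in> I" unfolding k_def by (rule LeastI_ex) fact
  then have kI': "\<delta> ^ k * 1 \<in> I" by simp
  have "k \<le> 3"
  proof (rule ccontr)
   assume k3: "\<not> k \<le> 3"
   \<comment> \<open>With \<open>m\<close> equal to k/2 rounded up, \<open>m * p\<close> is at least
     \<open>k\<close>, and the coordinate at 1 lowers the exponent to \<open>m + 1\<close>, which is
     below \<open>k\<close> once \<open>k > 3\<close>.\<close>
   define m where "m = (k + 1) div 2"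
   have m: "k \<le> 2 * m" "m + 1 < k" using k3 by (auto simp: m_def)
   have "m * 2 \<le> m * p" by (rule mult_le_mono2) (use p_gt_1 in linarith)
   then have "k \<le> m * p" using m by linarith
   then have "\<delta> ^ (m * p) * 1 \<in> I" using up[of k 1 I "m * p", OF kI' _ I(4)] by simp
   then have "\<delta> * l 1 ((\<delta> ^ m) ^ p * 1) \<in> I" using stable[of 1] Bs(1) by (simp add: power_mult)
   then have "\<delta> ^ (m + 1) \<in> I" unfolding l_smult l1 by simp
   then have "k \<le> m + 1" unfolding k_def by (rule Least_le)
   then show False using m by simp
  qed
  then have "\<delta> ^ 3 * 1 \<in> I" using up[of k 1 I 3, OF kI' _ I(4)] by simp
  then have "\<delta> ^ 3 * x ^ 1 \<in> B" by (simp only: I_def mem_Collect_eq mult_1_right)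
  then show ?thesis by simp
 qed
 then show ?thesis using \<delta> R by (intro bexI[of _ "\<delta> ^ 3"]) (auto simp: sring_power)
qed

context
 fixes B :: "'a set"
 assumes B: "noeth B" "frac_full B" "F_finite B"
begin

lemma int_closure_sring: "sring (int_closure B)"
proof -
 have "int_closure B = {x. almost B x}" using int_closure_iff[OF B(1,2)] by blast
 then show ?thesis using almost_sring[OF noeth_sring[OF B(1)]] by simp
qed

lemma int_closure_noeth: "noeth (int_closure B)"
proof -
 obtain d where "d \<in> B" "d ~= 0" "\<forall>x\<in>int_closure B. d * x \<in> B" using normalization_bound[OF B] by blast
 then show ?thesis
  by (intro noeth_overring[OF B(1) int_closure_sub[OF noeth_sring[OF B(1)]] int_closure_sring]) auto
qed

lemma int_closure_frac_full: "frac_full (int_closure B)"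
 by (rule frac_full_mono[OF B(2) int_closure_sub[OF noeth_sring[OF B(1)]]])

text \<open>\<open>d\<close> times the closure is an ideal of \<open>B\<close>, generated by a
  finite set \<open>G\<close>. The elements of \<open>G\<close> divided by \<open>d\<close>, times
  generators of \<open>B\<close> over p-th powers, generate the closure.\<close>

lemma int_closure_F_finite: "F_finite (int_closure B)"
proof -
 note R = noeth_sring[OF B(1)] and N = int_closure_sring and sub = int_closure_sub[OF noeth_sring[OF B(1)]]
 obtain d where d: "d \<in> B" "d ~= 0" "\<And>x. x \<in> int_closure B ==> d * x \<in> B" using normalization_bound[OF B] by blast
 let ?J = "(%x. d * x) ` int_closure B"
 have "sideal B ?J" unfolding sideal_def
 proof (intro conjI ballI)
  show "?J \<subseteq> B" using d(3) by auto
  show "0 \<in> ?J" using sring_zero[OF N] by force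
  fix u assume "u \<in> ?J"
  then obtain a where a: "u = d * a" "a \<in> int_closure B" by blast
  show "u + v \<in> ?J" if "v \<in> ?J" for v
  proof -
   obtain b where "v = d * b" "b \<in> int_closure B" using \<open>v \<in> ?J\<close> by blast
   then have "u + v = d * (a + b)" "a + b \<in> int_closure B" using a sring_add[OF N] by (auto simp: distrib_left)
   then show ?thesis by blast
  qed
  show "c * u \<in> ?J" if "c \<in> B" for c
  proof -
   have "c * u = d * (c * a)" "c * a \<in> int_closure B" using a sring_mult[OF N] sub that by (auto simp: mult_ac)
   then show ?thesis by blast
  qed
 qed
 then obtain G where G: "finite G" "G \<subseteq> ?J" "\<And>x. x \<in> ?J ==> \<exists>c. (\<forall>g\<in>G. c g \<in> B) & x = (\<Sum>g\<in>G. c g * g)"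
  using noeth_fg[OF B(1)] by meson
 have "\<exists>S. finite S & S \<subseteq> B & (\<forall>x\<in>B. \<exists>c. (\<forall>s\<in>S. c s \<in> B) & x = (\<Sum>s\<in>S. c s ^ p * s))"
  using B(3) by (simp add: F_finite_def)
 then obtain S where S: "finite S" "S \<subseteq> B" "\<And>x. x \<in> B ==> \<exists>c. (\<forall>s\<in>S. c s \<in> B) & x = (\<Sum>s\<in>S. c s ^ p * s)" by blast
 have GN: "g / d \<in> int_closure B" if "g \<in> G" for g using G(2) that d(2) by auto
 show ?thesis
 proof (rule F_finite_family[OF N, of "G \<times> S" "%(g, s). s * (g / d)"])
  show "finite (G \<times> S)" using G(1) S(1) by simp
  show "(case i of (g, s) => s * (g / d)) \<in> int_closure B" if "i \<in> G \<times> S" for i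
   using that GN S(2) sub sring_mult[OF N] by (auto simp del: times_divide_eq_right)
  fix x assume x: "x \<in> int_closure B"
  obtain c where c: "\<forall>g\<in>G. c g \<in> B" "d * x = (\<Sum>g\<in>G. c g * g)" using G(3)[of "d * x"] x by blast
  have "\<forall>g. \<exists>f. g \<in> G --> (\<forall>s\<in>S. f s \<in> B) & c g = (\<Sum>s\<in>S. f s ^ p * s)" using S(3) c(1) by blast
  from choice[OF this] obtain f where f: "\<And>g. g \<in> G ==> (\<forall>s\<in>S. f g s \<in> B) & c g = (\<Sum>s\<in>S. f g s ^ p * s)" by blast
  have "x = (\<Sum>g\<in>G. c g * (g / d))" using c(2) d(2) by (simp add: sum_divide_distrib[symmetric] field_simps)
  also have "... = (\<Sum>g\<in>G. \<Sum>s\<in>S. f g s ^ p * (s * (g / d)))"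
   using f by (intro sum.cong refl) (simp add: sum_distrib_right sum_divide_distrib mult.assoc)
  also have "... = (\<Sum>(g, s)\<in>G \<times> S. f g s ^ p * (s * (g / d)))" by (simp add: sum.cartesian_product)
  finally have "x = (\<Sum>i\<in>G \<times> S. (case i of (g, s) => f g s) ^ p * (case i of (g, s) => s * (g / d)))"
   by (simp add: case_prod_unfold)
  moreover have "(case i of (g, s) => f g s) \<in> int_closure B" if "i \<in> G \<times> S" for i using that f sub by auto
  ultimately show "\<exists>c. (\<forall>i\<in>G \<times> S. c i \<in> int_closure B) &
    x = (\<Sum>i\<in>G \<times> S. c i ^ p * (case i of (g, s) => s * (g / d)))"
   by (intro exI[of _ "%i. case i of (g, s) => f g s"] conjI ballI)
 qed
qed

lemma int_closure_idem: "int_closure (int_closure B) = int_closure B"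
proof
 note R = noeth_sring[OF B(1)]
 obtain d where d: "d \<in> B" "d ~= 0" "\<And>x. x \<in> int_closure B ==> d * x \<in> B" using normalization_bound[OF B] by blast
 show "int_closure (int_closure B) \<subseteq> int_closure B"
 proof
  fix x assume "x \<in> int_closure (int_closure B)"
  then obtain c where c: "c \<in> int_closure B" "c ~= 0" "\<And>n. c * x ^ n \<in> int_closure B"
   using int_closure_iff[OF int_closure_noeth int_closure_frac_full] by (auto simp: almost_def)
  have "d * c * x ^ n \<in> B" for n using d(3)[OF c(3)[of n]] by (simp add: mult.assoc)
  then have "almost B x" unfolding almost_def using d c by (intro bexI[of _ "d * c"]) auto
  then show "x \<in> int_closure B" using almost_integral[OF B(1)] by blast
 qed
qed (rule int_closure_sub[OF int_closure_sring])

lemma int_closure_local: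
 assumes N: "is_loc (int_closure B) N"
 shows "int_closure N = N"
proof
 show "int_closure N \<subseteq> N"
 proof
  fix x assume "x \<in> int_closure N"
  then obtain s where s: "s \<in> int_closure B" "unit_in N s" "s * x \<in> int_closure (int_closure B)"
   using int_closure_fractions[OF int_closure_sring is_loc_fractions[OF N]] by blast
  then have "s * x \<in> N" using N unfolding int_closure_idem is_loc_def by blast
  moreover have "sring N" "inverse s \<in> N" using N s(2) by (auto simp: is_loc_def loc_ring_def unit_in_def)
  ultimately have "inverse s * (s * x) \<in> N" by (blast intro: sring_mult)
  moreover have "inverse s * (s * x) = x" using s(2) by (simp add: unit_in_def)
  ultimately show "x \<in> N" by simp
 qed
 show "N \<subseteq> int_closure N" using N by (intro int_closure_sub) (simp add: is_loc_def loc_ring_def)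
qed

end

end

section \<open>Schemes\<close>

lemma invert_sring: "sring (invert A f)" unfolding invert_def by (rule gen_sring)

lemma invert_sub: "A \<subseteq> invert A f" unfolding invert_def using gen_incl by blast

lemma inverse_in_invert: "inverse f \<in> invert A f" unfolding invert_def using gen_incl by blast

lemma invert_least: "sring D ==> A \<subseteq> D ==> inverse f \<in> D ==> invert A f \<subseteq> D"
 unfolding invert_def by (rule gen_least) auto

lemma invert_iff:
 assumes A: "sring A" and f: "f \<in> A" "f ~= 0"
 shows "x \<in> invert A f \<longleftrightarrow> (\<exists>n. x * f ^ n \<in> A)"
proof
 let ?D = "{x. \<exists>n. x * f ^ n \<in> A}"
 have up: "x * f ^ m \<in> A" if x: "x * f ^ n \<in> A" "n \<le> m" for x n m
 proof -
  have "x * f ^ m = x * f ^ n * f ^ (m - n)" using x(2) by (simp add: mult.assoc power_add[symmetric])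
  also have "... \<in> A" by (rule sring_mult[OF A x(1) sring_power[OF A f(1)]])
  finally show ?thesis .
 qed
 have "sring ?D" unfolding sring_def
 proof (intro conjI ballI)
  show "1 \<in> ?D" using sring_one[OF A] by (intro CollectI exI[of _ 0]) simp
  fix x y assume "x \<in> ?D" "y \<in> ?D"
  then obtain n m where n: "x * f ^ n \<in> A" "y * f ^ m \<in> A" by blast
  have "(x - y) * f ^ (n + m) \<in> A"
   using up[OF n(1), of "n + m"] up[OF n(2), of "n + m"] A by (simp add: left_diff_distrib sring_diff)
  then show "x - y \<in> ?D" by blast
  have "(x * y) * f ^ (n + m) \<in> A" using sring_mult[OF A n] by (simp add: power_add mult_ac)
  then show "x * y \<in> ?D" by blast
 qed
 moreover have "A \<subseteq> ?D"
 proof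
  fix x assume "x \<in> A"
  then show "x \<in> ?D" by (intro CollectI exI[of _ 0]) simp
 qed
 moreover have "inverse f \<in> ?D" using f sring_one[OF A] by (intro CollectI exI[of _ 1]) simp
 ultimately have "invert A f \<subseteq> ?D" by (rule invert_least)
 then show "x \<in> invert A f ==> \<exists>n. x * f ^ n \<in> A" by blast
 assume "\<exists>n. x * f ^ n \<in> A"
 then obtain n where n: "x * f ^ n \<in> A" ..
 have "x * f ^ n * inverse f ^ n \<in> invert A f"
  by (rule sring_mult[OF invert_sring _ sring_power[OF invert_sring inverse_in_invert]]) (use n invert_sub in blast)
 moreover have "x * f ^ n * inverse f ^ n = x" using f(2) by (simp add: power_inverse)
 ultimately show "x \<in> invert A f" by simp
qed

lemma invert_fractions:
 assumes A: "sring A" and f: "f \<in> A" "f ~= 0"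
 shows "fractions A (invert A f)" unfolding fractions_def
proof (intro conjI invert_sring invert_sub ballI)
 fix x assume "x \<in> invert A f"
 then obtain n where n: "x * f ^ n \<in> A" using invert_iff[OF A f] by blast
 have "unit_in (invert A f) f" using f invert_sub inverse_in_invert by (auto simp: unit_in_def)
 then have "unit_in (invert A f) (f ^ n)" by (rule unit_in_power[OF invert_sring])
 then show "\<exists>s\<in>A. unit_in (invert A f) s & x * s \<in> A" using n sring_power[OF A f(1)] by blast
qed

lemma fractions_is_loc:
 assumes "fractions A D" "is_loc D M" "sring A"
 shows "is_loc A M" unfolding is_loc_def
proof (intro conjI ballI)
 note A = assms(1)[unfolded fractions_def] and N = assms(2)[unfolded is_loc_def]
 show "loc_ring M" "A \<subseteq> M" using A N by auto
 fix x assume "x \<in> M"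
 then obtain s where s: "s \<in> D" "unit_in M s" "x * s \<in> D" using N by blast
 obtain u v where u: "u \<in> A" "unit_in D u" "s * u \<in> A" and v: "v \<in> A" "unit_in D v" "x * s * v \<in> A"
  using A s by metis
 have M: "sring M" using N by (simp add: loc_ring_def)
 have "unit_in M u" "unit_in M v" using u v N unit_mono by blast+
 then have "unit_in M (s * u * v)" using s(2) M by (simp add: unit_in_mult)
 moreover have "s * u * v \<in> A" using u v assms(3) by (simp add: sring_mult)
 moreover have "x * (s * u * v) \<in> A" using sring_mult[OF assms(3) v(3) u(1)] by (simp add: mult_ac)
 ultimately show "\<exists>s\<in>A. unit_in M s & x * s \<in> A" by blast
qed

lemma Spec_invert:
 assumes A: "sring A" and f: "f \<in> A" "f ~= 0"
 shows "N \<in> Spec (invert A f) \<longleftrightarrow> is_loc A N & inverse f \<in> N"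
proof
 assume "N \<in> Spec (invert A f)"
 then have N: "is_loc (invert A f) N" using Spec_iff[OF invert_sring] by blast
 have "is_loc A N" by (rule fractions_is_loc[OF invert_fractions[OF A f] N A])
 then show "is_loc A N & inverse f \<in> N" using N inverse_in_invert[of f A] by (auto simp: is_loc_def)
next
 assume N: "is_loc A N & inverse f \<in> N"
 have "invert A f \<subseteq> N" using N by (intro invert_least) (auto simp: is_loc_def loc_ring_def)
 then have "is_loc (invert A f) N" using N by (intro is_loc_sandwich[OF _ invert_sub _ invert_sring]) auto
 then show "N \<in> Spec (invert A f)" using Spec_iff[OF invert_sring] by blast
qed

lemma is_loc_sring: "is_loc A N ==> sring N" by (simp add: is_loc_def loc_ring_def)

lemma center_self: "sring A ==> is_loc A N ==> center A N = N"
 using center_props(3)[of A N N] by (simp add: is_loc_def)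

text \<open>
 Two charts are glued correctly iff every local ring containing both has the same center on both and
 every common point has a principal neighborhood in each chart that lies in the other.
\<close>

definition glued :: "'a::field set set => bool" where
 "glued \<A> \<longleftrightarrow> \<A> ~= {} & (\<forall>A\<in>\<A>. sring A & frac_full A) &
   (\<forall>A\<in>\<A>. \<forall>B\<in>\<A>. \<forall>V. loc_ring V --> A \<subseteq> V --> B \<subseteq> V --> center A V = center B V) &
   (\<forall>A\<in>\<A>. \<forall>B\<in>\<A>. \<forall>N. is_loc A N --> is_loc B N -->
    (\<exists>f\<in>A. f ~= 0 & inverse f \<in> N & B \<subseteq> invert A f))"

lemma gluedD:
 assumes "glued \<A>"
 shows "\<A> ~= {}" "A \<in> \<A> ==> sring A" "A \<in> \<A> ==> frac_full A"
  "A \<in> \<A> ==> B \<in> \<A> ==> loc_ring V ==> A \<subseteq> V ==> B \<subseteq> V ==> center A V = center B V"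
  "A \<in> \<A> ==> B \<in> \<A> ==> is_loc A N ==> is_loc B N ==> \<exists>f\<in>A. f ~= 0 & inverse f \<in> N & B \<subseteq> invert A f"
proof -
 note g = assms[unfolded glued_def]
 note g4 = conjunct1[OF conjunct2[OF conjunct2[OF g]]] and g5 = conjunct2[OF conjunct2[OF conjunct2[OF g]]]
 show "\<A> ~= {}" by (rule conjunct1[OF g])
 show "A \<in> \<A> ==> sring A" "A \<in> \<A> ==> frac_full A" using conjunct1[OF conjunct2[OF g]] by blast+
 show "A \<in> \<A> ==> B \<in> \<A> ==> loc_ring V ==> A \<subseteq> V ==> B \<subseteq> V ==> center A V = center B V" by (rule g4[rule_format])
 show "A \<in> \<A> ==> B \<in> \<A> ==> is_loc A N ==> is_loc B N ==> \<exists>f\<in>A. f ~= 0 & inverse f \<in> N & B \<subseteq> invert A f"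
  by (rule g5[rule_format])
qed

text \<open>For a local ring of the generated ring, the common center on both charts already
  contains the generated ring and hence is that local ring itself.\<close>

lemma glued_atlas:
 assumes g: "glued \<A>"
 shows "atlas \<A>" unfolding atlas_def
proof (intro conjI ballI)
 note G = gluedD[OF g]
 show "\<A> ~= {}" by (rule G(1))
 show "subring A KR" "frac_full A" if "A \<in> \<A>" for A using G(2,3) that by (auto simp: subring_iff_sring)
 fix A B assume AB: "A \<in> \<A>" "B \<in> \<A>"
 let ?C = "generate_ring KR (A \<union> B)"
 note rA = G(2)[OF AB(1)] and rB = G(2)[OF AB(2)] and rC = gen_sring[of "A \<union> B"]
 have both: "is_loc B N" if N: "is_loc A N" "B \<subseteq> N" for N
 proof -
  have "center B N = N" using G(4)[OF AB, of N] N center_self[OF rA N(1)] by (simp add: is_loc_def)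
  moreover have "is_loc B (center B N)" using N by (intro center_props(1)[OF rB]) (auto simp: is_loc_def)
  ultimately show ?thesis by simp
 qed
 show "Spec A \<inter> Spec B = Spec ?C"
 proof (intro equalityI subsetI)
  fix N assume "N \<in> Spec A \<inter> Spec B"
  then have N: "is_loc A N" "is_loc B N" using Spec_iff[OF rA] Spec_iff[OF rB] by auto
  have "?C \<subseteq> N" using N by (intro gen_least is_loc_sring[OF N(1)]) (auto simp: is_loc_def)
  then show "N \<in> Spec ?C" using gen_incl[of "A \<union> B"] Spec_iff[OF rC] is_loc_sandwich[OF N(1) _ _ rC] by blast
 next
  fix N assume "N \<in> Spec ?C"
  then have N: "is_loc ?C N" using Spec_iff[OF rC] by blast
  then have CN: "loc_ring N" "A \<subseteq> N" "B \<subseteq> N" using gen_incl[of "A \<union> B"] by (auto simp: is_loc_def)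
  let ?M = "center A N"
  note MA = center_props(1,2)[OF rA CN(1,2)]
  have MB: "is_loc B ?M" using center_props(1)[OF rB CN(1,3)] G(4)[OF AB CN] by simp
  have "?C \<subseteq> ?M" using MA(1) MB by (intro gen_least is_loc_sring[OF MB]) (auto simp: is_loc_def)
  then have "is_loc ?C ?M" using gen_incl[of "A \<union> B"] by (intro is_loc_sandwich[OF MA(1) _ _ rC]) auto
  then have "?M = center ?C N" using center_props(3)[OF rC CN(1)] MA(2) N by (auto simp: is_loc_def)
  then have "?M = N" using center_self[OF rC N] by simp
  then show "N \<in> Spec A \<inter> Spec B" using MA(1) MB Spec_iff[OF rA] Spec_iff[OF rB] by auto
 qed
 show "open_in_Spec A (Spec A \<inter> Spec B)" unfolding open_in_Spec_def
 proof (intro conjI ballI)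
  fix N assume "N \<in> Spec A \<inter> Spec B"
  then have N: "is_loc A N" "is_loc B N" using Spec_iff[OF rA] Spec_iff[OF rB] by auto
  obtain f where f: "f \<in> A" "f ~= 0" "inverse f \<in> N" "B \<subseteq> invert A f" using G(5)[OF AB N] by blast
  have "Spec (invert A f) \<subseteq> Spec A \<inter> Spec B"
  proof
   fix M assume M: "M \<in> Spec (invert A f)"
   then have MA: "is_loc A M" and "is_loc (invert A f) M"
    using Spec_invert[OF rA f(1,2)] Spec_iff[OF invert_sring] by blast+
   then have "B \<subseteq> M" using f(4) by (auto simp: is_loc_def)
   then show "M \<in> Spec A \<inter> Spec B" using MA both Spec_iff[OF rA] Spec_iff[OF rB] by blast
  qed
  then show "\<exists>f\<in>A. f ~= 0 & N \<in> Spec (invert A f) & Spec (invert A f) \<subseteq> Spec A \<inter> Spec B"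
   using f N Spec_invert[OF rA f(1,2)] by blast
 qed blast
qed

text \<open>The inclusion of a principal open set in the other chart becomes an inclusion of rings
  by \<open>mem_of_local\<close>; noetherian charts enter at this point.\<close>

lemma atlas_glued:
 assumes a: "atlas \<A>" and n: "\<And>A. A \<in> \<A> ==> noeth A"
 shows "glued \<A>" unfolding glued_def
proof (intro conjI ballI allI impI)
 show "\<A> ~= {}" using a by (simp add: atlas_def)
 have ring: "sring A" "frac_full A" if "A \<in> \<A>" for A using a that by (auto simp: atlas_def subring_iff_sring)
 show "sring A" "frac_full A" if "A \<in> \<A>" for A using ring that by auto
 fix A B assume AB: "A \<in> \<A>" "B \<in> \<A>"
 let ?C = "generate_ring KR (A \<union> B)"
 note rA = ring(1)[OF AB(1)] and rB = ring(1)[OF AB(2)] and rC = gen_sring[of "A \<union> B"]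
 have eq: "Spec A \<inter> Spec B = Spec ?C" and op: "open_in_Spec A (Spec A \<inter> Spec B)"
  using a[unfolded atlas_def] AB by blast+
 show "center A V = center B V" if V: "loc_ring V" "A \<subseteq> V" "B \<subseteq> V" for V
 proof -
  have "?C \<subseteq> V" using V by (intro gen_least loc_ring_sring) auto
  note M = center_props(1,2)[OF rC V(1) this]
  then have "center ?C V \<in> Spec A \<inter> Spec B" unfolding eq using Spec_iff[OF rC] by blast
  then have "is_loc A (center ?C V)" "is_loc B (center ?C V)" using Spec_iff[OF rA] Spec_iff[OF rB] by auto
  then show ?thesis using center_props(3)[OF rA V(1,2)] center_props(3)[OF rB V(1,3)] M(2) by metis
 qed
 fix N assume "is_loc A N" "is_loc B N"
 then have NAB: "N \<in> Spec A \<inter> Spec B" using Spec_iff[OF rA] Spec_iff[OF rB] by auto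
 have "\<exists>f\<in>A. f ~= 0 & N \<in> Spec (invert A f) & Spec (invert A f) \<subseteq> Spec A \<inter> Spec B"
  by (rule bspec[OF conjunct2[OF op[unfolded open_in_Spec_def]] NAB])
 then obtain f where f: "f \<in> A" "f ~= 0" "N \<in> Spec (invert A f)" "Spec (invert A f) \<subseteq> Spec A \<inter> Spec B" by blast
 have "B \<subseteq> invert A f"
 proof
  fix x assume x: "x \<in> B"
  show "x \<in> invert A f"
  proof (rule mem_of_local)
   show "noeth (invert A f)" by (rule fractions_noeth[OF n[OF AB(1)] invert_fractions[OF rA f(1,2)]])
   show "frac_full (invert A f)" by (rule frac_full_mono[OF ring(2)[OF AB(1)] invert_sub])
   fix M assume "is_loc (invert A f) M"
   then have "M \<in> Spec B" using f(4) Spec_iff[OF invert_sring] by blast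
   then show "x \<in> M" using x Spec_iff[OF rB] by (auto simp: is_loc_def)
  qed
 qed
 then show "\<exists>f\<in>A. f ~= 0 & inverse f \<in> N & B \<subseteq> invert A f" using f Spec_invert[OF rA f(1,2)] by blast
qed

definition ff_scheme :: "'a::field set set => bool" where
 "ff_scheme \<A> \<longleftrightarrow> glued \<A> & (\<forall>A\<in>\<A>. noeth A & F_finite A)"

lemma F_finite_scheme_iff: "F_finite_scheme \<A> \<longleftrightarrow> ff_scheme \<A>"
proof
 assume F: "F_finite_scheme \<A>"
 then have "sring A" if "A \<in> \<A>" for A using that by (auto simp: F_finite_scheme_def atlas_def subring_iff_sring)
 then have n: "noeth A" "F_finite A" if "A \<in> \<A>" for A using F that by (auto simp: F_finite_scheme_def noeth_iff)
 then show "ff_scheme \<A>" using F atlas_glued[of \<A>] by (auto simp: F_finite_scheme_def ff_scheme_def)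
next
 assume F: "ff_scheme \<A>"
 then show "F_finite_scheme \<A>"
  using glued_atlas[of \<A>] gluedD(2)[of \<A>] by (auto simp: F_finite_scheme_def ff_scheme_def noeth_iff)
qed

lemma normal_scheme_iff: "normal_scheme \<A> \<longleftrightarrow> ff_scheme \<A> & (\<forall>N\<in>points \<A>. int_closure N = N)"
 by (simp add: normal_scheme_def F_finite_scheme_iff)

lemma ff_schemeD:
 assumes "ff_scheme \<A>"
 shows "glued \<A>" "A \<in> \<A> ==> noeth A" "A \<in> \<A> ==> F_finite A" "A \<in> \<A> ==> sring A" "A \<in> \<A> ==> frac_full A"
 using assms gluedD(2,3)[of \<A>] unfolding ff_scheme_def by auto

lemma points_glued:
 assumes "glued \<A>"
 shows "N \<in> points \<A> \<longleftrightarrow> (\<exists>A\<in>\<A>. is_loc A N)" unfolding points_def using gluedD(2)[OF assms] Spec_iff by blast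

text \<open>Each center can be computed on a chart, and centers on different charts agree by gluing.
  This is separatedness in valuative form.\<close>

lemma center_unique:
 assumes g: "glued \<A>" and N: "N \<in> points \<A>" "M \<in> points \<A>" and V: "loc_ring V" "dominates V N" "dominates V M"
 shows "N = M"
proof -
 obtain A B where A: "A \<in> \<A>" "is_loc A N" and B: "B \<in> \<A>" "is_loc B M" using N points_glued[OF g] by auto
 have sub: "A \<subseteq> V" "B \<subseteq> V" using A B V by (auto simp: is_loc_def dominates_def)
 have "N = center A V" "M = center B V" using center_props(3)[OF gluedD(2)[OF g A(1)] V(1) sub(1) A(2) V(2)]
   center_props(3)[OF gluedD(2)[OF g B(1)] V(1) sub(2) B(2) V(3)] by auto
 then show ?thesis using gluedD(4)[OF g A(1) B(1) V(1) sub] by simp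
qed

lemma points_loc_ring: "glued \<A> ==> N \<in> points \<A> ==> loc_ring N" using points_glued by (auto simp: is_loc_def)

text \<open>The center of such a point on \<open>A\<close> is a point dominated by it, so by
  uniqueness it is the point itself.\<close>

lemma gen_in_chart:
 assumes g: "glued \<A>" and A: "A \<in> \<A>" and R: "R \<in> points \<A>" "A \<subseteq> R"
 shows "is_loc A R"
proof -
 have loc: "loc_ring R" by (rule points_loc_ring[OF g R(1)])
 note C = center_props(1,2)[OF gluedD(2)[OF g A] loc R(2)]
 have "center A R \<in> points \<A>" using C(1) A points_glued[OF g] by blast
 then have "center A R = R" using center_unique[OF g _ R(1) loc C(2)] by simp
 then show ?thesis using C(1) by simp
qed

lemma generization_in_chart:
 assumes g: "glued \<A>" and A: "A \<in> \<A>" and N: "is_loc A N" and R: "R \<in> points \<A>" "N \<subseteq> R"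
 shows "is_loc A R" using N R(2) by (intro gen_in_chart[OF g A R(1)]) (auto simp: is_loc_def)

lemma is_loc_generization:
 assumes A: "sring A" and N: "is_loc A N" and R: "is_loc A R" "N \<subseteq> R"
 shows "is_loc N R" using is_loc_sandwich[OF R(1) _ R(2) is_loc_sring[OF N]] N by (auto simp: is_loc_def)

lemma points_localization:
 assumes g: "glued \<A>" and N: "N \<in> points \<A>" and R: "is_loc N R"
 shows "R \<in> points \<A>"
proof -
 obtain A where A: "A \<in> \<A>" "is_loc A N" using N points_glued[OF g] by auto
 then show ?thesis using fractions_is_loc[OF is_loc_fractions[OF A(2)] R gluedD(2)[OF g A(1)]] points_glued[OF g] by blast
qed

lemma generic_point: "glued \<A> ==> UNIV \<in> points \<A>"
proof -
 assume g: "glued \<A>"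
 then obtain A where A: "A \<in> \<A>" using gluedD(1) by blast
 have "is_loc A UNIV" unfolding is_loc_def
 proof (intro conjI ballI)
  show "loc_ring UNIV" by (auto simp: loc_ring_def max_ideal_def)
  fix x
  obtain a b where "a \<in> A" "b \<in> A" "b ~= 0" "x = a / b" using gluedD(3)[OF g A] unfolding frac_full_def by blast
  then show "\<exists>s\<in>A. unit_in UNIV s & x * s \<in> A" by (intro bexI[of _ b]) (auto simp: unit_in_def)
 qed auto
 then show ?thesis using A points_glued[OF g] by blast
qed

lemma glued_principal:
 assumes g: "glued \<A>" and I: "I ~= {}" "\<And>A f. (A, f) \<in> I ==> A \<in> \<A> & f \<in> A & f ~= 0"
 shows "glued {invert A f | A f. (A, f) \<in> I}" unfolding glued_def
proof (intro conjI ballI allI impI)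
 note G = gluedD[OF g]
 show "{invert A f | A f. (A, f) \<in> I} ~= {}" using I(1) by auto
 show "sring C" if "C \<in> {invert A f | A f. (A, f) \<in> I}" for C using that invert_sring by auto
 show "frac_full C" if C: "C \<in> {invert A f | A f. (A, f) \<in> I}" for C
 proof -
  obtain A f where "C = invert A f" "A \<in> \<A>" using C I(2) by blast
  then show ?thesis using frac_full_mono[OF G(3) invert_sub] by blast
 qed
 fix C D assume "C \<in> {invert A f | A f. (A, f) \<in> I}" "D \<in> {invert A f | A f. (A, f) \<in> I}"
 then obtain A f B h where C: "C = invert A f" "A \<in> \<A>" "f \<in> A" "f ~= 0"
   and D: "D = invert B h" "B \<in> \<A>" "h \<in> B" "h ~= 0" using I(2) by blast
 note rA = G(2)[OF C(2)] and rB = G(2)[OF D(2)]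
 have cen: "center (invert A' f') V = center A' V"
  if "A' \<in> \<A>" "f' \<in> A'" "f' ~= 0" "invert A' f' \<subseteq> V" "loc_ring V" for A' f' V
 proof -
  note c = center_props(1,2)[OF invert_sring that(5,4)]
  have "is_loc A' (center (invert A' f') V)"
   by (rule fractions_is_loc[OF invert_fractions[OF G(2)[OF that(1)] that(2,3)] c(1) G(2)[OF that(1)]])
  then show ?thesis using c(2) that invert_sub[of A' f'] by (intro center_props(3) G(2)) auto
 qed
 show "center C V = center D V" if V: "loc_ring V" "C \<subseteq> V" "D \<subseteq> V" for V
 proof -
  have "A \<subseteq> V" "B \<subseteq> V" using V C(1) D(1) invert_sub by blast+
  then show ?thesis using cen C D V G(4)[OF C(2) D(2) V(1)] by simp
 qed
 fix N assume "is_loc C N" "is_loc D N"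
 then have N: "is_loc A N" "inverse f \<in> N" "is_loc B N" "inverse h \<in> N"
  using Spec_invert[OF rA C(3,4)] Spec_invert[OF rB D(3,4)] Spec_iff[OF invert_sring] unfolding C(1) D(1) by blast+
 obtain k where k: "k \<in> A" "k ~= 0" "inverse k \<in> N" "B \<subseteq> invert A k" using G(5)[OF C(2) D(2) N(1,3)] by blast
 obtain n where n: "h * k ^ n \<in> A" using k(4) D(3) invert_iff[OF rA k(1,2)] by blast
 \<comment> \<open>One element of \<open>A\<close> whose inversion makes both \<open>k\<close> and
   \<open>h\<close> invertible: \<open>h\<close> comes from the other chart, but
   \<open>h * k ^ n\<close> lies in \<open>A\<close>.\<close>
 let ?l = "k * (h * k ^ n)"
 have l: "?l \<in> A" "?l ~= 0" using k n D(4) rA by (auto intro: sring_mult)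
 have "inverse ?l = inverse k * (inverse h * inverse k ^ n)" by (simp add: power_inverse)
 also have "... \<in> N" using k(3) N is_loc_sring[OF N(1)] by (intro sring_mult sring_power) auto
 finally have lN: "inverse ?l \<in> N" .
 have il: "inverse ?l \<in> invert C ?l" by (rule inverse_in_invert)
 have AC: "A \<subseteq> invert C ?l" using invert_sub C(1) by blast
 have "inverse k = h * k ^ n * inverse ?l" using k(2) D(4) by (simp add: field_simps)
 also have "... \<in> invert C ?l" by (rule sring_mult[OF invert_sring _ il]) (use AC n in blast)
 finally have ik: "inverse k \<in> invert C ?l" .
 have "inverse h = k ^ Suc n * inverse ?l" using k(2) D(4) by (simp add: field_simps)
 also have "... \<in> invert C ?l" using AC k(1) il by (intro sring_mult[OF invert_sring] sring_power[OF invert_sring]) auto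
 finally have ih: "inverse h \<in> invert C ?l" .
 have "invert A k \<subseteq> invert C ?l" by (rule invert_least[OF invert_sring AC ik])
 then have "D \<subseteq> invert C ?l" unfolding D(1) using k(4) ih by (intro invert_least invert_sring) auto
 then show "\<exists>f\<in>C. f ~= 0 & inverse f \<in> N & D \<subseteq> invert C f"
  using l lN invert_sub[of A f] C(1) by (intro bexI[of _ ?l]) auto
qed

lemma zariski_open_chart:
 assumes g: "glued \<A>" and U: "zariski_open \<A> U" and A: "A \<in> \<A>" "is_loc A N" "N \<in> U"
 shows "\<exists>f\<in>A. f ~= 0 & N \<in> Spec (invert A f) & Spec (invert A f) \<subseteq> U"
proof -
 have o: "open_in_Spec A (U \<inter> Spec A)" using U A(1) by (simp add: zariski_open_def)
 have "N \<in> U \<inter> Spec A" using A Spec_iff[OF gluedD(2)[OF g A(1)]] by simp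
 from bspec[OF conjunct2[OF o[unfolded open_in_Spec_def]] this] show ?thesis by blast
qed

lemma open_subscheme_points:
 assumes g: "glued \<A>" and U: "zariski_open \<A> U"
 shows "points (open_subscheme \<A> U) = U"
proof (intro equalityI subsetI)
 fix N assume N: "N \<in> U"
 then have "N \<in> points \<A>" using U by (auto simp: zariski_open_def)
 then obtain A where A: "A \<in> \<A>" "is_loc A N" using points_glued[OF g] by blast
 obtain f where "f \<in> A" "f ~= 0" "N \<in> Spec (invert A f)" "Spec (invert A f) \<subseteq> U"
  using zariski_open_chart[OF g U A N] by blast
 then show "N \<in> points (open_subscheme \<A> U)" using A(1) unfolding points_def open_subscheme_def by blast
qed (auto simp: points_def open_subscheme_def)

section \<open>Open subschemes and normalization of F-finite schemes\<close>

context char_p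
begin

lemma ff_scheme_open:
 assumes S: "ff_scheme (\<A>::'a set set)" and U: "zariski_open \<A> U" "U ~= {}"
 shows "ff_scheme (open_subscheme \<A> U)" unfolding ff_scheme_def
proof (intro conjI ballI)
 note F = ff_schemeD[OF S]
 let ?I = "{(A, f). A \<in> \<A> & f \<in> A & f ~= 0 & Spec (invert A f) \<subseteq> U}"
 have eq: "open_subscheme \<A> U = {invert A f | A f. (A, f) \<in> ?I}" by (auto simp: open_subscheme_def)
 show "glued (open_subscheme \<A> U)" unfolding eq
 proof (rule glued_principal[OF F(1)])
  obtain N where N: "N \<in> U" using U(2) by blast
  then have "open_subscheme \<A> U ~= {}" using open_subscheme_points[OF F(1) U(1)] by (auto simp: points_def)
  then show "?I ~= {}" unfolding eq by blast
 qed auto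
 fix C assume "C \<in> open_subscheme \<A> U"
 then obtain A f where C: "C = invert A f" "A \<in> \<A>" "f \<in> A" "f ~= 0" by (auto simp: open_subscheme_def)
 note fr = invert_fractions[OF F(4)[OF C(2)] C(3,4)]
 show "noeth C" unfolding C(1) by (rule fractions_noeth[OF F(2)[OF C(2)] fr])
 show "F_finite C" unfolding C(1) using p_gt_0 by (intro F_finite_fractions[OF _ F(3)[OF C(2)] F(4)[OF C(2)] fr]) simp
qed

lemma normal_scheme_open:
 assumes S: "normal_scheme (\<A>::'a set set)" and U: "zariski_open \<A> U" "U ~= {}"
 shows "normal_scheme (open_subscheme \<A> U)"
 using S ff_scheme_open[OF _ U] open_subscheme_points[OF ff_schemeD(1) U(1)] U(1)
 unfolding normal_scheme_iff zariski_open_def by auto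

text \<open>Centers on the closures are compared through centers on the original charts: a local
  ring of one closure is integrally closed and contains the other chart, hence also the closure of
  that chart.\<close>

lemma ff_scheme_normalization:
 assumes S: "ff_scheme (\<A>::'a set set)"
 shows "normal_scheme (scheme_normalization \<A>)"
proof -
 note F = ff_schemeD[OF S] and G = gluedD[OF ff_schemeD(1)[OF S]]
 note I = int_closure_sring[OF F(2) F(5) F(3)] int_closure_noeth[OF F(2) F(5) F(3)]
  int_closure_frac_full[OF F(2) F(5) F(3)] int_closure_F_finite[OF F(2) F(5) F(3)]
  int_closure_local[OF F(2) F(5) F(3)]
 have sub: "A \<subseteq> int_closure A" if "A \<in> \<A>" for A by (rule int_closure_sub[OF F(4)[OF that]])
 have half: "center (int_closure B) V \<subseteq> center (int_closure A) V"
  if AB: "A \<in> \<A>" "B \<in> \<A>" and V: "loc_ring V" "int_closure A \<subseteq> V" "int_closure B \<subseteq> V" for A B V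
 proof -
  let ?M = "center (int_closure A) V"
  note M = center_props(1,2)[OF I(1)[OF AB(1) AB(1) AB(1)] V(1,2)]
  have AV: "A \<subseteq> V" "B \<subseteq> V" using sub AB V by blast+
  have Mloc: "loc_ring ?M" "A \<subseteq> ?M" using M(1) sub[OF AB(1)] by (auto simp: is_loc_def)
  note c = center_props(1,2)[OF F(4)[OF AB(1)] Mloc]
  have "center A ?M = center A V"
   by (rule center_props(3)[OF F(4)[OF AB(1)] V(1) AV(1) c(1) dominates_trans[OF M(2) c(2)]])
  also have "... = center B V" by (rule G(4)[OF AB V(1) AV])
  finally have "B \<subseteq> ?M"
   using c(2) center_props(1)[OF F(4)[OF AB(2)] V(1) AV(2)] by (auto simp: is_loc_def dominates_def)
  then have "int_closure B \<subseteq> ?M" using int_closure_mono I(5)[OF AB(1) AB(1) AB(1) M(1)] by blast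
  note d = center_props(1,2)[OF I(1)[OF AB(2) AB(2) AB(2)] Mloc(1) this]
  have "center (int_closure B) ?M = center (int_closure B) V"
   by (rule center_props(3)[OF I(1)[OF AB(2) AB(2) AB(2)] V(1,3) d(1) dominates_trans[OF M(2) d(2)]])
  then show ?thesis using d(2) by (simp add: dominates_def)
 qed
 have "glued (scheme_normalization \<A>)" unfolding glued_def scheme_normalization_def
 proof (intro conjI ballI allI impI)
  show "int_closure ` \<A> ~= {}" using G(1) by simp
  show "sring C" "frac_full C" if "C \<in> int_closure ` \<A>" for C using that I(1,3) by auto
  fix C D assume "C \<in> int_closure ` \<A>" "D \<in> int_closure ` \<A>"
  then obtain A B where C: "C = int_closure A" "A \<in> \<A>" and D: "D = int_closure B" "B \<in> \<A>" by blast
  show "center C V = center D V" if "loc_ring V" "C \<subseteq> V" "D \<subseteq> V" for V using half C D that by blast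
  fix P assume P: "is_loc C P" "is_loc D P"
  have loc: "loc_ring P" and "C \<subseteq> P" "D \<subseteq> P" using P by (simp_all add: is_loc_def)
  then have CP: "A \<subseteq> P" "B \<subseteq> P" using sub[OF C(2)] sub[OF D(2)] C(1) D(1) by auto
  let ?N = "center A P"
  note NA = center_props(1,2)[OF F(4)[OF C(2)] loc CP(1)]
  have NB: "is_loc B ?N" using center_props(1)[OF F(4)[OF D(2)] loc CP(2)] G(4)[OF C(2) D(2) loc CP] by simp
  obtain f where f: "f \<in> A" "f ~= 0" "inverse f \<in> ?N" "B \<subseteq> invert A f" using G(5)[OF C(2) D(2) NA(1) NB] by blast
  have "D \<subseteq> invert C f"
  proof
   fix x assume "x \<in> D"
   then have "x \<in> int_closure (invert A f)" using int_closure_mono[OF f(4)] D by blast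
   then obtain s where s: "s \<in> A" "unit_in (invert A f) s" "s * x \<in> int_closure A"
    using int_closure_fractions[OF F(4)[OF C(2)] invert_fractions[OF F(4)[OF C(2)] f(1,2)]] by blast
   have "invert A f \<subseteq> invert C f"
    using sub[OF C(2)] C(1) invert_sub[of C f] inverse_in_invert by (intro invert_least invert_sring) auto
   then have "inverse s \<in> invert C f" using s(2) by (auto simp: unit_in_def)
   moreover have "s * x \<in> invert C f" using s(3) C(1) invert_sub by blast
   ultimately have "inverse s * (s * x) \<in> invert C f" by (rule sring_mult[OF invert_sring])
   moreover have "inverse s * (s * x) = x" using s(2) by (simp add: unit_in_def)
   ultimately show "x \<in> invert C f" by simp
  qed
  then show "\<exists>f\<in>C. f ~= 0 & inverse f \<in> P & D \<subseteq> invert C f"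
   using f sub[OF C(2)] C(1) NA(2) by (intro bexI[of _ f]) (auto simp: dominates_def)
 qed
 moreover have "noeth C" "F_finite C" if "C \<in> scheme_normalization \<A>" for C
  using that I(2,4) by (auto simp: scheme_normalization_def)
 ultimately have S': "ff_scheme (scheme_normalization \<A>)" by (simp add: ff_scheme_def)
 have "int_closure N = N" if N: "N \<in> points (scheme_normalization \<A>)" for N
 proof -
  obtain A where "A \<in> \<A>" "is_loc (int_closure A) N"
   using N points_glued[OF ff_schemeD(1)[OF S']] by (auto simp: scheme_normalization_def)
  then show ?thesis using I(5) by blast
 qed
 then show ?thesis using S' by (simp add: normal_scheme_iff)
qed

end

section \<open>Closed subschemes through residue maps\<close>

context
 fixes M and r :: "'a::field => 'b::field"
 assumes M: "loc_ring M" and r: "residue_map M r"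
begin

text \<open>If \<open>r y\<close> is inverse to \<open>r x\<close>, then \<open>1 - x * y\<close>
  lies in the maximal ideal of \<open>M\<close>. Were \<open>x * y\<close> a nonunit of
  \<open>N\<close>, this element would be a unit of \<open>N\<close> and therefore of
  \<open>M\<close>.\<close>

lemma res_unit:
 assumes N: "loc_ring N" "N \<subseteq> M" and x: "x \<in> N"
 shows "unit_in (r ` N) (r x) \<longleftrightarrow> unit_in N x"
proof
 note S = loc_ring_sring[OF M] and SN = loc_ring_sring[OF N(1)]
 assume u: "unit_in N x"
 then have m: "unit_in M x" by (rule unit_mono[OF _ N(2)])
 have "r (inverse x) \<in> r ` N" using u by (auto simp: unit_in_def)
 then show "unit_in (r ` N) (r x)" using res_nz[OF S r m] res_inverse[OF S r m] x by (simp add: unit_in_def)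
next
 note S = loc_ring_sring[OF M] and SN = loc_ring_sring[OF N(1)]
 assume u: "unit_in (r ` N) (r x)"
 then obtain y where y: "y \<in> N" "inverse (r x) = r y" by (auto simp: unit_in_def)
 have xy: "x * y \<in> N" using x y(1) SN by (simp add: sring_mult)
 have M': "x \<in> M" "y \<in> M" "x * y \<in> M" using x y(1) xy N(2) by auto
 have "r (x * y) = r x * r y" by (rule res_mult[OF S r M'(1,2)])
 also have "... = 1" unfolding y(2)[symmetric] using u by (simp add: unit_in_def)
 finally have "r (1 - x * y) = 0" using res_diff[OF S r sring_one[OF S] M'(3)] res_one[OF S r] by simp
 then have nm: "1 - x * y \<in> max_ideal M" using res_eq_0[OF S r sring_diff[OF S sring_one[OF S] M'(3)]] by simp
 have "unit_in N (x * y)"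
 proof (rule ccontr)
  assume "\<not> unit_in N (x * y)"
  then have m: "x * y \<in> max_ideal N" using unit_cases xy by blast
  have "1 - x * y \<in> N" using xy SN by (simp add: sring_diff sring_one)
  moreover have "1 - x * y \<notin> max_ideal N"
  proof
   assume "1 - x * y \<in> max_ideal N"
   then have "(1 - x * y) + x * y \<in> max_ideal N" using m N(1) by (simp only: loc_ring_def)
   then show False using one_not_max[of N] by simp
  qed
  ultimately have "unit_in M (1 - x * y)" using unit_cases unit_mono[OF _ N(2)] by blast
  then show False using nm unit_not_max by blast
 qed
 then have "x ~= 0" "inverse (x * y) * y \<in> N" using y(1) SN by (auto simp: unit_in_def intro!: sring_mult)
 moreover have "inverse (x * y) * y = inverse x" using \<open>unit_in N (x * y)\<close> by (auto simp: unit_in_def)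
 ultimately show "unit_in N x" using x unfolding unit_in_def by metis
qed

lemma res_max:
 assumes N: "loc_ring N" "N \<subseteq> M"
 shows "max_ideal (r ` N) = r ` max_ideal N"
proof (intro equalityI subsetI)
 fix y assume y: "y \<in> max_ideal (r ` N)"
 then obtain x where x: "x \<in> N" "y = r x" using max_ideal_sub by blast
 then have "\<not> unit_in N x" using res_unit[OF N x(1)] unit_not_max y by blast
 then show "y \<in> r ` max_ideal N" using unit_cases x by blast
next
 fix y assume "y \<in> r ` max_ideal N"
 then obtain x where x: "x \<in> max_ideal N" "y = r x" by blast
 then have "x \<in> N" using max_ideal_sub by blast
 then have "\<not> unit_in (r ` N) (r x)" using res_unit[OF N] unit_not_max x by blast
 then show "y \<in> max_ideal (r ` N)" using unit_cases x \<open>x \<in> N\<close> by blast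
qed

lemma res_loc_ring:
 assumes N: "loc_ring N" "N \<subseteq> M"
 shows "loc_ring (r ` N)" unfolding loc_ring_def res_max[OF N]
proof (intro conjI ballI)
 note S = loc_ring_sring[OF M] and SN = loc_ring_sring[OF N(1)]
 show "sring (r ` N)" by (rule sring_image[OF SN N(2) S r])
 fix x y assume "x \<in> r ` max_ideal N" "y \<in> r ` max_ideal N"
 then obtain a b where ab: "a \<in> max_ideal N" "b \<in> max_ideal N" "x = r a" "y = r b" by blast
 have "a \<in> M" "b \<in> M" using ab N(2) max_ideal_sub by blast+
 then have "x + y = r (a + b)" using res_add[OF S r] ab by simp
 moreover have "a + b \<in> max_ideal N" using ab N(1) by (simp add: loc_ring_def)
 ultimately show "x + y \<in> r ` max_ideal N" by blast
qed

lemma res_is_loc: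
 assumes N: "is_loc A N" "N \<subseteq> M"
 shows "is_loc (r ` A) (r ` N)" unfolding is_loc_def
proof (intro conjI ballI)
 have loc: "loc_ring N" and A: "A \<subseteq> N" using N by (auto simp: is_loc_def)
 show "loc_ring (r ` N)" by (rule res_loc_ring[OF loc N(2)])
 show "r ` A \<subseteq> r ` N" using A by blast
 fix y assume "y \<in> r ` N"
 then obtain x where x: "x \<in> N" "y = r x" by blast
 obtain s where s: "s \<in> A" "unit_in N s" "x * s \<in> A" using N x(1) by (auto simp: is_loc_def)
 have "x \<in> M" "s \<in> M" using x s A N(2) by blast+
 then have "y * r s = r (x * s)" using res_mult[OF loc_ring_sring[OF M] r, of x s] x by simp
 then show "\<exists>s\<in>r ` A. unit_in (r ` N) s & y * s \<in> r ` A"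
  using s res_unit[OF loc N(2), of s] A by (intro bexI[of _ "r s"]) auto
qed

text \<open>The composite of the place of \<open>M\<close> with \<open>V\<close>. It transfers
  questions about local rings of the residue field to the ambient field.\<close>

definition res_pre :: "'b set => 'a set" where
 "res_pre V = {x \<in> M. r x \<in> V}"

lemma res_pre:
 assumes V: "loc_ring V"
 shows "loc_ring (res_pre V)" "max_ideal (res_pre V) = {x \<in> M. r x \<in> max_ideal V}"
  "r ` res_pre V = V"
proof -
 note S = loc_ring_sring[OF M] and SV = loc_ring_sring[OF V]
 have sr: "sring (res_pre V)" unfolding res_pre_def sring_def
  using S SV res_one[OF S r] res_diff[OF S r] res_mult[OF S r] by (auto simp: sringD)
 have unit: "unit_in (res_pre V) x \<longleftrightarrow> unit_in V (r x)" if x: "x \<in> M" for x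
 proof
  assume u: "unit_in (res_pre V) x"
  then have "unit_in M x" by (auto simp: unit_in_def res_pre_def)
  then show "unit_in V (r x)" using u res_nz[OF S r] res_inverse[OF S r] by (auto simp: unit_in_def res_pre_def)
 next
  assume u: "unit_in V (r x)"
  then have "x \<notin> max_ideal M" using res_eq_0[OF S r x] by (auto simp: unit_in_def)
  then have "unit_in M x" using unit_cases x by blast
  then show "unit_in (res_pre V) x" using u res_inverse[OF S r] by (auto simp: unit_in_def res_pre_def)
 qed
 show max: "max_ideal (res_pre V) = {x \<in> M. r x \<in> max_ideal V}"
 proof (intro equalityI subsetI)
  fix x assume x: "x \<in> max_ideal (res_pre V)"
  then have "x \<in> M" "r x \<in> V" using max_ideal_sub by (auto simp: res_pre_def)
  moreover have "\<not> unit_in V (r x)" using unit[OF \<open>x \<in> M\<close>] unit_not_max x by blast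
  ultimately show "x \<in> {x \<in> M. r x \<in> max_ideal V}" using unit_cases by blast
 next
  fix x assume x: "x \<in> {x \<in> M. r x \<in> max_ideal V}"
  then have "x \<in> res_pre V" using max_ideal_sub by (auto simp: res_pre_def)
  moreover have "\<not> unit_in (res_pre V) x" using unit x unit_not_max by blast
  ultimately show "x \<in> max_ideal (res_pre V)" using unit_cases by blast
 qed
 show "loc_ring (res_pre V)" unfolding loc_ring_def max
  using sr V S res_add[OF S r] by (auto simp: loc_ring_def sring_add)
 show "r ` res_pre V = V"
 proof (intro equalityI subsetI)
  fix y assume "y \<in> V"
  moreover obtain x where "x \<in> M" "r x = y" using res_surj[OF S r] by blast
  ultimately show "y \<in> r ` res_pre V" by (auto simp: res_pre_def)
 qed (auto simp: res_pre_def)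
qed

lemma res_pre_dominates:
 assumes V: "loc_ring V" and N: "loc_ring N" "dominates (res_pre V) N"
 shows "N \<subseteq> M" "dominates V (r ` N)"
proof -
 show NM: "N \<subseteq> M" using N by (auto simp: dominates_def res_pre_def)
 show "dominates V (r ` N)"
  using N res_pre(2)[OF V] unfolding dominates_def res_max[OF N(1) NM] by (auto simp: res_pre_def)
qed

lemma dominates_res_pre:
 assumes V: "loc_ring V" and N: "loc_ring N" "N \<subseteq> M" "dominates V (r ` N)"
 shows "dominates (res_pre V) N" using N unfolding dominates_def res_max[OF N(1,2)] res_pre(2)[OF V]
 using max_ideal_sub by (auto simp: res_pre_def)

lemma res_center:
 assumes A: "sring A" and V: "loc_ring V" and AM: "A \<subseteq> M" "r ` A \<subseteq> V"
 shows "A \<subseteq> res_pre V" "center (r ` A) V = r ` center A (res_pre V)" "center A (res_pre V) \<subseteq> M"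
proof -
 show sub: "A \<subseteq> res_pre V" using AM by (auto simp: res_pre_def)
 note c = center_props(1,2)[OF A res_pre(1)[OF V] sub]
 have loc: "loc_ring (center A (res_pre V))" using c(1) by (simp add: is_loc_def)
 note d = res_pre_dominates[OF V loc c(2)]
 show "center A (res_pre V) \<subseteq> M" by (rule d(1))
 show "center (r ` A) V = r ` center A (res_pre V)"
  using center_props(3)[OF sring_image[OF A AM(1) loc_ring_sring[OF M] r] V AM(2) res_is_loc[OF c(1) d(1)] d(2)]
  by simp
qed

end

lemma (in char_p) F_finite_image:
 assumes A: "sring A" "F_finite (A::'a set)" "A \<subseteq> M" and M: "sring M" "residue_map M (r :: 'a => 'b::field)"
 shows "F_finite (r ` A)"
proof -
 interpret res: char_p p "TYPE('b)" by (rule char_p_residue[OF M])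
 have "\<exists>S. finite S & S \<subseteq> A & (\<forall>x\<in>A. \<exists>c. (\<forall>s\<in>S. c s \<in> A) & x = (\<Sum>s\<in>S. c s ^ p * s))"
  using A(2) by (simp add: F_finite_def)
 then obtain S where S: "finite S" "S \<subseteq> A" "\<And>x. x \<in> A ==> \<exists>c. (\<forall>s\<in>S. c s \<in> A) & x = (\<Sum>s\<in>S. c s ^ p * s)" by blast
 show ?thesis
 proof (rule res.F_finite_family[of _ S r])
  show "sring (r ` A)" by (rule sring_image[OF A(1,3) M])
  show "r i \<in> r ` A" if "i \<in> S" for i using S(2) that by blast
  fix y assume "y \<in> r ` A"
  then obtain x where x: "x \<in> A" "y = r x" by blast
  obtain c where c: "\<forall>s\<in>S. c s \<in> A" "x = (\<Sum>s\<in>S. c s ^ p * s)" using S(3)[OF x(1)] by blast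
  have "c s ^ p * s \<in> M" if "s \<in> S" for s using c S(2) that A(3) M(1) by (auto intro!: sring_mult sring_power)
  then have "y = (\<Sum>s\<in>S. r (c s ^ p * s))" unfolding x(2) c(2) by (rule res_sum[OF M])
  also have "... = (\<Sum>s\<in>S. r (c s) ^ p * r s)"
  proof (intro sum.cong refl)
   fix s assume "s \<in> S"
   then have "c s \<in> M" "s \<in> M" using c S(2) A(3) by auto
   then show "r (c s ^ p * s) = r (c s) ^ p * r s"
    using res_mult[OF M] res_power[OF M] M(1) by (simp add: sring_power)
  qed
  finally show "\<exists>c. (\<forall>i\<in>S. c i \<in> r ` A) & y = (\<Sum>i\<in>S. c i ^ p * r i)"
   using c(1) by (intro exI[of _ "%s. r (c s)"]) auto
 qed (rule S(1))
qed

text \<open>Local rings of the residue field are lifted along \<open>res_pre\<close>, and gluing is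
  inherited from the ambient charts.\<close>

lemma (in char_p) ff_scheme_subscheme:
 assumes S: "ff_scheme (\<A>::'a set set)" and M: "M \<in> points \<A>" and r: "residue_map M (r :: 'a => 'b::field)"
 shows "ff_scheme (subscheme \<A> M r)"
proof -
 note F = ff_schemeD[OF S] and G = gluedD[OF ff_schemeD(1)[OF S]]
 have locM: "loc_ring M" by (rule points_loc_ring[OF F(1) M])
 note SM = loc_ring_sring[OF locM]
 have charts: "\<exists>A\<in>\<A>. C = r ` A & is_loc A M" if "C \<in> subscheme \<A> M r" for C
  using that F(4) Spec_iff unfolding subscheme_def by blast
 have "glued (subscheme \<A> M r)" unfolding glued_def
 proof (intro conjI ballI allI impI)
  show "subscheme \<A> M r ~= {}" using M by (auto simp: subscheme_def points_def)
  fix C assume "C \<in> subscheme \<A> M r"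
  then obtain A where A: "A \<in> \<A>" "C = r ` A" "is_loc A M" using charts by blast
  have AM: "A \<subseteq> M" using A(3) by (simp add: is_loc_def)
  show "sring C" unfolding A(2) by (rule sring_image[OF F(4)[OF A(1)] AM SM r])
  show "frac_full C" unfolding frac_full_def
  proof
   fix y
   obtain x where x: "x \<in> M" "r x = y" using res_surj[OF SM r] by blast
   obtain s where s: "s \<in> A" "unit_in M s" "x * s \<in> A" using A(3) x(1) by (auto simp: is_loc_def)
   have "y = r (x * s) / r s" using res_mult[OF SM r, of x s] res_nz[OF SM r s(2)] x s by (auto simp: unit_in_def)
   then show "\<exists>a\<in>C. \<exists>b\<in>C. b ~= 0 & y = a / b" unfolding A(2) using s res_nz[OF SM r s(2)] by blast
  qed
  fix D assume "D \<in> subscheme \<A> M r"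
  then obtain B where B: "B \<in> \<A>" "D = r ` B" "is_loc B M" using charts by blast
  have BM: "B \<subseteq> M" using B(3) by (simp add: is_loc_def)
  have cen: "center A (res_pre M r V) = center B (res_pre M r V)" if V: "loc_ring V" "C \<subseteq> V" "D \<subseteq> V" for V
   using res_center(1)[OF locM r F(4)[OF A(1)] V(1) AM] res_center(1)[OF locM r F(4)[OF B(1)] V(1) BM] V A B
   by (intro G(4)[OF A(1) B(1) res_pre(1)[OF locM r V(1)]]) auto
  show "center C V = center D V" if V: "loc_ring V" "C \<subseteq> V" "D \<subseteq> V" for V
   using res_center(2)[OF locM r F(4)[OF A(1)] V(1) AM] res_center(2)[OF locM r F(4)[OF B(1)] V(1) BM] V A B cen[OF V]
   by simp
  fix P assume P: "is_loc C P" "is_loc D P"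
  have V: "loc_ring P" "C \<subseteq> P" "D \<subseteq> P" using P by (auto simp: is_loc_def)
  let ?N = "center A (res_pre M r P)"
  note a = res_center[OF locM r F(4)[OF A(1)] V(1) AM V(2)[unfolded A(2)]]
  note b = res_center[OF locM r F(4)[OF B(1)] V(1) BM V(3)[unfolded B(2)]]
  note lP = res_pre(1)[OF locM r V(1)]
  have N: "is_loc A ?N" "dominates (res_pre M r P) ?N" "is_loc B ?N"
   using center_props(1,2)[OF F(4)[OF A(1)] lP a(1)] center_props(1)[OF F(4)[OF B(1)] lP b(1)] cen[OF V] by auto
  obtain f where f: "f \<in> A" "f ~= 0" "inverse f \<in> ?N" "B \<subseteq> invert A f" using G(5)[OF A(1) B(1) N(1,3)] by blast
  have "unit_in M f" using f a(3) AM by (auto simp: unit_in_def)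
  note rf = res_nz[OF SM r this] res_inverse[OF SM r this]
  have "D \<subseteq> invert C (r f)"
  proof
   fix y assume "y \<in> D"
   then obtain x where x: "x \<in> B" "y = r x" using B(2) by blast
   obtain n where n: "x * f ^ n \<in> A" using x f(4) invert_iff[OF F(4)[OF A(1)] f(1,2)] by blast
   have "x \<in> M" "f \<in> M" using x f(1) AM BM by blast+
   then have "r (x * f ^ n) = y * r f ^ n"
    using res_mult[OF SM r, of x "f ^ n"] res_power[OF SM r, of f n] sring_power[OF SM, of f n] x(2) by simp
   then have "y * r f ^ n \<in> C" using n A(2) imageI[of "x * f ^ n" A r] by simp
   moreover have "sring C" unfolding A(2) by (rule sring_image[OF F(4)[OF A(1)] AM SM r])
   ultimately show "y \<in> invert C (r f)" using invert_iff[of C "r f" y] f(1) A(2) rf(1) by blast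
  qed
  moreover have "inverse (r f) \<in> P" using f(3) N(2) rf(2) by (auto simp: dominates_def res_pre_def[OF locM r])
  ultimately show "\<exists>f\<in>C. f ~= 0 & inverse f \<in> P & D \<subseteq> invert C f"
   using rf f(1) A(2) by (intro bexI[of _ "r f"]) auto
 qed
 moreover have "noeth C & F_finite C" if C: "C \<in> subscheme \<A> M r" for C
 proof -
  obtain A where A: "A \<in> \<A>" "C = r ` A" "is_loc A M" using charts[OF C] by blast
  have AM: "A \<subseteq> M" using A(3) by (simp add: is_loc_def)
  show ?thesis unfolding A(2) using noeth_image[OF F(2)[OF A(1)] AM SM r] F_finite_image[OF F(4,3)[OF A(1) ] AM SM r] A(1) F by blast
 qed
 ultimately show ?thesis by (auto simp: ff_scheme_def)
qed

section \<open>Prime divisors of normal schemes\<close>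

lemma dvr_not_UNIV: "dvr R ==> R ~= UNIV" by (auto simp: dvr_def)

locale nscheme = char_p p ty for p and ty :: "'a::field itself" +
 fixes \<A> :: "'a set set"
 assumes ns: "normal_scheme \<A>"
begin

lemma ff: "ff_scheme \<A>" using ns by (simp add: normal_scheme_iff)

lemmas chart = ff_schemeD[OF ff]

lemmas gl = chart(1)

lemma point_chart: "N \<in> points \<A> ==> \<exists>A\<in>\<A>. is_loc A N" using points_glued[OF gl] by blast

lemma point_props:
 assumes "N \<in> points \<A>"
 shows "loc_ring N" "sring N" "noeth N" "frac_full N" "F_finite N" "int_closure N = N"
proof -
 obtain A where A: "A \<in> \<A>" "is_loc A N" using point_chart[OF assms] by blast
 note fr = is_loc_fractions[OF A(2)]
 show "loc_ring N" "sring N" using A(2) is_loc_sring by (auto simp: is_loc_def)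
 show "noeth N" by (rule fractions_noeth[OF chart(2)[OF A(1)] fr])
 show "frac_full N" using A(2) by (intro frac_full_mono[OF chart(5)[OF A(1)]]) (auto simp: is_loc_def)
 show "F_finite N" using p_gt_0 by (intro F_finite_fractions[OF _ chart(3)[OF A(1)] chart(4)[OF A(1)] fr]) simp
 show "int_closure N = N" using ns assms by (simp add: normal_scheme_iff)
qed

lemma F_finite_K: "F_finite (UNIV :: 'a set)" using point_props(5)[OF generic_point[OF gl]] .

lemma pd_point: "R \<in> prime_divisors \<A> ==> R \<in> points \<A>" by (simp add: prime_divisors_def)

lemma pd_avoiding:
 assumes N: "N \<in> points \<A>" and y: "y \<notin> N"
 shows "\<exists>R\<in>points \<A>. dvr R & N \<subseteq> R & y \<notin> R"
proof -
 note P = point_props[OF N]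
 have "\<exists>R. is_loc N R & dvr R & y \<notin> R"
  by (rule dvr_localization_avoiding[OF P(3,4) _ y]) (rule point_props(6)[OF points_localization[OF gl N]])
 then obtain R where R: "is_loc N R" "dvr R" "y \<notin> R" by blast
 have "R \<in> points \<A>" by (rule points_localization[OF gl N R(1)])
 then show ?thesis using R by (auto simp: is_loc_def)
qed

text \<open>A point of codimension 1 misses some element, so it is contained in a discrete valuation
  point missing the same element; by codimension 1 the two coincide.\<close>

lemma prime_divisors_iff: "R \<in> prime_divisors \<A> \<longleftrightarrow> R \<in> points \<A> & dvr R"
proof
 assume R: "R \<in> prime_divisors \<A>"
 then obtain y where "y \<notin> R" by (auto simp: prime_divisors_def)
 then obtain S where S: "S \<in> points \<A>" "dvr S" "R \<subseteq> S" "y \<notin> S" using pd_avoiding[OF pd_point[OF R]] by blast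
 then have "S = R | S = UNIV" using R by (simp add: prime_divisors_def)
 then show "R \<in> points \<A> & dvr R" using S by auto
next
 assume "R \<in> points \<A> & dvr R"
 then have R: "R \<in> points \<A>" "dvr R" by auto
 have "N = R | N = UNIV" if "N \<in> points \<A>" "R \<subseteq> N" for N
  by (rule dvr_maximal[OF R(2) point_props(2)[OF that(1)] that(2)])
 then show "R \<in> prime_divisors \<A>" using R dvr_not_UNIV[OF R(2)] by (simp add: prime_divisors_def)
qed

lemma pd_dvr: "R \<in> prime_divisors \<A> ==> dvr R" by (simp add: prime_divisors_iff)

lemma pd_loc: "R \<in> prime_divisors \<A> ==> dvr_loc R" by (simp add: dvr_loc_def pd_dvr)

lemma pd_ex:
 assumes "N \<in> points \<A>" "y \<notin> N"
 shows "\<exists>R\<in>prime_divisors \<A>. N \<subseteq> R & y \<notin> R" using pd_avoiding[OF assms] prime_divisors_iff by blast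

lemma mem_point_iff:
 assumes N: "N \<in> points \<A>" and x: "x ~= 0"
 shows "x \<in> N \<longleftrightarrow> (\<forall>R\<in>prime_divisors \<A>. N \<subseteq> R --> 0 \<le> ord_at R x)"
proof
 assume "x \<in> N"
 then show "\<forall>R\<in>prime_divisors \<A>. N \<subseteq> R --> 0 \<le> ord_at R x" using dvr_loc.mem_iff[OF pd_loc x] by blast
next
 assume *: "\<forall>R\<in>prime_divisors \<A>. N \<subseteq> R --> 0 \<le> ord_at R x"
 show "x \<in> N"
 proof (rule ccontr)
  assume "x \<notin> N"
  then obtain R where R: "R \<in> prime_divisors \<A>" "N \<subseteq> R" "x \<notin> R" using pd_ex[OF N] by blast
  then show False using * dvr_loc.mem_iff[OF pd_loc[OF R(1)] x] by blast
 qed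
qed

lemma unit_point_iff:
 assumes N: "N \<in> points \<A>" and x: "x ~= 0"
 shows "unit_in N x \<longleftrightarrow> (\<forall>R\<in>prime_divisors \<A>. N \<subseteq> R --> ord_at R x = 0)"
proof -
 have "ord_at R (inverse x) = - ord_at R x" if "R \<in> prime_divisors \<A>" for R
  by (rule dvr_loc.ord_inverse[OF pd_loc[OF that] x])
 then show ?thesis
  unfolding unit_in_def using x mem_point_iff[OF N x] mem_point_iff[OF N, of "inverse x"] by fastforce
qed

lemma prime_divisors_open:
 assumes U: "zariski_open \<A> U" "U ~= {}"
 shows "prime_divisors (open_subscheme \<A> U) = prime_divisors \<A> \<inter> U"
proof -
 interpret o: nscheme p ty "open_subscheme \<A> U" by unfold_locales (rule normal_scheme_open[OF ns U])
 have "U \<subseteq> points \<A>" using U(1) by (simp add: zariski_open_def)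
 then show ?thesis using o.prime_divisors_iff prime_divisors_iff open_subscheme_points[OF gl U(1)] by blast
qed

text \<open>Below each prime above \<open>a\<close> lies one from a finite list. For a prime divisor
  the listed prime yields a generization that is not generic, hence the divisor itself.\<close>

lemma finite_nonunit:
 assumes A: "A \<in> \<A>" and a: "a \<in> A" "a ~= 0"
 shows "finite {R \<in> prime_divisors \<A>. is_loc A R & a \<in> max_ideal R}"
proof -
 note rA = chart(4)[OF A]
 have "sideal A ((%y. a * y) ` A)" unfolding sideal_def
 proof (intro conjI ballI)
  show "(%y. a * y) ` A \<subseteq> A" using a rA by (auto intro: sring_mult)
  show "0 \<in> (%y. a * y) ` A" using sring_zero[OF rA] by force
  fix u assume "u \<in> (%y. a * y) ` A"
  then obtain x where x: "u = a * x" "x \<in> A" by blast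
  show "u + v \<in> (%y. a * y) ` A" if v: "v \<in> (%y. a * y) ` A" for v
  proof -
   obtain y where y: "v = a * y" "y \<in> A" using v by blast
   have "u + v = a * (x + y)" using x y by (simp add: distrib_left)
   then show ?thesis using sring_add[OF rA x(2) y(2)] by blast
  qed
  show "b * u \<in> (%y. a * y) ` A" if b: "b \<in> A" for b
  proof -
   have "b * u = a * (b * x)" using x by simp
   then show ?thesis using sring_mult[OF rA b x(2)] by blast
  qed
 qed
 from finite_primes_above[OF chart(2)[OF A] this]
 obtain \<P> where P: "finite \<P>" "\<forall>P\<in>\<P>. sprime A P & (%y. a * y) ` A \<subseteq> P"
   "\<forall>Q. sprime A Q & (%y. a * y) ` A \<subseteq> Q --> (\<exists>P\<in>\<P>. P \<subseteq> Q)" by (elim exE conjE) (rule that)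
 have "{R \<in> prime_divisors \<A>. is_loc A R & a \<in> max_ideal R} \<subseteq> loc_at A ` \<P>"
 proof
  fix R assume "R \<in> {R \<in> prime_divisors \<A>. is_loc A R & a \<in> max_ideal R}"
  then have R: "R \<in> prime_divisors \<A>" "is_loc A R" "a \<in> max_ideal R" by auto
  let ?Q = "max_ideal R \<inter> A"
  note L = is_loc_loc_at[OF rA R(2)]
  have "a * y \<in> max_ideal R" if "y \<in> A" for y
   using max_ideal_mult[OF is_loc_sring[OF R(2)] R(3)] that R(2) by (auto simp: is_loc_def)
  then have "(%y. a * y) ` A \<subseteq> ?Q" using a rA by (auto intro: sring_mult)
  then obtain P0 where P0: "P0 \<in> \<P>" "P0 \<subseteq> ?Q" using P(3) L(2) by blast
  have pP: "sprime A P0" and "(%y. a * y) ` A \<subseteq> P0" using P(2) P0(1) by auto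
  then have aP: "a * 1 \<in> P0" using sring_one[OF rA] by blast
  note l0 = loc_at_is_loc[OF rA pP]
  have "loc_at A P0 \<in> points \<A>" using l0(1) A points_glued[OF gl] by blast
  moreover have "R \<subseteq> loc_at A P0"
  proof -
   have "loc_at A ?Q \<subseteq> loc_at A P0" using P0(2) unfolding loc_at_def by blast
   then show ?thesis using L(1) by simp
  qed
  moreover have "loc_at A P0 ~= UNIV"
  proof
   assume U: "loc_at A P0 = UNIV"
   have "a \<in> max_ideal (loc_at A P0)" using aP l0(2) by auto
   then show False unfolding U using a(2) by (simp add: max_ideal_def)
  qed
  ultimately have "loc_at A P0 = R" using R(1) by (auto simp: prime_divisors_def)
  then show "R \<in> loc_at A ` \<P>" using P0(1) by blast
 qed
 then show ?thesis using P(1) finite_surj by blast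
qed

lemma finite_ord:
 assumes A: "A \<in> \<A>" and x: "x ~= 0"
 shows "finite {R \<in> prime_divisors \<A>. is_loc A R & ord_at R x ~= 0}"
proof -
 obtain a b where ab: "a \<in> A" "b \<in> A" "b ~= 0" "x = a / b" using chart(5)[OF A] unfolding frac_full_def by blast
 then have a0: "a ~= 0" using x by auto
 have "a \<in> max_ideal R | b \<in> max_ideal R" if R: "R \<in> prime_divisors \<A>" "is_loc A R" "ord_at R x ~= 0" for R
 proof (rule ccontr)
  interpret d: dvr_loc R by (rule pd_loc[OF R(1)])
  assume "\<not> (a \<in> max_ideal R | b \<in> max_ideal R)"
  moreover have "a \<in> R" "b \<in> R" using ab R(2) by (auto simp: is_loc_def)
  ultimately have "unit_in R a" "unit_in R b" using unit_cases by blast+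
  then have "ord_at R x = 0" unfolding ab(4) using d.ord_divide[OF a0 ab(3)] d.ord_unit by simp
  then show False using R(3) by simp
 qed
 then have "{R \<in> prime_divisors \<A>. is_loc A R & ord_at R x ~= 0} \<subseteq>
   {R \<in> prime_divisors \<A>. is_loc A R & a \<in> max_ideal R} \<union> {R \<in> prime_divisors \<A>. is_loc A R & b \<in> max_ideal R}"
  by blast
 then show ?thesis by (rule finite_subset) (use finite_nonunit[OF A ab(1) a0] finite_nonunit[OF A ab(2,3)] in simp)
qed

lemma pd_char_p_dvr: "R \<in> prime_divisors \<A> ==> char_p_dvr p R"
 by (intro char_p_dvr.intro char_p.intro prime_p pd_loc) (use char_p in simp)

text \<open>The coordinates of \<open>\<omega>\<close> are a p-basis at every divisor where two
  denominators are units: \<open>d1\<close> for the coordinates, \<open>d2\<close> for the partial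
  derivatives of generators of \<open>A\<close>. There the order is that of a fixed
  function.\<close>

lemma finite_form_ord:
 assumes A: "A \<in> \<A>" and \<omega>: "rational_form \<omega>"
 shows "finite {R \<in> prime_divisors \<A>. is_loc A R & form_ord \<omega> R ~= 0}"
proof -
 note rA = chart(4)[OF A]
 define zs where "zs = snd \<omega>"
 have zs: "p_basis UNIV zs" using \<omega> by (simp add: rational_form_def zs_def)
 have "\<exists>S. finite S & S \<subseteq> A & (\<forall>x\<in>A. \<exists>c. (\<forall>s\<in>S. c s \<in> A) & x = (\<Sum>s\<in>S. c s ^ p * s))"
  using chart(3)[OF A] by (simp add: F_finite_def)
 then obtain S where S: "finite S" "S \<subseteq> A" "\<And>x. x \<in> A ==> \<exists>c. (\<forall>s\<in>S. c s \<in> A) & x = (\<Sum>s\<in>S. c s ^ p * s)" by blast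
 obtain d1 where d1: "d1 \<in> A" "d1 ~= 0" "\<And>z. z \<in> set zs ==> d1 * z \<in> A"
  using common_denominator[OF rA chart(5)[OF A], of "set zs" id] by auto
 obtain d2 where d2: "d2 \<in> A" "d2 ~= 0" "\<And>j s. j < length zs ==> s \<in> S ==> d2 * del zs j s \<in> A"
  using common_denominator[OF rA chart(5)[OF A], of "{..<length zs} \<times> S" "%(j, s). del zs j s"] S(1) by auto
 have "form_ord \<omega> R = ord_at R (form_coeff \<omega> zs)"
  if R: "R \<in> prime_divisors \<A>" "is_loc A R" "ord_at R d1 = 0" "ord_at R d2 = 0" for R
 proof -
  interpret d: char_p_dvr p ty R by (rule pd_char_p_dvr[OF R(1)])
  have AR: "A \<subseteq> R" using R(2) by (simp add: is_loc_def)
  have u: "unit_in R d1" "unit_in R d2" using R(3,4) d1(2) d2(2) d.unit_iff by auto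
  have mem: "z \<in> R" if u: "unit_in R u" "u * z \<in> A" for u z
  proof -
   have "inverse u \<in> R" "u * z \<in> R" using u AR by (auto simp: unit_in_def)
   then have "inverse u * (u * z) \<in> R" by (rule sring_mult[OF d.R])
   moreover have "inverse u * (u * z) = z" using u(1) by (simp add: unit_in_def)
   ultimately show ?thesis by simp
  qed
  have zsR: "set zs \<subseteq> R" using mem[OF u(1)] d1(3) by blast
  have der: "derivation (del zs j)" if "j < length zs" for j by (rule del_derivation[OF zs that])
  have delA: "del zs j x \<in> R" if j: "j < length zs" and x: "x \<in> A" for j x
  proof -
   obtain c where c: "\<forall>s\<in>S. c s \<in> A" "x = (\<Sum>s\<in>S. c s ^ p * s)" using S(3)[OF x] by blast
   have "del zs j x = (\<Sum>s\<in>S. c s ^ p * del zs j s)"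
    unfolding c(2) using der[OF j] by (simp add: derivation_sum derivation_p_power(2))
   also have "... \<in> R" using c(1) d2(3)[OF j] mem[OF u(2)] AR
    by (intro sring_sum[OF d.R] sring_mult[OF d.R sring_power[OF d.R]]) auto
   finally show ?thesis .
  qed
  have "p_basis R zs"
  proof (rule d.p_basis_of_stable[OF zs zsR])
   fix j x assume j: "j < length zs" and x: "x \<in> R"
   obtain s where s: "s \<in> A" "unit_in R s" "x * s \<in> A" using R(2) x by (auto simp: is_loc_def)
   have "del zs j (x * s) = x * del zs j s + s * del zs j x" using der[OF j] by (simp add: derivation_def)
   then have eq: "del zs j x = inverse s * (del zs j (x * s) - x * del zs j s)"
    using s(2) by (simp add: unit_in_def field_simps)
   have "del zs j (x * s) - x * del zs j s \<in> R"
    by (rule sring_diff[OF d.R delA[OF j s(3)] sring_mult[OF d.R x delA[OF j s(1)]]])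
   then show "del zs j x \<in> R"
    unfolding eq using s(2) by (intro sring_mult[OF d.R, of "inverse s"]) (auto simp: unit_in_def)
  qed
  then show ?thesis by (rule d.form_ord_eq[OF \<omega>])
 qed
 then have "{R \<in> prime_divisors \<A>. is_loc A R & form_ord \<omega> R ~= 0} \<subseteq>
   {R \<in> prime_divisors \<A>. is_loc A R & ord_at R d1 ~= 0} \<union> {R \<in> prime_divisors \<A>. is_loc A R & ord_at R d2 ~= 0}
   \<union> {R \<in> prime_divisors \<A>. is_loc A R & ord_at R (form_coeff \<omega> zs) ~= 0}" by fastforce
 moreover have "finite ..."
  using finite_ord[OF A d1(2)] finite_ord[OF A d2(2)] finite_ord[OF A form_coeff_nz[OF \<omega> zs]] by blast
 ultimately show ?thesis by (rule finite_subset)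
qed

text \<open>Taking the scheme as its own model bounds the coefficients of a sub-log canonical
  divisor; see \<open>lc_set_bounded\<close>.\<close>

lemma proper_birational_self: "proper_birational \<A> \<A>" unfolding proper_birational_def
proof (intro conjI ballI allI impI)
 show "\<exists>N\<in>points \<A>. dominates N' N" if "N' \<in> points \<A>" for N' using that dominates_refl by blast
 show "\<exists>\<C>. finite \<C> & (\<forall>C\<in>\<C>. affine_open \<A> C & A \<subseteq> C & fin_gen_over A C) &
    {N' \<in> points \<A>. \<exists>N\<in>Spec A. dominates N' N} = (\<Union>C\<in>\<C>. Spec C)" if A: "A \<in> \<A>" for A
 proof (intro exI[of _ "{A}"] conjI ballI)
  fix C assume C: "C \<in> {A}"
  have sub: "Spec A \<subseteq> points \<A>" using A by (auto simp: points_def)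
  show "affine_open \<A> C" unfolding affine_open_def using C A sub glued_atlas[OF gl] by (simp add: insert_absorb)
  show "A \<subseteq> C" using C by simp
  show "fin_gen_over A C"
   unfolding fin_gen_over_def using C gen_idem[OF chart(4)[OF A]] by (intro exI[of _ "{}"]) simp
 next
  show "{N' \<in> points \<A>. \<exists>N\<in>Spec A. dominates N' N} = (\<Union>C\<in>{A}. Spec C)"
  proof (intro equalityI subsetI)
   fix N' assume "N' \<in> {N' \<in> points \<A>. \<exists>N\<in>Spec A. dominates N' N}"
   then obtain N where N: "N' \<in> points \<A>" "N \<in> Spec A" "dominates N' N" by blast
   have "N \<in> points \<A>" using N(2) A by (auto simp: points_def)
   then have "N' = N" by (rule center_unique[OF gl N(1) _ points_loc_ring[OF gl N(1)] dominates_refl N(3)])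
   then show "N' \<in> (\<Union>C\<in>{A}. Spec C)" using N(2) by simp
  next
   fix N' assume "N' \<in> (\<Union>C\<in>{A}. Spec C)"
   then have "N' \<in> Spec A" "N' \<in> points \<A>" using A by (auto simp: points_def)
   then show "N' \<in> {N' \<in> points \<A>. \<exists>N\<in>Spec A. dominates N' N}" using dominates_refl[of N'] by blast
  qed
 qed simp
 show "\<exists>N'\<in>points \<A>. dominates V N'" if "valuation_subring V & (\<exists>N\<in>points \<A>. dominates V N)" for V
  using that by blast
qed

end

section \<open>Pull-back of divisors\<close>

definition fhom :: "('b::field => 'a::field) => bool" where
 "fhom \<iota> \<longleftrightarrow> (\<forall>x y. \<iota> (x + y) = \<iota> x + \<iota> y) & (\<forall>x y. \<iota> (x * y) = \<iota> x * \<iota> y) & \<iota> 1 = 1"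

lemma fhomD:
 assumes "fhom \<iota>"
 shows "\<iota> (x + y) = \<iota> x + \<iota> y" "\<iota> (x * y) = \<iota> x * \<iota> y" "\<iota> 1 = 1" "\<iota> 0 = 0" "\<iota> (- x) = - \<iota> x"
  "\<iota> (x - y) = \<iota> x - \<iota> y" "\<iota> x = 0 \<longleftrightarrow> x = 0" "\<iota> (inverse x) = inverse (\<iota> x)" "\<iota> (x ^ n) = \<iota> x ^ n"
proof -
 show add: "\<iota> (x + y) = \<iota> x + \<iota> y" and mult: "\<iota> (x * y) = \<iota> x * \<iota> y" and one: "\<iota> 1 = 1" for x y
  using assms by (auto simp: fhom_def)
 have "\<iota> 0 = \<iota> 0 + \<iota> 0" using add[of 0 0] by (simp only: add_0)
 then show z: "\<iota> 0 = 0" by (simp only: add_cancel_right_right)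
 have neg: "\<iota> (- x) = - \<iota> x" for x using add[of x "- x"] z by (simp add: eq_neg_iff_add_eq_0 add.commute)
 then show "\<iota> (- x) = - \<iota> x" .
 show "\<iota> (x - y) = \<iota> x - \<iota> y" using add[of x "- y"] neg by simp
 have nz: "\<iota> x ~= 0 & \<iota> (inverse x) = inverse (\<iota> x)" if "x ~= 0" for x
 proof -
  have "\<iota> x * \<iota> (inverse x) = 1" using mult[of x "inverse x"] that one by simp
  then show ?thesis by (metis inverse_unique mult_zero_left zero_neq_one)
 qed
 show "\<iota> x = 0 \<longleftrightarrow> x = 0" using nz z by blast
 show "\<iota> (inverse x) = inverse (\<iota> x)" using nz[of x] z by (cases "x = 0") auto
 show "\<iota> (x ^ n) = \<iota> x ^ n" by (induction n) (auto simp: one mult)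
qed

context
 fixes \<iota> :: "'b::field => 'a::field"
 assumes \<iota>: "fhom \<iota>"
begin

lemma fhom_unit: "unit_in R (\<iota> x) \<longleftrightarrow> unit_in (\<iota> -` R) x" by (simp add: unit_in_def fhomD[OF \<iota>])

lemma fhom_max: "max_ideal (\<iota> -` R) = \<iota> -` max_ideal R" by (auto simp: max_ideal_def fhomD[OF \<iota>])

lemma fhom_vimage_loc_ring: "loc_ring R ==> loc_ring (\<iota> -` R)"
 unfolding loc_ring_def fhom_max sring_def by (simp add: fhomD[OF \<iota>])

lemma fhom_inj: "\<iota> x = \<iota> y \<longleftrightarrow> x = y"
 using fhomD(6)[OF \<iota>, of x y] fhomD(7)[OF \<iota>, of "x - y"] by (metis eq_iff_diff_eq_0)

lemma fhom_max_image: "max_ideal (\<iota> ` N) = \<iota> ` max_ideal N"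
proof -
 have "inverse (\<iota> x) \<in> \<iota> ` N \<longleftrightarrow> inverse x \<in> N" for x unfolding fhomD(8)[OF \<iota>, symmetric] using fhom_inj by auto
 then show ?thesis unfolding max_ideal_def using fhomD(7)[OF \<iota>] by auto
qed

lemma fhom_dominates: "dominates R (\<iota> ` N) \<longleftrightarrow> dominates (\<iota> -` R) N"
 unfolding dominates_def fhom_max_image fhom_max by auto

end

text \<open>Obtained by extending \<open>{\<tau>}\<close> to a basis of the reals over the
  rationals; it serves to reduce real relations to rational ones.\<close>

lemma rational_functional:
 assumes "(\<tau>::real) ~= 0"
 shows "\<exists>l :: real => rat. (\<forall>x y. l (x + y) = l x + l y) & (\<forall>n x. l (x * real_of_int n) = l x * rat_of_int n) & l \<tau> ~= 0"
proof -
 interpret v: vector_space "%q (x::real). real_of_rat q * x"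
  by unfold_locales (simp_all add: algebra_simps of_rat_add of_rat_mult)
 interpret w: vector_space "%q (x::rat). q * x" by unfold_locales (simp_all add: algebra_simps)
 interpret vw: vector_space_pair "%q (x::real). real_of_rat q * x" "%q (x::rat). q * x" ..
 have "v.independent {\<tau>}" using assms by simp
 from vw.linear_independent_extend[OF this, of "%_. 1"]
 obtain l where l: "Vector_Spaces.linear (%q (x::real). real_of_rat q * x) (%q (x::rat). q * x) l" "l \<tau> = 1" by auto
 interpret l: Vector_Spaces.linear "%q (x::real). real_of_rat q * x" "%q (x::rat). q * x" l by (rule l(1))
 have "l (x * real_of_int n) = l x * rat_of_int n" for n x
  using l.scale[of "rat_of_int n" x] by (simp add: mult.commute)
 then show ?thesis using l(2) l.add by (intro exI[of _ l]) auto
qed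

text \<open>A functional that does not kill the defect turns a real counterexample into a rational
  one, and clearing denominators makes it integral.\<close>

lemma real_relation:
 fixes a :: "nat => real" and n :: "nat => int" and v :: "'q => nat => int"
 assumes int: "\<And>c. (\<forall>Q\<in>\<Q>. (\<Sum>i<k. c i * v Q i) = 0) ==> (\<Sum>i<k. c i * n i) = 0"
  and a: "\<forall>Q\<in>\<Q>. (\<Sum>i<k. a i * real_of_int (v Q i)) = 0"
 shows "(\<Sum>i<k. a i * real_of_int (n i)) = 0"
proof (rule ccontr)
 assume "(\<Sum>i<k. a i * real_of_int (n i)) ~= 0"
 from rational_functional[OF this] obtain l :: "real => rat" where l': "\<forall>x y. l (x + y) = l x + l y"
  "\<forall>n x. l (x * real_of_int n) = l x * rat_of_int n" "l (\<Sum>i<k. a i * real_of_int (n i)) ~= 0"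
  by (elim exE conjE) (rule that)
 note l = l'[rule_format]
 have l0: "l 0 = 0" using l(1)[of 0 0] by simp
 have ls: "l (\<Sum>i<k. a i * real_of_int (m i)) = (\<Sum>i<k. l (a i) * rat_of_int (m i))" for m k
  by (induction k) (auto simp: l l0)
 obtain D where D: "D > 0" "\<forall>i<k. \<exists>c. l (a i) * rat_of_int D = rat_of_int c"
 proof -
  have "\<exists>D>0. \<forall>i<k. \<exists>c. l (a i) * rat_of_int D = rat_of_int c"
  proof (induction k)
   case 0
   then show ?case by (intro exI[of _ 1]) simp
  next
   case (Suc k)
   then obtain D where D: "D > 0" "\<forall>i<k. \<exists>c. l (a i) * rat_of_int D = rat_of_int c" by blast
   obtain x y where xy: "y > 0" "l (a k) = rat_of_int x / rat_of_int y" by (metis Fract_of_int_quotient Rat_cases)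
   have "\<exists>c. l (a i) * rat_of_int (D * y) = rat_of_int c" if i: "i < Suc k" for i
   proof (cases "i = k")
    case True
    then show ?thesis using xy by (intro exI[of _ "D * x"]) simp
   next
    case False
    then have "i < k" using i by simp
    then obtain c where "l (a i) * rat_of_int D = rat_of_int c" using D(2) by blast
    then show ?thesis by (intro exI[of _ "c * y"]) (simp add: mult.assoc[symmetric])
   qed
   then show ?case using D(1) xy(1) by (intro exI[of _ "D * y"]) auto
  qed
  then show thesis using that by blast
 qed
 from D(2) have "\<forall>i. \<exists>c. i < k --> l (a i) * rat_of_int D = rat_of_int c" by blast
 from choice[OF this] obtain c where c: "\<And>i. i < k ==> l (a i) * rat_of_int D = rat_of_int (c i)" by blast
 have cs: "rat_of_int (\<Sum>i<k. c i * m i) = rat_of_int D * l (\<Sum>i<k. a i * real_of_int (m i))" for m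
  unfolding ls sum_distrib_left using c[symmetric] by (simp add: mult_ac)
 have "(\<Sum>i<k. c i * v Q i) = 0" if "Q \<in> \<Q>" for Q
 proof -
  have "rat_of_int (\<Sum>i<k. c i * v Q i) = 0" unfolding cs using a that l0 by simp
  then show ?thesis by (simp only: of_int_eq_0_iff)
 qed
 then have z: "(\<Sum>i<k. c i * n i) = 0" by (intro int) blast
 have "rat_of_int D * l (\<Sum>i<k. a i * real_of_int (n i)) = 0" unfolding cs[symmetric] z by simp
 then show False using l(3) D(1) by simp
qed

lemma (in dvr_loc) ord_prod_powi:
 "(\<And>i. i < k ==> h i ~= 0) ==> (\<Prod>i<k. h i powi c i) ~= 0 &
  ord_at R (\<Prod>i<(k::nat). h i powi c i) = (\<Sum>i<k. c i * ord_at R (h i))"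
 by (induction k) (auto simp: ord_one ord_mult ord_powi)

context nscheme
begin

text \<open>An integral combination that vanishes at all divisors through \<open>N\<close> is the
  divisor of a unit of \<open>N\<close>, and units remain units in \<open>R\<close>;
  \<open>real_relation\<close> passes to real coefficients.\<close>

lemma real_combination_zero:
 assumes N: "N \<in> points \<A>" and \<iota>: "fhom \<iota>" and R: "dvr R" "dominates R (\<iota> ` N)"
  and h: "\<And>i. i < k ==> h i ~= 0"
  and z: "\<forall>Q\<in>{Q \<in> prime_divisors \<A>. N \<subseteq> Q}. (\<Sum>i<k. a i * real_of_int (ord_at Q (h i))) = 0"
 shows "(\<Sum>i<(k::nat). a i * real_of_int (ord_at R (\<iota> (h i)))) = 0"
proof (rule real_relation[OF _ z])
 interpret d: dvr_loc R using R(1) by unfold_locales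
 fix c assume c: "\<forall>Q\<in>{Q \<in> prime_divisors \<A>. N \<subseteq> Q}. (\<Sum>i<k. c i * ord_at Q (h i)) = 0"
 let ?x = "\<Prod>i<k. h i powi c i"
 have powi: "\<iota> (x powi m) = \<iota> x powi m" for x m by (auto simp: power_int_def fhomD[OF \<iota>])
 have x0: "?x ~= 0" using h by (simp add: prod_zero_iff)
 have "ord_at Q ?x = 0" if "Q \<in> prime_divisors \<A>" "N \<subseteq> Q" for Q
  using dvr_loc.ord_prod_powi[OF pd_loc[OF that(1)], of k h c] h c that by simp
 then have "unit_in N ?x" using unit_point_iff[OF N x0] by blast
 then have "unit_in (\<iota> -` R) ?x" using R(2) unfolding fhom_dominates[OF \<iota>] by (auto simp: dominates_def intro: unit_mono)
 then have "ord_at R (\<iota> ?x) = 0" using d.ord_unit fhom_unit[OF \<iota>] by blast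
 moreover have "\<iota> ?x = (\<Prod>i<k. \<iota> (h i) powi c i)" by (induction k) (simp_all add: fhomD[OF \<iota>] powi)
 ultimately show "(\<Sum>i<k. c i * ord_at R (\<iota> (h i))) = 0"
  using d.ord_prod_powi[of k "%i. \<iota> (h i)" c] h fhomD(7)[OF \<iota>] by simp
qed

lemma list_sum_nth:
 "(\<Sum>(a, h)\<leftarrow>hs. a * f h) = (\<Sum>i<length hs. fst (hs ! i) * (f (snd (hs ! i)) :: real))"
 by (simp add: sum_list_sum_nth case_prod_unfold atLeast0LessThan)

text \<open>Concatenating one list with the negative of the other presents the zero divisor.\<close>

lemma pullback_unique:
 assumes N: "N \<in> points \<A>" and \<iota>: "fhom \<iota>" and R: "dvr R" "dominates R (\<iota> ` N)"
  and hs: "local_R_eq \<A> D N hs" and gs: "local_R_eq \<A> D N gs"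
 shows "(\<Sum>(a, h)\<leftarrow>hs. a * real_of_int (ord_at R (\<iota> h))) = (\<Sum>(a, h)\<leftarrow>gs. a * real_of_int (ord_at R (\<iota> h)))"
proof -
 define us where "us = hs @ map (%(a, h). (- a, h)) gs"
 have S: "(\<Sum>(a, h)\<leftarrow>us. a * f h) = (\<Sum>(a, h)\<leftarrow>hs. a * f h) - (\<Sum>(a, h)\<leftarrow>gs. a * f h)" for f :: "'a => real"
 proof -
  have "(\<Sum>(a, h)\<leftarrow>map (%(a, h). (- a, h)) gs. a * f h) = - (\<Sum>(a, h)\<leftarrow>gs. a * f h)" for gs by (induction gs) auto
  then show ?thesis by (simp add: us_def)
 qed
 have nz: "snd (us ! i) ~= 0" if "i < length us" for i
 proof -
  have "\<forall>(a, h)\<in>set us. h ~= 0" using hs gs by (auto simp: us_def local_R_eq_def)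
  then show ?thesis using nth_mem[OF that] by (auto simp: case_prod_unfold)
 qed
 have "(\<Sum>i<length us. fst (us ! i) * real_of_int (ord_at R (\<iota> (snd (us ! i))))) = 0"
 proof (rule real_combination_zero[OF N \<iota> R nz])
  show "\<forall>Q\<in>{Q \<in> prime_divisors \<A>. N \<subseteq> Q}. (\<Sum>i<length us. fst (us ! i) * real_of_int (ord_at Q (snd (us ! i)))) = 0"
  proof
   fix Q assume "Q \<in> {Q \<in> prime_divisors \<A>. N \<subseteq> Q}"
   then show "(\<Sum>i<length us. fst (us ! i) * real_of_int (ord_at Q (snd (us ! i)))) = 0"
    unfolding list_sum_nth[where hs=us and f="%h. real_of_int (ord_at Q h)", symmetric] S
    using hs gs by (auto simp: local_R_eq_def)
  qed
 qed
 then show ?thesis unfolding list_sum_nth[where hs=us and f="%h. real_of_int (ord_at R (\<iota> h))", symmetric] S by simp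
qed

lemma pullback_eq:
 assumes N: "N \<in> points \<A>" and \<iota>: "fhom \<iota>" and R: "dvr R" "dominates R (\<iota> ` N)"
  and hs: "local_R_eq \<A> D N hs"
 shows "pullback \<iota> \<A> D R = (\<Sum>(a, h)\<leftarrow>hs. a * real_of_int (ord_at R (\<iota> h)))" unfolding pullback_def
proof (rule the_equality)
 show "\<exists>N hs'. N \<in> points \<A> & dominates R (\<iota> ` N) & local_R_eq \<A> D N hs' &
   (\<Sum>(a, h)\<leftarrow>hs. a * real_of_int (ord_at R (\<iota> h))) = (\<Sum>(a, h)\<leftarrow>hs'. a * real_of_int (ord_at R (\<iota> h)))"
  using assms by (intro exI[of _ N] exI[of _ hs]) simp
 fix c assume "\<exists>N hs. N \<in> points \<A> & dominates R (\<iota> ` N) & local_R_eq \<A> D N hs &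
   c = (\<Sum>(a, h)\<leftarrow>hs. a * real_of_int (ord_at R (\<iota> h)))"
 then obtain M gs where M: "M \<in> points \<A>" "dominates R (\<iota> ` M)" "local_R_eq \<A> D M gs"
   "c = (\<Sum>(a, h)\<leftarrow>gs. a * real_of_int (ord_at R (\<iota> h)))" by (elim exE conjE) (rule that)
 have "M = N" using center_unique[OF gl M(1) N fhom_vimage_loc_ring[OF \<iota> dvr_loc_ring[OF R(1)]]] M(2) R(2)
  unfolding fhom_dominates[OF \<iota>] by blast
 then show "c = (\<Sum>(a, h)\<leftarrow>hs. a * real_of_int (ord_at R (\<iota> h)))"
  unfolding M(4) using M(3) hs by (intro pullback_unique[OF N \<iota> R]) simp_all
qed

end

section \<open>Valuation rings\<close>

lemma valuation_loc_ring:
 assumes V: "sring V" and val: "\<And>x. x \<in> V | inverse x \<in> V"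
 shows "loc_ring V" unfolding loc_ring_def
proof (intro conjI V ballI)
 have *: "x + y \<in> max_ideal V"
  if xy: "x \<in> max_ideal V" "y \<in> max_ideal V" "x ~= 0" "y * inverse x \<in> V" for x y
 proof -
  have "x * (1 + y * inverse x) \<in> max_ideal V" using xy V by (intro max_ideal_mult) (auto intro: sringD)
  moreover have "x * (1 + y * inverse x) = x + y" using xy(3) by (simp add: field_simps)
  ultimately show ?thesis by simp
 qed
 fix x y assume xy: "x \<in> max_ideal V" "y \<in> max_ideal V"
 show "x + y \<in> max_ideal V"
 proof (cases "x = 0 | y = 0")
  case False
  have "y * inverse x \<in> V | x * inverse y \<in> V" using val[of "y * inverse x"] False by (simp add: mult.commute)
  then show ?thesis using *[OF xy] *[OF xy(2,1)] False by (auto simp: add.commute)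
 qed (use xy in auto)
qed

text \<open>Chevalley's extension theorem.\<close>

lemma valuation_ring_dominating:
 assumes N: "loc_ring (N :: 'a::field set)"
 shows "\<exists>V. valuation_subring V & loc_ring V & dominates V N"
proof -
 note SN = loc_ring_sring[OF N]
 \<comment> \<open>Zorn's lemma is applied to pairs of a ring and an ideal, encoded as sets of tagged elements.\<close>
 define rg idl where "rg S = {x. (x, False) \<in> S}" and "idl S = {x. (x, True) \<in> S}" for S :: "('a \<times> bool) set"
 define good where "good V P \<longleftrightarrow> sring V & N \<subseteq> V & sideal V P & max_ideal N \<subseteq> P & 1 \<notin> P" for V P
 define \<F> where "\<F> = {S. good (rg S) (idl S)}"
 have "a * x \<in> max_ideal N" if "a \<in> N" "x \<in> max_ideal N" for a x
  using max_ideal_mult[OF SN that(2,1)] by (simp add: mult.commute)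
 then have "sideal N (max_ideal N)"
  unfolding sideal_def using N zero_in_max[OF SN] max_ideal_sub by (auto simp: loc_ring_def)
 then have start: "N \<times> {False} \<union> max_ideal N \<times> {True} \<in> \<F>"
  using SN one_not_max by (simp add: \<F>_def good_def rg_def idl_def)
 have "\<exists>M\<in>\<F>. \<forall>S\<in>\<F>. M \<subseteq> S --> S = M"
 proof (rule subset_Zorn_nonempty)
  show "\<F> ~= {}" using start by blast
  fix C assume C: "C ~= {}" "subset.chain \<F> C"
  have CF: "good (rg S) (idl S)" if "S \<in> C" for S using C(2) that by (auto simp: subset_chain_def \<F>_def)
  have dir: "\<exists>S\<in>C. u \<in> S & v \<in> S" if "u \<in> \<Union>C" "v \<in> \<Union>C" for u v
  proof -
   obtain S T where ST: "S \<in> C" "u \<in> S" "T \<in> C" "v \<in> T" using \<open>u \<in> \<Union>C\<close> \<open>v \<in> \<Union>C\<close> by blast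
   then have "S \<subseteq> T | T \<subseteq> S" using C(2) by (simp add: subset_chain_def)
   then show ?thesis using ST by blast
  qed
  have sr: "sring (rg S)" "N \<subseteq> rg S" "sideal (rg S) (idl S)" "max_ideal N \<subseteq> idl S" "1 \<notin> idl S" if "S \<in> C" for S
   using CF[OF that] by (auto simp: good_def)
  obtain S0 where S0: "S0 \<in> C" using C(1) by blast
  have mem: "rg S \<subseteq> rg (\<Union>C)" "idl S \<subseteq> idl (\<Union>C)" if "S \<in> C" for S using that by (auto simp: rg_def idl_def)
  have "good (rg (\<Union>C)) (idl (\<Union>C))" unfolding good_def sring_def sideal_def
  proof (intro conjI ballI)
   show "1 \<in> rg (\<Union>C)" using sring_one[OF sr(1)[OF S0]] mem(1)[OF S0] by blast
   show "0 \<in> idl (\<Union>C)" using sr(3)[OF S0] mem(2)[OF S0] by (auto simp: sideal_def)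
   show "N \<subseteq> rg (\<Union>C)" "max_ideal N \<subseteq> idl (\<Union>C)" using sr(2,4)[OF S0] mem[OF S0] by blast+
   show "1 \<notin> idl (\<Union>C)" using sr(5) by (auto simp: idl_def)
   show "idl (\<Union>C) \<subseteq> rg (\<Union>C)" using sr(3) unfolding sideal_def rg_def idl_def by blast
   fix x y
   { assume "x \<in> rg (\<Union>C)" "y \<in> rg (\<Union>C)"
    then obtain S where S: "S \<in> C" "x \<in> rg S" "y \<in> rg S"
     using dir[of "(x, False)" "(y, False)"] by (auto simp: rg_def)
    have "x - y \<in> rg S" "x * y \<in> rg S" using sr(1)[OF S(1)] S by (auto simp: sring_def)
    then show "x - y \<in> rg (\<Union>C)" "x * y \<in> rg (\<Union>C)" using S(1) by (auto simp: rg_def) }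
   assume y: "y \<in> idl (\<Union>C)"
   { assume "x \<in> idl (\<Union>C)"
    then obtain S where S: "S \<in> C" "x \<in> idl S" "y \<in> idl S"
     using dir[of "(x, True)" "(y, True)"] y by (auto simp: idl_def)
    have "x + y \<in> idl S" using sr(3)[OF S(1)] S by (auto simp: sideal_def)
    then show "x + y \<in> idl (\<Union>C)" using S(1) by (auto simp: idl_def) }
   assume "x \<in> rg (\<Union>C)"
   then obtain S where S: "S \<in> C" "x \<in> rg S" "y \<in> idl S"
    using dir[of "(x, False)" "(y, True)"] y by (auto simp: rg_def idl_def)
   have "x * y \<in> idl S" using sr(3)[OF S(1)] S by (auto simp: sideal_def)
   then show "x * y \<in> idl (\<Union>C)" using S(1) by (auto simp: idl_def)
  qed
  then show "\<Union>C \<in> \<F>" by (simp add: \<F>_def)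
 qed
 then obtain M where M: "M \<in> \<F>" and max: "\<forall>S\<in>\<F>. M \<subseteq> S --> S = M" by blast
 define V P where "V = rg M" and "P = idl M"
 have V: "sring V" "N \<subseteq> V" "sideal V P" "max_ideal N \<subseteq> P" "1 \<notin> P"
  using M by (auto simp: \<F>_def good_def V_def P_def)
 have P: "P \<subseteq> V" "0 \<in> P" "\<And>x y. x \<in> P ==> y \<in> P ==> x + y \<in> P" "\<And>a x. a \<in> V ==> x \<in> P ==> a * x \<in> P"
  using V(3) by (auto simp: sideal_def)
 have Psum: "sum u I \<in> P" if "\<And>i. i \<in> I ==> u i \<in> P" for u and I :: "nat set"
  using that by (induction I rule: infinite_finite_induct) (auto simp: P)
 \<comment> \<open>The relation expresses that 1 lies in the ideal generated by \<open>P\<close> in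
   the ring obtained by adjoining \<open>z\<close> to \<open>V\<close>, with degree at most
   \<open>n\<close>.\<close>
 define rel where "rel z n \<longleftrightarrow> (\<exists>u. (\<forall>i\<le>n. u i \<in> P) & (\<Sum>i\<le>(n::nat). u i * z ^ i) = 1)" for z n
 have rel_ex: "\<exists>n. rel z n" if z: "z \<notin> V" for z
 proof -
  define W J where "W = {poly q z | q. \<forall>i. poly.coeff q i \<in> V}" and "J = {poly q z | q. \<forall>i. poly.coeff q i \<in> P}"
  have VW: "v \<in> W" if "v \<in> V" for v unfolding W_def using that sring_zero[OF V(1)]
   by (intro CollectI exI[of _ "[:v:]"]) (simp add: coeff_pCons split: nat.split)
  have PJ: "v \<in> J" if "v \<in> P" for v
   unfolding J_def using that P(2) by (intro CollectI exI[of _ "[:v:]"]) (simp add: coeff_pCons split: nat.split)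
  have "z \<in> W" unfolding W_def using sring_zero[OF V(1)] sring_one[OF V(1)]
   by (intro CollectI exI[of _ "[:0, 1:]"]) (simp add: coeff_pCons split: nat.split)
  have "sring W" unfolding sring_def
  proof (intro conjI ballI)
   show "1 \<in> W" by (rule VW[OF sring_one[OF V(1)]])
   fix u v assume "u \<in> W" "v \<in> W"
   then obtain q q' where q: "u = poly q z" "\<forall>i. poly.coeff q i \<in> V" "v = poly q' z" "\<forall>i. poly.coeff q' i \<in> V"
    unfolding W_def by blast
   show "u - v \<in> W" unfolding W_def using q V(1) by (intro CollectI exI[of _ "q - q'"]) (simp add: sring_diff)
   show "u * v \<in> W" unfolding W_def using q by (intro CollectI exI[of _ "q * q'"])
     (auto simp: coeff_mult intro!: sring_sum[OF V(1)] sring_mult[OF V(1)])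
  qed
  moreover have "sideal W J" unfolding sideal_def
  proof (intro conjI ballI)
   show "J \<subseteq> W" unfolding J_def W_def using P(1) by blast
   show "0 \<in> J" by (rule PJ[OF P(2)])
   fix v assume "v \<in> J"
   then obtain q' where q': "v = poly q' z" "\<forall>i. poly.coeff q' i \<in> P" unfolding J_def by blast
   show "v + u \<in> J" if "u \<in> J" for u
   proof -
    obtain q where "u = poly q z" "\<forall>i. poly.coeff q i \<in> P" using \<open>u \<in> J\<close> unfolding J_def by blast
    then show ?thesis unfolding J_def using q' P(3) by (intro CollectI exI[of _ "q' + q"]) simp
   qed
   show "u * v \<in> J" if "u \<in> W" for u
   proof -
    obtain q where "u = poly q z" "\<forall>i. poly.coeff q i \<in> V" using \<open>u \<in> W\<close> unfolding W_def by blast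
    then show ?thesis unfolding J_def using q' by (intro CollectI exI[of _ "q * q'"]) (auto simp: coeff_mult intro!: Psum P(4))
   qed
  qed
  ultimately have new: "1 \<notin> J ==> W \<times> {False} \<union> J \<times> {True} \<in> \<F>"
   using V(2,4) VW PJ by (auto simp: \<F>_def good_def rg_def idl_def)
  have "M \<subseteq> W \<times> {False} \<union> J \<times> {True}"
  proof
   fix u assume u: "u \<in> M"
   obtain a t where at: "u = (a, t)" by (cases u)
   then show "u \<in> W \<times> {False} \<union> J \<times> {True}"
    using u VW[of a] PJ[of a] by (cases t) (auto simp: V_def P_def rg_def idl_def)
  qed
  \<comment> \<open>By maximality the enlarged pair is the old one unless the enlarged ideal
    contains 1; but \<open>z\<close> is a new element.\<close>
  then have "1 \<notin> J ==> W \<times> {False} \<union> J \<times> {True} = M" using max new by blast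
  then have "1 \<notin> J ==> W = V" by (auto simp: V_def rg_def)
  then have "1 \<in> J" using \<open>z \<in> W\<close> z by blast
  then obtain q where "poly q z = 1" "\<forall>i. poly.coeff q i \<in> P" unfolding J_def by force
  then show ?thesis unfolding rel_def by (intro exI[of _ "degree q"] exI[of _ "poly.coeff q"]) (simp add: poly_altdef)
 qed
 \<comment> \<open>Two relations for \<open>z\<close> and \<open>1/z\<close> yield one of smaller degree.\<close>
 have reduce: False if n: "rel z n" "rel (inverse z) l" "l \<le> n" "\<And>j. rel z j ==> n \<le> j" and z0: "z ~= 0" for z n l
 proof -
  obtain u where u: "\<forall>i\<le>n. u i \<in> P" "(\<Sum>i\<le>n. u i * z ^ i) = 1" using n(1) by (auto simp: rel_def)
  obtain v where v: "\<forall>i\<le>l. v i \<in> P" "(\<Sum>i\<le>l. v i * inverse z ^ i) = 1" using n(2) by (auto simp: rel_def)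
  have n0: "n ~= 0"
  proof
   assume "n = 0"
   then have "u 0 = 1" using u(2) by simp
   then show False using u(1) V(5) by auto
  qed
  have "{..l} = insert 0 {1..l}" by auto
  then have v1: "1 - v 0 = (\<Sum>i\<in>{1..l}. v i * inverse z ^ i)" using v(2) by (simp add: algebra_simps)
  have zn: "(1 - v 0) * z ^ n = (\<Sum>i\<in>{1..l}. v i * z ^ (n - i))" unfolding v1 sum_distrib_right
  proof (intro sum.cong refl)
   fix i assume "i \<in> {1..l}"
   then have "z ^ n = z ^ (n - i) * z ^ i" using n(3) by (simp add: power_add[symmetric])
   then show "v i * inverse z ^ i * z ^ n = v i * z ^ (n - i)" using z0 by (simp add: power_inverse)
  qed
  \<comment> \<open>The top term is eliminated: \<open>(1 - v 0) * z ^ n\<close> is a combination of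
    lower powers, so the relation for \<open>z\<close> is multiplied by \<open>1 - v 0\<close>, and
    \<open>v 0\<close> is added back to keep the value 1.\<close>
  define u' where "u' j = (if j = 0 then v 0 else 0) + (1 - v 0) * u j + (if n - l \<le> j then u n * v (n - j) else 0)" for j
  have "(\<Sum>j\<le>n - 1. u' j * z ^ j) = 1"
  proof -
   have "(\<Sum>j\<le>n - 1. u' j * z ^ j) = (\<Sum>j\<le>n - 1. (if j = 0 then v 0 else 0) * z ^ j) +
     (1 - v 0) * (\<Sum>j\<le>n - 1. u j * z ^ j) + (\<Sum>j\<le>n - 1. (if n - l \<le> j then u n * v (n - j) else 0) * z ^ j)"
    by (simp add: u'_def distrib_right sum.distrib sum_distrib_left mult.assoc)
   also have "(\<Sum>j\<le>n - 1. (if j = 0 then v 0 else 0) * z ^ j) = v 0"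
    by (simp add: if_distrib[of "%t. t * _"] cong: if_cong)
   also have "(\<Sum>j\<le>n - 1. (if n - l \<le> j then u n * v (n - j) else 0) * z ^ j) = (\<Sum>j\<in>{n - l..n - 1}. u n * v (n - j) * z ^ j)"
    by (intro sum.mono_neutral_cong_right) auto
   also have "... = u n * ((1 - v 0) * z ^ n)" unfolding zn sum_distrib_left mult.assoc[symmetric]
    by (rule sum.reindex_bij_witness[of _ "%i. n - i" "%j. n - j"]) (use n(3) n0 in auto)
   also have "v 0 + (1 - v 0) * (\<Sum>j\<le>n - 1. u j * z ^ j) + u n * ((1 - v 0) * z ^ n) =
     v 0 + (1 - v 0) * ((\<Sum>j\<le>n - 1. u j * z ^ j) + u n * z ^ n)" by (simp add: algebra_simps)
   also have "(\<Sum>j\<le>n - 1. u j * z ^ j) + u n * z ^ n = (\<Sum>j\<le>n. u j * z ^ j)" using n0 by (cases n) auto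
   finally show ?thesis using u(2) by simp
  qed
  moreover have "\<forall>j\<le>n - 1. u' j \<in> P"
  proof (intro allI impI)
   fix j assume j: "j \<le> n - 1"
   have "u n * v (n - j) \<in> P" if "n - l \<le> j" using u(1) v(1) P(1,4) n(3) that by (intro P(4)) auto
   moreover have "(1 - v 0) * u j \<in> P"
    using u(1) v(1) P(1) j by (intro P(4) sring_diff[OF V(1)] sring_one[OF V(1)]) auto
   ultimately show "u' j \<in> P" using v(1) P(2) by (auto simp: u'_def intro!: P(3))
  qed
  ultimately have "rel z (n - 1)" unfolding rel_def by blast
  then show False using n(4)[of "n - 1"] n0 by simp
 qed
 have val: "z \<in> V | inverse z \<in> V" for z
 proof (rule ccontr)
  assume *: "\<not> ?thesis"
  define n l where "n = (LEAST n. rel z n)" and "l = (LEAST l. rel (inverse z) l)"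
  have n: "rel z n" "\<And>j. rel z j ==> n \<le> j" unfolding n_def using rel_ex[of z] * by (auto intro: LeastI_ex Least_le)
  have l: "rel (inverse z) l" "\<And>j. rel (inverse z) j ==> l \<le> j"
   unfolding l_def using rel_ex[of "inverse z"] * by (auto intro: LeastI_ex Least_le)
  have z0: "z ~= 0" using * sring_zero[OF V(1)] by auto
  show False using reduce[OF n(1) l(1) _ n(2) z0] reduce[of "inverse z" l n] n(1) l z0 by (cases "l \<le> n") auto
 qed
 have loc: "loc_ring V" by (rule valuation_loc_ring[OF V(1) val])
 have "max_ideal N \<subseteq> max_ideal V"
 proof
  fix z assume z: "z \<in> max_ideal N"
  have "inverse z \<notin> V" if "z ~= 0"
  proof
   assume "inverse z \<in> V"
   then have "inverse z * z \<in> P" using z V(4) P(4) by blast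
   then show False using V(5) that by simp
  qed
  then show "z \<in> max_ideal V" using z V(2) max_ideal_sub by (auto simp: max_ideal_def)
 qed
 then show ?thesis using loc V val by (intro exI[of _ V]) (auto simp: valuation_subring_def subring_iff_sring dominates_def)
qed

section \<open>Divisors of maps\<close>

context char_p_dvr
begin

text \<open>A common denominator \<open>b\<close> of the values on generators over
  \<open>p ^ e\<close>-th powers is put in as \<open>b ^ (p ^ e)\<close> and leaves the map as
  \<open>b\<close>; so some multiplier preserves \<open>R\<close>.\<close>

lemma hom_level_ex_F_finite:
 assumes ff: "F_finite R" and lin: "p_inv_linear e \<psi>" and nz: "\<psi> x0 ~= 0"
 shows "\<exists>m. hom_level e \<psi> m"
proof -
 from F_finite_iter[OF R ff, of e]
 obtain S where S: "finite S" "S \<subseteq> R" "\<forall>x\<in>R. \<exists>c. (\<forall>s\<in>S. c s \<in> R) & x = (\<Sum>s\<in>S. c s ^ (p ^ e) * s)"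
  by (elim exE conjE) (rule that)
 obtain b where b: "b \<in> R" "b ~= 0" "\<forall>s\<in>S. b * \<psi> s \<in> R" using common_denominator[OF R fr S(1), of \<psi>] by blast
 have add: "\<psi> (x + y) = \<psi> x + \<psi> y" and smult: "\<psi> (a ^ (p ^ e) * x) = a * \<psi> x" for a x y
  using lin by (auto simp: p_inv_linear_iff)
 have \<psi>0: "\<psi> 0 = 0" using smult[of 0 0] by simp
 have \<psi>s: "\<psi> (sum f I) = (\<Sum>i\<in>I. \<psi> (f i))" for f :: "'a => 'a" and I
  by (induction I rule: infinite_finite_induct) (auto simp: add \<psi>0)
 have "\<psi> (b ^ (p ^ e) * x) \<in> R" if x: "x \<in> R" for x
 proof -
  obtain c where c: "\<forall>s\<in>S. c s \<in> R" "x = (\<Sum>s\<in>S. c s ^ (p ^ e) * s)" using S(3) x by blast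
  have "\<psi> (b ^ (p ^ e) * x) = (\<Sum>s\<in>S. c s * (b * \<psi> s))"
   unfolding smult unfolding c(2) \<psi>s smult by (simp add: sum_distrib_left mult.left_commute)
  also have "... \<in> R" using c(1) b(3) by (intro sring_sum[OF R]) (blast intro: sring_mult[OF R])
  finally show ?thesis .
 qed
 then show ?thesis using b(2) by (intro hom_level_ex[OF lin nz, of "b ^ (p ^ e)"]) auto
qed

end

locale phi_loc = nscheme p ty \<A> for p and ty :: "'a::field itself" and \<A> :: "'a set set" +
 fixes \<omega> :: "'a topform" and \<Delta> :: "'a wdiv" and e :: nat and \<phi> :: "'a => 'a"
 assumes \<omega>: "rational_form \<omega>" and e0: "e > 0"
  and ix: "index_divides \<A> \<omega> \<Delta> e" and ph: "phi_map \<A> \<omega> \<Delta> e \<phi>"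
begin

lemma q_gt_1: "p ^ e > 1" by (rule one_less_power[OF _ e0]) (use p_gt_1 in simp)

definition qm :: nat where
 "qm = p ^ e - 1"

lemma real_q: "real qm = real (p ^ e) - 1"
 unfolding qm_def using q_gt_1 by (simp only: of_nat_diff less_imp_le of_nat_1)

lemma real_q_pos: "real qm > 0" unfolding qm_def using q_gt_1 by (simp only: of_nat_0_less_iff zero_less_diff)

text \<open>A local equation of \<open>qm\<close> times K + \<open>\<Delta>\<close>; equivalently,
  \<open>h\<close> generates the stalk of the line bundle at a point \<open>N\<close>
  (\<open>L_stalk_eq\<close>, \<open>L_stalk_generator\<close>).\<close>

definition leq :: "'a set => 'a => bool" where
 "leq N h \<longleftrightarrow> h ~= 0 & (\<forall>R\<in>prime_divisors \<A>. N \<subseteq> R --> real qm * log_div \<omega> \<Delta> R = real_of_int (ord_at R h))"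

lemma leq_ex: "N \<in> points \<A> ==> \<exists>h. leq N h"
 using ix unfolding index_divides_def Cartier_def local_eq_def leq_def char_p real_q by blast

lemma leq_gen: "leq N h ==> N \<subseteq> M ==> leq M h" unfolding leq_def by blast

lemma leq_nz: "leq N h ==> h ~= 0" by (simp add: leq_def)

lemma leq_unit:
 assumes N: "N \<in> points \<A>" and h: "leq N h" "leq N h'"
 shows "unit_in N (h' / h)"
proof -
 have nz: "h ~= 0" "h' ~= 0" using h by (auto simp: leq_def)
 have "ord_at R (h' / h) = 0" if R: "R \<in> prime_divisors \<A>" "N \<subseteq> R" for R
 proof -
  have "real_of_int (ord_at R h) = real_of_int (ord_at R h')" using h R by (auto simp: leq_def)
  then show ?thesis using dvr_loc.ord_divide[OF pd_loc[OF R(1)] nz(2,1)] by simp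
 qed
 then show ?thesis using unit_point_iff[OF N, of "h' / h"] nz by simp
qed

lemma L_stalk_eq:
 assumes N: "N \<in> points \<A>" and h: "leq N h"
 shows "L_stalk \<A> \<omega> \<Delta> e N = (%x. h * x) ` N"
proof (intro equalityI subsetI)
 have h0: "h ~= 0" using h by (simp add: leq_def)
 have iff: "f \<in> L_stalk \<A> \<omega> \<Delta> e N \<longleftrightarrow> f / h \<in> N" if f: "f ~= 0" for f
 proof -
  have "0 \<le> real_of_int (ord_at R f) + (1 - real (p ^ e)) * log_div \<omega> \<Delta> R \<longleftrightarrow> 0 \<le> ord_at R (f / h)"
   if R: "R \<in> prime_divisors \<A>" "N \<subseteq> R" for R
  proof -
   have "real_of_int (ord_at R h) = (real (p ^ e) - 1) * log_div \<omega> \<Delta> R" using h R by (simp only: leq_def real_q)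
   then have "real_of_int (ord_at R f) + (1 - real (p ^ e)) * log_div \<omega> \<Delta> R = real_of_int (ord_at R (f / h))"
    using dvr_loc.ord_divide[OF pd_loc[OF R(1)] f h0] by (simp add: algebra_simps)
   then show ?thesis by simp
  qed
  then show ?thesis unfolding L_stalk_def sheaf_stalk_def char_p using f h0 mem_point_iff[OF N, of "f / h"] by auto
 qed
 fix f
 show "f \<in> (%x. h * x) ` N" if fL: "f \<in> L_stalk \<A> \<omega> \<Delta> e N"
 proof (cases "f = 0")
  case True
  then show ?thesis using sring_zero[OF point_props(2)[OF N]] by force
 next
  case False
  then have "f = h * (f / h)" "f / h \<in> N" using iff fL h0 by auto
  then show ?thesis by blast
 qed
 show "f \<in> L_stalk \<A> \<omega> \<Delta> e N" if fN: "f \<in> (%x. h * x) ` N"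
 proof (cases "f = 0")
  case True
  then show ?thesis by (simp add: L_stalk_def sheaf_stalk_def)
 next
  case False
  then show ?thesis using iff fN h0 by auto
 qed
qed

lemma L_stalk_generator:
 assumes N: "N \<in> points \<A>" and h: "leq N h" and g: "g ~= 0" "L_stalk \<A> \<omega> \<Delta> e N = (%x. g * x) ` N"
 shows "unit_in N (g / h)"
proof -
 note S = sring_one[OF point_props(2)[OF N]]
 have h0: "h ~= 0" using h by (simp add: leq_def)
 have eq: "(%x. g * x) ` N = (%x. h * x) ` N" using g(2) L_stalk_eq[OF N h] by simp
 have gh: "g * 1 \<in> (%x. h * x) ` N" "h * 1 \<in> (%x. g * x) ` N" using S eq by blast+
 obtain x where x: "g = h * x" "x \<in> N" using gh(1) by auto
 obtain y where y: "h = g * y" "y \<in> N" using gh(2) by auto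
 have "g / h = x" by (subst x(1)) (use h0 in simp)
 moreover have "h / g = y" by (subst y(1)) (use g(1) in simp)
 ultimately have "g / h \<in> N" "h / g \<in> N" using x(2) y(2) by simp_all
 then show ?thesis using h0 g(1) by (simp add: unit_in_def)
qed

lemma universal_phi: "universal e \<phi>"
proof -
 have lin: "p_inv_linear e \<phi>" and nz: "\<exists>x. \<phi> x ~= 0" using ph by (auto simp: phi_map_def)
 then show ?thesis unfolding universal_def using universal_of_nonzero[OF F_finite_K lin] by blast
qed

text \<open>
 \<open>\<phi>\<close> and the Cartier operator of \<open>\<omega>\<close>, both regarded as maps on \<open>\<L>\<close>, have the same divisor \<open>\<Delta>\<close>.
\<close>

lemma phi_cartier: "\<exists>w. (\<forall>x. \<phi> x = (cartier \<omega> ^^ e) (w * x)) & (\<forall>N\<in>points \<A>. unit_in N w)"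
 and phi_level: "R \<in> prime_divisors \<A> ==> char_p_dvr.hom_level R e \<phi> (int qm * form_ord \<omega> R)"
proof -
 have lin: "p_inv_linear e \<phi>" and nz: "\<exists>x. \<phi> x ~= 0" using ph by (auto simp: phi_map_def)
 obtain w where w: "\<And>x. \<phi> x = (cartier \<omega> ^^ e) (w * x)" 
  using universal_of_nonzero[OF F_finite_K cartier_linear[OF \<omega>] _ lin] cartier_iter_nonzero[OF \<omega>] by blast
 have w0: "w ~= 0"
 proof
  assume "w = 0"
  then have "\<phi> x = \<phi> 0" for x using w by simp
  moreover have "\<phi> 0 = 0" using lin by (auto simp: p_inv_linear_iff dest: spec[of _ 0])
  ultimately show False using nz by simp
 qed
 have zs: "p_basis UNIV (snd \<omega>)" using \<omega> by (simp add: rational_form_def)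
 have *: "ord_at R w = 0" "char_p_dvr.hom_level R e \<phi> (int qm * form_ord \<omega> R)"
  if R: "R \<in> prime_divisors \<A>" for R
 proof -
  interpret d: char_p_dvr p ty R by (rule pd_char_p_dvr[OF R])
  let ?m = "int qm * form_ord \<omega> R"
  obtain ys where ys: "p_basis R ys" using d.p_basis_ex[OF point_props(5)[OF pd_point[OF R]] zs] by blast
  have \<phi>: "\<phi> = (%x. (cartier \<omega> ^^ e) (w * x))" using w by blast
  have lev: "d.hom_level e \<phi> (?m - ord_at R w)"
   unfolding \<phi> qm_def by (rule d.hom_level_scale[OF d.cartier_level[OF \<omega> ys] w0])
  obtain h where h: "leq R h" using leq_ex[OF pd_point[OF R]] by blast
  have "map_divisor e (L_stalk \<A> \<omega> \<Delta> e R) R \<phi> = \<Delta> R" using ph R by (simp add: phi_map_def)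
  then have "real_of_int (map_order e ((%x. h * x) ` R) R \<phi>) / real qm = \<Delta> R"
   by (simp only: map_divisor_def char_p real_q L_stalk_eq[OF pd_point[OF R] h])
  then have "real_of_int (ord_at R h - (?m - ord_at R w)) = real qm * \<Delta> R"
   unfolding d.map_order_eq[OF universal_phi lev leq_nz[OF h]] using real_q_pos by (simp add: field_simps)
  moreover have "real_of_int (ord_at R h) = real qm * (real_of_int (form_ord \<omega> R) + \<Delta> R)"
   using h R by (simp add: leq_def log_div_def)
  ultimately have "real_of_int (ord_at R w) = 0" by (simp add: algebra_simps)
  then show "ord_at R w = 0" by simp
  then show "d.hom_level e \<phi> ?m" using lev by simp
 qed
 then show "R \<in> prime_divisors \<A> ==> char_p_dvr.hom_level R e \<phi> (int qm * form_ord \<omega> R)" by blast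
 have "unit_in N w" if "N \<in> points \<A>" for N using unit_point_iff[OF that w0] *(1) by blast
 then show "\<exists>w. (\<forall>x. \<phi> x = (cartier \<omega> ^^ e) (w * x)) & (\<forall>N\<in>points \<A>. unit_in N w)"
  using w by (intro exI[of _ w]) simp
qed

text \<open>Membership is tested at divisors, where effectivity of \<open>\<Delta>\<close> makes the
  order of \<open>h\<close> at least the level of \<open>\<phi>\<close>.\<close>

lemma phi_mem:
 assumes eff: "\<And>R. R \<in> prime_divisors \<A> ==> 0 \<le> \<Delta> R"
  and N: "N \<in> points \<A>" and h: "leq N h" and x: "x \<in> N"
 shows "\<phi> (h * x) \<in> N"
proof (rule ccontr)
 assume "\<phi> (h * x) \<notin> N"
 then obtain R where R: "R \<in> prime_divisors \<A>" "N \<subseteq> R" "\<phi> (h * x) \<notin> R" using pd_ex[OF N] by blast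
 interpret d: char_p_dvr p ty R by (rule pd_char_p_dvr[OF R(1)])
 have "real_of_int (ord_at R h) = real qm * (real_of_int (form_ord \<omega> R) + \<Delta> R)"
  using h R by (simp add: leq_def log_div_def)
 moreover have "0 \<le> real qm * \<Delta> R" using eff[OF R(1)] real_q_pos by simp
 ultimately have "real_of_int (int qm * form_ord \<omega> R) \<le> real_of_int (ord_at R h)" by (simp add: distrib_left)
 then have "int qm * form_ord \<omega> R \<le> ord_at R h" by (simp only: of_int_le_iff)
 then have "\<phi> (h * x) \<in> R" using phi_level[OF R(1)] leq_nz[OF h] x R(2) unfolding d.hom_level_def by blast
 then show False using R(3) by simp
qed

text \<open>The center of \<open>R\<close> is a generization of \<open>N\<close>, because elements
  inverted in \<open>N\<close> are units in \<open>R\<close>. So \<open>h\<close> is also a local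
  equation at the center and computes the pull-back.\<close>

lemma log_div_crepant:
 assumes R: "dvr R" and N: "N \<in> points \<A>" "N \<subseteq> R" and h: "leq N h"
 shows "real qm * log_div \<omega> (crepant \<A> \<omega> \<Delta>) R = real_of_int (ord_at R h)"
proof -
 obtain A where A: "A \<in> \<A>" "is_loc A N" using point_chart[OF N(1)] by blast
 note rA = chart(4)[OF A(1)] and locR = dvr_loc_ring[OF R]
 have AR: "A \<subseteq> R" using A(2) N(2) by (auto simp: is_loc_def)
 let ?M = "center A R"
 note M = center_props(1,2)[OF rA locR AR]
 have "N \<subseteq> ?M"
 proof
  fix x assume "x \<in> N"
  then obtain s where s: "s \<in> A" "unit_in N s" "x * s \<in> A" using A(2) by (auto simp: is_loc_def)
  have "unit_in R s" by (rule unit_mono[OF s(2) N(2)])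
  moreover have AM: "A \<subseteq> ?M" using M(1) by (simp add: is_loc_def)
  ultimately have "inverse s \<in> ?M" using dominates_unit[OF M(2), of s] s(1) by (auto simp: unit_in_def)
  then have "x * s * inverse s \<in> ?M" using s(3) AM by (intro sring_mult[OF is_loc_sring[OF M(1)], of "x * s"]) auto
  moreover have "x * s * inverse s = x" using s(2) by (simp add: unit_in_def)
  ultimately show "x \<in> ?M" by simp
 qed
 then have hM: "leq ?M h" by (rule leq_gen[OF h])
 have Mp: "?M \<in> points \<A>" using M(1) A(1) points_glued[OF gl] by blast
 have fid: "fhom (id :: 'a => 'a)" by (simp add: fhom_def)
 have "local_R_eq \<A> (log_div \<omega> \<Delta>) ?M [(1 / real qm, h)]"
  using hM real_q_pos by (auto simp: local_R_eq_def leq_def field_simps)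
 then have "pullback id \<A> (log_div \<omega> \<Delta>) R = 1 / real qm * real_of_int (ord_at R h)"
  using pullback_eq[OF Mp fid R] M(2) by simp
 then show ?thesis using real_q_pos by (simp add: log_div_def crepant_def)
qed

text \<open>F-purity gives surjectivity for divisible exponents only. If the map for
  \<open>e\<close> sent \<open>g * M\<close> into the maximal ideal, so would its iterates; but the
  iterate for \<open>e * e0'\<close> is, up to a unit, a map that attains 1.\<close>

lemma F_pure_nonzero:
 assumes pure: "F_pure \<A> \<omega> \<Delta>" and M: "M \<in> points \<A>" and g: "leq M g"
 shows "\<exists>x\<in>M. \<phi> (g * x) \<notin> max_ideal M"
proof (rule ccontr)
 assume no: "\<not> ?thesis"
 note S = point_props(2)[OF M]
 obtain w where w: "\<And>x. \<phi> x = (cartier \<omega> ^^ e) (w * x)" "\<forall>N\<in>points \<A>. unit_in N w" using phi_cartier by blast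
 then have wM: "unit_in M w" using M by blast
 let ?C = "cartier \<omega> ^^ e"
 have C: "?C (g * z) \<in> max_ideal M" if "z \<in> M" for z
 proof -
  have "w * (g * (z * inverse w)) = g * z" using wM by (simp add: unit_in_def)
  then have "?C (g * z) = \<phi> (g * (z * inverse w))" unfolding w(1)[of "g * (z * inverse w)"] by (simp only:)
  moreover have "z * inverse w \<in> M" using that wM S by (simp add: unit_in_def sring_mult)
  ultimately show ?thesis using no by auto
 qed
 have linC: "?C (a ^ (p ^ e) * x) = a * ?C x" for a x using cartier_linear[OF \<omega>, of e] by (simp add: p_inv_linear_iff)
 \<comment> \<open>The exponent \<open>1 + q + ... + q ^ (n - 1)\<close> for
   \<open>q = p ^ e\<close> counts the copies of \<open>g\<close> collected in \<open>n\<close>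
   iterations. As \<open>q ^ n - 1 = (q - 1) * s n\<close>, the power \<open>g ^ s e0'\<close>
   generates the line bundle at \<open>M\<close> for the exponent \<open>e * e0'\<close>.\<close>
 define s where "s n = (\<Sum>i<n. (p ^ e) ^ i)" for n :: nat
 have sSuc: "s (Suc n) = 1 + p ^ e * s n" for n
  unfolding s_def sum.lessThan_Suc_shift by (simp add: sum_distrib_left)
 have step: "(?C ^^ Suc n) (g ^ s (Suc n) * z) = (?C ^^ n) (g ^ s n * ?C (g * z))" for n z
 proof -
  have "g ^ s (Suc n) * z = (g ^ s n) ^ (p ^ e) * (g * z)"
   unfolding sSuc by (simp add: power_add power_mult[symmetric] mult_ac)
  then show ?thesis by (simp only: funpow_Suc_right o_apply linC)
 qed
 have iter: "(?C ^^ n) (g ^ s n * z) \<in> max_ideal M" if "z \<in> max_ideal M" for n z using that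
 proof (induction n arbitrary: z)
  case 0
  then show ?case by (simp add: s_def)
 next
  case (Suc n)
  have "?C (g * z) \<in> max_ideal M" using C Suc.prems max_ideal_sub by blast
  then show ?case unfolding step by (rule Suc.IH)
 qed
 obtain e0' where e0': "e0' > 0" "\<And>e'. e' > 0 ==> e0' dvd e' ==> index_divides \<A> \<omega> \<Delta> e' &
   (\<exists>\<phi>. phi_map \<A> \<omega> \<Delta> e' \<phi> & (\<forall>N\<in>points \<A>. N \<subseteq> \<phi> ` L_stalk \<A> \<omega> \<Delta> e' N))"
  using pure unfolding F_pure_def sub_F_pure_def by meson
 define e' where "e' = e * e0'"
 have "e' > 0" "e0' dvd e'" using e0 e0' by (auto simp: e'_def)
 then obtain \<phi>' where \<phi>': "index_divides \<A> \<omega> \<Delta> e'" "phi_map \<A> \<omega> \<Delta> e' \<phi>'" "\<forall>N\<in>points \<A>. N \<subseteq> \<phi>' ` L_stalk \<A> \<omega> \<Delta> e' N"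
  using e0'(2)[of e'] by blast
 interpret F: phi_loc p ty \<A> \<omega> \<Delta> e' \<phi>' by unfold_locales (use \<omega> \<open>e' > 0\<close> \<phi>' in auto)
 have geo: "int F.qm = int qm * int (s e0')"
 proof -
  have "(p ^ e) ^ n = qm * s n + 1" for n
  proof (induction n)
   case (Suc n)
   have "qm * s (Suc n) + 1 = p ^ e * (qm * s n) + qm + 1"
    unfolding sSuc by (simp only: distrib_left mult_1_right mult.left_commute add.commute)
   also have "... = p ^ e * (qm * s n) + p ^ e" using q_gt_1 by (simp add: qm_def)
   also have "... = p ^ e * (qm * s n + 1)" by (simp only: distrib_left mult_1_right)
   finally show ?case using Suc by simp
  qed (simp add: s_def)
  then have "F.qm = qm * s e0'" unfolding F.qm_def unfolding e'_def power_mult by simp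
  then show ?thesis by (simp only: of_nat_mult)
 qed
 have "F.leq M (g ^ s e0')" unfolding F.leq_def
 proof (intro conjI ballI impI)
  show "g ^ s e0' ~= 0" using leq_nz[OF g] by simp
  fix R assume R: "R \<in> prime_divisors \<A>" "M \<subseteq> R"
  have "real F.qm = real qm * real (s e0')"
   using arg_cong[OF geo, of real_of_int] by (simp only: of_int_mult of_int_of_nat_eq)
  moreover have "real qm * log_div \<omega> \<Delta> R = real_of_int (ord_at R g)" using g R by (simp add: leq_def)
  moreover have "ord_at R (g ^ s e0') = int (s e0') * ord_at R g"
   by (rule dvr_loc.ord_power[OF pd_loc[OF R(1)] leq_nz[OF g]])
  ultimately show "real F.qm * log_div \<omega> \<Delta> R = real_of_int (ord_at R (g ^ s e0'))"
   by (simp only: of_int_mult of_int_of_nat_eq) (simp only: mult_ac)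
 qed
 note L = F.L_stalk_eq[OF M this]
 have "1 \<in> \<phi>' ` (%x. g ^ s e0' * x) ` M" using \<phi>'(3) M sring_one[OF S] unfolding L[symmetric] by blast
 then obtain x where x: "x \<in> M" "\<phi>' (g ^ s e0' * x) = 1" by auto
 obtain w' where w': "\<And>x. \<phi>' x = (cartier \<omega> ^^ e') (w' * x)" "\<forall>N\<in>points \<A>. unit_in N w'" using F.phi_cartier by blast
 then have "w' * x \<in> M" using M S x(1) by (auto simp: unit_in_def intro: sring_mult)
 obtain n where n: "e0' = Suc n" using e0'(1) by (cases e0') auto
 have "1 = (?C ^^ e0') (g ^ s e0' * (w' * x))"
  using x(2) w'(1)[of "g ^ s e0' * x"] by (simp add: e'_def funpow_mult mult_ac)
 also have "... \<in> max_ideal M" unfolding n step by (rule iter[OF C[OF \<open>w' * x \<in> M\<close>]])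
 finally show False using one_not_max[of M] by simp
qed

end

section \<open>Adjunction along a divisor over the center\<close>

locale adjunction = phi_loc p ty \<A> \<omega> \<Delta> e \<phi>
 for p and ty :: "'k::field itself" and \<A> \<omega> \<Delta> e \<phi> +
 fixes \<A>' :: "'k set set" and W :: "'k set" and rW :: "'k => 'w::field"
  and E :: "'k set" and rE :: "'k => 'e::field" and \<iota> :: "'w => 'e" and \<omega>E :: "'e topform"
 assumes Q_div: "Q_divisor \<A> \<Delta>" and pure: "F_pure \<A> \<omega> \<Delta>" and W: "W \<in> points \<A>" and rW: "residue_map W rW"
  and ns': "normal_scheme \<A>'" and pb: "proper_birational \<A>' \<A>"
  and E: "E \<in> prime_divisors \<A>'" and rE: "residue_map E rE"
  and nsE: "normal_scheme (subscheme \<A>' E rE)" and disc: "crepant \<A> \<omega> \<Delta> E = 1"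
  and over: "dominates E W" "\<forall>x\<in>W. \<iota> (rW x) = rE x" and \<omega>E: "rational_form \<omega>E"
begin

abbreviation \<E> :: "'e set set" where
 "\<E> \<equiv> subscheme \<A>' E rE"

abbreviation \<W> :: "'w set set" where
 "\<W> \<equiv> scheme_normalization (subscheme \<A> W rW)"

abbreviation \<Delta>' :: "'k wdiv" where
 "\<Delta>' \<equiv> crepant \<A> \<omega> \<Delta>"

sublocale K': nscheme p ty \<A>' by unfold_locales (rule ns')

sublocale Ed: char_p_dvr p ty E by (rule K'.pd_char_p_dvr[OF E])

lemmas SE = Ed.R and locE = dvr_loc_ring[OF Ed.dvr] and SW = point_props(2)[OF W] and locW = point_props(1)[OF W]

sublocale EE: nscheme p "TYPE('e)" \<E> by (intro nscheme.intro nscheme_axioms.intro char_p_residue[OF SE rE] nsE)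

sublocale WW: nscheme p "TYPE('w)" \<W>
proof -
 interpret w: char_p p "TYPE('w)" by (rule char_p_residue[OF SW rW])
 show "nscheme p \<W>"
  by (intro nscheme.intro nscheme_axioms.intro w.char_p_axioms w.ff_scheme_normalization ff_scheme_subscheme[OF ff W rW])
qed

text \<open>Surjectivity of \<open>rW\<close> and compatibility with both residue maps force
  \<open>\<iota>\<close> to be a homomorphism.\<close>

lemma iota: "fhom \<iota>"
proof -
 have *: "\<exists>x\<in>W. rW x = y" for y using res_surj[OF SW rW] by blast
 have WE: "W \<subseteq> E" using over(1) by (simp add: dominates_def)
 have "\<iota> (a + b) = \<iota> a + \<iota> b & \<iota> (a * b) = \<iota> a * \<iota> b" for a b
 proof -
  obtain x y where xy: "x \<in> W" "rW x = a" "y \<in> W" "rW y = b" using *[of a] *[of b] by blast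
  then have E': "x \<in> E" "y \<in> E" using WE by auto
  have "\<iota> a = rE x" "\<iota> b = rE y" using over(2) xy by auto
  moreover have "\<iota> (a + b) = rE (x + y)" "\<iota> (a * b) = rE (x * y)"
   using over(2) xy res_add[OF SW rW xy(1,3)] res_mult[OF SW rW xy(1,3)] sring_add[OF SW xy(1,3)] sring_mult[OF SW xy(1,3)]
   by metis+
  ultimately show ?thesis using res_add[OF SE rE E'] res_mult[OF SE rE E'] by simp
 qed
 moreover have "\<iota> 1 = 1" using over(2) sring_one[OF SW] res_one[OF SW rW] res_one[OF SE rE] by metis
 ultimately show ?thesis by (simp add: fhom_def)
qed

lemma WE: "W \<subseteq> E" using over(1) by (simp add: dominates_def)

lemma iota_res: "x \<in> W ==> \<iota> (rW x) = rE x" using over(2) by blast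

lemma eff: "R \<in> prime_divisors \<A> ==> 0 \<le> \<Delta> R" using pure by (simp add: F_pure_def)

lemma unit_W_E: "x \<in> W ==> unit_in E x \<longleftrightarrow> unit_in W x" by (rule dominates_unit[OF over(1)])

end

text \<open>Choices made once: \<open>g\<close> trivializes the line bundle at the generic point of
  the center, \<open>w\<close> compares \<open>\<phi>\<close> with the Cartier operator of
  \<open>\<omega>\<close>, and \<open>t # ys\<close> are coordinates adapted to
  \<open>E\<close>.\<close>

locale adjunction_data = adjunction p ty \<A> \<omega> \<Delta> e \<phi> \<A>' W rW E rE \<iota> \<omega>E
 for p and ty :: "'k::field itself" and \<A> \<omega> \<Delta> e \<phi> \<A>' W and rW :: "'k => 'w::field" and E
  and rE :: "'k => 'e::field" and \<iota> \<omega>E +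
 fixes g w t :: 'k and ys :: "'k list"
 assumes g: "leq W g" and w: "\<And>x. \<phi> x = (cartier \<omega> ^^ e) (w * x)" "\<And>N. N \<in> points \<A> ==> unit_in N w"
  and t: "uniformizer E t" and ys: "p_basis E (t # ys)"
begin

text \<open>The coefficient of \<open>\<omega>\<close> with respect to dt/t and the differentials of
  \<open>ys\<close>; its order at \<open>E\<close> is therefore one more than that of
  \<open>\<omega>\<close>.\<close>

definition \<theta> :: 'k where
 "\<theta> = t * form_coeff \<omega> (t # ys)"

definition vs :: "'e list" where
 "vs = map rE ys"

text \<open>Compares \<open>g\<close> with the logarithmic form. It is a unit at \<open>E\<close>
  because the crepant divisor has coefficient 1 there (\<open>unit_mu\<close>).\<close>

definition \<mu> :: 'k where
 "\<mu> = g / \<theta> ^ qm"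

definition \<kappa> :: 'e where
 "\<kappa> = rE (w * \<mu>)"

lemma theta_any:
 assumes "uniformizer E s" "p_basis E (s # zs)"
 shows "s * form_coeff \<omega> (s # zs) ~= 0" "ord_at E (s * form_coeff \<omega> (s # zs)) = 1 + form_ord \<omega> E"
proof -
 have s: "s ~= 0" "ord_at E s = 1" using assms(1) Ed.uniformizer_iff by auto
 have f: "form_coeff \<omega> (s # zs) ~= 0" by (rule form_coeff_nz[OF \<omega> p_basis_field[OF SE Ed.fr assms(2)]])
 show "s * form_coeff \<omega> (s # zs) ~= 0" using s f by simp
 show "ord_at E (s * form_coeff \<omega> (s # zs)) = 1 + form_ord \<omega> E"
  using Ed.ord_mult[OF s(1) f] s(2) Ed.form_ord_eq[OF \<omega> assms(2)] by simp
qed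

lemmas theta = theta_any[OF t ys, folded \<theta>_def]

lemma log_div_E: "log_div \<omega> \<Delta>' E = real_of_int (1 + form_ord \<omega> E)" using disc by (simp add: log_div_def)

lemma ord_leq_E:
 assumes "N \<in> points \<A>" "N \<subseteq> E" "leq N h"
 shows "ord_at E h = int qm * (1 + form_ord \<omega> E)"
proof -
 have "real_of_int (ord_at E h) = real_of_int (int qm * (1 + form_ord \<omega> E))"
  using log_div_crepant[OF Ed.dvr assms] unfolding log_div_E by simp
 then show ?thesis by (simp only: of_int_eq_iff)
qed

lemma unit_theta:
 assumes "N \<in> points \<A>" "N \<subseteq> E" "leq N h"
 shows "unit_in E (h / \<theta> ^ qm)"
proof -
 have nz: "h ~= 0" "\<theta> ^ qm ~= 0" using leq_nz[OF assms(3)] theta(1) by auto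
 then have "ord_at E (h / \<theta> ^ qm) = 0"
  using Ed.ord_divide[OF nz] Ed.ord_power[OF theta(1)] theta(2) ord_leq_E[OF assms] by simp
 then show ?thesis using Ed.unit_iff[of "h / \<theta> ^ qm"] nz by simp
qed

lemma unit_mu: "unit_in E \<mu>" unfolding \<mu>_def by (rule unit_theta[OF W WE g])

lemma unit_w: "unit_in W w" "unit_in E w" using w(2)[OF W] unit_mono[OF _ WE] by auto

text \<open>The restriction of \<open>\<phi> (g * _)\<close> to \<open>E\<close>, by
  \<open>phi_E\<close>: residues remove the pole of the logarithmic form, and
  \<open>\<kappa>\<close> records the remaining twist.\<close>

definition \<phi>E :: "'e => 'e" where
 "\<phi>E y = (car vs ^^ e) (\<kappa> * y)"

lemma vs_basis: "p_basis UNIV vs" unfolding vs_def by (rule Ed.p_basis_residue[OF t ys rE])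

lemma phi_E:
 assumes x: "x \<in> E"
 shows "\<phi> (g * x) \<in> E" "rE (\<phi> (g * x)) = \<phi>E (rE x)"
proof -
 have wm: "w * \<mu> \<in> E" using unit_in_mult[OF SE unit_w(2) unit_mu] by (simp add: unit_in_def)
 then have wx: "w * \<mu> * x \<in> E" using x SE by (intro sring_mult[OF SE, of "w * \<mu>"])
 have "\<theta> ^ qm * (w * \<mu> * x) = w * (g * x)" using theta(1) by (simp add: \<mu>_def field_simps)
 then have eq: "\<phi> (g * x) = (cartier \<omega> ^^ e) (\<theta> ^ qm * (w * \<mu> * x))" by (simp only: w(1))
 show "\<phi> (g * x) \<in> E" unfolding eq \<theta>_def qm_def by (rule Ed.cartier_residue(1)[OF \<omega> t ys rE wx])
 have "rE (\<phi> (g * x)) = (car vs ^^ e) (rE (w * \<mu> * x))"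
  unfolding eq \<theta>_def qm_def vs_def by (rule Ed.cartier_residue(2)[OF \<omega> t ys rE wx])
 also have "rE (w * \<mu> * x) = \<kappa> * rE x" unfolding \<kappa>_def by (rule res_mult[OF SE rE wm x])
 finally show "rE (\<phi> (g * x)) = \<phi>E (rE x)" by (simp add: \<phi>E_def)
qed

lemma phi_W: "x \<in> W ==> \<phi> (g * x) \<in> W" by (rule phi_mem[OF eff W g])

text \<open>This is the compatibility of an F-pure center. An element of the maximal ideal of
  \<open>W\<close> vanishes on \<open>E\<close>, so its image does too; and an element of
  \<open>W\<close> vanishing on \<open>E\<close> is a nonunit of \<open>W\<close>, since
  \<open>E\<close> dominates \<open>W\<close>.\<close>

lemma phi_max_W:
 assumes x: "x \<in> max_ideal W"
 shows "\<phi> (g * x) \<in> max_ideal W"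
proof -
 have xW: "x \<in> W" and xE: "x \<in> max_ideal E" using x max_ideal_sub over(1) by (auto simp: dominates_def)
 have xE': "x \<in> E" using xE max_ideal_sub by blast
 have "\<phi>E 0 = 0" using EE.car_iter_smult[OF vs_basis, of e 0 0] EE.p_gt_0 by (simp add: \<phi>E_def)
 then have "rE (\<phi> (g * x)) = 0" using phi_E(2)[OF xE'] res_eq_0[OF SE rE xE'] xE by simp
 then have "\<phi> (g * x) \<in> max_ideal E" using res_eq_0[OF SE rE phi_E(1)[OF xE']] by simp
 then show ?thesis using unit_W_E[OF phi_W[OF xW]] unit_not_max unit_cases[OF phi_W[OF xW]] by blast
qed

lemma phi_add: "\<phi> (x + y) = \<phi> x + \<phi> y" and phi_smult: "\<phi> (a ^ (p ^ e) * x) = a * \<phi> x"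
 using ph by (auto simp: phi_map_def p_inv_linear_iff)

text \<open>Defined through an arbitrary lift; \<open>phi_max_W\<close> makes the result independent
  of it (\<open>psi\<close>).\<close>

definition \<psi> :: "'w => 'w" where
 "\<psi> y = rW (\<phi> (g * (SOME x. x \<in> W & rW x = y)))"

lemma psi:
 assumes x: "x \<in> W"
 shows "\<psi> (rW x) = rW (\<phi> (g * x))"
proof -
 define z where "z = (SOME z. z \<in> W & rW z = rW x)"
 have z: "z \<in> W" "rW z = rW x" using someI[of "%z. z \<in> W & rW z = rW x" x] x by (auto simp: z_def)
 have d: "x - z \<in> W" by (rule sring_diff[OF SW x z(1)])
 then have "x - z \<in> max_ideal W" using res_diff[OF SW rW x z(1)] z(2) res_eq_0[OF SW rW d] by simp
 then have "\<phi> (g * (x - z)) \<in> max_ideal W" by (rule phi_max_W)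
 then have "rW (\<phi> (g * (x - z))) = 0" using res_eq_0[OF SW rW phi_W[OF d]] by simp
 moreover have "\<phi> (g * x) = \<phi> (g * (x - z)) + \<phi> (g * z)" by (simp add: phi_add[symmetric] distrib_left[symmetric])
 ultimately have "rW (\<phi> (g * x)) = rW (\<phi> (g * z))" using res_add[OF SW rW phi_W[OF d] phi_W[OF z(1)]] by simp
 then show ?thesis by (simp add: \<psi>_def z_def)
qed

lemma W_surj: "\<exists>x\<in>W. rW x = y" using res_surj[OF SW rW] by blast

lemma psi_linear: "p_inv_linear e \<psi>" unfolding WW.p_inv_linear_iff
proof (intro conjI allI)
 fix a b
 obtain x y where xy: "x \<in> W" "rW x = a" "y \<in> W" "rW y = b" using W_surj[of a] W_surj[of b] by blast
 have "\<psi> (a + b) = rW (\<phi> (g * (x + y)))"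
  using psi[OF sring_add[OF SW xy(1,3)]] res_add[OF SW rW xy(1,3)] xy by simp
 also have "... = \<psi> a + \<psi> b"
  using psi[OF xy(1)] psi[OF xy(3)] res_add[OF SW rW phi_W[OF xy(1)] phi_W[OF xy(3)]] xy(2,4)
  by (simp add: distrib_left phi_add)
 finally show "\<psi> (a + b) = \<psi> a + \<psi> b" .
 have xq: "x ^ (p ^ e) \<in> W" by (rule sring_power[OF SW xy(1)])
 have "\<psi> (a ^ (p ^ e) * b) = rW (\<phi> (g * (x ^ (p ^ e) * y)))"
  using psi[OF sring_mult[OF SW xq xy(3)]] res_mult[OF SW rW xq xy(3)] res_power[OF SW rW xy(1)] xy by simp
 also have "g * (x ^ (p ^ e) * y) = x ^ (p ^ e) * (g * y)" by (simp add: mult_ac)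
 also have "rW (\<phi> (x ^ (p ^ e) * (g * y))) = a * \<psi> b"
  unfolding phi_smult using psi[OF xy(3)] res_mult[OF SW rW xy(1) phi_W[OF xy(3)]] xy by simp
 finally show "\<psi> (a ^ (p ^ e) * b) = a * \<psi> b" .
qed

lemma iota_psi: "\<iota> (\<psi> y) = \<phi>E (\<iota> y)"
proof -
 obtain x where x: "x \<in> W" "rW x = y" using W_surj by blast
 then have "\<iota> (\<psi> y) = rE (\<phi> (g * x))" using psi[OF x(1)] iota_res[OF phi_W[OF x(1)]] by simp
 also have "... = \<phi>E (\<iota> y)" using phi_E(2)[of x] WE x iota_res[OF x(1)] by auto
 finally show ?thesis .
qed

lemma psi_nz: "\<exists>y. \<psi> y ~= 0"
proof -
 obtain x where x: "x \<in> W" "\<phi> (g * x) \<notin> max_ideal W" using F_pure_nonzero[OF pure W g] by blast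
 then have "\<psi> (rW x) ~= 0" using psi[OF x(1)] res_eq_0[OF SW rW phi_W[OF x(1)]] by simp
 then show ?thesis by blast
qed

lemma psi_universal: "WW.universal e \<psi>" unfolding WW.universal_def
 using psi_linear psi_nz WW.universal_of_nonzero[OF WW.F_finite_K psi_linear] by blast

lemma psi_level:
 assumes Q: "Q \<in> prime_divisors \<W>"
 shows "\<exists>m. char_p_dvr.hom_level Q e \<psi> m"
proof -
 interpret q: char_p_dvr p "TYPE('w)" Q by (rule WW.pd_char_p_dvr[OF Q])
 obtain y where "\<psi> y ~= 0" using psi_nz by blast
 then show ?thesis by (rule q.hom_level_ex_F_finite[OF WW.point_props(5)[OF WW.pd_point[OF Q]] psi_linear])
qed

lemma W_chart:
 assumes P: "P \<in> points \<W>"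
 shows "\<exists>A\<in>\<A>. is_loc A W & is_loc (int_closure (rW ` A)) P"
proof -
 obtain C where C: "C \<in> \<W>" "is_loc C P" using WW.point_chart[OF P] by blast
 then obtain A where A: "A \<in> \<A>" "W \<in> Spec A" "C = int_closure (rW ` A)"
  by (auto simp: scheme_normalization_def subscheme_def)
 then show ?thesis using C(2) Spec_iff[OF chart(4)[OF A(1)]] by blast
qed

text \<open>Local rings of the residue field of \<open>W\<close> are brought to the base as centers
  of the composite \<open>res_pre\<close>.\<close>

lemma W_point_below:
 assumes A: "A \<in> \<A>" "is_loc A W" and P: "loc_ring P" "rW ` A \<subseteq> P"
 shows "is_loc A (center A (res_pre W rW P))" "center A (res_pre W rW P) \<in> points \<A>"
  "center A (res_pre W rW P) \<subseteq> W" "dominates P (rW ` center A (res_pre W rW P))"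
  "dominates (res_pre W rW P) (center A (res_pre W rW P))"
proof -
 have AW: "A \<subseteq> W" using A(2) by (simp add: is_loc_def)
 note c = res_center[OF locW rW chart(4)[OF A(1)] P(1) AW P(2)]
 note d = center_props(1,2)[OF chart(4)[OF A(1)] res_pre(1)[OF locW rW P(1)] c(1)]
 show "is_loc A (center A (res_pre W rW P))" "dominates (res_pre W rW P) (center A (res_pre W rW P))" using d by auto
 show "center A (res_pre W rW P) \<in> points \<A>" using d(1) A(1) points_glued[OF gl] by blast
 show "center A (res_pre W rW P) \<subseteq> W" by (rule c(3))
 show "dominates P (rW ` center A (res_pre W rW P))"
  using d by (intro res_pre_dominates(2)[OF locW rW P(1)]) (auto simp: is_loc_def)
qed

text \<open>Another generator at \<open>W\<close> rescales \<open>\<psi>\<close> by the residue of a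
  unit and shifts order and level alike; another generator at \<open>N\<close> changes the function
  by a unit at \<open>Q\<close>. So the definite description may be evaluated with the present
  data.\<close>

lemma F_different_eq:
 assumes Q: "Q \<in> prime_divisors \<W>" and N: "N \<in> points \<A>" "N \<subseteq> W" "dominates Q (rW ` N)" and h: "leq N h"
  and m: "char_p_dvr.hom_level Q e \<psi> m"
 shows "F_different \<A> \<omega> \<Delta> e \<phi> W rW Q = real_of_int (ord_at Q (rW (h / g)) - m) / real qm"
proof -
 interpret q: char_p_dvr p "TYPE('w)" Q by (rule WW.pd_char_p_dvr[OF Q])
 have hW: "leq W h" by (rule leq_gen[OF h N(2)])
 have hg: "unit_in W (h / g)" by (rule leq_unit[OF W g hW])
 have nz: "g ~= 0" "h ~= 0" using leq_nz g h by auto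
 have md: "map_divisor e ((%y. b * y) ` Q) Q \<psi>' = real_of_int (ord_at Q b - m') / real qm"
  if "WW.universal e \<psi>'" "q.hom_level e \<psi>' m'" "b ~= 0" for b \<psi>' m'
  unfolding map_divisor_def q.map_order_eq[OF that] WW.char_p real_q ..
 let ?P = "%c. \<exists>g \<psi> N h.
   g ~= 0 & L_stalk \<A> \<omega> \<Delta> e W = (%x. g * x) ` W &
   p_inv_linear e \<psi> & (\<forall>x\<in>W. \<phi> (g * x) \<in> W & \<psi> (rW x) = rW (\<phi> (g * x))) &
   N \<in> points \<A> & N \<subseteq> W & dominates Q (rW ` N) &
   h ~= 0 & L_stalk \<A> \<omega> \<Delta> e N = (%x. h * x) ` N &
   c = map_divisor e ((%y. rW (h / g) * y) ` Q) Q \<psi>"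
 have "(THE c. ?P c) = real_of_int (ord_at Q (rW (h / g)) - m) / real qm"
 proof (rule the_equality)
  have "real_of_int (ord_at Q (rW (h / g)) - m) / real qm = map_divisor e ((%y. rW (h / g) * y) ` Q) Q \<psi>"
   by (rule md[OF psi_universal m res_nz[OF SW rW hg], symmetric])
  moreover have "\<forall>x\<in>W. \<phi> (g * x) \<in> W & \<psi> (rW x) = rW (\<phi> (g * x))" using phi_W psi by blast
  ultimately show "?P (real_of_int (ord_at Q (rW (h / g)) - m) / real qm)"
   using nz L_stalk_eq[OF W g] psi_linear N L_stalk_eq[OF N(1) h]
   by (intro exI[of _ g] exI[of _ \<psi>] exI[of _ N] exI[of _ h] conjI)
  fix c assume "?P c"
  then obtain g' \<psi>' N' h' where g': "g' ~= 0" "L_stalk \<A> \<omega> \<Delta> e W = (%x. g' * x) ` W"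
   and \<psi>': "p_inv_linear e \<psi>'" "\<forall>x\<in>W. \<phi> (g' * x) \<in> W & \<psi>' (rW x) = rW (\<phi> (g' * x))"
   and N': "N' \<in> points \<A>" "N' \<subseteq> W" "dominates Q (rW ` N')"
   and h': "h' ~= 0" "L_stalk \<A> \<omega> \<Delta> e N' = (%x. h' * x) ` N'"
   and c: "c = map_divisor e ((%y. rW (h' / g') * y) ` Q) Q \<psi>'" by (elim exE conjE) (rule that)
  have locQ: "loc_ring Q" by (rule dvr_loc_ring[OF q.dvr])
  \<comment> \<open>Both candidates are dominated by the composite of \<open>W\<close> with
    \<open>Q\<close>.\<close>
  have "N' = N" by (rule center_unique[OF gl N'(1) N(1) res_pre(1)[OF locW rW locQ]
      dominates_res_pre[OF locW rW locQ points_loc_ring[OF gl N'(1)] N'(2,3)]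
      dominates_res_pre[OF locW rW locQ points_loc_ring[OF gl N(1)] N(2,3)]])
  then have vN: "unit_in N (h' / h)" using L_stalk_generator[OF N(1) h h'(1)] h'(2) by simp
  have uW: "unit_in W (g' / g)" by (rule L_stalk_generator[OF W g g'])
  have vW: "unit_in W (h' / h)" by (rule unit_mono[OF vN N(2)])
  let ?u = "rW (g' / g)"
  have u0: "?u ~= 0" by (rule res_nz[OF SW rW uW])
  have \<psi>'eq: "\<psi>' = (%y. \<psi> (?u * y))"
  proof
   fix y
   obtain x where x: "x \<in> W" "rW x = y" using W_surj by blast
   have uw: "g' / g \<in> W" using uW by (simp add: unit_in_def)
   have "g' * x = g * (g' / g * x)" using nz(1) by simp
   then have "\<psi>' y = rW (\<phi> (g * (g' / g * x)))" using \<psi>'(2) x by metis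
   also have "... = \<psi> (rW (g' / g * x))" by (rule psi[OF sring_mult[OF SW uw x(1)], symmetric])
   also have "... = \<psi> (?u * y)" using res_mult[OF SW rW uw x(1)] x(2) by simp
   finally show "\<psi>' y = \<psi> (?u * y)" .
  qed
  have lev: "q.hom_level e \<psi>' (m - ord_at Q ?u)" unfolding \<psi>'eq by (rule q.hom_level_scale[OF m u0])
  have uni: "WW.universal e \<psi>'" unfolding \<psi>'eq by (rule WW.universal_scale[OF psi_universal u0])
  have hgW: "h / g \<in> W" "h' / h \<in> W" "unit_in W (h / g)" using hg vW by (auto simp: unit_in_def)
  have eq: "h' / g' = (h / g) * (h' / h) / (g' / g)" using nz g'(1) h'(1) by simp
  have "rW (h' / g') = rW ((h / g) * (h' / h)) / ?u"
   unfolding eq by (rule res_divide[OF SW rW sring_mult[OF SW hgW(1,2)] uW])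
  then have rr: "rW (h' / g') = rW (h / g) * rW (h' / h) / ?u" using res_mult[OF SW rW hgW(1,2)] by simp
  have nz2: "rW (h / g) ~= 0" "rW (h' / h) ~= 0" using res_nz[OF SW rW] hg vW by auto
  have locN: "loc_ring N" by (rule points_loc_ring[OF gl N(1)])
  have "h' / h \<in> N" using vN by (simp add: unit_in_def)
  then have "unit_in (rW ` N) (rW (h' / h))" using res_unit[OF locW rW locN N(2)] vN by blast
  then have "unit_in Q (rW (h' / h))" using N(3) by (auto simp: dominates_def intro: unit_mono)
  then have "ord_at Q (rW (h' / h)) = 0" by (rule q.ord_unit)
  then have o: "ord_at Q (rW (h' / g')) = ord_at Q (rW (h / g)) - ord_at Q ?u"
   unfolding rr using q.ord_divide[of "rW (h / g) * rW (h' / h)" ?u] q.ord_mult[OF nz2] nz2 u0 by simp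
  have "rW (h' / g') ~= 0" unfolding rr using nz2 u0 by simp
  then show "c = real_of_int (ord_at Q (rW (h / g)) - m) / real qm" unfolding c using md[OF uni lev] o by simp
 qed
 then show ?thesis by (simp only: F_different_def)
qed

lemma E_point_unique:
 assumes P: "loc_ring P" and N: "N1 \<in> points \<A>'" "N1 \<subseteq> E" "rE ` N1 = P" "N2 \<in> points \<A>'" "N2 \<subseteq> E" "rE ` N2 = P"
 shows "N1 = N2"
proof -
 have d: "dominates (res_pre E rE P) N" if "N \<in> points \<A>'" "N \<subseteq> E" "rE ` N = P" for N
  by (rule dominates_res_pre[OF locE rE P points_loc_ring[OF K'.gl that(1)] that(2)]) (simp add: that(3))
 show ?thesis by (rule center_unique[OF K'.gl N(1,4) res_pre(1)[OF locE rE P] d[OF N(1-3)] d[OF N(4-6)]])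
qed

lemma E_chart:
 assumes C: "C \<in> \<E>"
 shows "\<exists>A'\<in>\<A>'. is_loc A' E & C = rE ` A'"
proof -
 obtain A' where A': "A' \<in> \<A>'" "E \<in> Spec A'" "C = rE ` A'" using C by (auto simp: subscheme_def)
 then show ?thesis using Spec_iff[OF K'.chart(4)[OF A'(1)]] by blast
qed

text \<open>By uniqueness of centers the lifted point is the same for all charts with the given
  image, which the last clause records.\<close>

lemma E_point:
 assumes C: "C \<in> \<E>" "is_loc C P"
 shows "\<exists>N'\<in>points \<A>'. N' \<subseteq> E & rE ` N' = P & (\<forall>A'\<in>\<A>'. is_loc A' E --> C = rE ` A' --> is_loc A' N')"
proof -
 have ex: "\<exists>N'\<in>points \<A>'. N' \<subseteq> E & rE ` N' = P & is_loc A' N'" if A': "A' \<in> \<A>'" "C = rE ` A'" and AE: "is_loc A' E" for A'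
 proof -
  have locP: "loc_ring P" "rE ` A' \<subseteq> P" using C(2) A'(2) by (auto simp: is_loc_def)
  have sub: "A' \<subseteq> E" using AE by (simp add: is_loc_def)
  note c = res_center[OF locE rE K'.chart(4)[OF A'(1)] locP(1) sub locP(2)]
  have "center (rE ` A') P = P" using center_self[of "rE ` A'" P] C(2) A'(2) EE.chart(4)[OF C(1)] by simp
  moreover have "is_loc A' (center A' (res_pre E rE P))"
   by (rule center_props(1)[OF K'.chart(4)[OF A'(1)] res_pre(1)[OF locE rE locP(1)] c(1)])
  ultimately show ?thesis
   using A'(1,2) c points_glued[OF K'.gl] by (intro bexI[of _ "center A' (res_pre E rE P)"]) auto
 qed
 obtain A' where A': "A' \<in> \<A>'" "C = rE ` A'" "is_loc A' E" using E_chart[OF C(1)] by blast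
 obtain N' where N': "N' \<in> points \<A>'" "N' \<subseteq> E" "rE ` N' = P" using ex[OF A'] by blast
 have locP: "loc_ring P" using C(2) by (simp add: is_loc_def)
 have "is_loc A'' N'" if A'': "A'' \<in> \<A>'" "is_loc A'' E" "C = rE ` A''" for A''
 proof -
  obtain N'' where N'': "N'' \<in> points \<A>'" "N'' \<subseteq> E" "rE ` N'' = P" "is_loc A'' N''" using ex[OF A''(1,3,2)] by blast
  then show ?thesis using E_point_unique[OF locP N''(1-3) N'] by simp
 qed
 then show ?thesis using N' by blast
qed

lemma form_ord_E:
 assumes R: "dvr R" "F_finite R"
 shows "form_ord \<omega>E R = ord_at R (form_coeff \<omega>E vs) + form_ord (1, vs) R"
proof -
 interpret r: char_p_dvr p "TYPE('e)" R by (intro char_p_dvr.intro EE.char_p_axioms dvr_loc.intro R(1))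
 obtain zs where zs: "p_basis R zs" using r.p_basis_ex[OF R(2) vs_basis] by blast
 have zsU: "p_basis UNIV zs" by (rule EE.p_basis_field[OF r.R r.fr zs])
 have r1: "rational_form (1, vs)" using vs_basis by (simp add: rational_form_def)
 have c: "form_coeff \<omega>E zs = form_coeff \<omega>E vs * jac vs zs" by (rule EE.form_coeff_change[OF \<omega>E vs_basis zsU])
 have "form_coeff (1, vs) zs = jac vs zs" by (simp add: form_coeff_jac)
 then show ?thesis using r.form_ord_eq[OF \<omega>E zs] r.form_ord_eq[OF r1 zs] c
   r.ord_mult[OF EE.form_coeff_nz[OF \<omega>E vs_basis] EE.jac_nz[OF vs_basis zsU]] by simp
qed

text \<open>The local equation \<open>h\<close> from the base serves for the multiple
  \<open>qm\<close>. For any other data, suitable powers of the two local equations differ by a unit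
  at the point, and the change of coordinates is absorbed by
  \<open>residue_form_ord\<close>.\<close>

lemma different_eq:
 assumes R: "R \<in> prime_divisors \<E>" and N': "N' \<in> points \<A>'" "N' \<subseteq> E" "rE ` N' = R"
  and N: "N \<in> points \<A>" "N \<subseteq> N'" and h: "leq N h"
 shows "different \<A>' \<omega> \<Delta>' E rE R =
  - (real_of_int (ord_at R (rE (\<theta> ^ qm / h))) + real qm * real_of_int (form_ord (1, vs) R)) / real qm"
proof -
 interpret r: char_p_dvr p "TYPE('e)" R by (rule EE.pd_char_p_dvr[OF R])
 have ffR: "F_finite R" by (rule EE.point_props(5)[OF EE.pd_point[OF R]])
 have NE: "N \<subseteq> E" using N N'(2) by blast
 have h0: "h ~= 0" by (rule leq_nz[OF h])
 have lh: "real qm * log_div \<omega> \<Delta>' R' = real_of_int (ord_at R' h)" if "R' \<in> prime_divisors \<A>'" "N' \<subseteq> R'" for R'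
  using log_div_crepant[OF K'.pd_dvr[OF that(1)] N(1) _ h] N(2) that(2) by blast
 have locN': "loc_ring N'" by (rule points_loc_ring[OF K'.gl N'(1)])
 let ?x = "\<theta> ^ qm / h"
 have ux: "unit_in E ?x" using unit_in_inverse[OF unit_theta[OF N(1) NE h]] by simp
 let ?P = "%c. \<exists>m N f t ys.
   m > 0 & N \<in> points \<A>' & N \<subseteq> E & rE ` N = R &
   local_eq \<A>' (%R'. real m * log_div \<omega> \<Delta>' R') N f &
   uniformizer E t & p_basis E (t # ys) &
   c = - (real_of_int (ord_at R (rE ((t * form_coeff \<omega> (t # ys)) ^ m / f)))
      + real m * real_of_int (form_ord (1, map rE ys) R)) / real m"
 have "(THE c. ?P c) = - (real_of_int (ord_at R (rE ?x)) + real qm * real_of_int (form_ord (1, vs) R)) / real qm"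
 proof (rule the_equality)
  show "?P (- (real_of_int (ord_at R (rE ?x)) + real qm * real_of_int (form_ord (1, vs) R)) / real qm)"
   using real_q_pos N' t ys lh h0
   by (intro exI[of _ qm] exI[of _ N'] exI[of _ h] exI[of _ t] exI[of _ ys]) (simp add: local_eq_def \<theta>_def vs_def)
  fix c assume "?P c"
  then obtain m N1 f t1 ys1 where m: "m > 0" and N1: "N1 \<in> points \<A>'" "N1 \<subseteq> E" "rE ` N1 = R"
   and f: "local_eq \<A>' (%R'. real m * log_div \<omega> \<Delta>' R') N1 f"
   and t1: "uniformizer E t1" "p_basis E (t1 # ys1)"
   and c: "c = - (real_of_int (ord_at R (rE ((t1 * form_coeff \<omega> (t1 # ys1)) ^ m / f)))
      + real m * real_of_int (form_ord (1, map rE ys1) R)) / real m" by (elim exE conjE) (rule that)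
  have "N1 = N'" by (rule E_point_unique[OF dvr_loc_ring[OF r.dvr] N1 N'])
  then have f0: "f ~= 0" and lf: "\<And>R'. R' \<in> prime_divisors \<A>' ==> N' \<subseteq> R' ==>
    real m * log_div \<omega> \<Delta>' R' = real_of_int (ord_at R' f)" using f by (auto simp: local_eq_def)
  define \<theta>1 where "\<theta>1 = t1 * form_coeff \<omega> (t1 # ys1)"
  note th1 = theta_any[OF t1, folded \<theta>1_def]
  let ?\<eta> = "\<theta>1 / \<theta>" and ?y = "\<theta>1 ^ m / f" and ?z = "f ^ qm / h ^ m"
  note rf = Ed.residue_form_ord[OF \<omega> rE t ys t1 r.dvr ffR, folded \<theta>1_def \<theta>_def vs_def]
  have "real_of_int (ord_at E f) = real_of_int (int m * (1 + form_ord \<omega> E))"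
   using lf[OF E N'(2)] unfolding log_div_E by simp
  then have "ord_at E f = int m * (1 + form_ord \<omega> E)" by (simp only: of_int_eq_iff)
  then have "ord_at E ?y = 0" using Ed.ord_divide[of "\<theta>1 ^ m" f] Ed.ord_power[OF th1(1)] th1 f0 by simp
  then have uy: "unit_in E ?y" using Ed.unit_iff[of ?y] th1(1) f0 by simp
  \<comment> \<open>\<open>f ^ qm\<close> and \<open>h ^ m\<close> are both local equations of
    \<open>m * qm\<close> times the same divisor.\<close>
  have "ord_at R' ?z = 0" if R': "R' \<in> prime_divisors \<A>'" "N' \<subseteq> R'" for R'
  proof -
   interpret r': dvr_loc R' by (rule K'.pd_loc[OF R'(1)])
   have "real_of_int (int qm * ord_at R' f) = real_of_int (int m * ord_at R' h)"
    unfolding of_int_mult lf[OF R', symmetric] lh[OF R', symmetric] by simp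
   then have "int qm * ord_at R' f = int m * ord_at R' h" by (simp only: of_int_eq_iff)
   then show ?thesis using r'.ord_divide[of "f ^ qm" "h ^ m"] r'.ord_power f0 h0 by simp
  qed
  then have uz: "unit_in N' ?z" using K'.unit_point_iff[OF N'(1), of ?z] f0 h0 by simp
  have uzE: "unit_in E ?z" by (rule unit_mono[OF uz N'(2)])
  have "?z \<in> N'" using uz by (simp add: unit_in_def)
  then have "unit_in R (rE ?z)" using res_unit[OF locE rE locN' N'(2)] uz N'(3) by blast
  then have oz: "ord_at R (rE ?z) = 0" by (rule r.ord_unit)
  have nz: "rE ?y ~= 0" "rE ?z ~= 0" "rE ?\<eta> ~= 0" "rE ?x ~= 0" using res_nz[OF SE rE] uy uzE rf(1) ux by auto
  have mem: "?y \<in> E" "?z \<in> E" "?\<eta> \<in> E" "?x \<in> E" using uy uzE rf(1) ux by (auto simp: unit_in_def)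
  \<comment> \<open>The two residue coefficients are raised to powers for which the multiples
    \<open>m\<close> and \<open>qm\<close> agree; the coordinate change appears as a power of
    \<open>?\<eta>\<close>.\<close>
  have "?y ^ qm * ?z = ?\<eta> ^ (m * qm) * ?x ^ m"
   using theta(1) f0 h0 by (simp add: power_divide power_mult[symmetric] mult.commute[of m])
  then have "rE (?y ^ qm * ?z) = rE (?\<eta> ^ (m * qm) * ?x ^ m)" by (rule arg_cong)
  then have "rE ?y ^ qm * rE ?z = rE ?\<eta> ^ (m * qm) * rE ?x ^ m"
   using res_mult[OF SE rE sring_power[OF SE mem(1), of qm] mem(2)]
    res_mult[OF SE rE sring_power[OF SE mem(3), of "m * qm"] sring_power[OF SE mem(4), of m]]
    res_power[OF SE rE mem(1)] res_power[OF SE rE mem(3)] res_power[OF SE rE mem(4)] by simp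
  then have "ord_at R (rE ?y ^ qm * rE ?z) = ord_at R (rE ?\<eta> ^ (m * qm) * rE ?x ^ m)" by (rule arg_cong)
  then have "int qm * ord_at R (rE ?y) = int (m * qm) * ord_at R (rE ?\<eta>) + int m * ord_at R (rE ?x)"
   using r.ord_mult[of "rE ?y ^ qm" "rE ?z"] r.ord_mult[of "rE ?\<eta> ^ (m * qm)" "rE ?x ^ m"] nz oz
    r.ord_power[OF nz(1)] r.ord_power[OF nz(3)] r.ord_power[OF nz(4)] by simp
  then have "int qm * (ord_at R (rE ?y) + int m * form_ord (1, map rE ys1) R) =
    int m * (int qm * (ord_at R (rE ?\<eta>) + form_ord (1, map rE ys1) R) + ord_at R (rE ?x))"
   by (simp add: algebra_simps)
  then have eq: "int qm * (ord_at R (rE ?y) + int m * form_ord (1, map rE ys1) R) =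
    int m * (ord_at R (rE ?x) + int qm * form_ord (1, vs) R)" unfolding rf(2) by (simp add: add.commute)
  have cross: "a / b = c / d" if "d * a = b * c" "b > 0" "d > 0" for a b c d :: real
   using that by (simp add: field_simps)
  from arg_cong[OF eq, of real_of_int]
  have "real qm * (real_of_int (ord_at R (rE ?y)) + real m * real_of_int (form_ord (1, map rE ys1) R)) =
    real m * (real_of_int (ord_at R (rE ?x)) + real qm * real_of_int (form_ord (1, vs) R))" by simp
  then have "(real_of_int (ord_at R (rE ?y)) + real m * real_of_int (form_ord (1, map rE ys1) R)) / real m =
    (real_of_int (ord_at R (rE ?x)) + real qm * real_of_int (form_ord (1, vs) R)) / real qm"
   by (rule cross) (use m real_q_pos in simp_all)
  then show "c = - (real_of_int (ord_at R (rE ?x)) + real qm * real_of_int (form_ord (1, vs) R)) / real qm"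
   unfolding c \<theta>1_def[symmetric] by (simp only: minus_divide_left[symmetric])
 qed
 then show ?thesis by (simp only: different_def)
qed

end

section \<open>Neighborhoods and preimages\<close>

lemma principal_zariski_open:
 assumes g: "glued \<A>" and A: "A \<in> \<A>" and f: "f \<in> A" "f ~= 0"
 shows "zariski_open \<A> (Spec (invert A f))" unfolding zariski_open_def
proof (intro conjI ballI)
 note G = gluedD[OF g]
 note SI = Spec_invert[OF G(2)[OF A] f]
 show "Spec (invert A f) \<subseteq> points \<A>" using SI A points_glued[OF g] by blast
 fix B assume B: "B \<in> \<A>"
 show "open_in_Spec B (Spec (invert A f) \<inter> Spec B)" unfolding open_in_Spec_def
 proof (intro conjI ballI)
  fix N assume "N \<in> Spec (invert A f) \<inter> Spec B"
  then have N: "is_loc A N" "inverse f \<in> N" "is_loc B N" using SI Spec_iff[OF G(2)[OF B]] by auto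
  obtain k where k: "k \<in> B" "k ~= 0" "inverse k \<in> N" "A \<subseteq> invert B k" using G(5)[OF B A N(3,1)] by blast
  obtain n where n: "f * k ^ n \<in> B" using k(4) f(1) invert_iff[OF G(2)[OF B] k(1,2)] by blast
  \<comment> \<open>Inverting \<open>?l\<close> makes \<open>k\<close> invertible, which leads into
    the chart \<open>A\<close>, and \<open>f\<close> as well.\<close>
  let ?l = "k * (f * k ^ n)"
  have l: "?l \<in> B" "?l ~= 0" using k n f(2) G(2)[OF B] by (auto intro: sring_mult)
  have "inverse ?l = inverse k * (inverse f * inverse k ^ n)" by (simp add: power_inverse)
  also have "... \<in> N" using k(3) N(2) is_loc_sring[OF N(1)] by (intro sring_mult sring_power) auto
  finally have lN: "inverse ?l \<in> N" .
  have "M \<in> Spec (invert A f) \<inter> Spec B" if "M \<in> Spec (invert B ?l)" for M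
  proof -
   have M: "is_loc B M" "inverse ?l \<in> M" using that Spec_invert[OF G(2)[OF B] l] by auto
   have BM: "B \<subseteq> M" using M(1) by (simp add: is_loc_def)
   note SM = is_loc_sring[OF M(1)]
   have "inverse k = f * k ^ n * inverse ?l" using k(2) f(2) by (simp add: field_simps)
   also have "... \<in> M" by (rule sring_mult[OF SM _ M(2)]) (use n BM in blast)
   finally have "invert B k \<subseteq> M" by (rule invert_least[OF SM BM])
   then have AM: "is_loc A M" using k(4) M(1) B points_glued[OF g] by (intro gen_in_chart[OF g A]) auto
   have "inverse f = k ^ Suc n * inverse ?l" using k(2) f(2) by (simp add: field_simps)
   also have "... \<in> M" using BM k(1) by (intro sring_mult[OF SM sring_power[OF SM] M(2)]) auto
   finally show ?thesis using AM M(1) SI Spec_iff[OF G(2)[OF B]] by blast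
  qed
  then show "\<exists>l\<in>B. l ~= 0 & N \<in> Spec (invert B l) & Spec (invert B l) \<subseteq> Spec (invert A f) \<inter> Spec B"
   using l lN N(3) Spec_invert[OF G(2)[OF B] l] by blast
 qed blast
qed

text \<open>For each \<open>R\<close> not containing \<open>N\<close> some element of
  \<open>A\<close> is a nonunit at \<open>R\<close> and a unit at \<open>N\<close>; the product over
  all \<open>R\<close> works. It is used to shrink a neighborhood of \<open>N\<close> so that
  finitely many divisors drop out.\<close>

lemma avoid_finite:
 assumes A: "sring A" and N: "is_loc A N" and fin: "finite \<R>" and R: "\<forall>R\<in>\<R>. is_loc A R & \<not> N \<subseteq> R"
 shows "\<exists>f\<in>A. unit_in N f & (\<forall>R\<in>\<R>. f \<in> max_ideal R)" using fin R
proof (induction \<R>)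
 case empty
 then show ?case using sring_one[OF A] unit_in_one[OF is_loc_sring[OF N]] by blast
next
 case (insert R \<R>)
 then obtain f where f: "f \<in> A" "unit_in N f" "\<forall>R\<in>\<R>. f \<in> max_ideal R" by auto
 have R: "is_loc A R" "\<not> N \<subseteq> R" using insert.prems by auto
 have "\<exists>a\<in>A. a \<in> max_ideal R & a \<notin> max_ideal N"
 proof (rule ccontr)
  assume "\<not> ?thesis"
  then have "loc_at A (max_ideal N \<inter> A) \<subseteq> loc_at A (max_ideal R \<inter> A)" unfolding loc_at_def by blast
  then show False using is_loc_loc_at(1)[OF A N] is_loc_loc_at(1)[OF A R(1)] R(2) by simp
 qed
 then obtain a where a: "a \<in> A" "a \<in> max_ideal R" "a \<notin> max_ideal N" by blast
 have "a \<in> N" using a(1) N by (auto simp: is_loc_def)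
 then have "unit_in N (f * a)" using unit_cases a(3) unit_in_mult[OF is_loc_sring[OF N] f(2)] by blast
 moreover have "f * a \<in> max_ideal R'" if R': "R' \<in> insert R \<R>" for R'
 proof (cases "R' = R")
  case True
  have "a * f \<in> max_ideal R" using R(1) f(1) by (intro max_ideal_mult[OF is_loc_sring[OF R(1)] a(2)]) (auto simp: is_loc_def)
  then show ?thesis using True by (simp add: mult.commute)
 next
  case False
  then have "R' \<in> \<R>" "is_loc A R'" using R' insert.prems by auto
  then show ?thesis using f(3) a(1) by (intro max_ideal_mult[OF is_loc_sring[of A R']]) (auto simp: is_loc_def)
 qed
 ultimately show ?case using sring_mult[OF A f(1) a(1)] by blast
qed

lemma fhom_powi: "fhom \<iota> ==> \<iota> (x powi n) = \<iota> x powi n" by (auto simp: power_int_def fhomD)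

lemma fhom_int_closure:
 assumes \<iota>: "fhom \<iota>" and y: "y \<in> int_closure A" and AD: "\<iota> ` A \<subseteq> D"
 shows "\<iota> y \<in> int_closure D"
proof -
 obtain q where q: "lead_coeff q = 1" "\<And>i. poly.coeff q i \<in> A" "poly q y = 0"
  using y by (auto simp: int_closure_def)
 let ?q = "map_poly \<iota> q"
 have co: "poly.coeff ?q i = \<iota> (poly.coeff q i)" for i by (simp add: coeff_map_poly fhomD[OF \<iota>])
 have deg: "degree ?q = degree q" by (rule degree_map_poly) (simp add: fhomD[OF \<iota>])
 have s: "\<iota> (sum f I) = (\<Sum>i\<in>I. \<iota> (f i))" for f and I :: "nat set"
  by (induction I rule: infinite_finite_induct) (auto simp: fhomD[OF \<iota>])
 have "poly ?q (\<iota> y) = \<iota> (poly q y)" unfolding poly_altdef deg co s by (simp add: fhomD[OF \<iota>])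
 then have "poly ?q (\<iota> y) = 0" using q(3) by (simp add: fhomD[OF \<iota>])
 moreover have "lead_coeff ?q = 1" using q(1) deg co by (simp add: fhomD[OF \<iota>])
 moreover have "poly.coeff ?q i \<in> D" for i using co q(2) AD by auto
 ultimately show ?thesis unfolding int_closure_def by blast
qed

lemma fhom_vimage_sring: "fhom \<iota> ==> sring P ==> sring (\<iota> -` P)" unfolding sring_def by (simp add: fhomD)

section \<open>The morphism from \<open>E\<close> to the normalization of \<open>W\<close>\<close>

context adjunction_data
begin

lemmas pb_def = pb[unfolded proper_birational_def]

lemma pb_point: "N' \<in> points \<A>' ==> \<exists>N\<in>points \<A>. dominates N' N" using conjunct1[OF pb_def] by blast

lemmas pb_cover = bspec[OF conjunct1[OF conjunct2[OF pb_def]]]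

lemma pb_valuative: "valuation_subring V ==> N \<in> points \<A> ==> dominates V N ==> \<exists>N'\<in>points \<A>'. dominates V N'"
 using conjunct2[OF conjunct2[OF pb_def]] by blast

text \<open>The point below \<open>N'\<close> is also the center on \<open>A\<close> of the
  composite of \<open>E\<close> with \<open>P\<close>, so it lies in the chart
  \<open>A\<close>.\<close>

lemma E_point_above:
 assumes A: "A \<in> \<A>" "is_loc A W" and N': "N' \<in> points \<A>'" "N' \<subseteq> E" "rE ` N' = P" and P: "loc_ring P" "\<iota> ` rW ` A \<subseteq> P"
 shows "\<exists>N\<in>points \<A>. is_loc A N & dominates N' N"
proof -
 obtain N where N: "N \<in> points \<A>" "dominates N' N" using pb_point[OF N'(1)] by blast
 have d: "dominates (res_pre E rE P) N'"
  by (rule dominates_res_pre[OF locE rE P(1) points_loc_ring[OF K'.gl N'(1)] N'(2)]) (simp add: N'(3))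
 note locO = res_pre(1)[OF locE rE P(1)]
 have AW: "A \<subseteq> W" using A(2) by (simp add: is_loc_def)
 have sub: "A \<subseteq> res_pre E rE P"
 proof
  fix a assume a: "a \<in> A"
  then have "rE a \<in> P" using iota_res[of a] P(2) AW by (metis imageI subsetD)
  then show "a \<in> res_pre E rE P" using a AW WE by (auto simp: res_pre_def[OF locE rE])
 qed
 note c = center_props(1,2)[OF chart(4)[OF A(1)] locO sub]
 have "center A (res_pre E rE P) \<in> points \<A>" using c(1) A(1) points_glued[OF gl] by blast
 then have "center A (res_pre E rE P) = N"
  using center_unique[OF gl _ N(1) locO c(2) dominates_trans[OF d N(2)]] by simp
 then show ?thesis using c(1) N by blast
qed

text \<open>This makes the map of function fields a morphism near \<open>P\<close>. The model has a
  chart containing \<open>A\<close> through the point, normality of \<open>E\<close> passes from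
  \<open>A\<close> to the integral closure of its image, and a further factor inverts
  \<open>\<iota> f\<close>.\<close>

lemma regular_neighborhood:
 assumes A: "A \<in> \<A>" "is_loc A W" and f: "f \<in> int_closure (rW ` A)" "f ~= 0"
  and A': "A' \<in> \<A>'" "is_loc A' E" and P: "is_loc (rE ` A') P" "\<iota> ` invert (int_closure (rW ` A)) f \<subseteq> P"
 shows "\<exists>l\<in>rE ` A'. l ~= 0 & inverse l \<in> P &
  (\<forall>P'. is_loc (rE ` A') P' --> inverse l \<in> P' --> \<iota> ` invert (int_closure (rW ` A)) f \<subseteq> P')"
proof -
 let ?B = "int_closure (rW ` A)" and ?C = "rE ` A'"
 have C: "?C \<in> \<E>" using A' Spec_iff[OF K'.chart(4)[OF A'(1)]] by (auto simp: subscheme_def)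
 note rA' = K'.chart(4)[OF A'(1)] and rC = EE.chart(4)[OF C] and SP = is_loc_sring[OF P(1)]
 have A'E: "A' \<subseteq> E" using A'(2) by (simp add: is_loc_def)
 have AW: "A \<subseteq> W" using A(2) by (simp add: is_loc_def)
 have rB: "sring (rW ` A)" by (rule sring_image[OF chart(4)[OF A(1)] AW SW rW])
 have BB: "rW ` A \<subseteq> ?B" by (rule int_closure_sub[OF rB])
 have locP: "loc_ring P" using P(1) by (simp add: is_loc_def)
 have BP: "\<iota> ` ?B \<subseteq> P" using P(2) invert_sub[of ?B f] by blast
 obtain N' where N': "N' \<in> points \<A>'" "N' \<subseteq> E" "rE ` N' = P" "is_loc A' N'" using E_point[OF C P(1)] A' by blast
 obtain N where N: "N \<in> points \<A>" "is_loc A N" "dominates N' N"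
  using E_point_above[OF A N'(1-3) locP] BB BP by blast
 \<comment> \<open>The chart containing \<open>A\<close> may differ from \<open>A'\<close>, so the
   two are compared on a principal open set of \<open>A'\<close>.\<close>
 from pb_cover[OF A(1)] obtain \<C> where \<C>: "\<forall>C\<in>\<C>. affine_open \<A>' C & A \<subseteq> C & fin_gen_over A C"
   "{N' \<in> points \<A>'. \<exists>N\<in>Spec A. dominates N' N} = (\<Union>C\<in>\<C>. Spec C)" by (elim exE conjE) (rule that)
 have "N' \<in> {N' \<in> points \<A>'. \<exists>N\<in>Spec A. dominates N' N}" using N' N Spec_iff[OF chart(4)[OF A(1)]] by blast
 then obtain D0 where D0: "D0 \<in> \<C>" "N' \<in> Spec D0" using \<C>(2) by blast
 have at: "atlas (insert D0 \<A>')" and AD0: "A \<subseteq> D0" using \<C>(1) D0(1) by (auto simp: affine_open_def)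
 have rD0: "sring D0" and op: "open_in_Spec A' (Spec A' \<inter> Spec D0)"
  using at A'(1) by (auto simp: atlas_def subring_iff_sring)
 have "N' \<in> Spec A' \<inter> Spec D0" using N'(4) D0(2) Spec_iff[OF rA'] by blast
 from bspec[OF conjunct2[OF op[unfolded open_in_Spec_def]] this]
 obtain f2 where f2: "f2 \<in> A'" "f2 ~= 0" "N' \<in> Spec (invert A' f2)" "Spec (invert A' f2) \<subseteq> Spec A' \<inter> Spec D0"
  by blast
 have AA': "A \<subseteq> invert A' f2"
 proof
  fix a assume a: "a \<in> A"
  show "a \<in> invert A' f2"
  proof (rule mem_of_local)
   show "noeth (invert A' f2)" by (rule fractions_noeth[OF K'.chart(2)[OF A'(1)] invert_fractions[OF rA' f2(1,2)]])
   show "frac_full (invert A' f2)" by (rule frac_full_mono[OF K'.chart(5)[OF A'(1)] invert_sub])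
   fix M assume "is_loc (invert A' f2) M"
   then have "M \<in> Spec D0" using f2(4) Spec_iff[OF invert_sring] by blast
   then show "a \<in> M" using a AD0 Spec_iff[OF rD0] by (auto simp: is_loc_def)
  qed
 qed
 have if2: "inverse f2 \<in> N'" using f2(3) Spec_invert[OF rA' f2(1,2)] by blast
 have u2: "unit_in E f2" using if2 f2 A'E N'(2) by (auto simp: unit_in_def)
 define b where "b = rE f2"
 have b: "b \<in> ?C" "b ~= 0" using f2(1) res_nz[OF SE rE u2] by (auto simp: b_def)
 have ib: "inverse b \<in> P" using res_inverse[OF SE rE u2] if2 N'(3) by (metis b_def imageI)
 let ?D = "invert ?C b"
 have AD: "\<iota> ` rW ` A \<subseteq> ?D"
 proof
  fix y assume "y \<in> \<iota> ` rW ` A"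
  then obtain a where a: "a \<in> A" "y = \<iota> (rW a)" by blast
  then have ya: "y = rE a" using iota_res AW by auto
  obtain n where n: "a * f2 ^ n \<in> A'" using a(1) AA' invert_iff[OF rA' f2(1,2)] by blast
  have aE: "a \<in> E" "f2 \<in> E" using a(1) AW WE f2(1) A'E by auto
  have "rE (a * f2 ^ n) = y * b ^ n"
   using res_mult[OF SE rE aE(1) sring_power[OF SE aE(2), of n]] res_power[OF SE rE aE(2)] ya by (simp add: b_def)
  then have "y * b ^ n \<in> ?C" using imageI[OF n, of rE] by simp
  then show "y \<in> ?D" using invert_iff[OF rC b] by blast
 qed
 have frD: "fractions ?C ?D" by (rule invert_fractions[OF rC b])
 \<comment> \<open>Elements integral over the image of \<open>A\<close> stay integral over
   \<open>?D\<close>, whose local rings are integrally closed.\<close>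
 have BD: "\<iota> ` ?B \<subseteq> ?D"
 proof
  fix z assume "z \<in> \<iota> ` ?B"
  then obtain y where y: "y \<in> ?B" "z = \<iota> y" by blast
  have zi: "z \<in> int_closure ?D" unfolding y(2) by (rule fhom_int_closure[OF iota y(1) AD])
  show "z \<in> ?D"
  proof (rule mem_of_local)
   show "noeth ?D" by (rule fractions_noeth[OF EE.chart(2)[OF C] frD])
   show "frac_full ?D" by (rule frac_full_mono[OF EE.chart(5)[OF C] invert_sub])
   fix M assume M: "is_loc ?D M"
   have "M \<in> points \<E>" using fractions_is_loc[OF frD M rC] C points_glued[OF EE.gl] by blast
   moreover have "z \<in> int_closure M" using zi int_closure_mono[of ?D M] M by (auto simp: is_loc_def)
   ultimately show "z \<in> M" using EE.point_props(6) by blast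
  qed
 qed
 obtain n where n: "\<iota> f * b ^ n \<in> ?C" using BD f(1) invert_iff[OF rC b] by blast
 have f0: "\<iota> f ~= 0" using f(2) fhomD(7)[OF iota] by blast
 \<comment> \<open>Its inverse yields the inverses of both \<open>b\<close> and
   \<open>\<iota> f\<close>.\<close>
 let ?l = "b * (\<iota> f * b ^ n)"
 have l: "?l \<in> ?C" "?l ~= 0" using b n f0 by (auto intro: sring_mult[OF rC])
 have "\<iota> (inverse f) \<in> P" using P(2) inverse_in_invert[of f ?B] by blast
 then have "inverse (\<iota> f) \<in> P" by (simp add: fhomD(8)[OF iota])
 then have "inverse b * (inverse (\<iota> f) * inverse b ^ n) \<in> P" using ib SP by (intro sring_mult sring_power)
 then have lP: "inverse ?l \<in> P" by (simp add: power_inverse)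
 have "\<iota> ` invert ?B f \<subseteq> P'" if P': "is_loc ?C P'" "inverse ?l \<in> P'" for P'
 proof -
  note SP' = is_loc_sring[OF P'(1)]
  have CP': "?C \<subseteq> P'" using P'(1) by (simp add: is_loc_def)
  have "inverse b = \<iota> f * b ^ n * inverse ?l" using b(2) f0 by (simp add: field_simps)
  also have "... \<in> P'" by (rule sring_mult[OF SP' _ P'(2)]) (use n CP' in blast)
  finally have "?D \<subseteq> P'" by (rule invert_least[OF SP' CP'])
  then have "?B \<subseteq> \<iota> -` P'" using BD by blast
  moreover have eq: "inverse (\<iota> f) = b ^ Suc n * inverse ?l" using b(2) f0 by (simp add: field_simps)
  have "inverse (\<iota> f) \<in> P'" unfolding eq by (rule sring_mult[OF SP' sring_power[OF SP'] P'(2)]) (use b(1) CP' in blast)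
  then have "\<iota> (inverse f) \<in> P'" by (simp only: fhomD(8)[OF iota])
  ultimately have "invert ?B f \<subseteq> \<iota> -` P'" by (intro invert_least fhom_vimage_sring[OF iota SP']) simp_all
  then show ?thesis by blast
 qed
 then show ?thesis using l lP by blast
qed

lemma preimage_of_invert:
 assumes B: "sring B" and f: "f \<in> B" "f ~= 0" and P: "P \<in> points \<E>" "\<iota> ` invert B f \<subseteq> P"
 shows "\<exists>M\<in>Spec (invert B f). dominates P (\<iota> ` M)"
proof -
 have V: "loc_ring (\<iota> -` P)" by (rule fhom_vimage_loc_ring[OF iota points_loc_ring[OF EE.gl P(1)]])
 have "invert B f \<subseteq> \<iota> -` P" using P(2) by blast
 note c = center_props(1,2)[OF invert_sring V this]
 then show ?thesis using Spec_iff[OF invert_sring] fhom_dominates[OF iota] by blast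
qed

text \<open>A point over \<open>U\<close> has a principal neighborhood on which the functions of a
  principal part of \<open>U\<close> remain regular; centers on that part then supply image points
  in \<open>U\<close>.\<close>

lemma preimage_open:
 assumes U: "zariski_open \<W> U"
 shows "zariski_open \<E> (preimage_of \<iota> \<E> U)" unfolding zariski_open_def
proof (intro conjI ballI)
 show "preimage_of \<iota> \<E> U \<subseteq> points \<E>" by (auto simp: preimage_of_def)
 fix C assume C: "C \<in> \<E>"
 note rC = EE.chart(4)[OF C]
 obtain A' where A': "A' \<in> \<A>'" "is_loc A' E" "C = rE ` A'" using E_chart[OF C] by blast
 show "open_in_Spec C (preimage_of \<iota> \<E> U \<inter> Spec C)" unfolding open_in_Spec_def
 proof (intro conjI ballI)
  fix P assume "P \<in> preimage_of \<iota> \<E> U \<inter> Spec C"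
  then obtain M where P: "P \<in> points \<E>" "is_loc C P" and M: "M \<in> U" "dominates P (\<iota> ` M)"
   using Spec_iff[OF rC] by (auto simp: preimage_of_def)
  have Mp: "M \<in> points \<W>" using U M(1) by (auto simp: zariski_open_def)
  obtain A where A: "A \<in> \<A>" "is_loc A W" "is_loc (int_closure (rW ` A)) M" using W_chart[OF Mp] by blast
  let ?B = "int_closure (rW ` A)"
  have B: "?B \<in> \<W>" using A(1,2) Spec_iff[OF chart(4)[OF A(1)]] by (auto simp: scheme_normalization_def subscheme_def)
  note rB = WW.chart(4)[OF B]
  obtain f where f: "f \<in> ?B" "f ~= 0" "M \<in> Spec (invert ?B f)" "Spec (invert ?B f) \<subseteq> U"
   using zariski_open_chart[OF WW.gl U B A(3) M(1)] by blast
  have "invert ?B f \<subseteq> M" using f(3) Spec_iff[OF invert_sring] by (auto simp: is_loc_def)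
  then have DP: "\<iota> ` invert ?B f \<subseteq> P" using M(2) by (auto simp: dominates_def)
  obtain l where l: "l \<in> C" "l ~= 0" "inverse l \<in> P"
   "\<And>P'. is_loc C P' ==> inverse l \<in> P' ==> \<iota> ` invert ?B f \<subseteq> P'"
   using regular_neighborhood[OF A(1,2) f(1,2) A'(1,2) P(2)[unfolded A'(3)] DP] unfolding A'(3) by blast
  have "P' \<in> preimage_of \<iota> \<E> U \<inter> Spec C" if "P' \<in> Spec (invert C l)" for P'
  proof -
   have P': "is_loc C P'" "inverse l \<in> P'" using that Spec_invert[OF rC l(1,2)] by auto
   have pP': "P' \<in> points \<E>" using P'(1) C points_glued[OF EE.gl] by blast
   obtain M' where "M' \<in> Spec (invert ?B f)" "dominates P' (\<iota> ` M')"
    using preimage_of_invert[OF rB f(1,2) pP' l(4)[OF P']] by blast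
   then show ?thesis using pP' P'(1) f(4) Spec_iff[OF rC] by (auto simp: preimage_of_def)
  qed
  then show "\<exists>l\<in>C. l ~= 0 & P \<in> Spec (invert C l) & Spec (invert C l) \<subseteq> preimage_of \<iota> \<E> U \<inter> Spec C"
   using l(1-3) P(2) Spec_invert[OF rC l(1,2)] by blast
 qed blast
qed

text \<open>
 A valuation ring of the function field of \<open>E\<close> dominating \<open>Q\<close> is composed with \<open>E\<close>; the valuative
 criterion for \<open>\<A>' \<rightarrow> \<A>\<close> then gives a point of \<open>E\<close> over \<open>Q\<close>.
\<close>

lemma prime_divisor_over:
 assumes Q: "Q \<in> prime_divisors \<W>"
 shows "\<exists>R\<in>prime_divisors \<E>. dominates R (\<iota> ` Q)"
proof -
 interpret q: char_p_dvr p "TYPE('w)" Q by (rule WW.pd_char_p_dvr[OF Q])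
 have locQ: "loc_ring Q" by (rule dvr_loc_ring[OF q.dvr])
 obtain A where A: "A \<in> \<A>" "is_loc A W" "is_loc (int_closure (rW ` A)) Q" using W_chart[OF WW.pd_point[OF Q]] by blast
 let ?B = "int_closure (rW ` A)"
 have AW: "A \<subseteq> W" using A(2) by (simp add: is_loc_def)
 have rB0: "sring (rW ` A)" by (rule sring_image[OF chart(4)[OF A(1)] AW SW rW])
 have BQ: "?B \<subseteq> Q" "rW ` A \<subseteq> Q" using A(3) int_closure_sub[OF rB0] by (auto simp: is_loc_def)
 define N where "N = center A (res_pre W rW Q)"
 note N = W_point_below[OF A(1,2) locQ BQ(2), folded N_def]
 have locN: "loc_ring N" using N(1) by (simp add: is_loc_def)
 have "loc_ring (\<iota> ` Q)" unfolding loc_ring_def fhom_max_image[OF iota] sring_def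
  using q.R locQ by (auto simp: fhomD[OF iota, symmetric] loc_ring_def sringD)
 then obtain V where V: "valuation_subring V" "loc_ring V" "dominates V (\<iota> ` Q)"
  using valuation_ring_dominating by blast
 have val: "y \<in> V | inverse y \<in> V" for y using V(1) by (simp add: valuation_subring_def)
 let ?V' = "res_pre E rE V"
 note V' = res_pre[OF locE rE V(2)]
 have "x \<in> ?V' | inverse x \<in> ?V'" for x
 proof -
  have inE: "x \<in> ?V' | inverse x \<in> ?V'" if x: "x \<in> E" for x
  proof (cases "unit_in E x")
   case True
   then show ?thesis
    using val[of "rE x"] res_inverse[OF SE rE True] by (auto simp: res_pre_def[OF locE rE] unit_in_def)
  next
   case False
   then have "rE x = 0" using unit_cases[OF x] res_eq_0[OF SE rE x] by blast
   then show ?thesis using x sring_zero[OF loc_ring_sring[OF V(2)]] by (simp add: res_pre_def[OF locE rE])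
  qed
  have "x \<in> E | inverse x \<in> E"
  proof (cases "x = 0")
   case False
   then show ?thesis using Ed.mem_iff[of x] Ed.mem_iff[of "inverse x"] Ed.ord_inverse[of x]
    by (cases "0 \<le> ord_at E x") auto
  qed (use sring_zero[OF SE] in simp)
  then show ?thesis using inE[of x] inE[of "inverse x"] by auto
 qed
 then have vV': "valuation_subring ?V'"
  using loc_ring_sring[OF V'(1)] by (simp add: valuation_subring_def subring_iff_sring)
 have dVQ: "dominates (\<iota> -` V) Q" using V(3) fhom_dominates[OF iota] by blast
 have dN: "dominates ?V' N" unfolding dominates_def
 proof (intro conjI subsetI)
  have rWN: "rW x \<in> Q" if "x \<in> N" for x using that N(4) by (auto simp: dominates_def)
  fix x
  { assume x: "x \<in> N"
   then have "\<iota> (rW x) \<in> V" using rWN dVQ by (auto simp: dominates_def)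
   then show "x \<in> ?V'" using x N(3) WE iota_res[of x] by (auto simp: res_pre_def[OF locE rE]) }
  assume x: "x \<in> max_ideal N"
  then have xN: "x \<in> N" using max_ideal_sub by blast
  have "rW x \<in> max_ideal Q" using x N(4) res_max[OF locW rW locN N(3)] by (auto simp: dominates_def)
  then have "\<iota> (rW x) \<in> max_ideal V" using dVQ fhom_max[OF iota] by (auto simp: dominates_def)
  then show "x \<in> max_ideal ?V'" using xN N(3) WE iota_res[of x] unfolding V'(2) by auto
 qed
 obtain N' where N': "N' \<in> points \<A>'" "dominates ?V' N'" using pb_valuative[OF vV' N(2) dN] by blast
 have locN': "loc_ring N'" by (rule points_loc_ring[OF K'.gl N'(1)])
 note d = res_pre_dominates[OF locE rE V(2) locN' N'(2)]
 define P where "P = rE ` N'"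
 obtain A' where A': "A' \<in> \<A>'" "is_loc A' N'" using K'.point_chart[OF N'(1)] by blast
 have "is_loc A' E" by (rule generization_in_chart[OF K'.gl A' K'.pd_point[OF E] d(1)])
 then have C: "rE ` A' \<in> \<E>" using A'(1) Spec_iff[OF K'.chart(4)[OF A'(1)]] by (auto simp: subscheme_def)
 have "is_loc (rE ` A') P" unfolding P_def by (rule res_is_loc[OF locE rE A'(2) d(1)])
 then have Pp: "P \<in> points \<E>" using C points_glued[OF EE.gl] by blast
 have dVP: "dominates V P" using d(2) by (simp add: P_def)
 obtain N1 where N1: "N1 \<in> points \<A>" "dominates N' N1" using pb_point[OF N'(1)] by blast
 have "N1 = N" by (rule center_unique[OF gl N1(1) N(2) V'(1) dominates_trans[OF N'(2) N1(2)] dN])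
 then have NN': "N \<subseteq> N'" using N1(2) by (simp add: dominates_def)
 have "\<iota> ` rW ` A \<subseteq> P"
 proof
  fix y assume "y \<in> \<iota> ` rW ` A"
  then obtain a where a: "a \<in> A" "y = \<iota> (rW a)" by blast
  then have "y = rE a" "a \<in> N'" using iota_res AW N(1) NN' by (auto simp: is_loc_def)
  then show "y \<in> P" by (simp add: P_def)
 qed
 then have BP: "\<iota> y \<in> P" if "y \<in> ?B" for y using fhom_int_closure[OF iota that] EE.point_props(6)[OF Pp] by blast
 note SP = EE.point_props(2)[OF Pp]
 \<comment> \<open>Denominators at \<open>Q\<close> become units in \<open>V\<close>, hence also in
   \<open>P\<close>, which \<open>V\<close> dominates.\<close>
 have QP: "\<iota> y \<in> P" if y: "y \<in> Q" for y
 proof -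
  obtain s where s: "s \<in> ?B" "unit_in Q s" "y * s \<in> ?B" using A(3) y by (auto simp: is_loc_def)
  have "unit_in V (\<iota> s)" using s(2) dVQ unit_mono[of Q s "\<iota> -` V"] fhom_unit[OF iota] by (auto simp: dominates_def)
  then have "unit_in P (\<iota> s)" using dominates_unit[OF dVP BP[OF s(1)]] by blast
  then have "\<iota> (y * s) * inverse (\<iota> s) \<in> P" using BP[OF s(3)] SP by (intro sring_mult) (auto simp: unit_in_def)
  moreover have "\<iota> (y * s) * inverse (\<iota> s) = \<iota> y" using \<open>unit_in P (\<iota> s)\<close> by (simp add: fhomD(2)[OF iota] unit_in_def)
  ultimately show ?thesis by simp
 qed
 obtain s where s: "uniformizer Q s" using q.uniformizer_ex by blast
 have sQ: "s \<in> max_ideal Q" by (rule uniformizer_in_max[OF q.R s])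
 then have "\<iota> s \<in> max_ideal V" using dVQ fhom_max[OF iota] by (auto simp: dominates_def)
 then have nu: "\<not> unit_in P (\<iota> s)" using dominates_unit[OF dVP QP[of s]] sQ max_ideal_sub unit_not_max by blast
 have s0: "\<iota> s ~= 0" using s fhomD(7)[OF iota] by (auto simp: uniformizer_def)
 have "inverse (\<iota> s) \<notin> P" using nu s0 QP[of s] sQ max_ideal_sub by (auto simp: unit_in_def)
 \<comment> \<open>\<open>P\<close> may have higher codimension. A divisor through it that misses
   the inverse of \<open>\<iota> s\<close> still lies over \<open>Q\<close>, because
   \<open>s\<close> generates the maximal ideal of \<open>Q\<close>.\<close>
 then obtain R where R: "R \<in> prime_divisors \<E>" "P \<subseteq> R" "inverse (\<iota> s) \<notin> R" using EE.pd_ex[OF Pp] by blast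
 note SR = EE.point_props(2)[OF EE.pd_point[OF R(1)]]
 have sR: "\<iota> s \<in> max_ideal R" using R QP[of s] sQ max_ideal_sub by (auto simp: max_ideal_def)
 have "dominates (\<iota> -` R) Q" unfolding dominates_def fhom_max[OF iota]
 proof (intro conjI subsetI)
  fix y
  show "y \<in> \<iota> -` R" if "y \<in> Q" using QP[OF that] R(2) by blast
  assume "y \<in> max_ideal Q"
  then obtain z where z: "z \<in> Q" "y = s * z" using s by (auto simp: uniformizer_def)
  have "\<iota> s * \<iota> z \<in> max_ideal R" using max_ideal_mult[OF SR sR] QP[OF z(1)] R(2) by blast
  then show "y \<in> \<iota> -` max_ideal R" using z(2) by (simp add: fhomD(2)[OF iota])
 qed
 then show ?thesis using R(1) fhom_dominates[OF iota] by blast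
qed

end

section \<open>The log canonical threshold\<close>

text \<open>Data of a small neighborhood of \<open>Q\<close>: where \<open>fA\<close> is invertible,
  \<open>h\<close> is a local equation; where \<open>f1\<close> is invertible, \<open>s\<close> cuts
  out only \<open>Q\<close>, and \<open>x\<close> has no zeros or poles away from
  \<open>Q\<close>.\<close>

locale adjunction_open = adjunction_data p ty \<A> \<omega> \<Delta> e \<phi> \<A>' W rW E rE \<iota> \<omega>E g w t ys
 for p and ty :: "'k::field itself" and \<A> \<omega> \<Delta> e \<phi> \<A>' W and rW :: "'k => 'w::field" and E
  and rE :: "'k => 'e::field" and \<iota> \<omega>E g w t ys +
 fixes Q :: "'w set" and A :: "'k set" and h :: 'k and s :: 'w and m :: int and x :: 'w and fA :: 'k and f1 :: 'w
 assumes Q: "Q \<in> prime_divisors \<W>"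
  and A: "A \<in> \<A>" "is_loc A W" "is_loc (int_closure (rW ` A)) Q"
  and h: "leq (center A (res_pre W rW Q)) h"
  and s: "uniformizer Q s"
  and m: "char_p_dvr.hom_level Q e \<psi> m"
  and x: "x \<in> Q" "\<psi> (rW (h / g) * s powi (int qm - (ord_at Q (rW (h / g)) - m)) * x) = 1"
  and fA: "fA \<in> A" "unit_in (center A (res_pre W rW Q)) fA"
   "\<And>R. R \<in> prime_divisors \<A> ==> is_loc A R ==> unit_in R fA ==> real qm * log_div \<omega> \<Delta> R = real_of_int (ord_at R h)"
  and f1: "f1 \<in> int_closure (rW ` A)" "unit_in Q f1"
   "\<And>R. R \<in> prime_divisors \<W> ==> is_loc (int_closure (rW ` A)) R ==> unit_in R f1 ==>
    R = Q | ord_at R s = 0 & ord_at R x = 0"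
begin

sublocale q: char_p_dvr p "TYPE('w)" Q by (rule WW.pd_char_p_dvr[OF Q])

abbreviation B :: "'w set" where
 "B \<equiv> int_closure (rW ` A)"

definition N :: "'k set" where
 "N = center A (res_pre W rW Q)"

text \<open>\<open>qm\<close> times one minus the F-different at \<open>Q\<close>
  (\<open>F_different_Q\<close>).\<close>

definition k :: int where
 "k = int qm - (ord_at Q (rW (h / g)) - m)"

definition f :: 'w where
 "f = f1 * rW fA"

definition U :: "'w set set" where
 "U = Spec (invert B f)"

definition D :: "real => 'e wdiv" where
 "D c P = different \<A>' \<omega> \<Delta>' E rE P + c * pullback \<iota> \<W> (prime_div Q) P"

abbreviation \<E>U :: "'e set set" where
 "\<E>U \<equiv> open_subscheme \<E> (preimage_of \<iota> \<E> U)"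

lemma B_chart: "B \<in> \<W>"
 using A(1,2) Spec_iff[OF chart(4)[OF A(1)]] by (auto simp: scheme_normalization_def subscheme_def)

lemmas rB = WW.chart(4)[OF B_chart]

lemma AW: "A \<subseteq> W" using A(2) by (simp add: is_loc_def)

lemma A_sub_B: "rW ` A \<subseteq> B" by (rule int_closure_sub[OF sring_image[OF chart(4)[OF A(1)] AW SW rW]])

lemma B_sub_Q: "B \<subseteq> Q" using A(3) by (simp add: is_loc_def)

lemma locQ: "loc_ring Q" by (rule dvr_loc_ring[OF q.dvr])

lemmas N = W_point_below[OF A(1,2) locQ subset_trans[OF A_sub_B B_sub_Q], folded N_def]

lemma leq_N: "leq N h" using h by (simp add: N_def)

lemma locN: "loc_ring N" using N(1) by (simp add: is_loc_def)

lemma unit_hg: "unit_in W (h / g)" by (rule leq_unit[OF W g leq_gen[OF leq_N N(3)]])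

lemma s_nz: "s ~= 0" "ord_at Q s = 1" using s q.uniformizer_iff by auto

lemma x_nz: "x ~= 0"
proof
 assume "x = 0"
 then have "\<psi> 0 = 1" using x(2) by simp
 moreover have "\<psi> 0 = 0" using psi_linear by (auto simp: WW.p_inv_linear_iff dest: spec[of _ 0])
 ultimately show False by simp
qed

lemma unit_fA_Q: "unit_in Q (rW fA)"
proof -
 have "fA \<in> N" "unit_in N fA" using fA(1,2) N(1) by (auto simp: is_loc_def N_def)
 then have "unit_in (rW ` N) (rW fA)" using res_unit[OF locW rW locN N(3)] by blast
 then show ?thesis using N(4) by (auto simp: dominates_def intro: unit_mono)
qed

lemma f: "f \<in> B" "f ~= 0" "unit_in Q f"
proof -
 show u: "unit_in Q f" unfolding f_def by (rule unit_in_mult[OF q.R f1(2) unit_fA_Q])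
 then show "f ~= 0" by (simp add: unit_in_def)
 show "f \<in> B" unfolding f_def using f1(1) fA(1) A_sub_B by (intro sring_mult[OF rB]) auto
qed

lemma U_iff: "P \<in> U \<longleftrightarrow> is_loc B P & inverse f \<in> P" unfolding U_def by (rule Spec_invert[OF rB f(1,2)])

lemma U_open: "zariski_open \<W> U" unfolding U_def by (rule principal_zariski_open[OF WW.gl B_chart f(1,2)])

lemma Q_U: "Q \<in> U" unfolding U_iff using A(3) f(3) by (auto simp: unit_in_def)

lemma U_point: "P \<in> U ==> P \<in> points \<W>" using U_open by (auto simp: zariski_open_def)

lemma U_units:
 assumes P: "P \<in> U"
 shows "unit_in P f1" "unit_in P (rW fA)"
proof -
 have BP: "B \<subseteq> P" and iP: "inverse f \<in> P" and SP: "sring P" using P U_iff is_loc_sring by (auto simp: is_loc_def)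
 have mem: "f1 \<in> P" "rW fA \<in> P" using f1(1) fA(1) A_sub_B BP by auto
 have nz: "f1 ~= 0" "rW fA ~= 0" using f(2) by (auto simp: f_def)
 have "inverse f1 = rW fA * inverse f" "inverse (rW fA) = f1 * inverse f" using nz by (simp_all add: f_def)
 then show "unit_in P f1" "unit_in P (rW fA)" using mem nz sring_mult[OF SP _ iP] by (simp_all add: unit_in_def)
qed

lemma U_generization:
 assumes P: "P \<in> U" and R: "R \<in> prime_divisors \<W>" "P \<subseteq> R"
 shows "R \<in> U"
proof -
 have "is_loc B R" using generization_in_chart[OF WW.gl B_chart _ WW.pd_point[OF R(1)] R(2)] P U_iff by blast
 then show ?thesis using P R(2) U_iff by blast
qed

lemma U_divisors:
 assumes R: "R \<in> prime_divisors \<W>" "R \<in> U"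
 shows "R = Q | ord_at R s = 0 & ord_at R x = 0" using f1(3)[OF R(1)] R(2) U_iff U_units(1)[OF R(2)] by blast

lemma U_local_eq:
 assumes P: "P \<in> U" and R: "R \<in> prime_divisors \<W>" "P \<subseteq> R"
 shows "prime_div Q R = real_of_int (ord_at R s)"
 using U_divisors[OF R(1) U_generization[OF P R]] s_nz(2) by (auto simp: prime_div_def)

lemma x_U:
 assumes P: "P \<in> U"
 shows "x \<in> P"
proof -
 have "0 \<le> ord_at R x" if R: "R \<in> prime_divisors \<W>" "P \<subseteq> R" for R
  using U_divisors[OF R(1) U_generization[OF P R]] q.mem_iff[OF x_nz] x(1) by auto
 then show ?thesis using WW.mem_point_iff[OF U_point[OF P] x_nz] by blast
qed

lemma U_Cartier: "Cartier (open_subscheme \<W> U) (prime_div Q)"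
proof -
 have ne: "U ~= {}" using Q_U by blast
 have "local_eq (open_subscheme \<W> U) (prime_div Q) P s" if "P \<in> U" for P
  using s_nz(1) U_local_eq[OF that] by (auto simp: local_eq_def WW.prime_divisors_open[OF U_open ne])
 then show ?thesis unfolding Cartier_def open_subscheme_points[OF WW.gl U_open] by blast
qed

lemma preimage_ne: "preimage_of \<iota> \<E> U ~= {}"
proof -
 have "UNIV \<in> points \<W>" by (rule generic_point[OF WW.gl])
 then have "is_loc B UNIV" by (intro gen_in_chart[OF WW.gl B_chart]) auto
 then have "UNIV \<in> U" by (simp add: U_iff)
 moreover have "dominates UNIV (\<iota> ` UNIV)" by (auto simp: dominates_def max_ideal_def fhomD(8)[OF iota, symmetric])
 ultimately show ?thesis using generic_point[OF EE.gl] by (auto simp: preimage_of_def)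
qed

lemmas pre_open = preimage_open[OF U_open]

sublocale O: nscheme p "TYPE('e)" \<E>U
 by (intro nscheme.intro nscheme_axioms.intro EE.char_p_axioms EE.normal_scheme_open[OF nsE pre_open preimage_ne])

lemmas O_points = open_subscheme_points[OF EE.gl pre_open]

lemmas O_divisors = EE.prime_divisors_open[OF pre_open preimage_ne]

text \<open>Invertibility of \<open>fA\<close> is carried from the neighborhood on \<open>W\<close>
  through residues and domination down to the point of the base, which makes \<open>h\<close> a
  local equation there.\<close>

lemma preimage_point:
 assumes P: "P \<in> preimage_of \<iota> \<E> U"
 shows "\<exists>N'\<in>points \<A>'. \<exists>N1\<in>points \<A>. N' \<subseteq> E & rE ` N' = P & N1 \<subseteq> N' & leq N1 h"
  and "\<iota> x \<in> P" and "unit_in P (rE w)"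
proof -
 obtain M where Pp: "P \<in> points \<E>" and M: "M \<in> U" "dominates P (\<iota> ` M)" using P by (auto simp: preimage_of_def)
 have MP: "\<iota> ` M \<subseteq> P" using M(2) by (simp add: dominates_def)
 show "\<iota> x \<in> P" using x_U[OF M(1)] MP by blast
 have BM: "B \<subseteq> M" using M(1) U_iff by (auto simp: is_loc_def)
 obtain C where C: "C \<in> \<E>" "is_loc C P" using EE.point_chart[OF Pp] by blast
 obtain N' where N': "N' \<in> points \<A>'" "N' \<subseteq> E" "rE ` N' = P" using E_point[OF C] by blast
 have "\<iota> ` rW ` A \<subseteq> P" using A_sub_B BM MP by blast
 then obtain N1 where N1: "N1 \<in> points \<A>" "is_loc A N1" "dominates N' N1"
  using E_point_above[OF A(1,2) N' EE.point_props(1)[OF Pp]] by blast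
 have locN': "loc_ring N'" by (rule points_loc_ring[OF K'.gl N'(1)])
 have N1N': "N1 \<subseteq> N'" using N1(3) by (simp add: dominates_def)
 have fN1: "fA \<in> N1" using fA(1) N1(2) by (auto simp: is_loc_def)
 have "unit_in M (rW fA)" by (rule U_units(2)[OF M(1)])
 then have "unit_in (\<iota> -` P) (rW fA)" by (rule unit_mono) (use MP in blast)
 then have "unit_in P (rE fA)" using fhom_unit[OF iota, of P "rW fA"] iota_res[of fA] fA(1) AW by (simp add: subset_iff)
 then have "unit_in N' fA" using res_unit[OF locE rE locN' N'(2), of fA] N'(3) fN1 N1N' by blast
 then have u1: "unit_in N1 fA" using dominates_unit[OF N1(3) fN1] by blast
 have "leq N1 h" unfolding leq_def
 proof (intro conjI ballI impI)
  fix R assume R: "R \<in> prime_divisors \<A>" "N1 \<subseteq> R"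
  show "real qm * log_div \<omega> \<Delta> R = real_of_int (ord_at R h)"
   by (rule fA(3)[OF R(1) generization_in_chart[OF gl A(1) N1(2) pd_point[OF R(1)] R(2)] unit_mono[OF u1 R(2)]])
 qed (rule leq_nz[OF leq_N])
 then show "\<exists>N'\<in>points \<A>'. \<exists>N1\<in>points \<A>. N' \<subseteq> E & rE ` N' = P & N1 \<subseteq> N' & leq N1 h" using N' N1 N1N' by blast
 have "unit_in N' w" by (rule unit_mono[OF w(2)[OF N1(1)] N1N'])
 then show "unit_in P (rE w)" using res_unit[OF locE rE locN' N'(2), of w] N'(3) by (auto simp: unit_in_def)
qed

definition v :: 'e where
 "v = form_coeff \<omega>E vs"

text \<open>Inverse on \<open>E\<close> of the local equation \<open>h\<close> measured against the
  logarithmic form; its order is \<open>- qm\<close> times the different up to the order of the form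
  in \<open>vs\<close>.\<close>

definition \<rho> :: 'e where
 "\<rho> = rE (\<theta> ^ qm / h)"

lemma v_nz: "v ~= 0" unfolding v_def by (rule EE.form_coeff_nz[OF \<omega>E vs_basis])

lemma unit_rho: "unit_in E (\<theta> ^ qm / h)" using unit_in_inverse[OF unit_theta[OF N(2) _ leq_N]] N(3) WE by auto

lemma rho_nz: "\<rho> ~= 0" unfolding \<rho>_def by (rule res_nz[OF SE rE unit_rho])

lemma iota_s_nz: "\<iota> s ~= 0" using s_nz(1) fhomD(7)[OF iota] by blast

lemma pullback_U:
 assumes R: "dvr R" "dominates R (\<iota> ` P)" and P: "P \<in> U"
 shows "pullback \<iota> \<W> (prime_div Q) R = real_of_int (ord_at R (\<iota> s))"
proof -
 have "local_R_eq \<W> (prime_div Q) P [(1, s)]" using s_nz(1) U_local_eq[OF P] by (auto simp: local_R_eq_def)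
 then show ?thesis using WW.pullback_eq[OF U_point[OF P] iota R] by simp
qed

text \<open>A local equation with real coefficients for the log divisor on \<open>E\<close>; the
  order of the form in \<open>vs\<close> enters the canonical divisor and the different with
  opposite signs and cancels.\<close>

definition eqs :: "real => (real \<times> 'e) list" where
 "eqs c = [(1, v), (- 1 / real qm, \<rho>), (c, \<iota> s)]"

lemma log_div_E_eq:
 assumes R: "R \<in> prime_divisors \<E>" "R \<in> preimage_of \<iota> \<E> U"
 shows "log_div \<omega>E (D c) R = (\<Sum>(a, z)\<leftarrow>eqs c. a * real_of_int (ord_at R z))"
proof -
 obtain N' N1 where N': "N' \<in> points \<A>'" "N' \<subseteq> E" "rE ` N' = R" and N1: "N1 \<in> points \<A>" "N1 \<subseteq> N'" "leq N1 h"
  using preimage_point(1)[OF R(2)] by blast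
 obtain M where M: "M \<in> U" "dominates R (\<iota> ` M)" using R(2) by (auto simp: preimage_of_def)
 have "form_ord \<omega>E R = ord_at R v + form_ord (1, vs) R"
  unfolding v_def by (rule form_ord_E[OF EE.pd_dvr[OF R(1)] EE.point_props(5)[OF EE.pd_point[OF R(1)]]])
 then have "log_div \<omega>E (D c) R = real_of_int (ord_at R v) + real_of_int (form_ord (1, vs) R)
   + (- (real_of_int (ord_at R \<rho>) + real qm * real_of_int (form_ord (1, vs) R)) / real qm
   + c * real_of_int (ord_at R (\<iota> s)))" using different_eq[OF R(1) N' N1] pullback_U[OF EE.pd_dvr[OF R(1)] M(2,1)]
  by (simp add: log_div_def D_def \<rho>_def)
 then show ?thesis unfolding eqs_def using real_q_pos by (simp add: field_simps)
qed

lemma E_local_R_eq: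
 assumes P: "P \<in> points \<E>U"
 shows "local_R_eq \<E>U (log_div \<omega>E (D c)) P (eqs c)" unfolding local_R_eq_def
proof (intro conjI ballI impI)
 show "case z of (a, y) => y ~= 0" if "z \<in> set (eqs c)" for z
  using that v_nz rho_nz iota_s_nz by (auto simp: eqs_def)
 fix R assume "R \<in> prime_divisors \<E>U" "P \<subseteq> R"
 then show "log_div \<omega>E (D c) R = (\<Sum>(a, z)\<leftarrow>eqs c. a * real_of_int (ord_at R z))"
  unfolding O_divisors by (intro log_div_E_eq) auto
qed

lemma fhom_id: "fhom (id :: 'z::field => 'z)" by (simp add: fhom_def)

lemma iota_one: "1 = (cartier \<omega>E ^^ e) (v ^ qm * (\<kappa> * \<iota> (rW (h / g)) * \<iota> s powi k) * \<iota> x)"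
proof -
 have "1 = \<iota> (\<psi> (rW (h / g) * s powi k * x))" using x(2) fhomD(3)[OF iota] by (simp add: k_def)
 also have "... = (car vs ^^ e) (\<kappa> * (\<iota> (rW (h / g)) * \<iota> s powi k * \<iota> x))"
  unfolding iota_psi \<phi>E_def by (simp add: fhomD(2)[OF iota] fhom_powi[OF iota])
 also have "... = (cartier \<omega>E ^^ e) (v ^ qm * (\<kappa> * (\<iota> (rW (h / g)) * \<iota> s powi k * \<iota> x)))"
  unfolding v_def qm_def by (rule EE.cartier_iter_power[OF \<omega>E vs_basis, symmetric])
 finally show ?thesis by (simp only: mult.assoc)
qed

text \<open>The twist of the restricted map and the equation of the different both compare a
  generator of the line bundle with the logarithmic form, in opposite directions; what remains is
  the unit \<open>w\<close>.\<close>

lemma kappa_rho: "\<kappa> * \<iota> (rW (h / g)) * \<rho> = rE w"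
proof -
 have hg: "h / g \<in> W" using unit_hg by (simp add: unit_in_def)
 have mem: "w * \<mu> \<in> E" "h / g \<in> E" "\<theta> ^ qm / h \<in> E"
  using unit_in_mult[OF SE unit_w(2) unit_mu] hg WE unit_rho by (auto simp: unit_in_def)
 have "\<kappa> * \<iota> (rW (h / g)) * \<rho> = rE (w * \<mu> * (h / g) * (\<theta> ^ qm / h))" unfolding \<kappa>_def \<rho>_def iota_res[OF hg]
  using res_mult[OF SE rE mem(1,2)] res_mult[OF SE rE sring_mult[OF SE mem(1,2)] mem(3)] by simp
 also have "w * \<mu> * (h / g) * (\<theta> ^ qm / h) = w" using leq_nz[OF g] leq_nz[OF leq_N] theta(1) by (simp add: \<mu>_def)
 finally show ?thesis .
qed

text \<open>
 The trace form of the threshold: a discrepancy below \<open>-1\<close> would force the value \<open>1\<close> of the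
 descended map into the maximal ideal.
\<close>

lemma threshold_sub_lc: "sub_lc \<E>U \<omega>E (D (real_of_int k / real qm))" unfolding sub_lc_def
proof (intro conjI allI impI ballI)
 let ?c = "real_of_int k / real qm"
 show "normal_scheme \<E>U" by (rule O.ns)
 show "R_Cartier \<E>U (log_div \<omega>E (D ?c))" unfolding R_Cartier_def using E_local_R_eq by blast
 fix \<B> R assume B: "normal_scheme \<B> & proper_birational \<B> \<E>U" and R: "R \<in> prime_divisors \<B>"
 interpret b: nscheme p "TYPE('e)" \<B>
  by (intro nscheme.intro nscheme_axioms.intro EE.char_p_axioms) (use B in blast)
 interpret r: char_p_dvr p "TYPE('e)" R by (rule b.pd_char_p_dvr[OF R])
 have "\<forall>R\<in>points \<B>. \<exists>P\<in>points \<E>U. dominates R P" using B by (simp add: proper_birational_def)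
 then obtain P where P: "P \<in> points \<E>U" "dominates R P" using b.pd_point[OF R] by blast
 have PU: "P \<in> preimage_of \<iota> \<E> U" using P(1) O_points by simp
 have PR: "P \<subseteq> R" using P(2) by (simp add: dominates_def)
 have "pullback id \<E>U (log_div \<omega>E (D ?c)) R = (\<Sum>(a, z)\<leftarrow>eqs ?c. a * real_of_int (ord_at R (id z)))"
  using P(2) by (intro O.pullback_eq[OF P(1) fhom_id r.dvr _ E_local_R_eq[OF P(1)]]) simp
 then have crep: "crepant \<E>U \<omega>E (D ?c) R = real_of_int (ord_at R v) - real_of_int (ord_at R \<rho>) / real qm
   + ?c * real_of_int (ord_at R (\<iota> s)) - real_of_int (form_ord \<omega>E R)" by (simp add: crepant_def eqs_def)
 show "crepant \<E>U \<omega>E (D ?c) R \<le> 1"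
 proof (rule ccontr)
  assume "\<not> ?thesis"
  then have "1 < crepant \<E>U \<omega>E (D ?c) R" by simp
  then have "real qm * 1 < real qm * crepant \<E>U \<omega>E (D ?c) R" by (rule mult_strict_left_mono[OF _ real_q_pos])
  also have "... = real_of_int (int qm * ord_at R v - ord_at R \<rho> + k * ord_at R (\<iota> s) - int qm * form_ord \<omega>E R)"
   unfolding crep using real_q_pos by (simp add: field_simps)
  finally have "real_of_int (int qm) < real_of_int (int qm * ord_at R v - ord_at R \<rho> + k * ord_at R (\<iota> s) - int qm * form_ord \<omega>E R)"
   by simp
  then have big: "int qm < int qm * ord_at R v - ord_at R \<rho> + k * ord_at R (\<iota> s) - int qm * form_ord \<omega>E R"
   by (simp only: of_int_less_iff)
  let ?d = "v ^ qm * (\<kappa> * \<iota> (rW (h / g)) * \<iota> s powi k)"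
  have nz: "\<kappa> * \<iota> (rW (h / g)) ~= 0" "\<iota> s powi k ~= 0" "v ^ qm ~= 0"
   using kappa_rho res_nz[OF SE rE unit_w(2)] iota_s_nz v_nz by auto
  have "unit_in R (rE w)" by (rule unit_mono[OF preimage_point(3)[OF PU] PR])
  then have "ord_at R (\<kappa> * \<iota> (rW (h / g)) * \<rho>) = 0" unfolding kappa_rho by (rule r.ord_unit)
  then have "ord_at R (\<kappa> * \<iota> (rW (h / g))) = - ord_at R \<rho>" using r.ord_mult[OF nz(1) rho_nz] by simp
  then have od: "ord_at R ?d = int qm * ord_at R v - ord_at R \<rho> + k * ord_at R (\<iota> s)"
   using r.ord_mult[OF nz(3), of "\<kappa> * \<iota> (rW (h / g)) * \<iota> s powi k"] r.ord_mult[OF nz(1,2)] nz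
    r.ord_power[OF v_nz] r.ord_powi[OF iota_s_nz] by simp
  obtain zs where zs: "p_basis R zs" using r.p_basis_ex[OF b.point_props(5)[OF b.pd_point[OF R]] vs_basis] by blast
  have lev: "r.hom_level e (cartier \<omega>E ^^ e) (int qm * form_ord \<omega>E R)"
   unfolding qm_def by (rule r.cartier_level[OF \<omega>E zs])
  \<comment> \<open>The strict inequality between integers gains one, which turns \<open>qm\<close>
    into the \<open>p ^ e\<close> required by \<open>hom_level_max\<close>.\<close>
  have "int (p ^ e) = int qm + 1" using q_gt_1 unfolding qm_def by (simp add: of_nat_diff)
  then have le: "int qm * form_ord \<omega>E R + int (p ^ e) \<le> ord_at R ?d" using big od by linarith
  have d0: "?d ~= 0" using nz by simp
  have "\<iota> x \<in> R" using preimage_point(2)[OF PU] PR by blast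
  then have "(cartier \<omega>E ^^ e) (?d * \<iota> x) \<in> max_ideal R"
   by (rule r.hom_level_max[OF EE.cartier_linear[OF \<omega>E] lev d0 le])
  then show False using iota_one one_not_max[of R] by simp
 qed
qed

lemma F_different_Q: "F_different \<A> \<omega> \<Delta> e \<phi> W rW Q = 1 - real_of_int k / real qm"
 unfolding F_different_eq[OF Q N(2,3,4) leq_N m] k_def using real_q_pos by (simp add: field_simps)

end

context adjunction_data
begin

text \<open>\<open>Sup\<close> is informative only for a set bounded above. The bound comes from a
  prime divisor \<open>R\<close> over \<open>Q\<close>: its coefficient grows linearly in
  \<open>c\<close> with slope \<open>ord_at R (\<iota> s) > 0\<close> and may not exceed 1.\<close>

lemma lc_set_bounded:
 assumes Q: "Q \<in> prime_divisors \<W>"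
 shows "bdd_above {c. \<exists>U. zariski_open \<W> U & Q \<in> U &
   Cartier (open_subscheme \<W> U) (prime_div Q) &
   sub_lc (open_subscheme \<E> (preimage_of \<iota> \<E> U)) \<omega>E
    (%P. different \<A>' \<omega> \<Delta>' E rE P + c * pullback \<iota> \<W> (prime_div Q) P)}"
proof -
 interpret q: char_p_dvr p "TYPE('w)" Q by (rule WW.pd_char_p_dvr[OF Q])
 obtain R where R: "R \<in> prime_divisors \<E>" "dominates R (\<iota> ` Q)" using prime_divisor_over[OF Q] by blast
 interpret r: dvr_loc R by (rule EE.pd_loc[OF R(1)])
 obtain s where s: "uniformizer Q s" using q.uniformizer_ex by blast
 have s': "s ~= 0" "ord_at Q s = 1" using s q.uniformizer_iff by auto
 have "R' = Q" if "R' \<in> prime_divisors \<W>" "Q \<subseteq> R'" for R'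
  using dvr_maximal[OF q.dvr, of R'] that dvr_not_UNIV[OF WW.pd_dvr[OF that(1)]] dvr_sring[OF WW.pd_dvr[OF that(1)]] by blast
 then have "local_R_eq \<W> (prime_div Q) Q [(1, s)]" using s' by (auto simp: local_R_eq_def prime_div_def)
 then have pull: "pullback \<iota> \<W> (prime_div Q) R = real_of_int (ord_at R (\<iota> s))"
  using WW.pullback_eq[OF WW.pd_point[OF Q] iota r.dvr R(2)] by simp
 have "s \<in> max_ideal Q" by (rule uniformizer_in_max[OF q.R s])
 then have "\<iota> s \<in> max_ideal R" using R(2) fhom_max_image[OF iota] by (auto simp: dominates_def)
 moreover have "\<iota> s ~= 0" using s'(1) fhomD(7)[OF iota] by blast
 ultimately have pos: "ord_at R (\<iota> s) > 0" using r.max_iff by blast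
 let ?d = "different \<A>' \<omega> \<Delta>' E rE"
 show ?thesis
 proof (rule bdd_aboveI)
  fix c assume "c \<in> {c. \<exists>U. zariski_open \<W> U & Q \<in> U & Cartier (open_subscheme \<W> U) (prime_div Q) &
    sub_lc (open_subscheme \<E> (preimage_of \<iota> \<E> U)) \<omega>E (%P. ?d P + c * pullback \<iota> \<W> (prime_div Q) P)}"
  then obtain U where U: "zariski_open \<W> U" "Q \<in> U"
   and lc: "sub_lc (open_subscheme \<E> (preimage_of \<iota> \<E> U)) \<omega>E (%P. ?d P + c * pullback \<iota> \<W> (prime_div Q) P)"
   by blast
  let ?D = "%P. ?d P + c * pullback \<iota> \<W> (prime_div Q) P"
  have RU: "R \<in> preimage_of \<iota> \<E> U" using R U(2) EE.pd_point by (auto simp: preimage_of_def)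
  then have ne: "preimage_of \<iota> \<E> U ~= {}" by blast
  note op = preimage_open[OF U(1)]
  let ?O = "open_subscheme \<E> (preimage_of \<iota> \<E> U)"
  interpret o: nscheme p "TYPE('e)" ?O
   by (intro nscheme.intro nscheme_axioms.intro EE.char_p_axioms EE.normal_scheme_open[OF nsE op ne])
  have Rd: "R \<in> prime_divisors ?O" unfolding EE.prime_divisors_open[OF op ne] using R(1) RU by blast
  obtain hs where hs: "local_R_eq ?O (log_div \<omega>E ?D) R hs"
   using lc o.pd_point[OF Rd] unfolding sub_lc_def R_Cartier_def by blast
  have fid: "fhom (id :: 'e => 'e)" by (simp add: fhom_def)
  have "pullback id ?O (log_div \<omega>E ?D) R = (\<Sum>(a, z)\<leftarrow>hs. a * real_of_int (ord_at R (id z)))"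
   by (rule o.pullback_eq[OF o.pd_point[OF Rd] fid r.dvr _ hs]) simp
  also have "... = log_div \<omega>E ?D R" using hs Rd by (simp add: local_R_eq_def)
  finally have "crepant ?O \<omega>E ?D R = ?D R" by (simp add: crepant_def log_div_def)
  moreover have "crepant ?O \<omega>E ?D R \<le> 1" using lc o.ns o.proper_birational_self Rd unfolding sub_lc_def by blast
  ultimately have "?d R + c * real_of_int (ord_at R (\<iota> s)) \<le> 1" using pull by simp
  then show "c \<le> (1 - ?d R) / real_of_int (ord_at R (\<iota> s))" using pos by (simp add: field_simps)
 qed
qed

lemma divisorial_part_le:
 assumes Q: "Q \<in> prime_divisors \<W>"
 shows "divisorial_part \<iota> \<W> \<E> \<omega>E (different \<A>' \<omega> \<Delta>' E rE) Q \<le> F_different \<A> \<omega> \<Delta> e \<phi> W rW Q"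
proof -
 interpret q: char_p_dvr p "TYPE('w)" Q by (rule WW.pd_char_p_dvr[OF Q])
 have locQ: "loc_ring Q" by (rule dvr_loc_ring[OF q.dvr])
 obtain A where A: "A \<in> \<A>" "is_loc A W" "is_loc (int_closure (rW ` A)) Q" using W_chart[OF WW.pd_point[OF Q]] by blast
 let ?B = "int_closure (rW ` A)"
 note rA = chart(4)[OF A(1)]
 have B: "?B \<in> \<W>" using A(1,2) Spec_iff[OF rA] by (auto simp: scheme_normalization_def subscheme_def)
 note rB = WW.chart(4)[OF B]
 have AW: "A \<subseteq> W" using A(2) by (simp add: is_loc_def)
 have "rW ` A \<subseteq> Q" using int_closure_sub[OF sring_image[OF rA AW SW rW]] A(3) by (auto simp: is_loc_def)
 note N = W_point_below[OF A(1,2) locQ this]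
 let ?N = "center A (res_pre W rW Q)"
 obtain h where h: "leq ?N h" using leq_ex[OF N(2)] by blast
 obtain s where s: "uniformizer Q s" using q.uniformizer_ex by blast
 then have s': "s ~= 0" "ord_at Q s = 1" using q.uniformizer_iff by auto
 obtain m where m: "q.hom_level e \<psi> m" using psi_level[OF Q] by blast
 \<comment> \<open>\<open>?k\<close> gives the multiplier the order \<open>m + p ^ e - 1\<close>, at
   which \<open>hom_level_top\<close> still yields the value 1.\<close>
 let ?a = "rW (h / g)" and ?k = "int qm - (ord_at Q (rW (h / g)) - m)"
 have a0: "?a ~= 0" by (rule res_nz[OF SW rW leq_unit[OF W g leq_gen[OF h N(3)]]])
 have "ord_at Q (?a * s powi ?k) = ord_at Q ?a + ?k"
  using q.ord_mult[OF a0, of "s powi ?k"] q.ord_powi[OF s'(1)] s' by simp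
 also have "... = m + int (p ^ e) - 1" using q_gt_1 unfolding qm_def by (simp add: of_nat_diff)
 finally obtain x where x: "x \<in> Q" "\<psi> (?a * s powi ?k * x) = 1"
  using q.hom_level_top[OF psi_linear m, of "?a * s powi ?k"] a0 s'(1) by auto
 have x0: "x ~= 0"
 proof
  assume "x = 0"
  then have "\<psi> 0 = 1" using x(2) by simp
  moreover have "\<psi> 0 = 0" using psi_linear by (auto simp: WW.p_inv_linear_iff dest: spec[of _ 0])
  ultimately show False by simp
 qed
 \<comment> \<open>Divisors of the chart at which \<open>h\<close> fails to be an equation; each
   belongs to the support of \<open>\<Delta>\<close>, of the form or of \<open>h\<close>.\<close>
 let ?bad = "{R \<in> prime_divisors \<A>. is_loc A R & real qm * log_div \<omega> \<Delta> R ~= real_of_int (ord_at R h)}"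
 have "?bad \<subseteq> {R \<in> Spec A. \<Delta> R ~= 0} \<union> {R \<in> prime_divisors \<A>. is_loc A R & form_ord \<omega> R ~= 0}
   \<union> {R \<in> prime_divisors \<A>. is_loc A R & ord_at R h ~= 0}" using Spec_iff[OF rA] by (auto simp: log_div_def)
 moreover have "finite ..."
  using Q_div A(1) finite_form_ord[OF A(1) \<omega>] finite_ord[OF A(1) leq_nz[OF h]] by (simp add: Q_divisor_def)
 ultimately have fin: "finite ?bad" by (rule finite_subset)
 have "\<forall>R\<in>?bad. is_loc A R & \<not> ?N \<subseteq> R" using h by (auto simp: leq_def)
 then obtain fA where fA: "fA \<in> A" "unit_in ?N fA" "\<forall>R\<in>?bad. fA \<in> max_ideal R"
  using avoid_finite[OF rA N(1) fin] by blast
 \<comment> \<open>Divisors other than \<open>Q\<close> on which \<open>s\<close> or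
   \<open>x\<close> has a zero or a pole. None of them contains \<open>Q\<close>, by maximality of
   discrete valuation rings.\<close>
 let ?bad' = "{R \<in> prime_divisors \<W>. is_loc ?B R & R ~= Q & (ord_at R s ~= 0 | ord_at R x ~= 0)}"
 have "?bad' \<subseteq> {R \<in> prime_divisors \<W>. is_loc ?B R & ord_at R s ~= 0} \<union> {R \<in> prime_divisors \<W>. is_loc ?B R & ord_at R x ~= 0}"
  by blast
 moreover have "finite ..." using WW.finite_ord[OF B s'(1)] WW.finite_ord[OF B x0] by blast
 ultimately have fin': "finite ?bad'" by (rule finite_subset)
 have "\<not> Q \<subseteq> R" if "R \<in> prime_divisors \<W>" "R ~= Q" for R
  using dvr_maximal[OF q.dvr, of R] that dvr_not_UNIV[OF WW.pd_dvr[OF that(1)]] dvr_sring[OF WW.pd_dvr[OF that(1)]] by blast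
 then have "\<forall>R\<in>?bad'. is_loc ?B R & \<not> Q \<subseteq> R" by blast
 then obtain f1 where f1: "f1 \<in> ?B" "unit_in Q f1" "\<forall>R\<in>?bad'. f1 \<in> max_ideal R"
  using avoid_finite[OF rB A(3) fin'] by blast
 interpret O: adjunction_open p ty \<A> \<omega> \<Delta> e \<phi> \<A>' W rW E rE \<iota> \<omega>E g w t ys Q A h s m x fA f1
 proof unfold_locales
  show "real qm * log_div \<omega> \<Delta> R = real_of_int (ord_at R h)"
   if "R \<in> prime_divisors \<A>" "is_loc A R" "unit_in R fA" for R using fA(3) that unit_not_max by blast
  show "R = Q | ord_at R s = 0 & ord_at R x = 0"
   if "R \<in> prime_divisors \<W>" "is_loc ?B R" "unit_in R f1" for R using f1(3) that unit_not_max by blast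
 qed (use Q A h s m x fA f1 in auto)
 let ?set = "{c. \<exists>U. zariski_open \<W> U & Q \<in> U & Cartier (open_subscheme \<W> U) (prime_div Q) &
   sub_lc (open_subscheme \<E> (preimage_of \<iota> \<E> U)) \<omega>E
    (%P. different \<A>' \<omega> \<Delta>' E rE P + c * pullback \<iota> \<W> (prime_div Q) P)}"
 have "O.D c = (%P. different \<A>' \<omega> \<Delta>' E rE P + c * pullback \<iota> \<W> (prime_div Q) P)" for c
  by (rule ext) (simp add: O.D_def)
 then have "real_of_int O.k / real qm \<in> ?set"
  using O.U_open O.Q_U O.U_Cartier O.threshold_sub_lc by (intro CollectI exI[of _ O.U]) simp
 then have "real_of_int O.k / real qm \<le> Sup ?set" by (rule cSup_upper[OF _ lc_set_bounded[OF Q]])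
 then show ?thesis unfolding O.F_different_Q divisorial_part_def lc_threshold_def by simp
qed

end

theorem theoremA:
  fixes p :: nat
    and \<A> \<A>' :: "'k::field set set" and \<omega> :: "'k topform" and \<Delta> :: "'k wdiv"
    and W :: "'k set" and r\<^sub>W :: "'k \<Rightarrow> 'w::field"
    and E :: "'k set" and r\<^sub>E :: "'k \<Rightarrow> 'e::field" and \<omega>\<^sub>E :: "'e topform"
    and \<iota> :: "'w \<Rightarrow> 'e"
    and e :: nat and \<phi> :: "'k \<Rightarrow> 'k"
  defines "\<W> \<equiv> scheme_normalization (subscheme \<A> W r\<^sub>W)"
    and "\<E> \<equiv> subscheme \<A>' E r\<^sub>E"
    and "\<Delta>' \<equiv> crepant \<A> \<omega> \<Delta>"
  defines "\<Delta>\<^sub>E \<equiv> different \<A>' \<omega> \<Delta>' E r\<^sub>E"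
  assumes char: "normalization_semidom_class.prime p" "CHAR('k) = p"
    and pair: "rational_form \<omega>" "pair \<A> \<omega> \<Delta>"
    and index: "\<not> p dvd cartier_index \<A> (log_div \<omega> \<Delta>)"
    and F_pure: "F_pure \<A> \<omega> \<Delta>"
    and center: "lc_center \<A> \<omega> \<Delta> W" "residue_map W r\<^sub>W"
    and model: "normal_scheme \<A>'" "proper_birational \<A>' \<A>"
    and E: "E \<in> prime_divisors \<A>'" "residue_map E r\<^sub>E" "normal_scheme \<E>" "\<Delta>' E = 1"
    and E_over_W: "dominates E W" "\<forall>x\<in>W. \<iota> (r\<^sub>W x) = r\<^sub>E x"
    and K_E: "rational_form \<omega>\<^sub>E"
    and phi: "e > 0" "index_divides \<A> \<omega> \<Delta> e" "phi_map \<A> \<omega> \<Delta> e \<phi>"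
  shows "\<forall>Q\<in>prime_divisors \<W>.
           divisorial_part \<iota> \<W> \<E> \<omega>\<^sub>E \<Delta>\<^sub>E Q \<le> F_different \<A> \<omega> \<Delta> e \<phi> W r\<^sub>W Q"
proof
 fix Q assume Q: "Q \<in> prime_divisors \<W>"
 interpret adj: adjunction p "TYPE('k)" \<A> \<omega> \<Delta> e \<phi> \<A>' W r\<^sub>W E r\<^sub>E \<iota> \<omega>\<^sub>E
 proof unfold_locales
  show "normal_scheme \<A>" "Q_divisor \<A> \<Delta>" using pair(2) by (auto simp: pair_def)
  show "W \<in> points \<A>" using center(1) by (simp add: lc_center_def)
  show "normal_scheme (subscheme \<A>' E r\<^sub>E)" using E(3) unfolding \<E>_def .
  show "crepant \<A> \<omega> \<Delta> E = 1" using E(4) unfolding \<Delta>'_def .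
 qed (use char pair F_pure center model E E_over_W K_E phi in auto)
 obtain g where g: "adj.leq W g" using adj.leq_ex[OF adj.W] by blast
 obtain w where w: "\<And>x. \<phi> x = (cartier \<omega> ^^ e) (w * x)" "\<forall>N\<in>points \<A>. unit_in N w" using adj.phi_cartier by blast
 have "p_basis UNIV (snd \<omega>)" using pair(1) by (simp add: rational_form_def)
 then obtain t ys where t: "uniformizer E t" "p_basis E (t # ys)"
  using adj.Ed.p_basis_uniformizer_ex[OF adj.K'.point_props(5)[OF adj.K'.pd_point[OF E(1)]]] by blast
 interpret data: adjunction_data p "TYPE('k)" \<A> \<omega> \<Delta> e \<phi> \<A>' W r\<^sub>W E r\<^sub>E \<iota> \<omega>\<^sub>E g w t ys
  by unfold_locales (use g w t in auto)
 show "divisorial_part \<iota> \<W> \<E> \<omega>\<^sub>E \<Delta>\<^sub>E Q \<le> F_different \<A> \<omega> \<Delta> e \<phi> W r\<^sub>W Q"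
  using data.divisorial_part_le Q unfolding \<W>_def \<E>_def \<Delta>\<^sub>E_def \<Delta>'_def by blast
qed

end
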